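(* In the setting described in the context, let $\phi : E \to E'$ be the $2$-isogeny with kernel $\{0,T\}$ and $\widehat\phi : E' \to E$ the dual isogeny. Then the degree-2 covering $\pi : D \to C$ is a $\widehat{\phi}$-covering: there are isomorphisms $D \cong E'$ and $C \cong E$ defined over $\overline{K}$ which, together with $\pi$ and $\widehat\phi$, form a commutative square (i.e. under these isomorphisms $\pi$ corresponds to $\widehat\phi$).
   Context: $K$ is a number field, $C \subset \mathbb{P}^3$ a non-singular intersection of two quadrics over $K$ with Jacobian $E$. The four singular quadrics in the pencil defining $C$ are cones over conics $\Gamma_1,\ldots,\Gamma_4$; projection from the vertex of the $i$-th cone gives a degree-2 morphism $\nu_i : C\to\Gamma_i$ with fibre $\mathfrak{a}_i$. Fix $0\ne T\in E(K)[2]$ and order the $\Gamma_i$ so that $\mathfrak{a}_1-\mathfrak{a}_2\sim\mathfrak{a}_3-\mathfrak{a}_4$ represents $T$ in $\operatorname{Pic}^0(C)\cong E$. Assume the Galois action on the $\Gamma_i$ has image in $\langle(12),(34)\rangle$. $D \subset \mathbb{P}^3$ and $\pi: D \to C$ are constructed as follows. Non-split case ($\Gamma_1,\Gamma_2$ defined over quadratic $L = K(\beta)$ and conjugate): $\Gamma_1$ is defined by $q\in L[X,Y,Z]$, its cone is $q(m_1,m_2,m_3)=0$ with linear forms $m_i \in L[x_1,\dots,x_4]$; using a point of $\Gamma_1(L)$ parametrise $\Gamma_1$ as $(Q_1:Q_2:Q_3)(\lambda,\mu)$ with binary quadratic forms over $L$; expanding $m_i(x_1,\ldots,x_4) = Q_i(x+\beta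 y,u+\beta v)$ ($i=1,2,3$) in the basis $1,\beta$ gives six $K$-equations which are equivalent to $x_i = r_i(x,y,u,v)$ ($i = 1,\dots,4$) and $F(x,y,u,v)=G(x,y,u,v)=0$ with quadratic forms $r_i,F,G$ over $K$. Split case ($\Gamma_1,\Gamma_2$ over $K$): cones $q(m_1,m_2,m_3)=0$, $q'(n_1,n_2,n_3)=0$ over $K$; parametrise $\Gamma_1$ by $(Q_1:Q_2:Q_3)(c,d)$ and $\Gamma_2$ by $(R_1:R_2:R_3)(\theta,\psi)$ over $K$ and rewrite $m_i = Q_i(c,d)$, $n_i = R_i(\theta,\psi)$ as $x_i = r_i(c,d,\theta,\psi)$ and $F=G=0$. Then $D = \{F=G=0\}$ and $\pi = (r_1:\cdots:r_4)$; $D$ is a non-singular quadric intersection and $\pi$ a degree-2 morphism. *)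

theory Defs
  imports
    "HOL-Analysis.Analysis"
    "HOL-Combinatorics.Transposition"
    "HOL-Algebra.Algebraic_Closure_Type"
    "HOL-Algebra.Free_Abelian_Groups"
begin

no_notation fps_nth (infixl \<open>$\<close> 75)

text \<open>
  A number field is a type \<open>'k\<close>, its algebraic closure is \<open>'k alg_closure\<close>, and all varieties are
  identified with their sets of points over the algebraic closure.  A field of definition is a
  subset \<open>S\<close> of the algebraic closure.
\<close>

definition number_field :: "'k::field_char_0 itself \<Rightarrow> bool" where
  "number_field _ \<longleftrightarrow>
    (\<exists>B :: 'k set. finite B \<and> module.span (\<lambda>(r::rat) x. of_rat r * x) B = UNIV)"

definition base_field :: "'k::field alg_closure set" where
  "base_field = range to_ac"

text \<open>The Galois group of \<open>'a\<close> over \<open>K\<close>, for \<open>'a\<close> an algebraic closure of \<open>K\<close>.\<close>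

definition galois_group :: "'a::field set \<Rightarrow> ('a \<Rightarrow> 'a) set" where
  "galois_group K = {\<sigma>. bij \<sigma> \<and> (\<forall>x y. \<sigma> (x + y) = \<sigma> x + \<sigma> y) \<and>
     (\<forall>x y. \<sigma> (x * y) = \<sigma> x * \<sigma> y) \<and> (\<forall>x\<in>K. \<sigma> x = x)}"


section \<open>Projective varieties and morphisms\<close>

text \<open>
  Homogeneous polynomials of degree \<open>d\<close> with coefficients in \<open>S\<close>, as functions.  Over an infinite
  field a polynomial is determined by the function it defines.
\<close>

inductive form :: "'a::comm_ring_1 set \<Rightarrow> nat \<Rightarrow> ('a ^ 'n \<Rightarrow> 'a) \<Rightarrow> bool"
  for S :: "'a set" where
  const: "c \<in> S \<Longrightarrow> form S 0 (\<lambda>_. c)"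
| coord: "form S d f \<Longrightarrow> form S (Suc d) (\<lambda>v. v $ i * f v)"
| add: "form S d f \<Longrightarrow> form S d g \<Longrightarrow> form S d (\<lambda>v. f v + g v)"

definition form_tuple :: "'a::comm_ring_1 set \<Rightarrow> nat \<Rightarrow> ('a ^ 'n \<Rightarrow> 'a ^ 'm) \<Rightarrow> bool" where
  "form_tuple S d h \<longleftrightarrow> (\<forall>i. form S d (\<lambda>v. h v $ i))"

text \<open>A point of projective space is the set of its vectors of homogeneous coordinates.\<close>

type_synonym ('a, 'n) ppoint = "('a ^ 'n) set"

definition pt :: "'a::field ^ 'n \<Rightarrow> ('a, 'n) ppoint" where
  "pt v = {c *s v | c. c \<noteq> 0}"

definition zero_locus :: "('a::field ^ 'n \<Rightarrow> 'a) set \<Rightarrow> ('a, 'n) ppoint set" where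
  "zero_locus fs = {pt v | v. v \<noteq> 0 \<and> (\<forall>f\<in>fs. f v = 0)}"

abbreviation proj_space :: "('a::field, 'n::finite) ppoint set" where
  "proj_space \<equiv> zero_locus {}"

text \<open>
  The map given by a tuple \<open>h\<close> of forms of equal degree, at the points where \<open>h\<close> does not vanish.
  (At the other points the value is \<open>{0}\<close>, which is not a point of projective space.)
\<close>

definition proj_map :: "('a::field ^ 'n \<Rightarrow> 'a ^ 'm) \<Rightarrow> ('a, 'n) ppoint \<Rightarrow> ('a, 'm) ppoint" where
  "proj_map h P = (\<Union>v\<in>P. pt (h v))"

definition conj_point :: "('a::field \<Rightarrow> 'a) \<Rightarrow> ('a, 'n::finite) ppoint \<Rightarrow> ('a, 'n) ppoint" where
  "conj_point \<sigma> P = (\<lambda>v. \<chi> i. \<sigma> (v $ i)) ` P"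

definition rational_over :: "'a::field set \<Rightarrow> ('a, 'n::finite) ppoint \<Rightarrow> bool" where
  "rational_over S P \<longleftrightarrow> (\<exists>v\<in>P. \<forall>i. v $ i \<in> S)"

definition morphism ::
  "'a::field set \<Rightarrow> ('a, 'n::finite) ppoint set \<Rightarrow> ('a, 'm::finite) ppoint set \<Rightarrow>
     (('a, 'n) ppoint \<Rightarrow> ('a, 'm) ppoint) \<Rightarrow> bool" where
  "morphism S V W \<phi> \<longleftrightarrow> \<phi> ` V \<subseteq> W \<and>
     (\<forall>P\<in>V. \<exists>d h. form_tuple S d h \<and> (\<forall>v\<in>P. h v \<noteq> 0) \<and>
        (\<forall>Q\<in>V. \<forall>v\<in>Q. h v \<noteq> 0 \<longrightarrow> \<phi> Q = pt (h v)))"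

definition isomorphism ::
  "'a::field set \<Rightarrow> ('a, 'n::finite) ppoint set \<Rightarrow> ('a, 'm::finite) ppoint set \<Rightarrow>
     (('a, 'n) ppoint \<Rightarrow> ('a, 'm) ppoint) \<Rightarrow> bool" where
  "isomorphism S V W \<phi> \<longleftrightarrow> morphism S V W \<phi> \<and>
     (\<exists>\<psi>. morphism S W V \<psi> \<and> (\<forall>P\<in>V. \<psi> (\<phi> P) = P) \<and> (\<forall>Q\<in>W. \<phi> (\<psi> Q) = Q))"


section \<open>Divisors on a non-singular curve\<close>

text \<open>
  \<open>t\<close> generates the maximal ideal of the local ring of \<open>C\<close> at \<open>P\<close>.  Elements of the local ring are
  fractions of forms whose denominator does not vanish at \<open>P\<close>, and up to units the
  numerators alone suffice; \<open>l\<close> is divisible by \<open>t\<close> in the local ring iff \<open>l g = t h\<close> on \<open>C\<close> with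
  \<open>g(P) \<noteq> 0\<close>.
\<close>

definition uniformizer ::
  "('a::field, 'n::finite) ppoint set \<Rightarrow> ('a, 'n) ppoint \<Rightarrow> ('a ^ 'n \<Rightarrow> 'a) \<Rightarrow> bool" where
  "uniformizer C P t \<longleftrightarrow> (\<exists>d. form UNIV d t) \<and> (\<forall>v\<in>P. t v = 0) \<and>
     (\<forall>d l. form UNIV d l \<and> (\<forall>v\<in>P. l v = 0) \<longrightarrow>
        (\<exists>e e' g h. form UNIV e g \<and> form UNIV e' h \<and> (\<forall>v\<in>P. g v \<noteq> 0) \<and>
           (\<forall>v\<in>\<Union>C. l v * g v = t v * h v)))"

text \<open>\<open>f\<close> is \<open>t ^ n\<close> times a unit of the local ring, \<open>t\<close> a uniformizer.\<close>

definition has_order ::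
  "('a::field, 'n::finite) ppoint set \<Rightarrow> ('a, 'n) ppoint \<Rightarrow> ('a ^ 'n \<Rightarrow> 'a) \<Rightarrow> nat \<Rightarrow> bool" where
  "has_order C P f n \<longleftrightarrow>
     (\<exists>t e e' g h. uniformizer C P t \<and> form UNIV e g \<and> form UNIV e' h \<and>
        (\<forall>v\<in>P. g v \<noteq> 0 \<and> h v \<noteq> 0) \<and> (\<forall>v\<in>\<Union>C. f v * g v = t v ^ n * h v))"

type_synonym ('a, 'n) divisor = "('a, 'n) ppoint \<Rightarrow>\<^sub>0 int"

definition divisor_degree :: "('a, 'n::finite) divisor \<Rightarrow> int" where
  "divisor_degree D = (\<Sum>P\<in>Poly_Mapping.keys D. Poly_Mapping.lookup D P)"

definition div0 :: "('a, 'n::finite) ppoint set \<Rightarrow> ('a, 'n) divisor set" where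
  "div0 C = {D. Poly_Mapping.keys D \<subseteq> C \<and> divisor_degree D = 0}"

text \<open>The divisor of the rational function \<open>f / g\<close>, where \<open>f\<close> and \<open>g\<close> have equal degree.\<close>

definition principal :: "('a::field, 'n::finite) ppoint set \<Rightarrow> ('a, 'n) divisor \<Rightarrow> bool" where
  "principal C D \<longleftrightarrow> Poly_Mapping.keys D \<subseteq> C \<and>
     (\<exists>d f g. form UNIV d f \<and> form UNIV d g \<and>
        (\<forall>P\<in>C. \<exists>m n. has_order C P f m \<and> has_order C P g n \<and>
           Poly_Mapping.lookup D P = int m - int n))"

definition conj_divisor :: "('a::field \<Rightarrow> 'a) \<Rightarrow> ('a, 'n::finite) divisor \<Rightarrow> ('a, 'n) divisor" where
  "conj_divisor \<sigma> D = frag_extend (\<lambda>P. frag_of (conj_point \<sigma> P)) D"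

text \<open>
  The fibre over \<open>Q\<close>, as a divisor on \<open>C\<close>, of a morphism \<open>\<nu>\<close> of degree 2: a sum of two distinct
  points, or twice a ramification point.
\<close>

definition double_cover_fibre ::
  "('a, 'n::finite) ppoint set \<Rightarrow> (('a, 'n) ppoint \<Rightarrow> ('a, 'm) ppoint) \<Rightarrow> ('a, 'm) ppoint \<Rightarrow>
     ('a, 'n) divisor" where
  "double_cover_fibre C \<nu> Q =
     (let F = {P \<in> C. \<nu> P = Q}
      in \<Sum>P\<in>F. frag_cmul (if card F = 1 then 2 else 1) (frag_of P))"


section \<open>Elliptic curves, isogenies and Jacobians\<close>

text \<open>\<open>y\<^sup>2 + a\<^sub>1 x y + a\<^sub>3 y = x\<^sup>3 + a\<^sub>2 x\<^sup>2 + a\<^sub>4 x + a\<^sub>6\<close>\<close>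

datatype 'a weierstrass = Weierstrass (a1: 'a) (a2: 'a) (a3: 'a) (a4: 'a) (a6: 'a)

definition discriminant :: "'a::field weierstrass \<Rightarrow> 'a" where
  "discriminant E =
    (let b2 = (a1 E)^2 + 4 * a2 E;
         b4 = 2 * a4 E + a1 E * a3 E;
         b6 = (a3 E)^2 + 4 * a6 E;
         b8 = (a1 E)^2 * a6 E + 4 * a2 E * a6 E - a1 E * a3 E * a4 E + a2 E * (a3 E)^2 - (a4 E)^2
     in - (b2^2 * b8) - 8 * b4^3 - 27 * b6^2 + 9 * b2 * b4 * b6)"

definition elliptic_curve :: "'a::field set \<Rightarrow> 'a weierstrass \<Rightarrow> bool" where
  "elliptic_curve K E \<longleftrightarrow> set_weierstrass E \<subseteq> K \<and> discriminant E \<noteq> 0"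

definition points :: "'a::field weierstrass \<Rightarrow> ('a, 3) ppoint set" where
  "points E = zero_locus {\<lambda>v. let x = v $ 1; y = v $ 2; z = v $ 3 in
     y^2 * z + a1 E * x * y * z + a3 E * y * z^2
       - (x^3 + a2 E * x^2 * z + a4 E * x * z^2 + a6 E * z^3)}"

definition origin :: "('a::field, 3) ppoint" where
  "origin = pt (vector [0, 1, 0])"

definition affine_rep :: "('a::field, 3) ppoint \<Rightarrow> 'a ^ 3" where
  "affine_rep P = (THE v. v \<in> P \<and> v $ 3 = 1)"

text \<open>Addition by chords and tangents; \<open>l\<close> is the slope of the chord or tangent.\<close>

definition ell_add ::
  "'a::field weierstrass \<Rightarrow> ('a, 3) ppoint \<Rightarrow> ('a, 3) ppoint \<Rightarrow> ('a, 3) ppoint" where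
  "ell_add E P Q =
    (if P = origin then Q else if Q = origin then P else
      let x1 = affine_rep P $ 1; y1 = affine_rep P $ 2;
          x2 = affine_rep Q $ 1; y2 = affine_rep Q $ 2
      in if x1 = x2 \<and> y1 + y2 + a1 E * x2 + a3 E = 0 then origin
         else let l = (if x1 = x2
                       then (3 * x1^2 + 2 * a2 E * x1 + a4 E - a1 E * y1)
                              / (2 * y1 + a1 E * x1 + a3 E)
                       else (y2 - y1) / (x2 - x1));
                  n = y1 - l * x1;
                  x3 = l^2 + a1 E * l - a2 E - x1 - x2
              in pt (vector [x3, - (l + a1 E) * x3 - n - a3 E, 1]))"

definition isogeny ::
  "'a::field set \<Rightarrow> 'a weierstrass \<Rightarrow> 'a weierstrass \<Rightarrow>
     (('a, 3) ppoint \<Rightarrow> ('a, 3) ppoint) \<Rightarrow> bool" where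
  "isogeny K E E' \<phi> \<longleftrightarrow> morphism K (points E) (points E') \<phi> \<and> \<phi> origin = origin"

text \<open>In characteristic 0, an isogeny has degree 2 iff its kernel has order 2.\<close>

definition two_isogeny_with_kernel ::
  "'a::field_char_0 set \<Rightarrow> 'a weierstrass \<Rightarrow> 'a weierstrass \<Rightarrow> ('a, 3) ppoint \<Rightarrow>
     (('a, 3) ppoint \<Rightarrow> ('a, 3) ppoint) \<Rightarrow> bool" where
  "two_isogeny_with_kernel K E E' T \<phi> \<longleftrightarrow>
     isogeny K E E' \<phi> \<and> {P \<in> points E. \<phi> P = origin} = {origin, T}"

text \<open>The dual of an isogeny of degree 2 is the isogeny whose composite with it is \<open>[2]\<close>.\<close>

definition dual_two_isogeny ::
  "'a::field set \<Rightarrow> 'a weierstrass \<Rightarrow> 'a weierstrass \<Rightarrow>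
     (('a, 3) ppoint \<Rightarrow> ('a, 3) ppoint) \<Rightarrow> (('a, 3) ppoint \<Rightarrow> ('a, 3) ppoint) \<Rightarrow> bool" where
  "dual_two_isogeny K E E' \<phi> \<phi>' \<longleftrightarrow>
     isogeny K E' E \<phi>' \<and> (\<forall>P\<in>points E. \<phi>' (\<phi> P) = ell_add E P P)"

text \<open>
  \<open>E\<close> is the Jacobian of the curve \<open>C\<close> of genus one: \<open>j\<close> induces a Galois equivariant
  isomorphism from \<open>Pic\<^sup>0(C)\<close> to \<open>E\<close> that is algebraic, i.e. the Abel-Jacobi maps
  \<open>P \<mapsto> j(P - P0)\<close> are isomorphisms of curves.
\<close>

definition is_jacobian ::
  "'a::field set \<Rightarrow> ('a, 'n::finite) ppoint set \<Rightarrow> 'a weierstrass \<Rightarrow>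
     (('a, 'n) divisor \<Rightarrow> ('a, 3) ppoint) \<Rightarrow> bool" where
  "is_jacobian K C E j \<longleftrightarrow> elliptic_curve K E \<and>
     j ` div0 C = points E \<and>
     (\<forall>D\<in>div0 C. \<forall>D'\<in>div0 C. j (D + D') = ell_add E (j D) (j D')) \<and>
     (\<forall>D\<in>div0 C. j D = origin \<longleftrightarrow> principal C D) \<and>
     (\<forall>\<sigma>\<in>galois_group K. \<forall>D\<in>div0 C. j (conj_divisor \<sigma> D) = conj_point \<sigma> (j D)) \<and>
     (\<forall>P0\<in>C. isomorphism UNIV C (points E) (\<lambda>P. j (frag_of P - frag_of P0)))"


section \<open>Quadric intersections and their singular cones\<close>

text \<open>
  For a quadratic form \<open>f\<close>, the derivative of \<open>f\<close> at \<open>v\<close> is the linear form \<open>polar f v\<close>.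
\<close>

definition polar :: "('a::field ^ 'n \<Rightarrow> 'a) \<Rightarrow> 'a ^ 'n \<Rightarrow> 'a ^ 'n \<Rightarrow> 'a" where
  "polar f v w = f (v + w) - f v - f w"

definition nonsingular_quadric_intersection ::
  "'a::field set \<Rightarrow> ('a ^ 4 \<Rightarrow> 'a) \<Rightarrow> ('a ^ 4 \<Rightarrow> 'a) \<Rightarrow> bool" where
  "nonsingular_quadric_intersection K A B \<longleftrightarrow> form K 2 A \<and> form K 2 B \<and>
     (\<forall>v. v \<noteq> 0 \<and> A v = 0 \<and> B v = 0 \<longrightarrow>
        (\<forall>s t. (\<forall>w. s * polar A v w + t * polar B v w = 0) \<longrightarrow> s = 0 \<and> t = 0))"

definition plane_conic :: "('a::field ^ 3 \<Rightarrow> 'a) \<Rightarrow> ('a, 3) ppoint set" where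
  "plane_conic q = zero_locus {q}"

definition quadric_cone :: "('a::field ^ 3 \<Rightarrow> 'a) \<Rightarrow> 'a ^ 4 ^ 3 \<Rightarrow> ('a, 4) ppoint set" where
  "quadric_cone q m = zero_locus {\<lambda>p. q (m *v p)}"

text \<open>
  The four singular members of the pencil spanned by \<open>A\<close> and \<open>B\<close>, written as
  \<open>q (m\<^sub>1, m\<^sub>2, m\<^sub>3) = 0\<close> with linear forms \<open>m\<^sub>1, m\<^sub>2, m\<^sub>3\<close>, the rows of \<open>m i\<close>.
  Every quaternary quadratic form of this shape is singular, and the pencil of a non-singular
  intersection has exactly four singular members, all of rank 3; hence four distinct members of this
  shape are all of them, and the common zero of the linear forms is the vertex.
\<close>

definition singular_cones ::
  "('a::field ^ 4 \<Rightarrow> 'a) \<Rightarrow> ('a ^ 4 \<Rightarrow> 'a) \<Rightarrow>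
     (4 \<Rightarrow> 'a ^ 3 \<Rightarrow> 'a) \<Rightarrow> (4 \<Rightarrow> 'a ^ 4 ^ 3) \<Rightarrow> bool" where
  "singular_cones A B q m \<longleftrightarrow> (\<forall>i. form UNIV 2 (q i)) \<and>
     (\<exists>s t. (\<forall>i p. q i (m i *v p) = s i * A p + t i * B p) \<and>
        (\<forall>i j. i \<noteq> j \<longrightarrow> s i * t j \<noteq> s j * t i))"

abbreviation projection :: "'a::field ^ 4 ^ 3 \<Rightarrow> ('a, 4) ppoint \<Rightarrow> ('a, 3) ppoint" where
  "projection m \<equiv> proj_map (\<lambda>p. m *v p)"

text \<open>The four elements of the group generated by the transpositions (1 2) and (3 4).\<close>

definition galois_image_in_12_34 ::
  "'a::field set \<Rightarrow> (4 \<Rightarrow> 'a ^ 3 \<Rightarrow> 'a) \<Rightarrow> (4 \<Rightarrow> 'a ^ 4 ^ 3) \<Rightarrow> bool" where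
  "galois_image_in_12_34 K q m \<longleftrightarrow>
     (\<forall>\<sigma>\<in>galois_group K.
        \<exists>\<tau> \<in> {id, Transposition.transpose 1 2, Transposition.transpose 3 4,
             Transposition.transpose 1 2 \<circ> Transposition.transpose 3 4}.
          \<forall>i. conj_point \<sigma> ` quadric_cone (q i) (m i) = quadric_cone (q (\<tau> i)) (m (\<tau> i)))"


section \<open>The construction of the double cover\<close>

definition parametrisation ::
  "'a::field set \<Rightarrow> ('a ^ 3 \<Rightarrow> 'a) \<Rightarrow> ('a ^ 2 \<Rightarrow> 'a ^ 3) \<Rightarrow> bool" where
  "parametrisation S q Q \<longleftrightarrow> form_tuple S 2 Q \<and>
     isomorphism S proj_space (plane_conic q) (proj_map Q)"

text \<open>
  \<open>w = (c, d, \<theta>, \<psi>)\<close>; the rewritten system has the same solutions over the algebraic closure.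
\<close>

definition split_construction ::
  "'a::field set \<Rightarrow> (4 \<Rightarrow> 'a ^ 3 \<Rightarrow> 'a) \<Rightarrow> (4 \<Rightarrow> 'a ^ 4 ^ 3) \<Rightarrow>
     ('a ^ 4 \<Rightarrow> 'a ^ 4) \<Rightarrow> ('a ^ 4 \<Rightarrow> 'a) \<Rightarrow> ('a ^ 4 \<Rightarrow> 'a) \<Rightarrow> bool" where
  "split_construction K q m r F G \<longleftrightarrow>
     (\<forall>i\<in>{1, 2}. form K 2 (q i) \<and> (\<forall>k l. m i $ k $ l \<in> K)) \<and>
     form_tuple K 2 r \<and> form K 2 F \<and> form K 2 G \<and>
     (\<exists>Q R. parametrisation K (q 1) Q \<and> parametrisation K (q 2) R \<and>
        (\<forall>p w. (m 1 *v p = Q (vector [w $ 1, w $ 2]) \<and> m 2 *v p = R (vector [w $ 3, w $ 4]))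
               \<longleftrightarrow> (p = r w \<and> F w = 0 \<and> G w = 0)))"

text \<open>
  \<open>w = (x, y, u, v)\<close>; \<open>m'\<close>, \<open>m''\<close> and \<open>Q'\<close>, \<open>Q''\<close> are the coefficients of \<open>1\<close> and \<open>\<beta>\<close> in the
  expansions of \<open>m 1\<close> and \<open>Q (x + \<beta> y, u + \<beta> v)\<close>, where the variables count as elements of \<open>K\<close>.
  As these have coefficients in \<open>K\<close>, they are determined by the identities over the algebraic
  closure.
\<close>

definition nonsplit_construction ::
  "'a::field set \<Rightarrow> (4 \<Rightarrow> 'a ^ 3 \<Rightarrow> 'a) \<Rightarrow> (4 \<Rightarrow> 'a ^ 4 ^ 3) \<Rightarrow>
     ('a ^ 4 \<Rightarrow> 'a ^ 4) \<Rightarrow> ('a ^ 4 \<Rightarrow> 'a) \<Rightarrow> ('a ^ 4 \<Rightarrow> 'a) \<Rightarrow> bool" where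
  "nonsplit_construction K q m r F G \<longleftrightarrow>
     form_tuple K 2 r \<and> form K 2 F \<and> form K 2 G \<and>
     (\<exists>\<beta> L. \<beta> \<notin> K \<and> (\<exists>b\<in>K. \<exists>c\<in>K. \<beta>^2 + b * \<beta> + c = 0) \<and>
        L = {a + b * \<beta> | a b. a \<in> K \<and> b \<in> K} \<and>
        form L 2 (q 1) \<and> (\<forall>k l. m 1 $ k $ l \<in> L) \<and>
        (\<forall>\<sigma>\<in>galois_group K. \<sigma> \<beta> \<noteq> \<beta> \<longrightarrow>
           conj_point \<sigma> ` quadric_cone (q 1) (m 1) = quadric_cone (q 2) (m 2)) \<and>
        (\<exists>Q Q' Q'' m' m''.
           parametrisation L (q 1) Q \<and>
           form_tuple K 2 Q' \<and> form_tuple K 2 Q'' \<and>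
           (\<forall>w. Q (vector [w $ 1 + \<beta> * w $ 2, w $ 3 + \<beta> * w $ 4]) = Q' w + \<beta> *s Q'' w) \<and>
           (\<forall>k l. m' $ k $ l \<in> K \<and> m'' $ k $ l \<in> K \<and>
                  m 1 $ k $ l = m' $ k $ l + \<beta> * m'' $ k $ l) \<and>
           (\<forall>p w. (m' *v p = Q' w \<and> m'' *v p = Q'' w)
                  \<longleftrightarrow> (p = r w \<and> F w = 0 \<and> G w = 0))))"

text \<open>
  \<open>\<pi> : D \<rightarrow> C\<close> is a covering over \<open>K\<close> that becomes isomorphic to \<open>\<phi> : E' \<rightarrow> E\<close> over the algebraic
  closure.
\<close>

definition isogeny_covering ::
  "'a::field set \<Rightarrow> 'a weierstrass \<Rightarrow> 'a weierstrass \<Rightarrow> (('a, 3) ppoint \<Rightarrow> ('a, 3) ppoint) \<Rightarrow>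
     ('a, 'n::finite) ppoint set \<Rightarrow> ('a, 'm::finite) ppoint set \<Rightarrow>
     (('a, 'n) ppoint \<Rightarrow> ('a, 'm) ppoint) \<Rightarrow> bool" where
  "isogeny_covering K E' E \<phi> D C \<pi> \<longleftrightarrow> morphism K D C \<pi> \<and>
     (\<exists>f g. isomorphism UNIV D (points E') f \<and> isomorphism UNIV C (points E) g \<and>
        (\<forall>P\<in>D. g (\<pi> P) = \<phi> (f P)))"

end

theory Submission
  imports Defs
begin

text \<open>
  Diagonalising the pencil brings \<open>C\<close> to the form \<open>x\<^sub>1\<^sup>2 + x\<^sub>3\<^sup>2 = x\<^sub>4\<^sup>2\<close>, \<open>x\<^sub>2\<^sup>2 + k\<^sup>2 x\<^sub>1\<^sup>2 = x\<^sub>4\<^sup>2\<close>,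
  with \<open>\<nu>\<^sub>i\<close> the quotient by the sign change of \<open>x\<^sub>i\<close>, and translation by \<open>T\<close> is the simultaneous sign
  change of \<open>x\<^sub>1\<close> and \<open>x\<^sub>2\<close>.  A quadratic parametrisation of the conic \<open>y\<^sub>2\<^sup>2 = y\<^sub>1 y\<^sub>3\<close> is the Veronese map up
  to a linear change of variables; hence \<open>D\<close> and \<open>\<pi>\<close> become an explicit quadric intersection and an
  explicit quadratic map \<open>po\<close>.  In the non-split case the same argument applies to the first cone
  and its Galois conjugate.

  Doubling on \<open>C\<close> factors as \<open>po \<circ> ps\<close>, where \<open>ps : C \<rightarrow> D\<close> is the quotient by translation by \<open>T\<close>; it
  is identified with doubling on \<open>E\<close> by exhibiting principal divisors.  As \<open>\<phi>\<close> identifies points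
  that differ by \<open>T\<close>, it equals \<open>f \<circ> ps\<close> for a morphism \<open>f : D \<rightarrow> E'\<close>, and \<open>f\<close> is an isomorphism
  because the function field of \<open>D\<close> is generated over that of \<open>C\<close> by functions that come from \<open>E'\<close>.
  Cancelling \<open>ps\<close> in \<open>\<phi>' \<circ> \<phi> = po \<circ> ps\<close> shows that \<open>f\<close> carries \<open>\<phi>'\<close> to \<open>po\<close>.
\<close>

section \<open>Forms\<close>

text \<open>Isogenies enter only as morphisms fixing the origin, with a given kernel or composite;
  nothing says that \<phi> is additive. Its invariance under translation by \<open>T\<close> is won
  geometrically: otherwise \<phi> would separate the four points in a general fibre of doubling and
  be birational, and an inverse regular at the origin of \<open>E'\<close> could not return both
  points of the kernel.

  This needs two facts about function fields, both put in terms of forms. Irreducibility: a form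
  with infinitely many zeros on the curve vanishes on it. Regularity of rational maps at smooth
  points: a tuple of forms can be replaced by a proportional one that is non-zero at a given point.
  Both are proved for Weierstrass cubics, where functions are \<open>a(x) + b(x) y\<close>; an
  Abel-Jacobi isomorphism carries irreducibility to \<open>C\<close>, and inverses are extended on
  \<open>E'\<close>.

  Doubling on \<open>C\<close> needs orders of linear forms on the space quartic: planes through a
  vertex show that the fibres of a projection are equivalent, and one further plane gives the double
  of a point.\<close>

lemma form_mono: "form S d f \<Longrightarrow> S \<subseteq> S' \<Longrightarrow> form S' d f"
  by (induction rule: form.induct) (auto intro: form.intros)

lemma form_UNIV: "form S d f \<Longrightarrow> form UNIV d f"
  by (rule form_mono) auto

lemma form_tuple_UNIV: "form_tuple S d h \<Longrightarrow> form_tuple UNIV d h"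
  unfolding form_tuple_def using form_UNIV by blast

lemma form_zero: "form UNIV d (\<lambda>_. 0)"
proof (induction d)
  case 0 then show ?case by (rule form.const) simp
next
  case (Suc d) then show ?case using form.coord[OF Suc, of undefined] by simp
qed

lemma form_homog: "form S d f \<Longrightarrow> f (c *s v) = c ^ d * f v"
  by (induction rule: form.induct) (auto simp: algebra_simps)

lemma form_at_0: "form S d f \<Longrightarrow> d > 0 \<Longrightarrow> f 0 = 0"
  using form_homog[of S d f 0 0] by (simp add: zero_power)

lemma form_cmult: "form UNIV d f \<Longrightarrow> form UNIV d (\<lambda>v. c * f v)"
proof (induction rule: form.induct)
  case (coord d f i)
  then show ?case using form.coord[OF coord(2), of i] by (simp add: algebra_simps)
qed (auto intro: form.intros simp: algebra_simps)

lemma form_mult: "form UNIV d f \<Longrightarrow> form UNIV e g \<Longrightarrow> n = d + e \<Longrightarrow> form UNIV n (\<lambda>v. f v * g v)"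
proof (induction arbitrary: n rule: form.induct)
  case (const c)
  then show ?case by (simp add: form_cmult)
next
  case (coord d f i)
  from coord(2)[OF coord(3) refl] have "form UNIV (Suc (d + e)) (\<lambda>v. v $ i * (f v * g v))"
    by (rule form.coord)
  then show ?case using coord by (simp add: algebra_simps)
next
  case (add d f g')
  then show ?case using form.add[OF add(3)[OF add(5,6)] add(4)[OF add(5,6)]] by (simp add: algebra_simps)
qed

lemma form_coord: "form UNIV 1 (\<lambda>v. v $ i)"
  using form.coord[OF form.const[of 1 UNIV], of i] by simp

lemma form_cong: "form S d f \<Longrightarrow> (\<And>v. f v = g v) \<Longrightarrow> form S d g"
  by (metis ext)

lemma form_minus: "form UNIV d f \<Longrightarrow> form UNIV d (\<lambda>v. - f v)"
  using form_cmult[of d f "-1"] by simp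

lemma form_diff: "form UNIV d f \<Longrightarrow> form UNIV d g \<Longrightarrow> form UNIV d (\<lambda>v. f v - g v)"
  using form.add[OF _ form_minus] by fastforce

lemma form_sum: "(\<And>i. i \<in> I \<Longrightarrow> form UNIV d (f i)) \<Longrightarrow> form UNIV d (\<lambda>v. \<Sum>i\<in>I. f i v)"
proof (induction I rule: infinite_finite_induct)
  case (insert x F)
  then have "form UNIV d (\<lambda>v. f x v + (\<Sum>i\<in>F. f i v))" by (intro form.add) auto
  then show ?case using insert by simp
qed (auto intro: form_zero)

lemma form_power: "form UNIV d f \<Longrightarrow> m = n * d \<Longrightarrow> form UNIV m (\<lambda>v. f v ^ n)"
proof (induction n arbitrary: m)
  case 0
  then show ?case using form.const[of 1 UNIV] by simp
next
  case (Suc n)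
  show ?case using form_mult[OF Suc(2) Suc(1)[OF Suc(2) refl], of m] Suc by simp
qed

lemma form_prod:
  "finite I \<Longrightarrow> (\<And>i. i \<in> I \<Longrightarrow> form UNIV d (f i)) \<Longrightarrow> m = card I * d \<Longrightarrow> form UNIV m (\<lambda>v. \<Prod>i\<in>I. f i v)"
proof (induction I arbitrary: m rule: finite_induct)
  case empty
  then show ?case using form.const[of 1 UNIV] by simp
next
  case (insert x F)
  have "form UNIV m (\<lambda>v. f x v * (\<Prod>i\<in>F. f i v))"
    by (rule form_mult[OF _ insert(3)]) (use insert in auto)
  then show ?case using insert by simp
qed

lemma form_comp:
  "form UNIV d f \<Longrightarrow> form_tuple UNIV e h \<Longrightarrow> n = d * e \<Longrightarrow> form UNIV n (\<lambda>v. f (h v))"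
proof (induction arbitrary: n rule: form.induct)
  case (const c)
  then show ?case by (simp add: form.const)
next
  case (coord d f i)
  show ?case
    by (rule form_mult[OF _ coord(2)[OF coord(3) refl]]) (use coord in \<open>auto simp: form_tuple_def\<close>)
next
  case (add d f g)
  then show ?case by (intro form.add) auto
qed

lemma form_tuple_comp:
  "form_tuple UNIV d f \<Longrightarrow> form_tuple UNIV e h \<Longrightarrow> n = d * e \<Longrightarrow> form_tuple UNIV n (\<lambda>v. f (h v))"
  unfolding form_tuple_def[of UNIV d] form_tuple_def[of UNIV n] using form_comp by blast

lemma form_tuple_matrix: "form_tuple UNIV 1 (\<lambda>v. M *v v)"
  unfolding form_tuple_def matrix_vector_mult_def
  by (auto intro!: form_sum form_cmult form_coord[unfolded One_nat_def])

lemma form_tuple_homog: "form_tuple S d h \<Longrightarrow> h (c *s v) = c ^ d *s h v"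
  unfolding form_tuple_def using form_homog[of S d "\<lambda>v. h v $ _"] by (auto simp: vec_eq_iff)

lemma form_tuple_smult:
  "form UNIV d f \<Longrightarrow> form_tuple UNIV e h \<Longrightarrow> n = d + e \<Longrightarrow> form_tuple UNIV n (\<lambda>v. f v *s h v)"
  unfolding form_tuple_def by (auto intro: form_mult)

lemma form_tuple_nth: "form_tuple UNIV d h \<Longrightarrow> form UNIV d (\<lambda>v. h v $ i)"
  unfolding form_tuple_def by auto

text \<open>The homogenisation of the expansion around \<open>v\<close> in the chart where the coordinate \<open>i\<close> is 1.\<close>

lemma form_expand:
  fixes f :: "'a::comm_ring_1 ^ 'n \<Rightarrow> 'a"
  assumes "form UNIV d f" "v $ i = 1"
  shows "\<exists>g. (\<forall>j. form UNIV (d - 1) (g j) \<and> (d = 0 \<longrightarrow> g j = (\<lambda>_. 0))) \<and>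
     (\<forall>x. f x = f v * x $ i ^ d + (\<Sum>j\<in>UNIV. (x $ j - v $ j * x $ i) * g j x))"
  using assms(1)
proof (induction rule: form.induct)
  case (const c)
  show ?case by (rule exI[of _ "\<lambda>_ _. 0"]) (auto intro: form_zero)
next
  case (coord d f l)
  then obtain g where g: "\<And>j. form UNIV (d - 1) (g j)" "\<And>j. d = 0 \<Longrightarrow> g j = (\<lambda>_. 0)"
    "\<And>x. f x = f v * x $ i ^ d + (\<Sum>j\<in>UNIV. (x $ j - v $ j * x $ i) * g j x)" by blast
  \<comment> \<open>Comes from \<open>x $ l * f x = v $ l * x $ i * f x + (x $ l - v $ l * x $ i) *
    f x\<close>, with the expansion of \<open>f\<close> inserted into the first summand.\<close>
  define g' where "g' j x = v $ l * (x $ i * g j x) + (if j = l then f x else 0)" for j x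
  \<comment> \<open>For \<open>d = 0\<close> the truncated \<open>d - 1\<close> would give degree 1
    here; the clause that all \<open>g j\<close> are zero in that case repairs this.\<close>
  have d: "form UNIV d (\<lambda>x. x $ i * g j x)" for j
  proof (cases d)
    case 0
    then show ?thesis using g(2)[of j] form_zero by simp
  next
    case (Suc e)
    then show ?thesis using g(1)[of j] form.coord[of UNIV e "g j" i] by simp
  qed
  have g'1: "form UNIV d (g' j)" for j
  proof (cases "j = l")
    case True
    then show ?thesis using form.add[OF form_cmult[OF d, of "v $ l" j] coord(1)] unfolding g'_def by simp
  next
    case False
    then show ?thesis using form_cmult[OF d, of "v $ l" j] unfolding g'_def by simp
  qed
  have g'2: "x $ l * f x = v $ l * f v * x $ i ^ Suc d + (\<Sum>j\<in>UNIV. (x $ j - v $ j * x $ i) * g' j x)" for x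
  proof -
    have "(\<Sum>j\<in>UNIV. (x $ j - v $ j * x $ i) * g' j x) =
       (\<Sum>j\<in>UNIV. v $ l * x $ i * ((x $ j - v $ j * x $ i) * g j x)) +
       (\<Sum>j\<in>UNIV. (if j = l then (x $ j - v $ j * x $ i) * f x else 0))"
      unfolding g'_def sum.distrib[symmetric] by (rule sum.cong) (auto simp: algebra_simps)
    also have "\<dots> = v $ l * x $ i * (f x - f v * x $ i ^ d) + (x $ l - v $ l * x $ i) * f x"
      using g(3)[of x] by (simp add: sum_distrib_left[symmetric])
    finally show ?thesis by (simp add: algebra_simps)
  qed
  show ?case using g'1 by (intro exI[of _ g'] conjI allI g'2) auto
next
  case (add d f1 f2)
  from add(3) obtain g1 where g1: "\<And>j. form UNIV (d - 1) (g1 j)" "\<And>j. d = 0 \<Longrightarrow> g1 j = (\<lambda>_. 0)"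
    "\<And>x. f1 x = f1 v * x $ i ^ d + (\<Sum>j\<in>UNIV. (x $ j - v $ j * x $ i) * g1 j x)" by blast
  from add(4) obtain g2 where g2: "\<And>j. form UNIV (d - 1) (g2 j)" "\<And>j. d = 0 \<Longrightarrow> g2 j = (\<lambda>_. 0)"
    "\<And>x. f2 x = f2 v * x $ i ^ d + (\<Sum>j\<in>UNIV. (x $ j - v $ j * x $ i) * g2 j x)" by blast
  show ?case
  proof (intro exI[of _ "\<lambda>j x. g1 j x + g2 j x"] conjI allI impI)
    fix x
    show "f1 x + f2 x = (f1 v + f2 v) * x $ i ^ d +
      (\<Sum>j\<in>UNIV. (x $ j - v $ j * x $ i) * (g1 j x + g2 j x))"
      unfolding g1(3)[of x] g2(3)[of x] distrib_left distrib_right sum.distrib by simp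
  qed (use g1 g2 in \<open>auto intro: form.add\<close>)
qed

section \<open>Projective points and morphisms\<close>

lemma in_pt: "w \<in> pt v \<longleftrightarrow> (\<exists>c. c \<noteq> 0 \<and> w = c *s v)"
  unfolding pt_def by auto

lemma self_in_pt: "v \<in> pt v"
  unfolding in_pt by (rule exI[of _ 1]) simp

lemma pt_smult: "c \<noteq> 0 \<Longrightarrow> pt (c *s v) = pt v"
  unfolding set_eq_iff in_pt
  by (metis (no_types, opaque_lifting) divide_eq_eq divide_eq_0_iff vector_smult_assoc)

lemma pt_eq_iff: "pt v = pt w \<longleftrightarrow> (\<exists>c. c \<noteq> 0 \<and> v = c *s w)"
  by (metis in_pt pt_smult self_in_pt)

lemma pt_eqI: "v \<in> pt w \<Longrightarrow> pt v = pt w"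
  unfolding in_pt pt_eq_iff .

text \<open>Proportionality as vanishing of all 2 by 2 minors. In this shape an equality of points
  is a system of polynomial identities, so it spreads from infinitely many points to a whole
  irreducible curve.\<close>

lemma pt_eq_minors:
  fixes v w :: "'a::field ^ 'n"
  assumes "v \<noteq> 0" "w \<noteq> 0"
  shows "pt v = pt w \<longleftrightarrow> (\<forall>i j. v $ i * w $ j = v $ j * w $ i)"
proof
  assume "\<forall>i j. v $ i * w $ j = v $ j * w $ i"
  then have *: "\<And>i j. v $ i * w $ j = v $ j * w $ i" by auto
  obtain j where j: "w $ j \<noteq> 0" using assms(2) by (auto simp: vec_eq_iff)
  have v: "v = (v $ j / w $ j) *s w"
    unfolding vec_eq_iff using *[of _ j] j by (auto simp: field_simps)
  moreover have "v $ j / w $ j \<noteq> 0" using v assms(1) by (metis vector_smult_lzero)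
  ultimately show "pt v = pt w" unfolding pt_eq_iff by blast
next
  assume "pt v = pt w"
  then show "\<forall>i j. v $ i * w $ j = v $ j * w $ i" unfolding pt_eq_iff by (auto simp: algebra_simps)
qed

lemma in_zero_locus:
  assumes "\<And>f. f \<in> fs \<Longrightarrow> \<exists>n. \<forall>c v. f (c *s v) = c ^ n * f v"
  shows "pt v \<in> zero_locus fs \<longleftrightarrow> v \<noteq> 0 \<and> (\<forall>f\<in>fs. f v = 0)"
proof
  assume "pt v \<in> zero_locus fs"
  then obtain w where w: "pt v = pt w" "w \<noteq> 0" "\<forall>f\<in>fs. f w = 0" unfolding zero_locus_def by auto
  then obtain c where "c \<noteq> 0" "v = c *s w" unfolding pt_eq_iff by auto
  then show "v \<noteq> 0 \<and> (\<forall>f\<in>fs. f v = 0)" using w(2,3) assms by fastforce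
qed (auto simp: zero_locus_def)

lemma zero_locus_subset: "zero_locus fs \<subseteq> proj_space"
  unfolding zero_locus_def by auto

lemma pt_in_proj_space: "pt v \<in> proj_space \<longleftrightarrow> v \<noteq> 0"
  by (subst in_zero_locus) auto

lemma proj_setE:
  assumes "V \<subseteq> proj_space" "P \<in> V"
  obtains v where "P = pt v" "v \<noteq> 0" "pt v \<in> V"
  using assms unfolding zero_locus_def by auto

lemma proj_set_memD:
  assumes "V \<subseteq> proj_space" "P \<in> V" "v \<in> P"
  shows "P = pt v" "v \<noteq> 0"
proof -
  obtain w where w: "P = pt w" "w \<noteq> 0" using proj_setE[OF assms(1,2)] by blast
  then show "P = pt v" using assms(3) pt_eqI by metis
  then show "v \<noteq> 0" using assms pt_in_proj_space by blast
qed

lemma in_Union_proj_set: "V \<subseteq> proj_space \<Longrightarrow> v \<in> \<Union>V \<longleftrightarrow> pt v \<in> V"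
  by (metis UnionE UnionI proj_set_memD(1) self_in_pt)

lemma form_zero_smult: "form S d f \<Longrightarrow> f v = 0 \<Longrightarrow> f (c *s v) = 0"
  by (simp add: form_homog)

lemma form_eq_0_iff_smult:
  fixes f :: "'a::field ^ 'n \<Rightarrow> 'a"
  shows "form S d f \<Longrightarrow> c \<noteq> 0 \<Longrightarrow> f (c *s v) = 0 \<longleftrightarrow> f v = 0"
  by (simp add: form_homog)

lemma form_tuple_eq_0_iff_smult:
  fixes h :: "'a::field ^ 'n \<Rightarrow> 'a ^ 'm"
  shows "form_tuple S d h \<Longrightarrow> c \<noteq> 0 \<Longrightarrow> h (c *s v) = 0 \<longleftrightarrow> h v = 0"
  by (simp add: form_tuple_homog vec_eq_iff)

lemma form_tuple_pt_smult:
  fixes h :: "'a::field ^ 'n \<Rightarrow> 'a ^ 'm"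
  shows "form_tuple S d h \<Longrightarrow> c \<noteq> 0 \<Longrightarrow> pt (h (c *s v)) = pt (h v)"
  by (simp add: form_tuple_homog pt_smult)

lemma proj_map_pt:
  fixes h :: "'a::field ^ 'n \<Rightarrow> 'a ^ 'm"
  assumes "form_tuple S d h"
  shows "proj_map h (pt v) = pt (h v)"
proof -
  have "pt (h w) = pt (h v)" if "w \<in> pt v" for w
    using that form_tuple_pt_smult[OF assms] unfolding in_pt by auto
  then show ?thesis unfolding proj_map_def using self_in_pt by blast
qed

lemma morphismI:
  assumes V: "V \<subseteq> proj_space" and W: "\<And>v. pt v \<in> V \<Longrightarrow> \<phi> (pt v) \<in> W"
    and loc: "\<And>v. pt v \<in> V \<Longrightarrow> \<exists>d h. form_tuple S d h \<and> h v \<noteq> 0 \<and> (\<forall>w. pt w \<in> V \<and> h w \<noteq> 0 \<longrightarrow> \<phi> (pt w) = pt (h w))"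
  shows "morphism S V W \<phi>"
  unfolding morphism_def
proof (intro conjI ballI)
  show "\<phi> ` V \<subseteq> W" using W proj_setE[OF V] by (metis image_subsetI)
next
  fix P assume "P \<in> V"
  then obtain v where v: "P = pt v" "pt v \<in> V" using proj_setE[OF V] by metis
  from loc[OF v(2)] obtain d h where h: "form_tuple S d h" "h v \<noteq> 0"
    "\<And>w. pt w \<in> V \<Longrightarrow> h w \<noteq> 0 \<Longrightarrow> \<phi> (pt w) = pt (h w)" by blast
  show "\<exists>d h. form_tuple S d h \<and> (\<forall>v\<in>P. h v \<noteq> 0) \<and> (\<forall>Q\<in>V. \<forall>v\<in>Q. h v \<noteq> 0 \<longrightarrow> \<phi> Q = pt (h v))"
  proof (intro exI conjI ballI impI)
    show "form_tuple S d h" by fact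
    fix w assume "w \<in> P"
    then show "h w \<noteq> 0" using h(2) form_tuple_eq_0_iff_smult[OF h(1)] unfolding v(1) in_pt by auto
  next
    fix Q w assume "Q \<in> V" "w \<in> Q" "h w \<noteq> 0"
    then show "\<phi> Q = pt (h w)" using h(3)[of w] proj_set_memD[OF V] by metis
  qed
qed

lemma morphism_in: "morphism S V W \<phi> \<Longrightarrow> P \<in> V \<Longrightarrow> \<phi> P \<in> W"
  unfolding morphism_def by auto

text \<open>The degree can be taken positive, so that the local representative vanishes at 0.\<close>

lemma morphism_local:
  fixes V :: "('a::field, 'n::finite) ppoint set"
  assumes "morphism UNIV V W \<phi>" "V \<subseteq> proj_space" "pt v \<in> V"
  obtains d h where "form_tuple UNIV d h" "d > 0" "h v \<noteq> 0"
    "\<And>w. pt w \<in> V \<Longrightarrow> h w \<noteq> 0 \<Longrightarrow> \<phi> (pt w) = pt (h w)"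
proof -
  from assms(1,3) obtain d h where h: "form_tuple UNIV d h" "h v \<noteq> 0"
    "\<And>w. pt w \<in> V \<Longrightarrow> h w \<noteq> 0 \<Longrightarrow> \<phi> (pt w) = pt (h w)"
    unfolding morphism_def using self_in_pt by metis
  have "v \<noteq> 0" using assms(2,3) pt_in_proj_space by blast
  then obtain i where i: "v $ i \<noteq> 0" by (auto simp: vec_eq_iff)
  show thesis
  proof (rule that[of "Suc d" "\<lambda>w. w $ i *s h w"])
    show "form_tuple UNIV (Suc d) (\<lambda>w. w $ i *s h w)"
      by (rule form_tuple_smult[OF form_coord h(1)]) simp
    show "v $ i *s h v \<noteq> 0" using i h(2) by (simp add: vec_eq_iff)
    fix w assume w: "pt w \<in> V" "w $ i *s h w \<noteq> 0"
    then have "w $ i \<noteq> 0" "h w \<noteq> 0" by auto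
    then show "\<phi> (pt w) = pt (w $ i *s h w)" using h(3)[OF w(1)] pt_smult by metis
  qed simp
qed

lemma morphism_comp:
  fixes \<phi> :: "('a::field, 'n::finite) ppoint \<Rightarrow> ('a, 'm::finite) ppoint" and \<psi> :: "_ \<Rightarrow> ('a, 'l::finite) ppoint"
  assumes 1: "morphism UNIV V W \<phi>" and 2: "morphism UNIV W U \<psi>"
    and V: "V \<subseteq> proj_space" and W: "W \<subseteq> proj_space"
  shows "morphism UNIV V U (\<lambda>P. \<psi> (\<phi> P))"
proof (rule morphismI[OF V])
  fix v assume v: "pt v \<in> V"
  show "\<psi> (\<phi> (pt v)) \<in> U" using morphism_in[OF 2 morphism_in[OF 1 v]] .
  obtain d h where h: "form_tuple UNIV d h" "h v \<noteq> 0"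
    "\<And>w. pt w \<in> V \<Longrightarrow> h w \<noteq> 0 \<Longrightarrow> \<phi> (pt w) = pt (h w)"
    using morphism_local[OF 1 V v] by metis
  have "pt (h v) \<in> W" using h(2,3) v morphism_in[OF 1 v] by simp
  then obtain e g where g: "form_tuple UNIV e g" "e > 0" "g (h v) \<noteq> 0"
    "\<And>w. pt w \<in> W \<Longrightarrow> g w \<noteq> 0 \<Longrightarrow> \<psi> (pt w) = pt (g w)"
    using morphism_local[OF 2 W] by metis
  show "\<exists>d' h'. form_tuple UNIV d' h' \<and> h' v \<noteq> 0 \<and> (\<forall>w. pt w \<in> V \<and> h' w \<noteq> 0 \<longrightarrow> \<psi> (\<phi> (pt w)) = pt (h' w))"
  proof (intro exI conjI allI impI)
    show "form_tuple UNIV (e * d) (\<lambda>w. g (h w))" by (rule form_tuple_comp[OF g(1) h(1)]) simp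
    show "g (h v) \<noteq> 0" by fact
    fix w assume w: "pt w \<in> V \<and> g (h w) \<noteq> 0"
    \<comment> \<open>Positive degree makes \<open>g\<close> vanish at 0, so \<open>g (h w)\<close>
      can be non-zero only where \<open>h w\<close> is.\<close>
    have "g 0 = 0" using g(1,2) form_at_0 by (auto simp: vec_eq_iff form_tuple_def)
    then have "h w \<noteq> 0" using w by auto
    then have *: "\<phi> (pt w) = pt (h w)" using h(3) w by blast
    then have "pt (h w) \<in> W" using morphism_in[OF 1, of "pt w"] w by simp
    then show "\<psi> (\<phi> (pt w)) = pt (g (h w))" using g(4) w * by metis
  qed
qed

lemma morphism_id:
  fixes V :: "('a::field, 'n::finite) ppoint set"
  assumes "V \<subseteq> proj_space"
  shows "morphism UNIV V V (\<lambda>P. P)"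
proof (rule morphismI[OF assms])
  fix v :: "'a^'n" assume "pt v \<in> V"
  then have "v \<noteq> 0" using pt_in_proj_space assms by blast
  then show "\<exists>d h. form_tuple UNIV d h \<and> h v \<noteq> 0 \<and> (\<forall>w. pt w \<in> V \<and> h w \<noteq> 0 \<longrightarrow> pt w = pt (h w))"
    by (intro exI[of _ 1] exI[of _ "\<lambda>v. v"]) (auto simp: form_tuple_def form_coord[unfolded One_nat_def])
qed

lemma isomorphism_comp:
  fixes \<phi> :: "('a::field, 'n::finite) ppoint \<Rightarrow> ('a, 'm::finite) ppoint" and \<psi> :: "_ \<Rightarrow> ('a, 'l::finite) ppoint"
  assumes 1: "isomorphism UNIV V W \<phi>" and 2: "isomorphism UNIV W U \<psi>"
    and V: "V \<subseteq> proj_space" and W: "W \<subseteq> proj_space" and U: "U \<subseteq> proj_space"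
  shows "isomorphism UNIV V U (\<lambda>P. \<psi> (\<phi> P))"
proof -
  obtain \<phi>' where 1: "morphism UNIV V W \<phi>" "morphism UNIV W V \<phi>'"
    "\<And>P. P \<in> V \<Longrightarrow> \<phi>' (\<phi> P) = P" "\<And>P. P \<in> W \<Longrightarrow> \<phi> (\<phi>' P) = P"
    using 1 unfolding isomorphism_def by metis
  obtain \<psi>' where 2: "morphism UNIV W U \<psi>" "morphism UNIV U W \<psi>'"
    "\<And>P. P \<in> W \<Longrightarrow> \<psi>' (\<psi> P) = P" "\<And>P. P \<in> U \<Longrightarrow> \<psi> (\<psi>' P) = P"
    using 2 unfolding isomorphism_def by metis
  show ?thesis unfolding isomorphism_def
  proof (intro conjI exI[of _ "\<lambda>P. \<phi>' (\<psi>' P)"] ballI)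
    show "morphism UNIV V U (\<lambda>P. \<psi> (\<phi> P))" by (rule morphism_comp[OF 1(1) 2(1) V W])
    show "morphism UNIV U V (\<lambda>P. \<phi>' (\<psi>' P))" by (rule morphism_comp[OF 2(2) 1(2) U W])
    show "\<phi>' (\<psi>' (\<psi> (\<phi> P))) = P" if "P \<in> V" for P
      using 2(3)[OF morphism_in[OF 1(1) that]] 1(3)[OF that] by simp
    show "\<psi> (\<phi> (\<phi>' (\<psi>' P))) = P" if "P \<in> U" for P
      using 1(4)[OF morphism_in[OF 2(2) that]] 2(4)[OF that] by simp
  qed
qed

section \<open>Irreducible curves\<close>

text \<open>Irreducibility and dimension one in a single condition: a hypersurface section is finite
  or everything. It takes the place of a function field; all density arguments use it.\<close>

definition irr_curve :: "('a::field, 'n::finite) ppoint set \<Rightarrow> bool" where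
  "irr_curve V \<longleftrightarrow> V \<subseteq> proj_space \<and> infinite V \<and>
     (\<forall>d f. form UNIV d f \<and> infinite {P \<in> V. \<forall>v\<in>P. f v = 0} \<longrightarrow> (\<forall>v. pt v \<in> V \<longrightarrow> f v = 0))"

lemma irr_curve_proj: "irr_curve V \<Longrightarrow> V \<subseteq> proj_space"
  unfolding irr_curve_def by blast

lemma irr_curve_zero:
  assumes V: "irr_curve V" and f: "form UNIV d f" and "infinite A" "A \<subseteq> V" "\<And>v. pt v \<in> A \<Longrightarrow> f v = 0" "pt v \<in> V"
  shows "f v = 0"
proof -
  have "P \<in> {P \<in> V. \<forall>v\<in>P. f v = 0}" if P: "P \<in> A" for P
    using P assms(4,5) proj_set_memD(1)[OF irr_curve_proj[OF V], of P] by auto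
  then have "A \<subseteq> {P \<in> V. \<forall>v\<in>P. f v = 0}" by blast
  then have "infinite {P \<in> V. \<forall>v\<in>P. f v = 0}" using assms(3) infinite_super by blast
  then show ?thesis using V f assms(6) unfolding irr_curve_def by blast
qed

text \<open>The zero sets of \<open>f\<close> and \<open>g\<close> cover \<open>V\<close>, so one of
  them is infinite: the coordinate ring is a domain.\<close>

lemma irr_curve_integral:
  assumes V: "irr_curve V" and "form UNIV d f" "form UNIV e g" "\<And>v. pt v \<in> V \<Longrightarrow> f v * g v = 0"
    and "pt x \<in> V" "f x \<noteq> 0" "pt v \<in> V"
  shows "g v = 0"
proof (rule ccontr)
  assume g: "g v \<noteq> 0"
  let ?A = "{P \<in> V. \<forall>v\<in>P. f v = 0}" and ?B = "{P \<in> V. \<forall>v\<in>P. g v = 0}"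
  have "P \<in> ?A \<union> ?B" if P: "P \<in> V" for P
  proof -
    obtain w where w: "P = pt w" using proj_setE[OF irr_curve_proj[OF V] P] by metis
    then have "f w = 0 \<or> g w = 0" using assms(4)[of w] P by auto
    then show ?thesis using P form_eq_0_iff_smult[OF assms(2)] form_eq_0_iff_smult[OF assms(3)]
      by (auto simp: w in_pt)
  qed
  then have "V \<subseteq> ?A \<union> ?B" by blast
  then have "infinite (?A \<union> ?B)" using V infinite_super unfolding irr_curve_def by blast
  then have "infinite ?A \<or> infinite ?B" by simp
  then show False using assms g unfolding irr_curve_def by blast
qed

lemma irr_curve_extend:
  assumes V: "irr_curve V" and "form UNIV d f" "form UNIV e g" "\<And>v. pt v \<in> V \<Longrightarrow> f v \<noteq> 0 \<Longrightarrow> g v = 0"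
    and "pt x \<in> V" "f x \<noteq> 0" "pt v \<in> V"
  shows "g v = 0"
  by (rule irr_curve_integral[OF V assms(2,3) _ assms(5-7)]) (use assms(4) in force)

lemma irr_curve_nonzero_mult:
  assumes V: "irr_curve V" and "form UNIV d f" "form UNIV e g"
    and "pt x \<in> V" "f x \<noteq> 0" "pt y \<in> V" "g y \<noteq> 0"
  obtains z where "pt z \<in> V" "f z \<noteq> 0" "g z \<noteq> 0"
  using irr_curve_extend[OF assms(1-3) _ assms(4-6)] assms(7) by blast

lemma irr_curve_finite_zeros:
  assumes "irr_curve V" "form UNIV d f" "pt x \<in> V" "f x \<noteq> 0"
  shows "finite {P \<in> V. \<exists>v\<in>P. f v = 0}"
proof -
  have "P \<in> {P \<in> V. \<forall>v\<in>P. f v = 0}" if P: "P \<in> V" "v \<in> P" "f v = 0" for P v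
  proof -
    have "P = pt v" using proj_set_memD(1)[OF irr_curve_proj[OF assms(1)] P(1,2)] .
    then show ?thesis using P form_zero_smult[OF assms(2), of v] by (auto simp: in_pt)
  qed
  then have "{P \<in> V. \<exists>v\<in>P. f v = 0} \<subseteq> {P \<in> V. \<forall>v\<in>P. f v = 0}" by blast
  moreover have "finite {P \<in> V. \<forall>v\<in>P. f v = 0}" using assms unfolding irr_curve_def by blast
  ultimately show ?thesis by (rule finite_subset)
qed

lemma irr_curve_surj_image:
  fixes \<phi> :: "('a::field, 'n::finite) ppoint \<Rightarrow> ('a, 'm::finite) ppoint"
  assumes V: "irr_curve V" and \<phi>: "morphism UNIV V W \<phi>" "\<phi> ` V = W" and W: "W \<subseteq> proj_space" "infinite W"
  shows "irr_curve W"
  unfolding irr_curve_def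
proof (intro conjI allI impI W)
  fix d f w assume f: "form UNIV d f \<and> infinite {P \<in> W. \<forall>v\<in>P. f v = 0}" and w: "pt w \<in> W"
  let ?Z = "{P \<in> W. \<forall>v\<in>P. f v = 0}" and ?A = "{P \<in> V. \<phi> P \<in> {P \<in> W. \<forall>v\<in>P. f v = 0}}"
  obtain P where P: "P \<in> V" "\<phi> P = pt w" using \<phi>(2) w by auto
  then obtain v where v: "P = pt v" "pt v \<in> V" using proj_setE[OF irr_curve_proj[OF V]] by metis
  obtain e h where h: "form_tuple UNIV e h" "e > 0" "h v \<noteq> 0"
    "\<And>w. pt w \<in> V \<Longrightarrow> h w \<noteq> 0 \<Longrightarrow> \<phi> (pt w) = pt (h w)"
    using morphism_local[OF \<phi>(1) irr_curve_proj[OF V] v(2)] by metis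
  have "?Z \<subseteq> \<phi> ` ?A" using \<phi>(2) by blast
  then have inf: "infinite ?A" using f finite_surj by blast
  \<comment> \<open>The factor \<open>w $ i\<close> makes the form pulled back along
    \<open>h\<close> vanish wherever \<open>h\<close> does, even if \<open>f\<close> is a
    constant.\<close>
  have ff: "form UNIV (d + 1) (\<lambda>w. w $ i * f w)" for i
    by (rule form_mult[OF form_coord]) (use f in auto)
  have "h v $ i * f (h v) = 0" for i
  proof (rule irr_curve_zero[OF V _ inf, where d = "(d + 1) * e"])
    show "form UNIV ((d + 1) * e) (\<lambda>v. h v $ i * f (h v))"
      by (rule form_comp[OF ff h(1)]) simp
    fix u assume u: "pt u \<in> ?A"
    show "h u $ i * f (h u) = 0"
    proof (cases "h u = 0")
      case False
      then have "\<phi> (pt u) = pt (h u)" using h(4) u by auto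
      then show ?thesis using u self_in_pt by auto
    qed auto
  qed (use v in auto)
  then have "f (h v) = 0" using h(3) by (auto simp: vec_eq_iff)
  moreover have "pt w = pt (h v)" using P v h(3,4) by auto
  ultimately show "f w = 0" using f form_zero_smult unfolding pt_eq_iff by metis
qed

text \<open>The minors of two local representatives vanish wherever the morphisms agree, hence on
  all of \<open>V\<close>, and in particular at \<open>v\<close>, where both representatives are
  non-zero.\<close>

lemma morphism_eqI:
  fixes \<phi> \<psi> :: "('a::field, 'n::finite) ppoint \<Rightarrow> ('a, 'm::finite) ppoint"
  assumes V: "irr_curve V" and \<phi>: "morphism UNIV V W \<phi>" and \<psi>: "morphism UNIV V W \<psi>"
    and A: "infinite A" "A \<subseteq> V" "\<And>P. P \<in> A \<Longrightarrow> \<phi> P = \<psi> P" and P: "P \<in> V"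
  shows "\<phi> P = \<psi> P"
proof -
  obtain v where v: "P = pt v" "pt v \<in> V" using proj_setE[OF irr_curve_proj[OF V] P] by metis
  obtain d h where h: "form_tuple UNIV d h" "h v \<noteq> 0"
    "\<And>w. pt w \<in> V \<Longrightarrow> h w \<noteq> 0 \<Longrightarrow> \<phi> (pt w) = pt (h w)"
    using morphism_local[OF \<phi> irr_curve_proj[OF V] v(2)] by metis
  obtain e g where g: "form_tuple UNIV e g" "g v \<noteq> 0"
    "\<And>w. pt w \<in> V \<Longrightarrow> g w \<noteq> 0 \<Longrightarrow> \<psi> (pt w) = pt (g w)"
    using morphism_local[OF \<psi> irr_curve_proj[OF V] v(2)] by metis
  have "h v $ i * g v $ j - h v $ j * g v $ i = 0" for i j
  proof (rule irr_curve_zero[OF V _ A(1,2)])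
    show "form UNIV (d + e) (\<lambda>v. h v $ i * g v $ j - h v $ j * g v $ i)"
      by (intro form_diff form_mult[where d = d and e = e] form_tuple_nth h g refl)
    fix w assume w: "pt w \<in> A"
    then have wV: "pt w \<in> V" using A(2) by auto
    show "h w $ i * g w $ j - h w $ j * g w $ i = 0"
    proof (cases "h w = 0 \<or> g w = 0")
      case False
      then have "pt (h w) = pt (g w)" using h(3) g(3) wV A(3)[OF w] by metis
      then show ?thesis using pt_eq_minors False by (metis diff_self)
    qed auto
  qed (use v in auto)
  then have "pt (h v) = pt (g v)" using pt_eq_minors[OF h(2) g(2)] by simp
  then show ?thesis using v h g by simp
qed

section \<open>Plane cubics in short Weierstrass form\<close>

text \<open>The curve \<open>y^2 = x^3 + c2 x^2 + c1 x + c0\<close>; the assumption excludes a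
  double root of the cubic.\<close>

locale short_cubic =
  fixes c2 c1 c0 :: "'a::{alg_closed_field, field_char_0}"
  assumes smooth: "x ^ 3 + c2 * x^2 + c1 * x + c0 = 0 \<Longrightarrow> 3 * x^2 + 2 * c2 * x + c1 \<noteq> 0"
begin

definition cub :: "'a poly" where "cub = [:c0, c1, c2, 1:]"

definition Y :: "('a, 3) ppoint set" where
  "Y = zero_locus {\<lambda>v. (v $ 2)^2 * v $ 3
     - ((v $ 1)^3 + c2 * (v $ 1)^2 * v $ 3 + c1 * v $ 1 * (v $ 3)^2 + c0 * (v $ 3)^3)}"

definition aff :: "'a \<Rightarrow> 'a \<Rightarrow> 'a ^ 3" where "aff x y = vector [x, y, 1]"

definition orig :: "'a ^ 3" where "orig = vector [0, 1, 0]"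

lemma aff_nth [simp]: "aff x y $ 1 = x" "aff x y $ 2 = y" "aff x y $ 3 = 1"
  and orig_nth [simp]: "orig $ 1 = 0" "orig $ 2 = 1" "orig $ 3 = 0"
  by (simp_all add: aff_def orig_def)

lemma aff_nonzero [simp]: "aff x y \<noteq> 0" and orig_nonzero [simp]: "orig \<noteq> 0"
  by (simp_all add: vec_eq_iff forall_3)

lemma poly_cub: "poly cub x = x ^ 3 + c2 * x^2 + c1 * x + c0"
  by (simp add: cub_def algebra_simps power2_eq_square power3_eq_cube)

lemma in_Y: "pt v \<in> Y \<longleftrightarrow> v \<noteq> 0 \<and> (v $ 2)^2 * v $ 3
     = (v $ 1)^3 + c2 * (v $ 1)^2 * v $ 3 + c1 * v $ 1 * (v $ 3)^2 + c0 * (v $ 3)^3"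
  unfolding Y_def
  by (subst in_zero_locus) (auto intro!: exI[of _ 3] simp: algebra_simps power2_eq_square power3_eq_cube)

lemma Y_proj: "Y \<subseteq> proj_space"
  unfolding Y_def by (rule zero_locus_subset)

lemma aff_in_Y: "pt (aff x y) \<in> Y \<longleftrightarrow> y^2 = poly cub x"
  unfolding in_Y poly_cub by simp

lemma Y_cases:
  assumes "pt v \<in> Y"
  obtains x y c where "y^2 = poly cub x" "c \<noteq> 0" "v = c *s aff x y" | c where "c \<noteq> 0" "v = c *s orig"
proof (cases "v $ 3 = 0")
  case True
  then have "v $ 1 = 0" "v \<noteq> 0" using assms unfolding in_Y by auto
  then have "v = (v $ 2) *s orig" "v $ 2 \<noteq> 0" using True by (auto simp: vec_eq_iff forall_3)
  then show ?thesis using that(2) by blast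
next
  case False
  let ?x = "v $ 1 / v $ 3" and ?y = "v $ 2 / v $ 3"
  have "v = v $ 3 *s aff ?x ?y" using False by (auto simp: vec_eq_iff forall_3)
  moreover from this have "pt v = pt (aff ?x ?y)" using pt_smult[OF False, of "aff ?x ?y"] by simp
  then have "pt (aff ?x ?y) \<in> Y" using assms by simp
  ultimately show ?thesis using that(1) False aff_in_Y by blast
qed

lemma sqrt_cub: obtains y where "y^2 = poly cub x"
  using nth_root_exists[of 2] by auto

lemma inj_pt_aff: "pt (aff x y) = pt (aff x' y') \<longleftrightarrow> x = x' \<and> y = y'"
  unfolding pt_eq_iff vec_eq_iff forall_3 by auto

lemma infinite_Y: "infinite Y"
proof -
  have "\<forall>x. \<exists>y. y^2 = poly cub x" using sqrt_cub by blast
  then obtain s where s: "\<And>x. (s x)^2 = poly cub x" unfolding choice_iff by blast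
  have "inj (\<lambda>x. pt (aff x (s x)))" unfolding inj_def inj_pt_aff by auto
  then have "infinite (range (\<lambda>x. pt (aff x (s x))))"
    using finite_imageD[of "\<lambda>x. pt (aff x (s x))" UNIV] infinite_UNIV_char_0[where 'a = 'a] by blast
  moreover have "range (\<lambda>x. pt (aff x (s x))) \<subseteq> Y" using s aff_in_Y by auto
  ultimately show ?thesis using infinite_super by blast
qed

text \<open>Degree bounds and leading coefficient encode the pole order at the origin, which is 2 for
  \<open>x\<close> and 3 for \<open>y\<close>.\<close>

definition lead :: "nat \<Rightarrow> 'a poly \<Rightarrow> 'a poly \<Rightarrow> 'a" where
  "lead d a b = (if even d then Polynomial.coeff a (3 * (d div 2)) else Polynomial.coeff b (3 * (d div 2)))"

text \<open>The monomials \<open>x^n\<close> and \<open>x^n y\<close> have the pole orders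
  \<open>2 n\<close> and \<open>2 n + 3\<close>, all different, so the order of a sum is the
  maximum. For the bound \<open>3 * d\<close> exactly one monomial attains it, and
  \<open>lead d\<close> is its coefficient.\<close>

definition pole_le :: "nat \<Rightarrow> 'a poly \<Rightarrow> 'a poly \<Rightarrow> bool" where
  "pole_le m a b \<longleftrightarrow> (\<forall>n. 2 * n > m \<longrightarrow> Polynomial.coeff a n = 0) \<and> (\<forall>n. 2 * n + 3 > m \<longrightarrow> Polynomial.coeff b n = 0)"

section \<open>Coordinate ring and irreducibility of the cubic\<close>

text \<open>Even powers of \<open>y\<close> are eliminated by the equation, so the affine ring is
  free over the polynomials in \<open>x\<close> with basis 1, \<open>y\<close>. The three
  coordinates contribute pole orders 2, 3 and 0; only the second keeps the top coefficient, and it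
  is also the only one that does not vanish at the origin.\<close>

lemma form_coordinates:
  assumes "form UNIV d f"
  shows "\<exists>a b. (\<forall>x y. y^2 = poly cub x \<longrightarrow> f (aff x y) = poly a x + poly b x * y) \<and>
    pole_le (3 * d) a b \<and> f orig = lead d a b"
  using assms
proof (induction rule: form.induct)
  case (const c)
  then show ?case
    by (intro exI[of _ "[:c:]"] exI[of _ 0])
      (auto simp: lead_def pole_le_def coeff_pCons split: nat.splits)
next
  case (coord d f i)
  then obtain a b where ab: "\<And>x y. y^2 = poly cub x \<Longrightarrow> f (aff x y) = poly a x + poly b x * y"
    "\<And>n. 2 * n > 3 * d \<Longrightarrow> Polynomial.coeff a n = 0" "\<And>n. 2 * n + 3 > 3 * d \<Longrightarrow> Polynomial.coeff b n = 0"
    "f orig = lead d a b" unfolding pole_le_def by auto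
  have coeff_cub: "Polynomial.coeff (cub * b) n = c0 * Polynomial.coeff b n
      + (if n \<ge> 1 then c1 * Polynomial.coeff b (n - 1) else 0) + (if n \<ge> 2 then c2 * Polynomial.coeff b (n - 2) else 0)
      + (if n \<ge> 3 then Polynomial.coeff b (n - 3) else 0)" for n
    by (auto simp: cub_def coeff_pCons numeral_2_eq_2 numeral_3_eq_3 split: nat.splits)
  consider "i = 1" | "i = 2" | "i = 3" using exhaust_3 by blast
  then show ?case
  proof cases
    case 1
    have "lead (Suc d) (pCons 0 a) (pCons 0 b) = 0"
    proof (cases "even d")
      case True
      then obtain u where "d = 2 * u" by blast
      then show ?thesis using ab(3) by (auto simp: lead_def coeff_pCons split: nat.splits)
    next
      case False
      then obtain u where "d = 2 * u + 1" by (elim oddE)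
      then show ?thesis using ab(2) by (auto simp: lead_def coeff_pCons split: nat.splits)
    qed
    moreover have "pole_le (3 * Suc d) (pCons 0 a) (pCons 0 b)"
      unfolding pole_le_def using ab(2,3) by (auto simp: coeff_pCons split: nat.splits)
    ultimately show ?thesis using ab(1) 1
      by (intro exI[of _ "pCons 0 a"] exI[of _ "pCons 0 b"]) (auto simp: algebra_simps)
  next
    case 2
    have "lead (Suc d) (cub * b) a = lead d a b"
    proof (cases "even d")
      case True
      then obtain u where "d = 2 * u" by blast
      then show ?thesis by (auto simp: lead_def)
    next
      case False
      then obtain u where u: "d = 2 * u + 1" by (elim oddE)
      have "Polynomial.coeff b n = 0" if "n > 3 * u" for n using ab(3)[of n] that u by auto
      then show ?thesis using u by (simp add: lead_def coeff_cub)
    qed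
    moreover have "pole_le (3 * Suc d) (cub * b) a"
      unfolding pole_le_def using ab(2,3) by (auto simp: coeff_cub)
    moreover have "y * (poly a x + poly b x * y) = poly (cub * b) x + poly a x * y" if "y^2 = poly cub x" for x y
      using that[symmetric] by (simp add: algebra_simps power2_eq_square)
    ultimately show ?thesis using ab(1,4) 2
      by (intro exI[of _ "cub * b"] exI[of _ "a"]) auto
  next
    case 3
    have "lead (Suc d) a b = 0"
    proof (cases "even d")
      case True
      then obtain u where "d = 2 * u" by blast
      then show ?thesis using ab(3) by (auto simp: lead_def)
    next
      case False
      then obtain u where "d = 2 * u + 1" by (elim oddE)
      then show ?thesis using ab(2) by (auto simp: lead_def)
    qed
    moreover have "pole_le (3 * Suc d) a b"
      unfolding pole_le_def using ab(2,3) by auto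
    ultimately show ?thesis using ab(1) 3
      by (intro exI[of _ a] exI[of _ b]) auto
  qed
next
  case (add d f g)
  from add(3) obtain a b where ab: "\<And>x y. y^2 = poly cub x \<Longrightarrow> f (aff x y) = poly a x + poly b x * y"
    "pole_le (3 * d) a b" "f orig = lead d a b" by blast
  from add(4) obtain a' b' where ab': "\<And>x y. y^2 = poly cub x \<Longrightarrow> g (aff x y) = poly a' x + poly b' x * y"
    "pole_le (3 * d) a' b'" "g orig = lead d a' b'" by blast
  show ?case using ab ab'
    by (intro exI[of _ "a + a'"] exI[of _ "b + b'"]) (auto simp: algebra_simps pole_le_def lead_def)
qed

text \<open>The norm of \<open>a + b y\<close> is non-zero by parity: the left side has even degree,
  the right side odd degree since the cubic has degree 3.\<close>

lemma norm_eq_0: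
  assumes "a^2 = b^2 * cub"
  shows "a = 0 \<and> b = 0"
proof (cases "b = 0")
  case True then show ?thesis using assms by simp
next
  case False
  have c: "Polynomial.degree cub = 3" "cub \<noteq> 0" by (auto simp: cub_def)
  have "a \<noteq> 0" using assms False c by auto
  then have "Polynomial.degree (a^2) = 2 * Polynomial.degree a"
    "Polynomial.degree (b^2 * cub) = 2 * Polynomial.degree b + 3"
    using False c by (auto simp: power2_eq_square Polynomial.degree_mult_eq)
  then have "2 * Polynomial.degree a = 2 * Polynomial.degree b + 3" using assms by simp
  then have False by presburger
  then show ?thesis ..
qed

lemma coordinates_zero:
  assumes "infinite {x. \<exists>y. y^2 = poly cub x \<and> poly a x + poly b x * y = 0}"
  shows "a = 0 \<and> b = 0"
proof -
  have "{x. \<exists>y. y^2 = poly cub x \<and> poly a x + poly b x * y = 0} \<subseteq> {x. poly (a^2 - b^2 * cub) x = 0}"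
  proof safe
    fix x y assume "y^2 = poly cub x" "poly a x + poly b x * y = 0"
    then have "poly a x = - (poly b x * y)" by (simp add: eq_neg_iff_add_eq_0)
    then show "poly (a^2 - b^2 * cub) x = 0" using \<open>y^2 = poly cub x\<close>[symmetric]
      by (simp add: algebra_simps power2_eq_square)
  qed
  then have "infinite {x. poly (a^2 - b^2 * cub) x = 0}" using assms infinite_super by blast
  then have "a^2 - b^2 * cub = 0" using poly_roots_finite by blast
  then have "a^2 = b^2 * cub" by simp
  then show ?thesis by (rule norm_eq_0)
qed

lemma irr_Y: "irr_curve Y"
  unfolding irr_curve_def
proof (intro conjI Y_proj infinite_Y allI impI)
  fix d f v assume f: "form UNIV d f \<and> infinite {P \<in> Y. \<forall>v\<in>P. f v = 0}" and v: "pt v \<in> Y"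
  obtain a b where ab: "\<And>x y. y^2 = poly cub x \<Longrightarrow> f (aff x y) = poly a x + poly b x * y" "f orig = lead d a b"
    using form_coordinates f by blast
  let ?Z = "{x. \<exists>y. y^2 = poly cub x \<and> poly a x + poly b x * y = 0}"
  have "\<forall>x. \<exists>y. y^2 = poly cub x" using sqrt_cub by blast
  then obtain s where s: "\<And>x. (s x)^2 = poly cub x" unfolding choice_iff by blast
  \<comment> \<open>Over each \<open>x\<close> lie only the points with \<open>y = s x\<close> and
    \<open>y = - s x\<close>, so infinitely many zeros have infinitely many abscissas.\<close>
  have "{P \<in> Y. \<forall>v\<in>P. f v = 0} \<subseteq> {pt orig} \<union> (\<lambda>x. pt (aff x (s x))) ` ?Z \<union> (\<lambda>x. pt (aff x (- s x))) ` ?Z"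
  proof
    fix P assume P: "P \<in> {P \<in> Y. \<forall>v\<in>P. f v = 0}"
    then obtain v where v: "P = pt v" "pt v \<in> Y" "f v = 0"
      by (smt (verit, best) proj_setE[OF Y_proj] self_in_pt mem_Collect_eq)
    from v(2) show "P \<in> {pt orig} \<union> (\<lambda>x. pt (aff x (s x))) ` ?Z \<union> (\<lambda>x. pt (aff x (- s x))) ` ?Z"
    proof (cases rule: Y_cases)
      case (1 x y c)
      have P: "P = pt (aff x y)" using v 1 pt_smult[OF 1(2)] by simp
      have "f (aff x y) = 0" using v(3) 1(2,3) f form_eq_0_iff_smult[of UNIV d f c] by simp
      then have "x \<in> ?Z" using 1(1) ab(1) by auto
      moreover have "y = s x \<or> y = - s x" using 1(1) s[of x] power2_eq_iff by metis
      ultimately show ?thesis using P by blast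
    next
      case (2 c)
      then show ?thesis using v pt_smult by auto
    qed
  qed
  then have "infinite ({pt orig} \<union> (\<lambda>x. pt (aff x (s x))) ` ?Z \<union> (\<lambda>x. pt (aff x (- s x))) ` ?Z)"
    using f infinite_super by blast
  then have "infinite ?Z" by auto
  then have 0: "a = 0" "b = 0" using coordinates_zero by blast+
  then have *: "f orig = 0" using ab(2) by (simp add: lead_def)
  from v show "f v = 0"
  proof (cases rule: Y_cases)
    case (1 x y c) then show ?thesis using ab(1)[OF 1(1)] 0 form_zero_smult[of UNIV d f "aff x y"] f by simp
  next
    case (2 c) then show ?thesis using * form_zero_smult[of UNIV d f orig] f by simp
  qed
qed

section \<open>Extension of rational maps to every point of the cubic\<close>

lemma form_of_poly:
  "\<exists>f. form UNIV (Polynomial.degree a + k) f \<and> (\<forall>x y. f (aff x y) = poly a x)"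
proof -
  let ?N = "Polynomial.degree a"
  let ?f = "\<lambda>v::'a^3. \<Sum>i\<le>?N. (Polynomial.coeff a i * v $ 1 ^ i) * v $ 3 ^ (?N - i + k)"
  have "form UNIV (?N + k) ?f"
    by (intro form_sum form_mult[where d = "i" and e = "?N - i + k" for i] form_cmult form_power[OF form_coord]) auto
  then show ?thesis by (intro exI[of _ ?f]) (auto simp: poly_altdef)
qed

lemma form_of_polys:
  "\<exists>D. \<exists>h :: 'a^3 \<Rightarrow> 'a^'m::finite. form_tuple UNIV D h \<and> (\<forall>i x y. h (aff x y) $ i = poly (a i) x + poly (b i) x * y)"
proof -
  define D where "D = Suc (\<Sum>i\<in>UNIV. Polynomial.degree (a i) + Polynomial.degree (b i))"
  have *: "\<exists>f. form UNIV D f \<and> (\<forall>x y. f (aff x y) = poly (a i) x + poly (b i) x * y)" for i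
  proof -
    have "Polynomial.degree (a i) + Polynomial.degree (b i) \<le> (\<Sum>i\<in>UNIV. Polynomial.degree (a i) + Polynomial.degree (b i))"
      by (rule member_le_sum) auto
    then have "Polynomial.degree (a i) \<le> D" "Suc (Polynomial.degree (b i)) \<le> D" unfolding D_def by auto
    then obtain k l where kl: "D = Polynomial.degree (a i) + k" "D = Suc (Polynomial.degree (b i) + l)"
      by (metis le_iff_add add_Suc)
    obtain f where f: "form UNIV D f" "\<And>x y. f (aff x y) = poly (a i) x" using form_of_poly[of "a i" k] kl by metis
    obtain g where g: "form UNIV (Polynomial.degree (b i) + l) g" "\<And>x y. g (aff x y) = poly (b i) x"
      using form_of_poly[of "b i" l] by metis
    have "form UNIV D (\<lambda>v. v $ 2 * g v)" using form.coord[OF g(1), of 2] kl by simp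
    then show ?thesis using f g by (intro exI[of _ "\<lambda>v. f v + v $ 2 * g v"]) (auto intro: form.add)
  qed
  then obtain F where "\<And>i. form UNIV D (F i)" "\<And>i x y. F i (aff x y) = poly (a i) x + poly (b i) x * y" by metis
  then show ?thesis by (intro exI[of _ D] exI[of _ "\<lambda>v. \<chi> i. F i v"]) (auto simp: form_tuple_def)
qed

text \<open>Where \<rho> does not vanish, \<open>h'\<close> is \<open>h\<close> times a scalar, so
  the minors of the two tuples vanish on an infinite set and therefore on the curve. This justifies
  multiplying and dividing all coordinates by a common function.\<close>

lemma representatives_agree:
  fixes h h' :: "'a ^ 3 \<Rightarrow> 'a ^ 'm::finite"
  assumes "form_tuple UNIV d h" "form_tuple UNIV d' h'" "\<rho> \<noteq> 0"
    and "\<And>x y i. y^2 = poly cub x \<Longrightarrow> poly \<rho> x * h' (aff x y) $ i = \<sigma> x y * h (aff x y) $ i"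
    and v: "pt v \<in> Y"
  shows "h' v $ i * h v $ j = h' v $ j * h v $ i"
proof -
  have "\<forall>x. \<exists>y. y^2 = poly cub x" using sqrt_cub by blast
  then obtain s where s: "\<And>x. (s x)^2 = poly cub x" unfolding choice_iff by blast
  let ?A = "(\<lambda>x. pt (aff x (s x))) ` {x. poly \<rho> x \<noteq> 0}"
  have "{x. poly \<rho> x \<noteq> 0} = UNIV - {x. poly \<rho> x = 0}" by auto
  then have "infinite {x. poly \<rho> x \<noteq> 0}"
    using Diff_infinite_finite[OF poly_roots_finite[OF assms(3)] infinite_UNIV_char_0] by simp
  moreover have "inj_on (\<lambda>x. pt (aff x (s x))) {x. poly \<rho> x \<noteq> 0}" unfolding inj_on_def inj_pt_aff by auto
  ultimately have inf: "infinite ?A" using finite_imageD by blast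
  have form: "form UNIV (d' + d) (\<lambda>v. h' v $ i * h v $ j - h' v $ j * h v $ i)"
    by (intro form_diff form_mult[where d = d' and e = d] form_tuple_nth assms refl)
  have "h' v $ i * h v $ j - h' v $ j * h v $ i = 0"
  proof (rule irr_curve_zero[OF irr_Y form inf])
    show "?A \<subseteq> Y" using s aff_in_Y by auto
    fix w assume "pt w \<in> ?A"
    then obtain x where x: "pt w = pt (aff x (s x))" "poly \<rho> x \<noteq> 0" by auto
    have *: "h' (aff x (s x)) $ i = \<sigma> x (s x) * h (aff x (s x)) $ i / poly \<rho> x" for i
      using assms(4)[OF s[of x], of i] x(2) by (simp add: field_simps)
    have "h' (aff x (s x)) $ i * h (aff x (s x)) $ j - h' (aff x (s x)) $ j * h (aff x (s x)) $ i = 0"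
      unfolding * by simp
    moreover obtain c where "w = c *s aff x (s x)" using x(1) pt_eq_iff by metis
    ultimately show "h' w $ i * h w $ j - h' w $ j * h w $ i = 0" using form_zero_smult[OF form] by blast
  qed fact
  then show ?thesis by simp
qed

lemma common_root_factor:
  fixes g :: "'i::finite \<Rightarrow> 'a poly"
  assumes "g i0 \<noteq> 0"
  shows "\<exists>\<mu> g'. (\<forall>i. g i = [:- x0, 1:] ^ \<mu> * g' i) \<and> (\<exists>i. poly (g' i) x0 \<noteq> 0)"
proof -
  let ?p = "[:- x0, 1:]"
  define S where "S = {n. \<forall>i. ?p ^ n dvd g i}"
  have "S \<subseteq> {..Polynomial.order x0 (g i0)}" unfolding S_def using assms order_divides by blast
  then have fin: "finite S" using finite_subset by blast
  have "0 \<in> S" unfolding S_def by simp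
  then have "Max S \<in> S" using fin Max_in by blast
  then have "\<forall>i. \<exists>q. g i = ?p ^ Max S * q" unfolding S_def by auto
  then obtain g' where g': "\<And>i. g i = ?p ^ Max S * g' i" by metis
  have "\<exists>i. poly (g' i) x0 \<noteq> 0"
  proof (rule ccontr)
    assume "\<not> ?thesis"
    then have "?p dvd g' i" for i using poly_eq_0_iff_dvd by blast
    then have "?p ^ Suc (Max S) dvd g i" for i
      unfolding g'[of i] power_Suc2 by (intro mult_dvd_mono) auto
    then have "Suc (Max S) \<in> S" unfolding S_def by blast
    then have "Suc (Max S) \<le> Max S" by (rule Max_ge[OF fin])
    then show False by simp
  qed
  then show ?thesis using g' by blast
qed

text \<open>Hensel lifting: a square root of the cubic at \<open>x0\<close> is improved by one power
  of \<open>x - x0\<close> at a time, which works because the derivative \<open>2 * y0\<close> is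
  non-zero.\<close>

lemma sqrt_power_series:
  assumes "y0^2 = poly cub x0" "y0 \<noteq> 0"
  shows "\<exists>s. poly s x0 = y0 \<and> [:- x0, 1:] ^ Suc L dvd s^2 - cub"
proof (induction L)
  case 0
  have "[:- x0, 1:] dvd [:y0:]^2 - cub" using assms poly_eq_0_iff_dvd[of "[:y0:]^2 - cub" x0] by simp
  then show ?case by (intro exI[of _ "[:y0:]"]) simp
next
  case (Suc L)
  let ?p = "[:- x0, 1:]"
  from Suc obtain s where s0: "poly s x0 = y0" "?p ^ Suc L dvd s^2 - cub" by blast
  from s0(2) obtain q where "s^2 - cub = ?p ^ Suc L * q" by (elim dvdE)
  with s0(1) have s: "poly s x0 = y0" "s^2 - cub = ?p ^ Suc L * q" by blast+
  \<comment> \<open>Solves \<open>q(x0) + 2 * \<kappa> * y0 = 0\<close>, the condition for the next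
    coefficient of the error to vanish.\<close>
  define \<kappa> where "\<kappa> = - poly q x0 / (2 * y0)"
  define k where "k = [:\<kappa>:]"
  define P where "P = ?p ^ Suc L"
  define s' where "s' = s + k * P"
  have "s'^2 - cub = (s^2 - cub) + P * (2 * k * s + k^2 * P)"
    unfolding s'_def by (simp add: power2_eq_square algebra_simps)
  also have "\<dots> = P * (q + 2 * k * s + k^2 * P)"
    unfolding s(2) P_def[symmetric] by (simp add: algebra_simps)
  finally have *: "s'^2 - cub = P * (q + 2 * k * s + k^2 * P)" .
  have "poly P x0 = 0" by (simp add: P_def)
  then have "poly (q + 2 * k * s + k^2 * P) x0 = 0"
    using assms(2) by (simp add: s(1) k_def \<kappa>_def)
  then have "?p dvd q + 2 * k * s + k^2 * P" using poly_eq_0_iff_dvd by blast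
  then have "?p ^ Suc (Suc L) dvd s'^2 - cub"
    unfolding * P_def power_Suc2[of ?p "Suc L"] by (rule mult_dvd_mono[OF dvd_refl])
  moreover have "poly s' x0 = y0" using s(1) \<open>poly P x0 = 0\<close> by (simp add: s'_def)
  ultimately show ?case by blast
qed

text \<open>Away from the 2-torsion a square root \<open>s\<close> of the cubic modulo a high power of \<open>x - x0\<close>
  replaces \<open>y\<close>; multiplying by \<open>y + s\<close> makes the common power of \<open>x - x0\<close> visible.\<close>

lemma extend_generic:
  fixes a b :: "'m::finite \<Rightarrow> 'a poly"
  assumes Q: "y0^2 = poly cub x0" "y0 \<noteq> 0" and nz: "a i0 \<noteq> 0 \<or> b i0 \<noteq> 0"
  shows "\<exists>\<rho> \<sigma> a' b'. \<rho> \<noteq> 0 \<and> (\<forall>x y i. y^2 = poly cub x \<longrightarrow>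
      poly \<rho> x * (poly (a' i) x + poly (b' i) x * y) = \<sigma> x y * (poly (a i) x + poly (b i) x * y)) \<and>
    (\<exists>i. poly (a' i) x0 + poly (b' i) x0 * y0 \<noteq> 0)"
proof -
  let ?p = "[:- x0, 1:]"
  define N where "N = (a i0)^2 - (b i0)^2 * cub"
  have "N \<noteq> 0" using norm_eq_0[of "a i0" "b i0"] nz unfolding N_def by auto
  \<comment> \<open>One more than the order of the norm. As \<open>(a + b s) (a - b s)\<close>
    equals the norm up to a multiple of \<open>s^2 - cub\<close>, the power \<open>L\<close> cannot
    divide \<open>a i0 + b i0 * s\<close>; the common power of \<open>x - x0\<close> is therefore
    smaller than \<open>L\<close>.\<close>
  define L where "L = Suc (Polynomial.order x0 N)"
  obtain s r where s: "poly s x0 = y0" "s^2 - cub = ?p ^ L * r"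
    using sqrt_power_series[OF Q, of "Polynomial.order x0 N"] unfolding L_def by (metis dvdE)
  have L: "\<not> ?p ^ L dvd a i0 + b i0 * s"
  proof
    assume "?p ^ L dvd a i0 + b i0 * s"
    then have "?p ^ L dvd (a i0 + b i0 * s) * (a i0 - b i0 * s) + (b i0)^2 * (?p ^ L * r)" by (intro dvd_add) auto
    also have "(a i0 + b i0 * s) * (a i0 - b i0 * s) + (b i0)^2 * (?p ^ L * r) = N"
      unfolding N_def s(2)[symmetric] by (simp add: algebra_simps power2_eq_square)
    finally show False using \<open>N \<noteq> 0\<close> order_divides[of x0 L N] unfolding L_def by simp
  qed
  then have "a i0 + b i0 * s \<noteq> 0" by auto
  then obtain \<mu> g where g: "\<And>i. a i + b i * s = ?p ^ \<mu> * g i" "\<exists>i. poly (g i) x0 \<noteq> 0"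
    using common_root_factor[of "\<lambda>i. a i + b i * s" i0 x0] by metis
  have "\<mu> < L"
  proof (rule ccontr)
    assume "\<not> \<mu> < L"
    then have "?p ^ L dvd ?p ^ \<mu>" by (simp add: le_imp_power_dvd)
    then show False using L g(1)[of i0] dvd_mult2 by metis
  qed
  \<comment> \<open>The coefficient of \<open>y\<close> in \<open>(y + s) (a + b y)\<close> is
    \<open>a + b s\<close>, and the constant one is \<open>(a + b s) s - b (s^2 - cub)\<close>; this
    is the latter divided by the common power.\<close>
  define a' where "a' i = g i * s - b i * (?p ^ (L - \<mu>) * r)" for i
  show ?thesis
  proof (rule exI[of _ "?p ^ \<mu>"], rule exI[of _ "\<lambda>x y. y + poly s x"], rule exI[of _ a'], rule exI[of _ g],
      intro conjI allI impI)
    show "?p ^ \<mu> \<noteq> 0" by simp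
    fix x y i assume y: "y^2 = poly cub x"
    have p: "?p ^ \<mu> * ?p ^ (L - \<mu>) = ?p ^ L" using \<open>\<mu> < L\<close> by (simp add: power_add[symmetric])
    have "?p ^ \<mu> * a' i = (a i + b i * s) * s - b i * (s^2 - cub)"
      unfolding g(1) s(2) p[symmetric] a'_def by (simp add: algebra_simps)
    then have *: "poly (?p ^ \<mu>) x * poly (a' i) x = poly ((a i + b i * s) * s - b i * (s^2 - cub)) x"
      by (metis poly_mult)
    have **: "poly (?p ^ \<mu>) x * poly (g i) x = poly (a i + b i * s) x" unfolding g(1) by simp
    have "poly (?p ^ \<mu>) x * (poly (a' i) x + poly (g i) x * y) =
       poly (?p ^ \<mu>) x * poly (a' i) x + (poly (?p ^ \<mu>) x * poly (g i) x) * y"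
      by (simp add: algebra_simps)
    also have "\<dots> = (y + poly s x) * (poly (a i) x + poly (b i) x * y)"
      unfolding * ** using y[symmetric] by (simp add: algebra_simps power2_eq_square)
    finally show "poly (?p ^ \<mu>) x * (poly (a' i) x + poly (g i) x * y) =
       (y + poly s x) * (poly (a i) x + poly (b i) x * y)" by simp
  next
    have "poly (a' i) x0 + poly (g i) x0 * y0 = 2 * y0 * poly (g i) x0" for i
      using \<open>\<mu> < L\<close> s(1) by (simp add: a'_def)
    then show "\<exists>i. poly (a' i) x0 + poly (g i) x0 * y0 \<noteq> 0" using g(2) Q(2) by simp
  qed
qed

text \<open>At a point with \<open>y = 0\<close> the function \<open>y\<close> is a uniformizer and
  \<open>x - x0\<close> is its square times a unit, by smoothness. After removal of the common power
  of \<open>x - x0\<close> the tuple either is non-zero at the point or vanishes there to order one;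
  then it is multiplied by \<open>y\<close> and divided by \<open>x - x0\<close>.\<close>

lemma extend_two_torsion:
  fixes a b :: "'m::finite \<Rightarrow> 'a poly"
  assumes Q: "poly cub x0 = 0" and nz: "a i0 \<noteq> 0 \<or> b i0 \<noteq> 0"
  shows "\<exists>\<rho> \<sigma> a' b'. \<rho> \<noteq> 0 \<and> (\<forall>x y i. y^2 = poly cub x \<longrightarrow>
      poly \<rho> x * (poly (a' i) x + poly (b' i) x * y) = \<sigma> x y * (poly (a i) x + poly (b i) x * y)) \<and>
    (\<exists>i. poly (a' i) x0 \<noteq> 0)"
proof -
  let ?p = "[:- x0, 1:]"
  obtain c where c: "cub = ?p * c" using Q poly_eq_0_iff_dvd by (metis dvdE)
  have "pderiv cub = [:c1, 2 * c2, 3:]" by (simp add: cub_def pderiv_pCons)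
  then have "poly (pderiv cub) x0 = 3 * x0^2 + 2 * c2 * x0 + c1" by (simp add: algebra_simps power2_eq_square)
  then have "poly (pderiv cub) x0 \<noteq> 0" using smooth[of x0] Q unfolding poly_cub by simp
  then have c0: "poly c x0 \<noteq> 0" unfolding c pderiv_mult by (simp add: pderiv_pCons)
  \<comment> \<open>Indexing by pairs puts the polynomials \<open>a i\<close> and \<open>b i\<close>
    into one family, so that one common power of \<open>x - x0\<close> is taken out of both.\<close>
  have "(\<lambda>(i, t). if t then a i else b i) (i0, True) \<noteq> 0 \<or> (\<lambda>(i, t). if t then a i else b i) (i0, False) \<noteq> 0"
    using nz by simp
  then obtain i1 where "(\<lambda>(i, t). if t then a i else b i) i1 \<noteq> 0" by blast
  then obtain \<mu> g where g: "\<And>k. (\<lambda>(i, t). if t then a i else b i) k = ?p ^ \<mu> * g k" "\<exists>k. poly (g k) x0 \<noteq> 0"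
    using common_root_factor[of "\<lambda>(i, t). if t then a i else b i" i1 x0] by metis
  have a: "a i = ?p ^ \<mu> * g (i, True)" and b: "b i = ?p ^ \<mu> * g (i, False)" for i
    using g(1)[of "(i, True)"] g(1)[of "(i, False)"] by auto
  show ?thesis
  proof (cases "\<exists>i. poly (g (i, True)) x0 \<noteq> 0")
    case True
    show ?thesis
      by (rule exI[of _ "?p ^ \<mu>"], rule exI[of _ "\<lambda>x y. 1"], rule exI[of _ "\<lambda>i. g (i, True)"], rule exI[of _ "\<lambda>i. g (i, False)"])
        (use True in \<open>auto simp: a b algebra_simps\<close>)
  next
    case False
    then have "\<forall>i. \<exists>q. g (i, True) = ?p * q" using poly_eq_0_iff_dvd by (metis dvdE)
    then obtain a'' where a'': "\<And>i. g (i, True) = ?p * a'' i" by metis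
    have *: "\<exists>i. poly (g (i, False)) x0 \<noteq> 0" using g(2) False by (metis (full_types) surj_pair)
    show ?thesis
    proof (rule exI[of _ "?p ^ Suc \<mu>"], rule exI[of _ "\<lambda>x y. y"], rule exI[of _ "\<lambda>i. c * g (i, False)"],
        rule exI[of _ a''], intro conjI allI impI)
      show "?p ^ Suc \<mu> \<noteq> 0" by (simp del: power_Suc)
      fix x y i assume y: "y^2 = poly cub x"
      have y2: "y * y = poly ?p x * poly c x" using y by (simp only: c poly_mult power2_eq_square)
      have "(poly (a i) x + poly (b i) x * y) * y = poly (a i) x * y + poly (b i) x * (y * y)" by (simp add: algebra_simps)
      then show "poly (?p ^ Suc \<mu>) x * (poly (c * g (i, False)) x + poly (a'' i) x * y)
        = y * (poly (a i) x + poly (b i) x * y)"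
        unfolding y2 a b a'' power_Suc poly_mult by (simp add: algebra_simps)
    next
      show "\<exists>i. poly (c * g (i, False)) x0 \<noteq> 0" using * c0 by simp
    qed
  qed
qed

text \<open>Homogenising \<open>x^p\<close> directly would need degree \<open>p\<close>. Replacing
  \<open>x^3\<close> by the quadratic form \<open>y^2 - c2 x^2 - c1 x - c0\<close>, which is 1 at
  the origin, lowers this to the degree that the pole order permits.\<close>

lemma form_of_power:
  assumes "2 * p \<le> 3 * m"
  shows "\<exists>f. form UNIV m f \<and> (\<forall>x y. y^2 = poly cub x \<longrightarrow> f (aff x y) = x ^ p) \<and> f orig = (if 2 * p = 3 * m then 1 else 0)"
proof -
  define r u where "r = p mod 3" and "u = p div 3"
  have p: "p = 3 * u + r" "r < 3" by (auto simp: r_def u_def)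
  consider "r = 0" | "r = 1" | "r = 2" using p(2) by linarith
  then have le: "r + 2 * u \<le> m"
  proof cases
    case 1 then show ?thesis using assms p(1) by simp
  next
    case 2 then have "2 * u + 2 * u + 2 * u + 2 \<le> 3 * m" using assms p(1) by simp
    then show ?thesis using 2 by presburger
  next
    case 3 then have "2 * u + 2 * u + 2 * u + 4 \<le> 3 * m" using assms p(1) by simp
    then show ?thesis using 3 by presburger
  qed
  let ?U = "\<lambda>v::'a^3. v $ 2 * v $ 2 - (c2 * (v $ 1 * v $ 1) + c1 * (v $ 1 * v $ 3) + c0 * (v $ 3 * v $ 3))"
  have U: "form UNIV 2 ?U"
    by (intro form_diff form.add form_cmult form_mult[OF form_coord form_coord]) auto
  let ?f = "\<lambda>v::'a^3. v $ 1 ^ r * (?U v ^ u * v $ 3 ^ (m - r - 2 * u))"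
  have "form UNIV m ?f"
    by (rule form_mult[OF form_power[OF form_coord] form_mult[OF form_power[OF U] form_power[OF form_coord]]])
      (use le in auto)
  moreover have "?f (aff x y) = x ^ p" if "y^2 = poly cub x" for x y
  proof -
    have "?U (aff x y) = x ^ 3" using that by (simp add: poly_cub power2_eq_square)
    then show ?thesis unfolding p power_add power_mult by simp
  qed
  moreover have "?f orig = (if 2 * p = 3 * m then 1 else 0)"
  proof -
    obtain w where "m = r + 2 * u + w" using le le_Suc_ex by blast
    then have "2 * p = 3 * m \<longleftrightarrow> r = 0 \<and> m - r - 2 * u = 0" using p(1) by auto
    then show ?thesis by auto
  qed
  ultimately show ?thesis by (intro exI[of _ ?f]) auto
qed

lemma form_of_power_y:
  assumes "2 * p + 3 \<le> 3 * m"
  shows "\<exists>f. form UNIV m f \<and> (\<forall>x y. y^2 = poly cub x \<longrightarrow> f (aff x y) = x ^ p * y) \<and> f orig = (if 2 * p + 3 = 3 * m then 1 else 0)"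
proof -
  obtain m' where m': "m = Suc m'" using assms by (cases m) auto
  then obtain f where f: "form UNIV m' f" "\<And>x y. y^2 = poly cub x \<Longrightarrow> f (aff x y) = x ^ p"
    "f orig = (if 2 * p = 3 * m' then 1 else 0)"
    using form_of_power[of p m'] assms by auto
  show ?thesis
    by (rule exI[of _ "\<lambda>v. v $ 2 * f v"]) (use f form.coord[OF f(1), of 2] m' in \<open>auto simp: mult.commute\<close>)
qed

text \<open>The converse of \<open>form_coordinates\<close>: every function with its only pole at
  the origin, of order at most \<open>3 * m\<close>, comes from a form of degree
  \<open>m\<close>.\<close>

lemma form_of_pole_le:
  assumes "pole_le (3 * m) a b"
  shows "\<exists>f. form UNIV m f \<and> (\<forall>x y. y^2 = poly cub x \<longrightarrow> f (aff x y) = poly a x + poly b x * y) \<and> f orig = lead m a b"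
proof -
  have A: "Polynomial.coeff a n = 0" if "2 * n > 3 * m" for n using assms that unfolding pole_le_def by blast
  have B: "Polynomial.coeff b n = 0" if "2 * n + 3 > 3 * m" for n using assms that unfolding pole_le_def by blast
  let ?I = "{n. 2 * n \<le> 3 * m}" and ?J = "{n. 2 * n + 3 \<le> 3 * m}"
  have "?I \<subseteq> {..3 * m}" "?J \<subseteq> {..3 * m}" by auto
  then have fin: "finite ?I" "finite ?J" using finite_subset finite_atMost by blast+
  have pa: "poly a x = (\<Sum>n\<in>?I. Polynomial.coeff a n * x ^ n)" for x
  proof -
    have "(\<Sum>n\<le>Polynomial.degree a. Polynomial.coeff a n * x ^ n) = (\<Sum>n\<in>{..Polynomial.degree a} \<union> ?I. Polynomial.coeff a n * x ^ n)"
      by (rule sum.mono_neutral_left) (use fin in \<open>auto simp: coeff_eq_0\<close>)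
    also have "\<dots> = (\<Sum>n\<in>?I. Polynomial.coeff a n * x ^ n)"
      by (rule sum.mono_neutral_right) (use fin A in \<open>auto simp: not_le\<close>)
    finally show ?thesis by (simp add: poly_altdef)
  qed
  have pb: "poly b x = (\<Sum>n\<in>?J. Polynomial.coeff b n * x ^ n)" for x
  proof -
    have "(\<Sum>n\<le>Polynomial.degree b. Polynomial.coeff b n * x ^ n) = (\<Sum>n\<in>{..Polynomial.degree b} \<union> ?J. Polynomial.coeff b n * x ^ n)"
      by (rule sum.mono_neutral_left) (use fin in \<open>auto simp: coeff_eq_0\<close>)
    also have "\<dots> = (\<Sum>n\<in>?J. Polynomial.coeff b n * x ^ n)"
      by (rule sum.mono_neutral_right) (use fin B in \<open>auto simp: not_le\<close>)
    finally show ?thesis by (simp add: poly_altdef)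
  qed
  have "\<forall>p. \<exists>f. 2 * p \<le> 3 * m \<longrightarrow> form UNIV m f \<and> (\<forall>x y. y^2 = poly cub x \<longrightarrow> f (aff x y) = x ^ p) \<and> f orig = (if 2 * p = 3 * m then 1 else 0)"
    using form_of_power by blast
  then obtain F where F: "\<And>p. 2 * p \<le> 3 * m \<Longrightarrow> form UNIV m (F p)"
    "\<And>p x y. 2 * p \<le> 3 * m \<Longrightarrow> y^2 = poly cub x \<Longrightarrow> F p (aff x y) = x ^ p"
    "\<And>p. 2 * p \<le> 3 * m \<Longrightarrow> F p orig = (if 2 * p = 3 * m then 1 else 0)" unfolding choice_iff by blast
  have "\<forall>p. \<exists>f. 2 * p + 3 \<le> 3 * m \<longrightarrow> form UNIV m f \<and> (\<forall>x y. y^2 = poly cub x \<longrightarrow> f (aff x y) = x ^ p * y) \<and> f orig = (if 2 * p + 3 = 3 * m then 1 else 0)"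
    using form_of_power_y by blast
  then obtain G where G: "\<And>p. 2 * p + 3 \<le> 3 * m \<Longrightarrow> form UNIV m (G p)"
    "\<And>p x y. 2 * p + 3 \<le> 3 * m \<Longrightarrow> y^2 = poly cub x \<Longrightarrow> G p (aff x y) = x ^ p * y"
    "\<And>p. 2 * p + 3 \<le> 3 * m \<Longrightarrow> G p orig = (if 2 * p + 3 = 3 * m then 1 else 0)" unfolding choice_iff by blast
  let ?f = "\<lambda>v. (\<Sum>n\<in>?I. Polynomial.coeff a n * F n v) + (\<Sum>n\<in>?J. Polynomial.coeff b n * G n v)"
  have "form UNIV m ?f" using F(1) G(1) by (intro form.add form_sum form_cmult) auto
  moreover have "?f (aff x y) = poly a x + poly b x * y" if "y^2 = poly cub x" for x y
    unfolding pa pb sum_distrib_right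
    by (intro arg_cong2[of _ _ _ _ plus] sum.cong) (use F(2) G(2) that in \<open>auto simp: mult.assoc\<close>)
  moreover have "?f orig = lead m a b"
  proof -
    have "?f orig = (\<Sum>n\<in>?I. if 2 * n = 3 * m then Polynomial.coeff a n else 0) + (\<Sum>n\<in>?J. if 2 * n + 3 = 3 * m then Polynomial.coeff b n else 0)"
      by (intro arg_cong2[of _ _ _ _ plus] sum.cong) (use F(3) G(3) in auto)
    also have "\<dots> = lead m a b"
    proof (cases "even m")
      case True
      then obtain u where u: "m = 2 * u" by blast
      have "2 * n = 3 * m \<longleftrightarrow> n = 3 * u" "\<not> 2 * n + 3 = 3 * m" for n using u by presburger+
      then show ?thesis using u fin by (simp add: lead_def)
    next
      case False
      then obtain u where u: "m = 2 * u + 1" by (elim oddE)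
      have "2 * n + 3 = 3 * m \<longleftrightarrow> n = 3 * u" "\<not> 2 * n = 3 * m" for n using u by presburger+
      then show ?thesis using u fin by (simp add: lead_def)
    qed
    finally show ?thesis .
  qed
  ultimately show ?thesis by (intro exI[of _ ?f]) auto
qed

text \<open>\<open>n\<close> is the largest pole order among the functions
  \<open>a i + b i y\<close>. Multiplication by \<open>x^e\<close> raises it to a multiple
  \<open>3 * m\<close> of 3, and a coordinate in which the maximum is attained then has non-zero top
  coefficient, that is, non-zero value at the origin.\<close>

lemma extend_origin:
  fixes a b :: "'m::finite \<Rightarrow> 'a poly"
  assumes nz: "a i0 \<noteq> 0 \<or> b i0 \<noteq> 0"
  shows "\<exists>e m. (\<forall>i. pole_le (3 * m) (Polynomial.monom 1 e * a i) (Polynomial.monom 1 e * b i)) \<and>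
     (\<exists>i. lead m (Polynomial.monom 1 e * a i) (Polynomial.monom 1 e * b i) \<noteq> 0)"
proof -
  let ?P = "\<lambda>n. \<forall>i. pole_le n (a i) (b i)"
  define M where "M = (\<Sum>i\<in>UNIV. 2 * Polynomial.degree (a i) + 2 * Polynomial.degree (b i)) + 3"
  have M0: "2 * Polynomial.degree (a i) + 2 * Polynomial.degree (b i) + 3 \<le> M" for i
    unfolding M_def by (intro add_right_mono member_le_sum) auto
  have M: "2 * Polynomial.degree (a i) \<le> M" "2 * Polynomial.degree (b i) + 3 \<le> M" for i
    using M0[of i] by linarith+
  have "pole_le M (a i) (b i)" for i
  proof -
    have "Polynomial.degree (a i) < n" if "2 * n > M" for n using M(1)[of i] that by linarith
    moreover have "Polynomial.degree (b i) < n" if "2 * n + 3 > M" for n using M(2)[of i] that by linarith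
    ultimately show ?thesis unfolding pole_le_def using coeff_eq_0 by blast
  qed
  then have PM: "?P M" by blast
  define n where "n = (LEAST n. ?P n)"
  have n: "?P n" unfolding n_def using PM by (rule LeastI)
  have min: "\<not> ?P k" if "k < n" for k using that not_less_Least unfolding n_def by blast
  have top: "\<exists>i. (\<exists>k. 2 * k = n \<and> Polynomial.coeff (a i) k \<noteq> 0) \<or> (\<exists>k. 2 * k + 3 = n \<and> Polynomial.coeff (b i) k \<noteq> 0)"
  proof (cases n)
    case 0
    have "Polynomial.coeff (b i0) k = 0" for k using n 0 unfolding pole_le_def by simp
    then have "b i0 = 0" by (simp add: poly_eq_iff)
    then have "a i0 \<noteq> 0" using nz by blast
    moreover have "Polynomial.coeff (a i0) k = 0" if "k > 0" for k using n 0 that unfolding pole_le_def by simp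
    ultimately have "Polynomial.coeff (a i0) 0 \<noteq> 0" unfolding poly_eq_iff by (metis gr0I Polynomial.coeff_0)
    then show ?thesis using 0 by auto
  next
    case (Suc n')
    then obtain i where "\<not> pole_le n' (a i) (b i)" using min[of n'] by auto
    then consider k where "2 * k > n'" "Polynomial.coeff (a i) k \<noteq> 0" | k where "2 * k + 3 > n'" "Polynomial.coeff (b i) k \<noteq> 0"
      unfolding pole_le_def by blast
    then show ?thesis
    proof cases
      case 1
      then have "\<not> 2 * k > n" using n unfolding pole_le_def by blast
      then have "2 * k = n" using 1 Suc by linarith
      then show ?thesis using 1 by blast
    next
      case 2
      then have "\<not> 2 * k + 3 > n" using n unfolding pole_le_def by blast
      then have "2 * k + 3 = n" using 2 Suc by linarith
      then show ?thesis using 2 by blast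
    qed
  qed
  obtain e m where em: "n + 2 * e = 3 * m"
  proof -
    \<comment> \<open>With \<open>e = n mod 3\<close> the sum \<open>n + 2 * e\<close> is divisible
      by 3.\<close>
    have "n + 2 * (n mod 3) = 3 * (n div 3 + n mod 3)" by presburger
    then show thesis by (rule that)
  qed
  have co: "Polynomial.coeff (Polynomial.monom 1 e * p) k = (if k < e then 0 else Polynomial.coeff p (k - e))" for p :: "'a poly" and k
    by (simp add: coeff_monom_mult)
  show ?thesis
  proof (rule exI[of _ e], rule exI[of _ m], intro conjI allI)
    fix i
    have na: "\<And>k. 2 * k > n \<Longrightarrow> Polynomial.coeff (a i) k = 0" "\<And>k. 2 * k + 3 > n \<Longrightarrow> Polynomial.coeff (b i) k = 0"
      using n unfolding pole_le_def by blast+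
    show "pole_le (3 * m) (Polynomial.monom 1 e * a i) (Polynomial.monom 1 e * b i)"
      unfolding pole_le_def co em[symmetric]
    proof (intro conjI allI impI)
      fix k assume k: "n + 2 * e < 2 * k"
      show "(if k < e then 0 else Polynomial.coeff (a i) (k - e)) = 0"
      proof (cases "k < e")
        case False
        then obtain l where l: "k = e + l" using le_Suc_ex not_less by blast
        then have "n < 2 * l" using k by simp
        from na(1)[OF this] show ?thesis unfolding l by simp
      qed simp
    next
      fix k assume k: "n + 2 * e < 2 * k + 3"
      show "(if k < e then 0 else Polynomial.coeff (b i) (k - e)) = 0"
      proof (cases "k < e")
        case False
        then obtain l where l: "k = e + l" using le_Suc_ex not_less by blast
        then have "n < 2 * l + 3" using k by simp
        from na(2)[OF this] show ?thesis unfolding l by simp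
      qed simp
    qed
  next
    obtain i where "(\<exists>k. 2 * k = n \<and> Polynomial.coeff (a i) k \<noteq> 0) \<or> (\<exists>k. 2 * k + 3 = n \<and> Polynomial.coeff (b i) k \<noteq> 0)"
      using top by blast
    then have "lead m (Polynomial.monom 1 e * a i) (Polynomial.monom 1 e * b i) \<noteq> 0"
    proof (elim disjE exE conjE)
      fix k assume k: "2 * k = n" "Polynomial.coeff (a i) k \<noteq> 0"
      then have km: "3 * m = 2 * (k + e)" using em by simp
      then have "even (3 * m)" by simp
      then have "even m" by simp
      moreover from this obtain t where "m = 2 * t" by blast
      then have "3 * (m div 2) = k + e" using km by simp
      ultimately have "even m" "3 * (m div 2) = k + e" by blast+
      then show ?thesis using k(2) by (simp add: lead_def co)
    next
      fix k assume k: "2 * k + 3 = n" "Polynomial.coeff (b i) k \<noteq> 0"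
      then have km: "3 * m = 2 * (k + e) + 3" using em by simp
      then have "odd (3 * m)" by simp
      then have "odd m" by simp
      moreover from this obtain t where "m = 2 * t + 1" by (elim oddE)
      then have "3 * (m div 2) = k + e" using km by simp
      ultimately have "odd m" "3 * (m div 2) = k + e" by blast+
      then show ?thesis using k(2) by (simp add: lead_def co)
    qed
    then show "\<exists>i. lead m (Polynomial.monom 1 e * a i) (Polynomial.monom 1 e * b i) \<noteq> 0" by blast
  qed
qed

text \<open>A rational map from a smooth curve to projective space is regular everywhere. The
  vanishing minors say that \<open>h'\<close> represents the map given by \<open>h\<close>; the
  three kinds of points need different multipliers.\<close>

lemma extend_Y:
  fixes h :: "'a ^ 3 \<Rightarrow> 'a ^ 'm::finite"
  assumes h: "form_tuple UNIV d h" and "pt v0 \<in> Y" "h v0 \<noteq> 0" and v: "pt v \<in> Y"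
  shows "\<exists>e h'. form_tuple UNIV e h' \<and> h' v \<noteq> 0 \<and> (\<forall>w i j. pt w \<in> Y \<longrightarrow> h' w $ i * h w $ j = h' w $ j * h w $ i)"
proof -
  have "\<forall>i. \<exists>ab. (\<forall>x y. y^2 = poly cub x \<longrightarrow> h (aff x y) $ i = poly (fst ab) x + poly (snd ab) x * y) \<and>
      h orig $ i = lead d (fst ab) (snd ab)"
    using form_coordinates[OF form_tuple_nth[OF h]] by (metis fst_conv snd_conv)
  then obtain ab where ab: "\<And>i x y. y^2 = poly cub x \<Longrightarrow> h (aff x y) $ i = poly (fst (ab i)) x + poly (snd (ab i)) x * y"
      "\<And>i. h orig $ i = lead d (fst (ab i)) (snd (ab i))" unfolding choice_iff by blast
  define a b where "a i = fst (ab i)" and "b i = snd (ab i)" for i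
  have hab: "\<And>i x y. y^2 = poly cub x \<Longrightarrow> h (aff x y) $ i = poly (a i) x + poly (b i) x * y"
    "\<And>i. h orig $ i = lead d (a i) (b i)" using ab unfolding a_def b_def by auto
  have "\<exists>i. a i \<noteq> 0 \<or> b i \<noteq> 0"
  proof (rule ccontr)
    assume "\<not> ?thesis"
    then have 0: "h orig = 0" "\<And>x y. y^2 = poly cub x \<Longrightarrow> h (aff x y) = 0"
      using hab by (auto simp: vec_eq_iff lead_def)
    from \<open>pt v0 \<in> Y\<close> have "h v0 = 0"
    proof (cases rule: Y_cases)
      case (1 x y c)
      then show ?thesis using 0(2)[OF 1(1)] form_tuple_homog[OF h, of c "aff x y"] by simp
    next
      case (2 c)
      then show ?thesis using 0(1) form_tuple_homog[OF h, of c orig] by simp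
    qed
    then show False using assms by blast
  qed
  then obtain i0 where i0: "a i0 \<noteq> 0 \<or> b i0 \<noteq> 0" by blast
  have conclude: ?thesis if "form_tuple UNIV e h'" "h' u \<noteq> 0" "v = c *s u" "c \<noteq> 0" "\<rho> \<noteq> 0"
    "\<And>x y i. y^2 = poly cub x \<Longrightarrow> poly \<rho> x * h' (aff x y) $ i = \<sigma> x y * h (aff x y) $ i" for e h' u c \<rho> \<sigma>
    using that form_tuple_eq_0_iff_smult[OF that(1,4)] representatives_agree[OF h that(1,5,6)] by blast
  from v show ?thesis
  proof (cases rule: Y_cases)
    case (1 x0 y0 c)
    have "\<exists>\<rho> \<sigma> a' b'. \<rho> \<noteq> 0 \<and> (\<forall>x y i. y^2 = poly cub x \<longrightarrow>
      poly \<rho> x * (poly (a' i) x + poly (b' i) x * y) = \<sigma> x y * (poly (a i) x + poly (b i) x * y)) \<and>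
      (\<exists>i. poly (a' i) x0 + poly (b' i) x0 * y0 \<noteq> 0)"
    proof (cases "y0 = 0")
      case True
      then show ?thesis using extend_two_torsion[of x0 a i0 b] 1(1) i0 by simp
    next
      case False
      then show ?thesis using extend_generic[of y0 x0 a i0 b] 1(1) i0 by blast
    qed
    then obtain \<rho> \<sigma> a' b' where *: "\<rho> \<noteq> 0"
      "\<And>x y i. y^2 = poly cub x \<Longrightarrow> poly \<rho> x * (poly (a' i) x + poly (b' i) x * y) = \<sigma> x y * (poly (a i) x + poly (b i) x * y)"
      "\<exists>i. poly (a' i) x0 + poly (b' i) x0 * y0 \<noteq> 0" by blast
    obtain D and h' :: "'a^3 \<Rightarrow> 'a^'m" where h': "form_tuple UNIV D h'"
      "\<And>i x y. h' (aff x y) $ i = poly (a' i) x + poly (b' i) x * y" using form_of_polys by blast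
    show ?thesis
    proof (rule conclude[OF h'(1) _ 1(3,2) *(1)])
      show "h' (aff x0 y0) \<noteq> 0" using *(3) h'(2) by (auto simp: vec_eq_iff)
      show "poly \<rho> x * h' (aff x y) $ i = \<sigma> x y * h (aff x y) $ i" if "y^2 = poly cub x" for x y i
        using *(2)[OF that] hab(1)[OF that] h'(2) by simp
    qed
  next
    case (2 c)
    obtain e m where em: "\<And>i. pole_le (3 * m) (Polynomial.monom 1 e * a i) (Polynomial.monom 1 e * b i)"
     "\<exists>i. lead m (Polynomial.monom 1 e * a i) (Polynomial.monom 1 e * b i) \<noteq> 0"
      using extend_origin[of a i0 b] i0 by blast
    obtain F where F: "\<And>i. form UNIV m (F i)"
      "\<And>i x y. y^2 = poly cub x \<Longrightarrow> F i (aff x y) = poly (Polynomial.monom 1 e * a i) x + poly (Polynomial.monom 1 e * b i) x * y"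
      "\<And>i. F i orig = lead m (Polynomial.monom 1 e * a i) (Polynomial.monom 1 e * b i)"
      using form_of_pole_le[OF em(1)] by metis
    show ?thesis
    proof (rule conclude[where h' = "\<lambda>v. \<chi> i. F i v" and \<rho> = 1 and \<sigma> = "\<lambda>x y. x ^ e", OF _ _ 2(2,1)])
      show "form_tuple UNIV m (\<lambda>v. \<chi> i. F i v)" using F(1) by (simp add: form_tuple_def)
      show "(\<chi> i. F i orig) \<noteq> 0" using F(3) em(2) by (auto simp: vec_eq_iff)
      show "poly 1 x * (\<chi> i. F i (aff x y)) $ i = x ^ e * h (aff x y) $ i" if "y^2 = poly cub x" for x y i
        using F(2)[OF that] hab(1)[OF that] by (simp add: poly_monom algebra_simps)
    qed simp
  qed
qed

end

lemma irr_curve_isomorphic: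
  fixes \<phi> :: "('a::field, 'n::finite) ppoint \<Rightarrow> ('a, 'm::finite) ppoint"
  assumes V: "irr_curve V" and \<phi>: "isomorphism UNIV V W \<phi>" and W: "W \<subseteq> proj_space"
  shows "irr_curve W"
proof -
  obtain \<psi> where \<psi>: "morphism UNIV V W \<phi>" "morphism UNIV W V \<psi>"
    "\<And>P. P \<in> V \<Longrightarrow> \<psi> (\<phi> P) = P" "\<And>Q. Q \<in> W \<Longrightarrow> \<phi> (\<psi> Q) = Q"
    using \<phi> unfolding isomorphism_def by metis
  have im: "\<phi> ` V = W"
  proof
    show "\<phi> ` V \<subseteq> W" using morphism_in[OF \<psi>(1)] by blast
    show "W \<subseteq> \<phi> ` V" using \<psi>(4) morphism_in[OF \<psi>(2)] by (metis image_eqI subsetI)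
  qed
  have "inj_on \<phi> V" using \<psi>(3) by (metis inj_onI)
  then have "infinite W" using V im finite_imageD unfolding irr_curve_def by blast
  then show ?thesis using irr_curve_surj_image[OF V \<psi>(1) im W] by blast
qed

lemma isomorphism_in: "isomorphism S V W \<phi> \<Longrightarrow> P \<in> V \<Longrightarrow> \<phi> P \<in> W"
  by (metis isomorphism_def morphism_in)

lemma proj_map_morphism:
  fixes V :: "('a::field, 'n::finite) ppoint set"
  assumes "form_tuple S d h" "V \<subseteq> proj_space" "\<And>v. pt v \<in> V \<Longrightarrow> h v \<noteq> 0 \<and> pt (h v) \<in> W"
  shows "morphism S V W (proj_map h)"
  by (rule morphismI[OF assms(2)]) (use assms proj_map_pt[OF assms(1)] in auto)

lemma linear_isomorphism:
  fixes L L' :: "'a::field ^ 'n::finite \<Rightarrow> 'a ^ 'n"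
  assumes L: "form_tuple UNIV 1 L" and L': "form_tuple UNIV 1 L'"
    and inv: "\<And>v. L (L' v) = v" "\<And>v. L' (L v) = v"
    and V: "V \<subseteq> proj_space" and W: "W \<subseteq> proj_space" and WV: "\<And>v. pt v \<in> W \<longleftrightarrow> pt (L v) \<in> V"
  shows "isomorphism UNIV W V (proj_map L)"
  unfolding isomorphism_def
proof (intro conjI exI[of _ "proj_map L'"] ballI)
  have nz: "L v \<noteq> 0" if "pt v \<in> W" for v using that WV V pt_in_proj_space by blast
  have nz': "L' v \<noteq> 0" if "pt v \<in> V" for v
  proof -
    have "pt (L' v) \<in> W" using that WV[of "L' v"] inv by simp
    then show ?thesis using W pt_in_proj_space by blast
  qed
  show "morphism UNIV W V (proj_map L)"
    by (rule proj_map_morphism[OF L W]) (use nz WV in auto)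
  show "morphism UNIV V W (proj_map L')"
    by (rule proj_map_morphism[OF L' V]) (use nz' WV inv in auto)
  show "proj_map L' (proj_map L P) = P" if P: "P \<in> W" for P
    using proj_setE[OF W P] proj_map_pt[OF L] proj_map_pt[OF L'] inv by metis
  show "proj_map L (proj_map L' P) = P" if P: "P \<in> V" for P
    using proj_setE[OF V P] proj_map_pt[OF L] proj_map_pt[OF L'] inv by metis
qed

text \<open>The regularity property of \<open>extend_Y\<close> as a notion for arbitrary curves. The
  type argument fixes the number of coordinates of the target, over which a definition cannot
  quantify.\<close>

definition extends_maps :: "('a::field, 'n::finite) ppoint set \<Rightarrow> 'm::finite itself \<Rightarrow> bool" where
  "extends_maps V _ \<longleftrightarrow> (\<forall>d (h :: 'a ^ 'n \<Rightarrow> 'a ^ 'm) v0 v. form_tuple UNIV d h \<and> pt v0 \<in> V \<and> h v0 \<noteq> 0 \<and> pt v \<in> V \<longrightarrow>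
     (\<exists>e h'. form_tuple UNIV e h' \<and> h' v \<noteq> 0 \<and> (\<forall>w i j. pt w \<in> V \<longrightarrow> h' w $ i * h w $ j = h' w $ j * h w $ i)))"

section \<open>Elliptic curves\<close>

lemma points_mem:
  "pt v \<in> points E \<longleftrightarrow> v \<noteq> 0 \<and> (v $ 2)^2 * v $ 3 + a1 E * v $ 1 * v $ 2 * v $ 3 + a3 E * v $ 2 * (v $ 3)^2
     = (v $ 1)^3 + a2 E * (v $ 1)^2 * v $ 3 + a4 E * v $ 1 * (v $ 3)^2 + a6 E * (v $ 3)^3"
  unfolding points_def
  by (subst in_zero_locus) (auto intro!: exI[of _ 3] simp: Let_def algebra_simps power2_eq_square power3_eq_cube)

lemma points_proj: "points E \<subseteq> proj_space"
  unfolding points_def by (rule zero_locus_subset)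

lemma origin_in_points: "origin \<in> points E"
  unfolding origin_def points_mem by (simp add: vec_eq_iff forall_3)

text \<open>Completing the square brings the curve to short form; a singular point of the short form
  would make the discriminant vanish.\<close>

context
  fixes E :: "'a::{alg_closed_field, field_char_0} weierstrass" and L L' :: "'a ^ 3 \<Rightarrow> 'a ^ 3" and \<alpha> \<beta> \<gamma> :: 'a
  assumes disc: "discriminant E \<noteq> 0"
  defines "L \<equiv> \<lambda>v. vector [v $ 1, v $ 2 + (a1 E * v $ 1 + a3 E * v $ 3) / 2, v $ 3]"
    and "L' \<equiv> \<lambda>v. vector [v $ 1, v $ 2 - (a1 E * v $ 1 + a3 E * v $ 3) / 2, v $ 3]"
    and "\<alpha> \<equiv> a2 E + (a1 E)^2 / 4" and "\<beta> \<equiv> a4 E + a1 E * a3 E / 2" and "\<gamma> \<equiv> a6 E + (a3 E)^2 / 4"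
begin

lemma short_cubic_E: "short_cubic \<alpha> \<beta> \<gamma>"
proof
  fix x assume x: "x ^ 3 + \<alpha> * x^2 + \<beta> * x + \<gamma> = 0"
  show "3 * x^2 + 2 * \<alpha> * x + \<beta> \<noteq> 0"
  proof
    assume x': "3 * x^2 + 2 * \<alpha> * x + \<beta> = 0"
    have b: "\<beta> = - 3 * x^2 - 2 * \<alpha> * x" using x' by (simp add: algebra_simps eq_neg_iff_add_eq_0)
    have "\<gamma> = - (x ^ 3 + \<alpha> * x^2 + \<beta> * x)" using x by (simp add: eq_neg_iff_add_eq_0 algebra_simps)
    then have c: "\<gamma> = 2 * x ^ 3 + \<alpha> * x^2" unfolding b by (simp add: algebra_simps power2_eq_square power3_eq_cube)
    \<comment> \<open>In these terms the b-invariants of the curve are \<open>4 \<alpha>\<close>,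
      \<open>2 \<beta>\<close>, \<open>4 \<gamma>\<close> and
      \<open>4 \<alpha> \<gamma> - \<beta>^2\<close>, so the discriminant depends only on the short
      form.\<close>
    define A B where "A = a1 E / 2" and "B = a3 E / 2"
    have a13: "a1 E = 2 * A" "a3 E = 2 * B" by (simp_all add: A_def B_def)
    have a246: "a2 E = \<alpha> - A^2" "a4 E = \<beta> - 2 * A * B" "a6 E = \<gamma> - B^2"
      unfolding \<alpha>_def \<beta>_def \<gamma>_def a13 by (simp_all add: power2_eq_square)
    have b8: "(2 * A)^2 * (\<gamma> - B^2) + 4 * (\<alpha> - A^2) * (\<gamma> - B^2) - 2 * A * (2 * B) * (\<beta> - 2 * A * B) + (\<alpha> - A^2) * (2 * B)^2
       - (\<beta> - 2 * A * B)^2 = 4 * \<alpha> * \<gamma> - \<beta>^2"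
      by (simp add: algebra_simps power2_eq_square)
    have b246: "(2 * A)^2 + 4 * (\<alpha> - A^2) = 4 * \<alpha>" "2 * (\<beta> - 2 * A * B) + 2 * A * (2 * B) = 2 * \<beta>"
       "(2 * B)^2 + 4 * (\<gamma> - B^2) = 4 * \<gamma>"
      by (simp_all add: algebra_simps power2_eq_square)
    have "discriminant E = - ((4 * \<alpha>)^2 * (4 * \<alpha> * \<gamma> - \<beta>^2)) - 8 * (2 * \<beta>)^3 - 27 * (4 * \<gamma>)^2 + 9 * (4 * \<alpha>) * (2 * \<beta>) * (4 * \<gamma>)"
      unfolding discriminant_def Let_def a13 a246 b8 b246 by (rule refl)
    also have "\<dots> = 0" unfolding b c by (simp add: algebra_simps power2_eq_square power3_eq_cube)
    finally have "discriminant E = 0" .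
    then show False using disc by blast
  qed
qed

lemma L_form: "form_tuple UNIV 1 L" and L'_form: "form_tuple UNIV 1 L'"
proof -
  have "form UNIV 1 (\<lambda>v::'a^3. v $ 2 + c * (a1 E * v $ 1 + a3 E * v $ 3))" for c
    by (intro form.add form_cmult form_coord)
  from this[of "1/2"] this[of "-1/2"] show "form_tuple UNIV 1 L" "form_tuple UNIV 1 L'"
    unfolding L_def L'_def form_tuple_def forall_3 using form_coord by auto
qed

lemma LL': "L (L' v) = v" and L'L: "L' (L v) = v"
  unfolding L_def L'_def by (auto simp: vec_eq_iff forall_3)

lemma points_L: "pt v \<in> points E \<longleftrightarrow> pt (L v) \<in> short_cubic.Y \<alpha> \<beta> \<gamma>"
proof -
  interpret short_cubic \<alpha> \<beta> \<gamma> by (rule short_cubic_E)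
  have 0: "L v = 0 \<longleftrightarrow> v = 0" by (auto simp: L_def vec_eq_iff forall_3)
  define A B where "A = a1 E / 2" and "B = a3 E / 2"
  have a13: "a1 E = 2 * A" "a3 E = 2 * B" by (simp_all add: A_def B_def)
  have ag: "\<alpha> = a2 E + A^2" "\<beta> = a4 E + 2 * A * B" "\<gamma> = a6 E + B^2"
    unfolding \<alpha>_def \<beta>_def \<gamma>_def a13 by (simp_all add: power2_eq_square)
  have L2: "L v $ 1 = v $ 1" "L v $ 2 = v $ 2 + (A * v $ 1 + B * v $ 3)" "L v $ 3 = v $ 3"
    unfolding L_def a13 by (simp_all add: add_divide_distrib)
  have "(y + (A * x + B * z))^2 * z - (x^3 + (a2 E + A^2) * x^2 * z + (a4 E + 2 * A * B) * x * z^2 + (a6 E + B^2) * z^3)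
    = (y^2 * z + 2 * A * x * y * z + 2 * B * y * z^2) - (x^3 + a2 E * x^2 * z + a4 E * x * z^2 + a6 E * z^3)" for x y z
    by (simp add: algebra_simps power2_eq_square power3_eq_cube)
  from diff_eq_diff_eq[OF this[of "v $ 2" "v $ 1" "v $ 3"]] show ?thesis
    unfolding points_mem in_Y unfolding 0 L2 ag a13 by blast
qed

lemma irr_points: "irr_curve (points E)"
proof -
  interpret short_cubic \<alpha> \<beta> \<gamma> by (rule short_cubic_E)
  have "isomorphism UNIV Y (points E) (proj_map L')"
    by (rule linear_isomorphism[OF L'_form L_form L'L LL' points_proj Y_proj]) (simp add: points_L LL')
  then show ?thesis using irr_curve_isomorphic[OF irr_Y _ points_proj] by blast
qed

lemma extends_points: "extends_maps (points E) TYPE('m::finite)"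
  unfolding extends_maps_def
proof (intro allI impI, elim conjE)
  fix d v0 v and h :: "'a ^ 3 \<Rightarrow> 'a ^ 'm"
  assume h: "form_tuple UNIV d h" "pt v0 \<in> points E" "h v0 \<noteq> 0" "pt v \<in> points E"
  interpret short_cubic \<alpha> \<beta> \<gamma> by (rule short_cubic_E)
  have g: "form_tuple UNIV d (\<lambda>v. h (L' v))" by (rule form_tuple_comp[OF h(1) L'_form]) simp
  obtain e h' where h': "form_tuple UNIV e h'" "h' (L v) \<noteq> 0"
    "\<And>w i j. pt w \<in> Y \<Longrightarrow> h' w $ i * h (L' w) $ j = h' w $ j * h (L' w) $ i"
    using extend_Y[OF g, of "L v0" "L v"] h points_L L'L by auto
  show "\<exists>e h'. form_tuple UNIV e h' \<and> h' v \<noteq> 0 \<and> (\<forall>w i j. pt w \<in> points E \<longrightarrow> h' w $ i * h w $ j = h' w $ j * h w $ i)"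
  proof (intro exI conjI allI impI)
    show "form_tuple UNIV e (\<lambda>v. h' (L v))" by (rule form_tuple_comp[OF h'(1) L_form]) simp
    fix w i j assume "pt w \<in> points E"
    then show "h' (L w) $ i * h w $ j = h' (L w) $ j * h w $ i" using h'(3)[of "L w" i j] points_L L'L by simp
  qed fact
qed

end

section \<open>Sign changes and their quotients\<close>

definition flip :: "'n set \<Rightarrow> 'a::comm_ring_1 ^ 'n \<Rightarrow> 'a ^ 'n" where
  "flip S v = (\<chi> i. if i \<in> S then - v $ i else v $ i)"

lemma flip_nth: "flip S v $ i = (if i \<in> S then - v $ i else v $ i)"
  by (simp add: flip_def)

lemma flip_flip: "flip S (flip S v) = v"
  by (simp add: vec_eq_iff flip_nth)

lemma flip_empty [simp]: "flip {} v = v"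
  by (simp add: vec_eq_iff flip_nth)

lemma flip_form: "form_tuple UNIV 1 (flip S)"
  unfolding form_tuple_def flip_nth
proof
  fix i show "form UNIV 1 (\<lambda>v. if i \<in> S then - v $ i else v $ i)"
    using form_coord form_minus[OF form_coord] by (cases "i \<in> S") (auto simp del: One_nat_def)
qed

lemma flip_smult: "flip S (c *s v) = c *s flip S v"
  by (simp add: vec_eq_iff flip_nth)

lemma flip_eq_0 [simp]: "flip S v = 0 \<longleftrightarrow> v = 0"
  by (metis flip_flip flip_smult vector_smult_lzero)

text \<open>If all quadratic monomials invariant under a sign change are linear forms in \<open>\<rho>\<close>, then so
  are, in the appropriate degree, all invariant forms.  The induction runs over all forms and keeps
  track of both isotypic parts.\<close>

lemma trace_flip:
  fixes \<rho> :: "'a::comm_ring_1 ^ 'n \<Rightarrow> 'a ^ 'm"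
  assumes lin: "\<And>i j. i \<in> S \<longleftrightarrow> j \<in> S \<Longrightarrow> \<exists>l. form UNIV 1 l \<and> (\<forall>v\<in>Z. v $ i * v $ j = l (\<rho> v))"
    and f: "form UNIV (2 * n) f"
  shows "\<exists>g. form UNIV n g \<and> (\<forall>v\<in>Z. f v + f (flip S v) = g (\<rho> v))"
proof -
  define R where "R m F \<longleftrightarrow> (\<exists>g. form UNIV m g \<and> (\<forall>v\<in>Z. F v = g (\<rho> v)))" for m :: nat and F
  have R_mult: "R (Suc m) (\<lambda>v. v $ i * v $ j * F v)" if R: "R m F" "i \<in> S \<longleftrightarrow> j \<in> S" for m i j F
  proof -
    obtain l where l: "form UNIV 1 l" "\<forall>v\<in>Z. v $ i * v $ j = l (\<rho> v)" using lin R(2) by blast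
    obtain g where g: "form UNIV m g" "\<forall>v\<in>Z. F v = g (\<rho> v)" using R(1) unfolding R_def by blast
    show ?thesis unfolding R_def
      by (rule exI[of _ "\<lambda>v. l v * g v"]) (use l g form_mult[OF l(1) g(1)] in auto)
  qed
  have R_add: "R m (\<lambda>v. F v + G v)" if RR: "R m F" "R m G" for m F G
  proof -
    obtain f g where "form UNIV m f" "\<forall>v\<in>Z. F v = f (\<rho> v)" "form UNIV m g" "\<forall>v\<in>Z. G v = g (\<rho> v)"
      using RR unfolding R_def by blast
    then show ?thesis unfolding R_def by (intro exI[of _ "\<lambda>v. f v + g v"]) (auto intro: form.add)
  qed
  have cong: "R m G" if "R m F" "\<And>v. G v = F v" for m F G
    using that unfolding R_def by metis
  define plus minus where "plus f v = f v + f (flip S v)" and "minus f v = f v - f (flip S v)" for f :: "'a ^ 'n \<Rightarrow> 'a" and v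
  \<comment> \<open>\<open>plus f\<close> is invariant and \<open>minus f\<close> anti-invariant.
    Each product listed is invariant and of even degree: an anti-invariant part needs a flipped
    coordinate, and one coordinate is added or taken away to correct the parity.\<close>
  have "(even d \<longrightarrow> R (d div 2) (plus f) \<and> (\<forall>i\<in>S. \<forall>j\<in>-S. R (Suc (d div 2)) (\<lambda>v. v $ i * v $ j * minus f v))) \<and>
    (odd d \<longrightarrow> (\<forall>j\<in>-S. R (Suc (d div 2)) (\<lambda>v. v $ j * plus f v)) \<and> (\<forall>i\<in>S. R (Suc (d div 2)) (\<lambda>v. v $ i * minus f v)))"
    if "form UNIV d f" for d f
    using that
  proof (induction rule: form.induct)
    case (const c)
    have "R 0 (plus (\<lambda>_. c))"
      unfolding R_def plus_def by (rule exI[of _ "\<lambda>_. c + c"]) (auto intro: form.const)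
    moreover have "R (Suc 0) (\<lambda>v. v $ i * v $ j * minus (\<lambda>_. c) v)" for i j
      unfolding R_def minus_def by (rule exI[of _ "\<lambda>_. 0"]) (auto intro: form_zero)
    ultimately show ?case by simp
  next
    case (coord d f l)
    have pm: "plus (\<lambda>v. v $ l * f v) v = v $ l * (if l \<in> S then minus f v else plus f v)"
       "minus (\<lambda>v. v $ l * f v) v = v $ l * (if l \<in> S then plus f v else minus f v)" for v
      unfolding plus_def minus_def flip_nth by (auto simp: algebra_simps)
    show ?case
    proof (cases "even d")
      case True
      then have IH: "R (d div 2) (plus f)" "\<And>i j. i \<in> S \<Longrightarrow> j \<notin> S \<Longrightarrow> R (Suc (d div 2)) (\<lambda>v. v $ i * v $ j * minus f v)"
        using coord.IH by auto
      have d: "odd (Suc d)" "Suc d div 2 = d div 2" using True by auto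
      have "R (Suc (d div 2)) (\<lambda>v. v $ j * plus (\<lambda>v. v $ l * f v) v)" if "j \<notin> S" for j
      proof (cases "l \<in> S")
        case True
        show ?thesis by (rule cong[OF IH(2)[OF True that]]) (unfold pm, simp add: True mult_ac)
      next
        case False
        show ?thesis by (rule cong[OF R_mult[OF IH(1), of j l]]) (unfold pm, use that False in \<open>simp_all add: mult_ac\<close>)
      qed
      moreover have "R (Suc (d div 2)) (\<lambda>v. v $ i * minus (\<lambda>v. v $ l * f v) v)" if "i \<in> S" for i
      proof (cases "l \<in> S")
        case True
        show ?thesis by (rule cong[OF R_mult[OF IH(1), of i l]]) (unfold pm, use that True in \<open>simp_all add: mult_ac\<close>)
      next
        case False
        show ?thesis by (rule cong[OF IH(2)[OF that False]]) (unfold pm, simp add: False mult_ac)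
      qed
      ultimately show ?thesis using d by auto
    next
      case False
      then have IH: "\<And>j. j \<notin> S \<Longrightarrow> R (Suc (d div 2)) (\<lambda>v. v $ j * plus f v)"
        "\<And>i. i \<in> S \<Longrightarrow> R (Suc (d div 2)) (\<lambda>v. v $ i * minus f v)"
        using coord.IH by auto
      have d: "even (Suc d)" "Suc d div 2 = Suc (d div 2)" using False by presburger+
      have "R (Suc (d div 2)) (plus (\<lambda>v. v $ l * f v))"
      proof (cases "l \<in> S")
        case True
        show ?thesis by (rule cong[OF IH(2)[OF True]]) (unfold pm, simp add: True)
      next
        case False
        show ?thesis by (rule cong[OF IH(1)[OF False]]) (unfold pm, simp add: False)
      qed
      moreover have "R (Suc (Suc (d div 2))) (\<lambda>v. v $ i * v $ j * minus (\<lambda>v. v $ l * f v) v)" if "i \<in> S" "j \<notin> S" for i j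
      proof (cases "l \<in> S")
        case True
        show ?thesis by (rule cong[OF R_mult[OF IH(1)[OF that(2)], of i l]]) (unfold pm, use that True in \<open>simp_all add: mult_ac\<close>)
      next
        case False
        show ?thesis by (rule cong[OF R_mult[OF IH(2)[OF that(1)], of j l]]) (unfold pm, use that False in \<open>simp_all add: mult_ac\<close>)
      qed
      ultimately show ?thesis using d by auto
    qed
  next
    case (add d f g)
    have pm: "plus (\<lambda>v. f v + g v) = (\<lambda>v. plus f v + plus g v)" "minus (\<lambda>v. f v + g v) = (\<lambda>v. minus f v + minus g v)"
      unfolding plus_def minus_def by (auto simp: algebra_simps)
    show ?case using add.IH unfolding pm distrib_left by (auto intro!: R_add)
  qed
  from this[OF f] show ?thesis unfolding R_def plus_def by simp
qed

section \<open>Descent along a quotient by sign changes\<close>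

text \<open>The relation is pulled back along a local representative of \<Phi> and becomes a form on
  \<open>Z\<close>, to which density of the set \<open>f \<noteq> 0\<close> applies. The extra
  factor \<open>h u $ m\<close> covers the points where the representative vanishes.\<close>

lemma irr_curve_relation:
  fixes \<Phi> :: "('a::field, 'n::finite) ppoint \<Rightarrow> ('a, 'm::finite) ppoint" and G :: "'a ^ 'm \<Rightarrow> 'a ^ 'n"
  assumes Z: "irr_curve Z" and \<Phi>: "morphism UNIV Z W \<Phi>" and G: "form_tuple UNIV e G"
    and f: "form UNIV d f" "pt x \<in> Z" "f x \<noteq> 0"
    and rel: "\<And>v w i j. pt v \<in> Z \<Longrightarrow> f v \<noteq> 0 \<Longrightarrow> \<Phi> (pt v) = pt w \<Longrightarrow> G w $ i * v $ j = G w $ j * v $ i"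
    and v: "pt v \<in> Z" "\<Phi> (pt v) = pt w"
  shows "G w $ i * v $ j = G w $ j * v $ i"
proof -
  obtain d' h where h: "form_tuple UNIV d' h" "h v \<noteq> 0" "\<And>u. pt u \<in> Z \<Longrightarrow> h u \<noteq> 0 \<Longrightarrow> \<Phi> (pt u) = pt (h u)"
    using morphism_local[OF \<Phi> irr_curve_proj[OF Z] v(1)] by metis
  obtain m where m: "h v $ m \<noteq> 0" using h(2) by (auto simp: vec_eq_iff)
  let ?F = "\<lambda>u. h u $ m * (G (h u) $ i * u $ j - G (h u) $ j * u $ i)"
  have Gh: "form_tuple UNIV (e * d') (\<lambda>u. G (h u))" by (rule form_tuple_comp[OF G h(1)]) simp
  have F: "form UNIV (d' + (e * d' + 1)) ?F"
    by (intro form_mult[OF form_tuple_nth[OF h(1)] form_diff refl] form_mult[OF form_tuple_nth[OF Gh] form_coord refl])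
  have "?F v = 0"
  proof (rule irr_curve_extend[OF Z f(1) F _ f(2,3) v(1)])
    fix u assume u: "pt u \<in> Z" "f u \<noteq> 0"
    show "?F u = 0"
    proof (cases "h u = 0")
      case False
      then show ?thesis using rel[OF u h(3)[OF u(1) False], of i j] by simp
    qed simp
  qed
  then have *: "G (h v) $ i * v $ j = G (h v) $ j * v $ i" using m by simp
  have "pt w = pt (h v)" using h(3)[OF v(1) h(2)] v(2) by simp
  then obtain c where "w = c *s h v" unfolding pt_eq_iff by blast
  then have "G w = c ^ e *s G (h v)" using form_tuple_homog[OF G] by simp
  then show ?thesis using * by simp
qed

lemma form_sum_list: "(\<And>t. t \<in> set ts \<Longrightarrow> form UNIV d (f t)) \<Longrightarrow> form UNIV d (\<lambda>v. \<Sum>t\<leftarrow>ts. f t v)"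
proof (induction ts)
  case (Cons t ts)
  then have "form UNIV d (\<lambda>v. f t v + (\<Sum>t\<leftarrow>ts. f t v))" by (intro form.add) auto
  then show ?case by simp
qed (auto intro: form_zero)

text \<open>A form in two groups of variables as a sum of products. Traces are taken in
  \<open>x\<close> only, term by term, with \<open>w\<close> as a parameter.\<close>

lemma biform_prod:
  fixes r s :: "'s \<Rightarrow> 'a::comm_ring_1 ^ 'n \<Rightarrow> 'a" and \<alpha> \<beta> :: "'s \<Rightarrow> 'm::finite"
  assumes "finite I" "\<And>S. S \<in> I \<Longrightarrow> form UNIV d (r S)" "\<And>S. S \<in> I \<Longrightarrow> form UNIV d (s S)"
  shows "\<exists>ts. (\<forall>t\<in>set ts. form UNIV (card I) (fst t) \<and> form UNIV (card I * d) (snd t)) \<and>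
    (\<forall>w x. (\<Prod>S\<in>I. w $ \<alpha> S * r S x - w $ \<beta> S * s S x) = (\<Sum>t\<leftarrow>ts. fst t w * snd t x))"
  using assms
proof (induction I rule: finite_induct)
  case empty
  show ?case
    by (rule exI[of _ "[(\<lambda>_. 1, \<lambda>_. 1)]"]) (auto intro: form.const)
next
  case (insert S I)
  then obtain ts where ts: "\<And>t. t \<in> set ts \<Longrightarrow> form UNIV (card I) (fst t) \<and> form UNIV (card I * d) (snd t)"
    "\<And>w x. (\<Prod>S\<in>I. w $ \<alpha> S * r S x - w $ \<beta> S * s S x) = (\<Sum>t\<leftarrow>ts. fst t w * snd t x)" by auto
  have rs: "form UNIV d (r S)" "form UNIV d (s S)" using insert by auto
  let ?ts = "map (\<lambda>t. (\<lambda>w. w $ \<alpha> S * fst t w, \<lambda>x. r S x * snd t x)) ts @ map (\<lambda>t. (\<lambda>w. - (w $ \<beta> S * fst t w), \<lambda>x. s S x * snd t x)) ts"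
  show ?case
  proof (intro exI[of _ ?ts] conjI ballI allI)
    fix t assume "t \<in> set ?ts"
    then obtain u where u: "u \<in> set ts" "t = (\<lambda>w. w $ \<alpha> S * fst u w, \<lambda>x. r S x * snd u x) \<or> t = (\<lambda>w. - (w $ \<beta> S * fst u w), \<lambda>x. s S x * snd u x)"
      by auto
    have 1: "form UNIV (card (insert S I)) (\<lambda>w. w $ l * fst u w)" for l
      using form.coord[of UNIV "card I" "fst u" l] ts(1)[OF u(1)] insert by simp
    have 2: "form UNIV (card (insert S I) * d) (\<lambda>x. q x * snd u x)" if "form UNIV d q" for q
      by (rule form_mult[OF that]) (use ts(1)[OF u(1)] insert in auto)
    show "form UNIV (card (insert S I)) (fst t)" using u(2) 1 form_minus[OF 1] by auto
    show "form UNIV (card (insert S I) * d) (snd t)" using u(2) 2 rs by auto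
  next
    fix w x
    have "(\<Sum>t\<leftarrow>?ts. fst t w * snd t x) = (w $ \<alpha> S * r S x - w $ \<beta> S * s S x) * (\<Sum>t\<leftarrow>ts. fst t w * snd t x)"
      by (induction ts) (simp_all add: algebra_simps)
    then show "(\<Prod>S\<in>insert S I. w $ \<alpha> S * r S x - w $ \<beta> S * s S x) = (\<Sum>t\<leftarrow>?ts. fst t w * snd t x)"
      using insert ts(2) by simp
  qed
qed

lemma irr_curve_nonzero_prod:
  assumes Z: "irr_curve Z" and "finite I" "form UNIV d0 f0" "pt x0 \<in> Z" "f0 x0 \<noteq> 0"
    and "\<And>S. S \<in> I \<Longrightarrow> form UNIV d (F S)" "\<And>S. S \<in> I \<Longrightarrow> \<exists>x. pt x \<in> Z \<and> F S x \<noteq> 0"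
  shows "\<exists>z. pt z \<in> Z \<and> f0 z \<noteq> 0 \<and> (\<forall>S\<in>I. F S z \<noteq> 0)"
  using assms(2,6,7)
proof (induction I rule: finite_induct)
  case empty
  then show ?case using assms by auto
next
  case (insert S I)
  then obtain z where z: "pt z \<in> Z" "f0 z \<noteq> 0" "\<forall>S\<in>I. F S z \<noteq> 0" by auto
  have "\<exists>x. pt x \<in> Z \<and> F S x \<noteq> 0" by (rule insert.prems) simp
  then obtain x where x: "pt x \<in> Z" "F S x \<noteq> 0" by blast
  have P: "form UNIV (d0 + card I * d) (\<lambda>v. f0 v * (\<Prod>S\<in>I. F S v))"
    by (intro form_mult[OF assms(3) form_prod refl]) (use insert in auto)
  have "f0 z * (\<Prod>S\<in>I. F S z) \<noteq> 0" using z insert(1) by simp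
  then obtain y where "pt y \<in> Z" "f0 y * (\<Prod>S\<in>I. F S y) \<noteq> 0" "F S y \<noteq> 0"
    using irr_curve_nonzero_mult[OF Z P insert(4)[of S] z(1) _ x] by auto
  then show ?case using insert(1) by (intro exI[of _ y]) auto
qed

lemma morphism_eqI_form:
  fixes \<phi> \<psi> :: "('a::field, 'n::finite) ppoint \<Rightarrow> ('a, 'm::finite) ppoint"
  assumes V: "irr_curve V" and \<phi>: "morphism UNIV V W \<phi>" and \<psi>: "morphism UNIV V W \<psi>"
    and f: "form UNIV d f" "pt x \<in> V" "f x \<noteq> 0"
    and eq: "\<And>v. pt v \<in> V \<Longrightarrow> f v \<noteq> 0 \<Longrightarrow> \<phi> (pt v) = \<psi> (pt v)" and P: "P \<in> V"
  shows "\<phi> P = \<psi> P"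
proof (rule morphism_eqI[OF V \<phi> \<psi> _ _ _ P])
  let ?A = "V - {P \<in> V. \<exists>v\<in>P. f v = 0}"
  show "infinite ?A"
    using Diff_infinite_finite[OF irr_curve_finite_zeros[OF V f]] V unfolding irr_curve_def by blast
  show "?A \<subseteq> V" by blast
  fix Q assume Q: "Q \<in> ?A"
  then have "Q \<in> V" by blast
  then obtain v where v: "Q = pt v" using proj_setE[OF irr_curve_proj[OF V]] by metis
  then have "f v \<noteq> 0" using Q self_in_pt by blast
  then show "\<phi> Q = \<psi> Q" using eq v Q by blast
qed

lemma flip_morphism:
  fixes Z :: "('a::field, 'n::finite) ppoint set"
  assumes "Z \<subseteq> proj_space" "\<And>v. pt v \<in> Z \<Longrightarrow> pt (flip S v) \<in> Z"
  shows "morphism UNIV Z Z (proj_map (flip S))"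
proof (rule proj_map_morphism[OF flip_form assms(1)])
  fix v :: "'a ^ 'n" assume "pt v \<in> Z"
  then show "flip S v \<noteq> 0 \<and> pt (flip S v) \<in> Z" using assms pt_in_proj_space by blast
qed

text \<open>Lagrange interpolation: a function on \<open>Z\<close> is recovered from the traces of its products
  with functions that come from \<open>W\<close>, because \<open>\<Phi>\<close> separates the points of a generic fibre
  of \<open>N\<close>.  The numerators suffice, as only the ratios of the coordinates matter.\<close>

lemma galois_descent:
  fixes Z :: "('a::field, 'n::finite) ppoint set" and W :: "('a, 'm::finite) ppoint set"
    and Gs :: "'n set set" and N :: "'a ^ 'n \<Rightarrow> 'a ^ 'l::finite"
  assumes Z: "irr_curve Z" and W: "W \<subseteq> proj_space" and Gs: "{} \<in> Gs"
    and flip: "\<And>S v. S \<in> Gs \<Longrightarrow> pt v \<in> Z \<Longrightarrow> pt (flip S v) \<in> Z"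
    and trace: "\<And>d f. form UNIV (c * d) f \<Longrightarrow> \<exists>g. form UNIV d g \<and> (\<forall>v. pt v \<in> Z \<longrightarrow> (\<Sum>S\<in>Gs. f (flip S v)) = g (N v))"
    and c: "c > 0"
    and \<Phi>: "morphism UNIV Z W \<Phi>" and \<kappa>: "morphism UNIV W U \<kappa>"
    and N: "\<And>v. pt v \<in> Z \<Longrightarrow> \<kappa> (\<Phi> (pt v)) = pt (N v)"
    and sep: "\<And>S. S \<in> Gs \<Longrightarrow> S \<noteq> {} \<Longrightarrow> \<exists>v. pt v \<in> Z \<and> \<Phi> (pt (flip S v)) \<noteq> \<Phi> (pt v)"
  shows "\<exists>e (H :: 'a ^ 'm \<Rightarrow> 'a ^ 'n). form_tuple UNIV e H \<and>
     (\<forall>v w i j. pt v \<in> Z \<and> \<Phi> (pt v) = pt w \<longrightarrow> H w $ i * v $ j = H w $ j * v $ i) \<and>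
     (\<exists>v w. pt v \<in> Z \<and> \<Phi> (pt v) = pt w \<and> H w \<noteq> 0)"
proof -
  have Zp: "Z \<subseteq> proj_space" by (rule irr_curve_proj[OF Z])
  have fin: "finite Gs" by (rule finite_subset[of _ UNIV]) auto
  have "Z \<noteq> {}" using Z unfolding irr_curve_def by auto
  then obtain v0 where v0: "pt v0 \<in> Z" "v0 \<noteq> 0" using proj_setE[OF Zp] by (metis ex_in_conv)
  obtain d h where h: "form_tuple UNIV d h" "d > 0" "h v0 \<noteq> 0"
    "\<And>w. pt w \<in> Z \<Longrightarrow> h w \<noteq> 0 \<Longrightarrow> \<Phi> (pt w) = pt (h w)"
    using morphism_local[OF \<Phi> Zp v0(1)] by metis
  have "pt (h v0) \<in> W" using h(4)[OF v0(1) h(3)] morphism_in[OF \<Phi> v0(1)] by simp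
  then obtain ek k where k: "form_tuple UNIV ek k" "ek > 0" "k (h v0) \<noteq> 0"
    "\<And>w. pt w \<in> W \<Longrightarrow> k w \<noteq> 0 \<Longrightarrow> \<kappa> (pt w) = pt (k w)"
    using morphism_local[OF \<kappa> W] by metis
  have k0: "k 0 = 0" using k(1,2) form_at_0 by (auto simp: form_tuple_def vec_eq_iff)
  obtain t where t: "k (h v0) $ t \<noteq> 0" using k(3) by (auto simp: vec_eq_iff)
  obtain l where l: "v0 $ l \<noteq> 0" using v0(2) by (auto simp: vec_eq_iff)
  obtain m where m: "h v0 $ m \<noteq> 0" using h(3) by (auto simp: vec_eq_iff)
  define I where "I = Gs - {{}}"
  have hf: "form_tuple UNIV d (\<lambda>x. h (flip S x))" for S by (rule form_tuple_comp[OF h(1) flip_form]) simp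
  have minor: "form UNIV (d + d) (\<lambda>x. h x $ i * h (flip S x) $ j - h x $ j * h (flip S x) $ i)" for S i j
    by (intro form_diff form_mult[OF form_tuple_nth form_tuple_nth refl] h hf)
  \<comment> \<open>If all these minors vanished for some \<open>S\<close>, then \<Phi> and its
    composite with the sign change would agree wherever both representatives are non-zero, hence
    everywhere, against \<open>sep\<close>.\<close>
  have ex: "\<exists>i j x. pt x \<in> Z \<and> h x $ i * h (flip S x) $ j - h x $ j * h (flip S x) $ i \<noteq> 0" if S: "S \<in> I" for S
  proof (rule ccontr)
    assume "\<not> ?thesis"
    then have 0: "h x $ i * h (flip S x) $ j = h x $ j * h (flip S x) $ i" if "pt x \<in> Z" for x i j
      using that by (metis right_minus_eq)
    have SG: "S \<in> Gs" "S \<noteq> {}" using S unfolding I_def by auto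
    have fZ: "\<And>v. pt v \<in> Z \<Longrightarrow> pt (flip S v) \<in> Z" using flip SG by blast
    have mor: "morphism UNIV Z W (\<lambda>P. \<Phi> (proj_map (flip S) P))"
      by (rule morphism_comp[OF flip_morphism[OF Zp fZ] \<Phi> Zp Zp])
    have 1: "form UNIV d (\<lambda>x. h x $ m)" "form UNIV d (\<lambda>x. h (flip S x) $ m)" using form_tuple_nth h hf by blast+
    obtain z where z: "pt z \<in> Z" "h z $ m \<noteq> 0" "h (flip S z) $ m \<noteq> 0"
      using irr_curve_nonzero_mult[OF Z 1 v0(1) m fZ[OF v0(1)]] m flip_flip by metis
    have eq: "\<Phi> (proj_map (flip S) P) = \<Phi> P" if "P \<in> Z" for P
    proof (rule morphism_eqI_form[OF Z mor \<Phi> form_mult[OF 1 refl] z(1) _ _ that])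
      show "h z $ m * h (flip S z) $ m \<noteq> 0" using z by simp
      fix v assume v: "pt v \<in> Z" "h v $ m * h (flip S v) $ m \<noteq> 0"
      then have nz: "h v \<noteq> 0" "h (flip S v) \<noteq> 0" by auto
      have "pt (h v) = pt (h (flip S v))" using pt_eq_minors[OF nz] 0[OF v(1)] by blast
      then show "\<Phi> (proj_map (flip S) (pt v)) = \<Phi> (pt v)"
        using h(4) v(1) fZ nz by (simp add: proj_map_pt[OF flip_form])
    qed
    obtain v where "pt v \<in> Z" "\<Phi> (pt (flip S v)) \<noteq> \<Phi> (pt v)" using sep[OF SG] by blast
    then show False using eq[of "pt v"] by (simp add: proj_map_pt[OF flip_form])
  qed
  then obtain \<alpha> \<beta> where ab: "\<And>S. S \<in> I \<Longrightarrow> \<exists>x. pt x \<in> Z \<and> h x $ \<alpha> S * h (flip S x) $ \<beta> S - h x $ \<beta> S * h (flip S x) $ \<alpha> S \<noteq> 0"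
    by metis
  \<comment> \<open>The interpolation kernel. For \<open>w = h x\<close> it vanishes at every
    conjugate \<open>flip S x\<close> with \<open>S \<in> I\<close>, because the factor with index
    \<open>S\<close> becomes a trivial minor; at \<open>x\<close> itself it is generically non-zero.
    So only the term of \<open>S = {}\<close> survives in a trace.\<close>
  define K where "K w x = (\<Prod>S\<in>I. w $ \<alpha> S * h (flip S x) $ \<beta> S - w $ \<beta> S * h (flip S x) $ \<alpha> S)" for w x
  have finI: "finite I" unfolding I_def using fin by blast
  obtain ts where ts: "\<And>t. t \<in> set ts \<Longrightarrow> form UNIV (card I) (fst t) \<and> form UNIV (card I * d) (snd t)"
    "\<And>w x. K w x = (\<Sum>t\<leftarrow>ts. fst t w * snd t x)"
    using biform_prod[OF finI, of d "\<lambda>S x. h (flip S x) $ \<beta> S" "\<lambda>S x. h (flip S x) $ \<alpha> S" \<alpha> \<beta>]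
      form_tuple_nth[OF hf] unfolding K_def by blast
  define D where "D = 1 + card I * d"
  \<comment> \<open>The power \<open>x $ l ^ e\<close> pads the degree to \<open>c * D\<close>, as
    \<open>trace\<close> applies to degrees divisible by \<open>c\<close>.\<close>
  define e where "e = (c - 1) * D"
  have deg: "1 + (e + card I * d) = c * D"
  proof -
    have "1 + (e + card I * d) = (c - 1) * D + D" unfolding e_def D_def by simp
    also have "\<dots> = c * D" using c by (cases c) simp_all
    finally show ?thesis .
  qed
  have "form UNIV (c * D) (\<lambda>x. x $ i * (x $ l ^ e * q x))" if "form UNIV (card I * d) q" for i q
    unfolding deg[symmetric] by (intro form_mult[OF form_coord form_mult[OF form_power[OF form_coord] that refl] refl]) simp
  then have tr: "\<exists>g. form UNIV D g \<and>
      (\<forall>v. pt v \<in> Z \<longrightarrow> (\<Sum>S\<in>Gs. flip S v $ i * (flip S v $ l ^ e * q (flip S v))) = g (N v))"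
    if "form UNIV (card I * d) q" for i q
    using trace that by blast
  define g where "g i q = (SOME g. form UNIV D g \<and>
      (\<forall>v. pt v \<in> Z \<longrightarrow> (\<Sum>S\<in>Gs. flip S v $ i * (flip S v $ l ^ e * q (flip S v))) = g (N v)))" for i q
  have g: "form UNIV D (g i q)"
    "pt v \<in> Z \<Longrightarrow> (\<Sum>S\<in>Gs. flip S v $ i * (flip S v $ l ^ e * q (flip S v))) = g i q (N v)"
    if "form UNIV (card I * d) q" for i q v
    using someI_ex[OF tr[OF that, of i]] unfolding g_def[symmetric] by blast+
  \<comment> \<open>The traces are forms in \<open>N x\<close>. Evaluating them at the multiple
    \<open>k w\<close> of \<open>N x\<close> instead turns the interpolation formula into a tuple of
    forms in \<open>w\<close> alone.\<close>
  define H where "H w = (\<chi> i. \<Sum>t\<leftarrow>ts. fst t w * g i (snd t) (k w))" for w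
  have H: "form_tuple UNIV (card I + D * ek) H"
    unfolding form_tuple_def H_def vec_lambda_beta
    by (intro allI form_sum_list form_mult[OF _ form_comp[OF g(1) k(1) refl] refl]) (use ts in auto)
  have key: "\<exists>mu. k (h x) = mu *s N x \<and> H (h x) = (mu ^ D * (x $ l ^ e * K (h x) x)) *s x" if x: "pt x \<in> Z" for x
  proof -
    obtain mu where lam: "k (h x) = mu *s N x"
    proof (cases "k (h x) = 0")
      case True
      then show thesis using that[of 0] by simp
    next
      case False
      then have "h x \<noteq> 0" using k0 by auto
      then have 1: "\<Phi> (pt x) = pt (h x)" using h(4) x by blast
      then have "pt (h x) \<in> W" using morphism_in[OF \<Phi> x] by simp
      then have "pt (k (h x)) = pt (N x)" using k(4)[OF _ False] N[OF x] 1 by simp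
      then show thesis using that unfolding pt_eq_iff by blast
    qed
    have Kz: "K (h x) (flip S x) = 0" if "S \<in> I" for S
      unfolding K_def by (rule prod_zero[OF finI]) (use that in \<open>auto simp: flip_flip mult.commute intro!: bexI[of _ S]\<close>)
    have swap: "(\<Sum>t\<leftarrow>us. fst t (h x) * (\<Sum>S\<in>Gs. A S * (B S * snd t (flip S x)))) = (\<Sum>S\<in>Gs. A S * (B S * (\<Sum>t\<leftarrow>us. fst t (h x) * snd t (flip S x))))"
      for us :: "(('a ^ 'm \<Rightarrow> 'a) \<times> ('a ^ 'n \<Rightarrow> 'a)) list" and A B :: "'n set \<Rightarrow> 'a"
      by (induction us) (simp_all add: sum.distrib[symmetric] sum_distrib_left algebra_simps)
    have gk: "g i (snd t) (mu *s N x) = mu ^ D * (\<Sum>S\<in>Gs. flip S x $ i * (flip S x $ l ^ e * snd t (flip S x)))"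
      if "t \<in> set ts" for i t
    proof -
      have q: "form UNIV (card I * d) (snd t)" using ts(1) that by blast
      show ?thesis unfolding form_homog[OF g(1)[OF q]] g(2)[OF q x] ..
    qed
    have "H (h x) $ i = mu ^ D * (x $ l ^ e * K (h x) x) * x $ i" for i
    proof -
      have "H (h x) $ i = (\<Sum>t\<leftarrow>ts. fst t (h x) * (mu ^ D * (\<Sum>S\<in>Gs. flip S x $ i * (flip S x $ l ^ e * snd t (flip S x)))))"
        unfolding H_def vec_lambda_beta lam
        by (intro arg_cong[of _ _ sum_list] map_cong refl arg_cong2[of _ _ _ _ times])
          (rule gk)
      also have "\<dots> = mu ^ D * (\<Sum>t\<leftarrow>ts. fst t (h x) * (\<Sum>S\<in>Gs. flip S x $ i * (flip S x $ l ^ e * snd t (flip S x))))"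
        by (simp add: sum_list_const_mult[symmetric] mult.left_commute)
      also have "\<dots> = mu ^ D * (\<Sum>S\<in>Gs. flip S x $ i * (flip S x $ l ^ e * K (h x) (flip S x)))"
        unfolding swap ts(2) by simp
      also have "(\<Sum>S\<in>Gs. flip S x $ i * (flip S x $ l ^ e * K (h x) (flip S x))) = (\<Sum>S\<in>{{}}. flip S x $ i * (flip S x $ l ^ e * K (h x) (flip S x)))"
        by (rule sum.mono_neutral_right[OF fin]) (use Gs Kz in \<open>auto simp: I_def\<close>)
      finally show ?thesis by (simp add: mult_ac)
    qed
    then show ?thesis using lam by (intro exI[of _ mu]) (simp add: vec_eq_iff)
  qed
  show ?thesis
  proof (rule exI[of _ "card I + D * ek"], rule exI[of _ H], intro conjI)
    show "form_tuple UNIV (card I + D * ek) H" by fact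
    show "\<forall>v w i j. pt v \<in> Z \<and> \<Phi> (pt v) = pt w \<longrightarrow> H w $ i * v $ j = H w $ j * v $ i"
    proof (intro allI impI, elim conjE)
      fix v w i j assume v: "pt v \<in> Z" "\<Phi> (pt v) = pt w"
      show "H w $ i * v $ j = H w $ j * v $ i"
      proof (rule irr_curve_relation[OF Z \<Phi> H form_tuple_nth[OF h(1)] v0(1) m _ v])
        fix v w i j assume v: "pt v \<in> Z" "h v $ m \<noteq> 0" "\<Phi> (pt v) = pt w"
        then have "h v \<noteq> 0" by auto
        then have "pt w = pt (h v)" using h(4) v by simp
        then obtain c where "w = c *s h v" unfolding pt_eq_iff by blast
        then have "H w = c ^ (card I + D * ek) *s H (h v)" using form_tuple_homog[OF H] by simp
        moreover obtain mu where "H (h v) = mu *s v" using key[OF v(1)] by blast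
        ultimately show "H w $ i * v $ j = H w $ j * v $ i" by simp
      qed
    qed
    let ?f0 = "\<lambda>x. x $ l * k (h x) $ t"
    have kh: "form_tuple UNIV (ek * d) (\<lambda>x. k (h x))" by (rule form_tuple_comp[OF k(1) h(1) refl])
    obtain z where z: "pt z \<in> Z" "?f0 z \<noteq> 0"
      "\<And>S. S \<in> I \<Longrightarrow> h z $ \<alpha> S * h (flip S z) $ \<beta> S - h z $ \<beta> S * h (flip S z) $ \<alpha> S \<noteq> 0"
      using irr_curve_nonzero_prod[OF Z finI form_mult[OF form_coord form_tuple_nth[OF kh] refl] v0(1), of l t,
          where F = "\<lambda>S x. h x $ \<alpha> S * h (flip S x) $ \<beta> S - h x $ \<beta> S * h (flip S x) $ \<alpha> S", OF _ minor ab] l t by auto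
    obtain mu where lam: "k (h z) = mu *s N z" "H (h z) = (mu ^ D * (z $ l ^ e * K (h z) z)) *s z" using key[OF z(1)] by blast
    have "K (h z) z \<noteq> 0" unfolding K_def using z(3) finI by simp
    moreover have "mu \<noteq> 0" "z $ l \<noteq> 0" using z(2) lam(1) by auto
    ultimately have "H (h z) \<noteq> 0" unfolding lam(2) by (auto simp: vec_eq_iff)
    moreover have "h z \<noteq> 0" using z(2) k0 by auto
    ultimately show "\<exists>v w. pt v \<in> Z \<and> \<Phi> (pt v) = pt w \<and> H w \<noteq> 0" using z(1) h(4) by blast
  qed
qed

text \<open>\<open>H\<close> recovers a point of \<open>Z\<close> from its image but may vanish at
  \<open>q\<close>. A proportional tuple that is non-zero at \<open>q\<close> satisfies the same
  relations where \<open>H\<close> is non-zero, and by density everywhere.\<close>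

lemma extended_inverse:
  fixes Z :: "('a::field, 'n::finite) ppoint set" and W :: "('a, 'm::finite) ppoint set"
  assumes Z: "irr_curve Z" and W: "extends_maps W TYPE('n)" and \<Phi>: "morphism UNIV Z W \<Phi>"
    and H: "form_tuple UNIV e H"
      "\<And>v w i j. pt v \<in> Z \<Longrightarrow> \<Phi> (pt v) = pt w \<Longrightarrow> H w $ i * v $ j = H w $ j * v $ i"
      "pt v0 \<in> Z" "\<Phi> (pt v0) = pt w0" "H w0 \<noteq> 0"
    and q: "pt q \<in> W"
  shows "\<exists>e' h. form_tuple UNIV e' h \<and> h q \<noteq> 0 \<and>
     (\<forall>v w i j. pt v \<in> Z \<longrightarrow> \<Phi> (pt v) = pt w \<longrightarrow> h w $ i * v $ j = h w $ j * v $ i)"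
proof -
  have w0: "pt w0 \<in> W" using H(3,4) morphism_in[OF \<Phi>] by metis
  then obtain e' and h :: "'a ^ 'm \<Rightarrow> 'a ^ 'n" where h: "form_tuple UNIV e' h" "h q \<noteq> 0"
    "\<And>w i j. pt w \<in> W \<Longrightarrow> h w $ i * H w $ j = h w $ j * H w $ i"
    using W H(1,5) q unfolding extends_maps_def by blast
  obtain d k where k: "form_tuple UNIV d k" "k v0 \<noteq> 0" "\<And>u. pt u \<in> Z \<Longrightarrow> k u \<noteq> 0 \<Longrightarrow> \<Phi> (pt u) = pt (k u)"
    using morphism_local[OF \<Phi> irr_curve_proj[OF Z] H(3)] by metis
  obtain m where m: "k v0 $ m \<noteq> 0" using k(2) by (auto simp: vec_eq_iff)
  have "pt (k v0) = pt w0" using k(3)[OF H(3) k(2)] H(4) by simp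
  then obtain c where c: "c \<noteq> 0" "k v0 = c *s w0" unfolding pt_eq_iff by blast
  then have "H (k v0) \<noteq> 0" using form_tuple_eq_0_iff_smult[OF H(1) c(1)] H(5) by simp
  then obtain l where l: "H (k v0) $ l \<noteq> 0" by (auto simp: vec_eq_iff)
  have Hk: "form_tuple UNIV (e * d) (\<lambda>u. H (k u))" by (rule form_tuple_comp[OF H(1) k(1) refl])
  have f: "form UNIV (d + e * d) (\<lambda>u. k u $ m * H (k u) $ l)"
    by (rule form_mult[OF form_tuple_nth[OF k(1)] form_tuple_nth[OF Hk] refl])
  have nz: "k v0 $ m * H (k v0) $ l \<noteq> 0" using m l by simp
  have "h w $ i * v $ j = h w $ j * v $ i" if v: "pt v \<in> Z" "\<Phi> (pt v) = pt w" for v w i j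
  proof (rule irr_curve_relation[OF Z \<Phi> h(1) f H(3) nz _ v])
    fix v w i j assume v: "pt v \<in> Z" "k v $ m * H (k v) $ l \<noteq> 0" "\<Phi> (pt v) = pt w"
    then have "k v \<noteq> 0" by auto
    then have "pt (k v) = pt w" using k(3) v by simp
    then obtain c where c: "c \<noteq> 0" "k v = c *s w" unfolding pt_eq_iff by blast
    have "H (k v) \<noteq> 0" using v by auto
    then have Hw: "H w \<noteq> 0" using form_tuple_eq_0_iff_smult[OF H(1) c(1)] c(2) by simp
    then obtain n where n: "H w $ n \<noteq> 0" by (auto simp: vec_eq_iff)
    have "pt w \<in> W" using v morphism_in[OF \<Phi>] by metis
    then have 1: "h w $ i * H w $ n = h w $ n * H w $ i" for i using h(3) by blast
    have 2: "H w $ n * v $ j = H w $ j * v $ n" for j using H(2) v by blast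
    have hi: "h w $ i = h w $ n / H w $ n * H w $ i" for i using 1[of i] n by (simp add: field_simps)
    have "H w $ i * v $ j = H w $ j * v $ i" using H(2) v by blast
    then show "h w $ i * v $ j = h w $ j * v $ i" unfolding hi[of i] hi[of j] by (simp add: mult.assoc)
  qed
  then show ?thesis using h by blast
qed

section \<open>The standard model of the covering\<close>

lemma vector_4 [simp]:
  "(vector [x, y, z, w] :: 'a::zero ^ 4) $ 1 = x" "(vector [x, y, z, w] :: 'a ^ 4) $ 2 = y"
  "(vector [x, y, z, w] :: 'a ^ 4) $ 3 = z" "(vector [x, y, z, w] :: 'a ^ 4) $ 4 = w"
  unfolding vector_def by simp_all

text \<open>The curve \<open>Cs\<close> carries the Jacobi functions \<open>(sn : dn : cn : 1)\<close> of modulus \<open>k\<close>.  On it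
  \<open>po \<circ> ps\<close> is multiplication by 2 with origin \<open>sn = 0\<close>; the formulas for \<open>ps\<close> come from the
  factorisations of \<open>1 \<plusminus> cn 2u\<close> and \<open>k cn 2u \<plusminus> i k'\<close> into squares.\<close>

locale standard_curves =
  fixes a a' k :: "'a::{alg_closed_field, field_char_0}"
  assumes aa': "a * a' = 1" and k: "2 * k = a + a'" and a4: "a ^ 4 \<noteq> 1"
begin

definition Cs :: "('a, 4) ppoint set" where
  "Cs = zero_locus {\<lambda>v. (v $ 1)^2 + (v $ 3)^2 - (v $ 4)^2, \<lambda>v. (v $ 2)^2 + k^2 * (v $ 1)^2 - (v $ 4)^2}"

text \<open>On \<open>Cs\<close> the form \<open>(x3 x4)^2 - b^2 (x1 x2)^2\<close> is the square of
  \<open>b k x1^2 - x4^2\<close> if \<open>b^2 - 2 k b + 1 = 0\<close>. The two roots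
  \<open>a\<close> and \<open>a'\<close> give the two equations, and the four forms involved are the
  coordinates of \<open>ps\<close>.\<close>

definition Ds :: "('a, 4) ppoint set" where
  "Ds = zero_locus {\<lambda>w. (w $ 1)^2 - (w $ 3)^2 + a^2 * (w $ 4)^2, \<lambda>w. (w $ 2)^2 - (w $ 3)^2 + a'^2 * (w $ 4)^2}"

definition ps :: "'a ^ 4 \<Rightarrow> 'a ^ 4" where
  "ps v = vector [a * k * (v $ 1)^2 - (v $ 4)^2, a' * k * (v $ 1)^2 - (v $ 4)^2, v $ 3 * v $ 4, v $ 1 * v $ 2]"

definition po :: "'a ^ 4 \<Rightarrow> 'a ^ 4" where
  "po w = vector [2 * w $ 3 * w $ 4, w $ 1 * w $ 2, (w $ 3)^2 - (w $ 4)^2, (w $ 3)^2 + (w $ 4)^2]"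

lemma Cs_proj: "Cs \<subseteq> proj_space" and Ds_proj: "Ds \<subseteq> proj_space"
  unfolding Cs_def Ds_def by (rule zero_locus_subset)+

lemma in_Cs: "pt v \<in> Cs \<longleftrightarrow> v \<noteq> 0 \<and> (v $ 3)^2 = (v $ 4)^2 - (v $ 1)^2 \<and> (v $ 2)^2 = (v $ 4)^2 - k^2 * (v $ 1)^2"
  unfolding Cs_def by (subst in_zero_locus) (auto intro!: exI[of _ 2] simp: algebra_simps power2_eq_square)

lemma in_Ds: "pt w \<in> Ds \<longleftrightarrow> w \<noteq> 0 \<and> (w $ 1)^2 = (w $ 3)^2 - a^2 * (w $ 4)^2 \<and> (w $ 2)^2 = (w $ 3)^2 - a'^2 * (w $ 4)^2"
  unfolding Ds_def by (subst in_zero_locus) (auto intro!: exI[of _ 2] simp: algebra_simps power2_eq_square)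

text \<open>The excluded values are the degenerate moduli: \<open>a^2 = 1\<close> means
  \<open>k^2 = 1\<close>, and \<open>a^2 = -1\<close> means \<open>k = 0\<close>.\<close>

lemma a2: "a^2 \<noteq> 1" "a^2 \<noteq> -1" using a4 by (auto simp: power4_eq_xxxx power2_eq_square mult.assoc)

lemma aa_ne: "a - a' \<noteq> 0"
proof
  assume "a - a' = 0"
  then have "a^2 = 1" using aa' by (simp add: power2_eq_square)
  then show False using a2 by blast
qed

lemma k_nz: "k \<noteq> 0"
proof
  assume "k = 0"
  then have "a' = - a" using k by (simp add: eq_neg_iff_add_eq_0 add.commute)
  then have "a^2 = -1" using aa' by (simp add: power2_eq_square minus_equation_iff)
  then show False using a2 by blast
qed

lemma ak: "2 * a * k = a^2 + 1" "2 * a' * k = a'^2 + 1" "4 * k^2 = a^2 + 2 + a'^2"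
proof -
  have "2 * a * k = a * (2 * k)" by simp
  also have "\<dots> = a^2 + 1" unfolding k using aa' by (simp add: algebra_simps power2_eq_square)
  finally show "2 * a * k = a^2 + 1" .
  have "2 * a' * k = a' * (2 * k)" by simp
  also have "\<dots> = a'^2 + 1" unfolding k using aa' by (simp add: algebra_simps power2_eq_square)
  finally show "2 * a' * k = a'^2 + 1" .
  have "4 * k^2 = (2 * k)^2" by (simp add: power2_eq_square)
  also have "\<dots> = a^2 + 2 + a'^2" unfolding k using aa' by (simp add: algebra_simps power2_eq_square)
  finally show "4 * k^2 = a^2 + 2 + a'^2" .
qed

lemma k2: "k^2 \<noteq> 1"
proof
  assume "k^2 = 1"
  then have "(a - a')^2 = 0" using ak(3) aa' by (simp add: algebra_simps power2_eq_square)
  then show False using aa_ne by simp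
qed

lemma ps_form: "form_tuple UNIV 2 ps"
proof -
  have sq: "form UNIV 2 (\<lambda>v::'a^4. v $ i * v $ j)" for i j by (rule form_mult[OF form_coord form_coord]) simp
  have "form UNIV 2 (\<lambda>v::'a^4. c * (v $ 1 * v $ 1) - v $ 4 * v $ 4)" for c
    by (intro form_diff form_cmult sq)
  then show ?thesis unfolding form_tuple_def forall_4 ps_def vector_4 power2_eq_square using sq by simp
qed

lemma po_form: "form_tuple UNIV 2 po"
proof -
  have sq: "form UNIV 2 (\<lambda>v::'a^4. v $ i * v $ j)" for i j by (rule form_mult[OF form_coord form_coord]) simp
  have "form UNIV 2 (\<lambda>v::'a^4. 2 * (v $ 3 * v $ 4))" by (intro form_cmult sq)
  then show ?thesis unfolding form_tuple_def forall_4 po_def vector_4 power2_eq_square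
    using sq by (auto intro: form.add form_diff simp: mult.assoc)
qed

lemma ps_in:
  assumes "pt v \<in> Cs"
  shows "ps v \<noteq> 0" "pt (ps v) \<in> Ds"
proof -
  have v: "v \<noteq> 0" "(v $ 3)^2 = (v $ 4)^2 - (v $ 1)^2" "(v $ 2)^2 = (v $ 4)^2 - k^2 * (v $ 1)^2"
    using assms in_Cs by auto
  show nz: "ps v \<noteq> 0"
  proof
    assume "ps v = 0"
    then have 0: "a * k * (v $ 1)^2 = (v $ 4)^2" "a' * k * (v $ 1)^2 = (v $ 4)^2"
      by (simp_all add: ps_def vec_eq_iff forall_4)
    then have "(a - a') * k * (v $ 1)^2 = 0" by (simp add: algebra_simps)
    then have "v $ 1 = 0" using aa_ne k_nz by simp
    then have "v $ 4 = 0" "v $ 1 = 0" using 0 by auto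
    then have "v $ 3 = 0" "v $ 2 = 0" using v by auto
    then show False using v(1) \<open>v $ 1 = 0\<close> \<open>v $ 4 = 0\<close> by (simp add: vec_eq_iff forall_4)
  qed
  have *: "(b * k * (v $ 1)^2 - (v $ 4)^2)^2 = (v $ 3 * v $ 4)^2 - b^2 * (v $ 1 * v $ 2)^2" if "2 * b * k = b^2 + 1" for b
  proof -
    have "(v $ 3 * v $ 4)^2 - b^2 * (v $ 1 * v $ 2)^2
      = ((v $ 4)^2 - (v $ 1)^2) * (v $ 4)^2 - b^2 * ((v $ 1)^2 * ((v $ 4)^2 - k^2 * (v $ 1)^2))"
      unfolding power_mult_distrib v(2,3) by simp
    also have "\<dots> = (b * k * (v $ 1)^2)^2 - (b^2 + 1) * ((v $ 1)^2 * (v $ 4)^2) + ((v $ 4)^2)^2"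
      by (simp add: algebra_simps power2_eq_square)
    also have "\<dots> = (b * k * (v $ 1)^2 - (v $ 4)^2)^2"
      unfolding that[symmetric] by (simp add: algebra_simps power2_eq_square)
    finally show ?thesis by simp
  qed
  show "pt (ps v) \<in> Ds" unfolding in_Ds using nz *[OF ak(1)] *[OF ak(2)] by (simp add: ps_def)
qed

lemma po_in:
  assumes "pt w \<in> Ds"
  shows "po w \<noteq> 0" "pt (po w) \<in> Cs"
proof -
  have w: "w \<noteq> 0" "(w $ 1)^2 = (w $ 3)^2 - a^2 * (w $ 4)^2" "(w $ 2)^2 = (w $ 3)^2 - a'^2 * (w $ 4)^2"
    using assms in_Ds by auto
  show nz: "po w \<noteq> 0"
  proof
    assume "po w = 0"
    then have "po w $ 3 = 0" "po w $ 4 = 0" by simp_all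
    then have 0: "(w $ 3)^2 - (w $ 4)^2 = 0" "(w $ 3)^2 + (w $ 4)^2 = 0"
      unfolding po_def vector_4 .
    have "2 * (w $ 3)^2 = ((w $ 3)^2 - (w $ 4)^2) + ((w $ 3)^2 + (w $ 4)^2)" by simp
    then have "2 * (w $ 3)^2 = 0" unfolding 0 by simp
    then have w3: "w $ 3 = 0" by simp
    then have "w $ 4 = 0" using 0(2) by simp
    note w3 this
    then show False using w by (auto simp add: vec_eq_iff forall_4)
  qed
  have "(w $ 1 * w $ 2)^2 = ((w $ 3)^2 - a^2 * (w $ 4)^2) * ((w $ 3)^2 - a'^2 * (w $ 4)^2)"
    unfolding power_mult_distrib w(2,3) by simp
  also have "\<dots> = ((w $ 3)^2)^2 - (a^2 + a'^2) * ((w $ 3)^2 * (w $ 4)^2) + (a * a')^2 * ((w $ 4)^2)^2"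
    by (simp add: algebra_simps power2_eq_square)
  also have "\<dots> = ((w $ 3)^2)^2 - (4 * k^2 - 2) * ((w $ 3)^2 * (w $ 4)^2) + ((w $ 4)^2)^2"
    unfolding aa' ak(3) by simp
  also have "\<dots> = ((w $ 3)^2 + (w $ 4)^2)^2 - k^2 * (2 * w $ 3 * w $ 4)^2"
    by (simp add: algebra_simps power2_eq_square)
  finally show "pt (po w) \<in> Cs" unfolding in_Cs using nz
    by (simp add: po_def) (simp add: algebra_simps power2_eq_square)
qed

lemma flip_Cs: "pt v \<in> Cs \<Longrightarrow> pt (flip S v) \<in> Cs"
  unfolding in_Cs by (simp add: flip_nth)

lemma flip_Ds: "pt v \<in> Ds \<Longrightarrow> pt (flip S v) \<in> Ds"
  unfolding in_Ds by (simp add: flip_nth)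

text \<open>The sign changes of two coordinates are the translations of \<open>Cs\<close> by points
  of order 2. The one of \<open>{1, 2}\<close> belongs to \<open>ps\<close>; the other two induce on
  \<open>Ds\<close> the same involution, which belongs to \<open>po\<close>.\<close>

lemma ps_sigma: "ps (flip {1, 3} v) = flip {3, 4} (ps v)"
  and ps_sigma': "ps (flip {2, 3} v) = flip {3, 4} (ps v)"
  and po_iota: "po (flip {3, 4} w) = po w"
  by (simp_all add: vec_eq_iff forall_4 ps_def po_def flip_nth)

lemma equal_up_to_sign:
  fixes p q p' q' :: 'a
  assumes "p'^2 = p^2" "q'^2 = q^2" "p' * q' = p * q"
  shows "\<exists>\<epsilon>. (\<epsilon> = 1 \<or> \<epsilon> = -1) \<and> p' = \<epsilon> * p \<and> q' = \<epsilon> * q"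
proof (cases "p = 0")
  case True
  then have "p' = 0" using assms(1) by simp
  moreover have "q' = q \<or> q' = - q" using assms(2) power2_eq_iff by blast
  ultimately show ?thesis using True by (metis mult_1 mult_minus1 mult_zero_right)
next
  case False
  have "p' = p \<or> p' = - p" using assms(1) power2_eq_iff by blast
  then show ?thesis
  proof
    assume p: "p' = p"
    then have "q' = q" using assms(3) False by simp
    then show ?thesis using p by (intro exI[of _ 1]) simp
  next
    assume p: "p' = - p"
    then have "p * (- q') = p * q" using assms(3) by simp
    then have "q' = - q" using False by (metis minus_minus mult_left_cancel)
    then show ?thesis using p by (intro exI[of _ "-1"]) simp
  qed
qed

lemma squares_ps:
  "(a - a') * k * (v $ 1)^2 = ps v $ 1 - ps v $ 2" "(a - a') * (v $ 4)^2 = a' * ps v $ 1 - a * ps v $ 2"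
  by (simp_all add: ps_def algebra_simps)

text \<open>\<open>ps\<close> determines the squares of all coordinates and the products
  \<open>x3 x4\<close> and \<open>x1 x2\<close>. What remains free is one common sign of the first
  two coordinates relative to the last two. The scalar between the images is absorbed by its square
  root, as \<open>ps\<close> is quadratic.\<close>

lemma ps_fibre:
  assumes v: "pt v \<in> Cs" "pt v' \<in> Cs" "pt (ps v) = pt (ps v')"
  shows "pt v' = pt v \<or> pt v' = pt (flip {1, 2} v)"
proof -
  obtain c where c: "c \<noteq> 0" "ps v' = c *s ps v" using v(3) unfolding pt_eq_iff by (metis v(3) pt_eq_iff)
  obtain s where s: "s^2 = c" using nth_root_exists[of 2 c] by auto
  then have s0: "s \<noteq> 0" using c by auto
  define u where "u = s *s v"
  have u: "pt u = pt v" "ps v' = ps u" unfolding u_def using pt_smult[OF s0] c s form_tuple_homog[OF ps_form, of s v] by auto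
  have uC: "pt u \<in> Cs" using u(1) v(1) by simp
  have 1: "(v' $ 1)^2 = (u $ 1)^2" using squares_ps(1)[of u] squares_ps(1)[of v'] u(2) aa_ne k_nz
    by (metis mult_cancel_left mult_eq_0_iff)
  have 4: "(v' $ 4)^2 = (u $ 4)^2" using squares_ps(2)[of u] squares_ps(2)[of v'] u(2) aa_ne
    by (metis mult_cancel_left)
  have 23: "(v' $ 2)^2 = (u $ 2)^2" "(v' $ 3)^2 = (u $ 3)^2"
    using v(2) uC 1 4 unfolding in_Cs by simp_all
  have pr: "v' $ 3 * v' $ 4 = u $ 3 * u $ 4" "v' $ 1 * v' $ 2 = u $ 1 * u $ 2"
    using arg_cong[OF u(2), of "\<lambda>w. w $ 3"] arg_cong[OF u(2), of "\<lambda>w. w $ 4"] by (simp_all add: ps_def)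
  obtain e where e: "e = 1 \<or> e = -1" "v' $ 3 = e * u $ 3" "v' $ 4 = e * u $ 4"
    using equal_up_to_sign[OF 23(2) 4 pr(1)] by blast
  obtain e' where e': "e' = 1 \<or> e' = -1" "v' $ 1 = e' * u $ 1" "v' $ 2 = e' * u $ 2"
    using equal_up_to_sign[OF 1 23(1) pr(2)] by blast
  have "v' = e *s u \<or> v' = e *s flip {1, 2} u"
    using e e' by (auto simp: vec_eq_iff forall_4 flip_nth)
  moreover have "e \<noteq> 0" using e(1) by auto
  ultimately have "pt v' = pt u \<or> pt v' = pt (flip {1, 2} u)" using pt_smult by metis
  moreover have "pt (flip {1, 2} u) = pt (flip {1, 2} v)" unfolding u_def flip_smult by (rule pt_smult[OF s0])
  ultimately show ?thesis using u by simp
qed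

text \<open>The first two coordinates of \<open>w\<close> determine \<open>x1^2\<close> and
  \<open>x4^2\<close>, and the curve gives the other squares. Then the equations of
  \<open>Ds\<close> determine the last two coordinates of the image up to sign, and the signs of
  \<open>x2\<close> and \<open>x3\<close> are adjusted. Thus every vector, not only every point, is
  attained.\<close>

lemma ps_surj:
  assumes w: "pt w \<in> Ds"
  obtains v where "pt v \<in> Cs" "ps v = w"
proof -
  have w': "w \<noteq> 0" "(w $ 1)^2 = (w $ 3)^2 - a^2 * (w $ 4)^2" "(w $ 2)^2 = (w $ 3)^2 - a'^2 * (w $ 4)^2"
    using w in_Ds by auto
  have ex: "\<exists>y. y^2 = x" for x :: 'a using nth_root_exists[of 2 x] by auto
  obtain x1 where x1: "x1^2 = (w $ 1 - w $ 2) / ((a - a') * k)" using ex by blast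
  obtain x4 where x4: "x4^2 = (a' * w $ 1 - a * w $ 2) / (a - a')" using ex by blast
  obtain x2 where x2: "x2^2 = x4^2 - k^2 * x1^2" using ex by blast
  obtain x3 where x3: "x3^2 = x4^2 - x1^2" using ex by blast
  let ?u = "vector [x1, x2, x3, x4] :: 'a ^ 4"
  have s1: "(a - a') * k * x1^2 = w $ 1 - w $ 2" and s4: "(a - a') * x4^2 = a' * w $ 1 - a * w $ 2"
    using x1 x4 aa_ne k_nz by simp_all
  have "(a - a') * (b * k * x1^2 - x4^2) = b * ((a - a') * k * x1^2) - (a - a') * x4^2" for b
    by (simp add: algebra_simps)
  then have "(a - a') * (b * k * x1^2 - x4^2) = b * (w $ 1 - w $ 2) - (a' * w $ 1 - a * w $ 2)" for b
    unfolding s1 s4 .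
  from this[of a] this[of a'] have "(a - a') * (ps ?u $ 1) = (a - a') * w $ 1" "(a - a') * (ps ?u $ 2) = (a - a') * w $ 2"
    by (simp_all add: ps_def) (simp_all add: algebra_simps)
  then have p12: "ps ?u $ 1 = w $ 1" "ps ?u $ 2 = w $ 2" using aa_ne by simp_all
  have u0: "?u \<noteq> 0"
  proof
    assume "?u = 0"
    then have "ps ?u = 0" by (simp add: ps_def vec_eq_iff forall_4)
    then have "w $ 1 = 0" "w $ 2 = 0" "x1 = 0" "x4 = 0" using p12 \<open>?u = 0\<close> by (simp_all add: vec_eq_iff forall_4)
    then have 0: "(w $ 3)^2 = a^2 * (w $ 4)^2" "(w $ 3)^2 = a'^2 * (w $ 4)^2" using w' by simp_all
    then have "(a - a') * ((a + a') * (w $ 4)^2) = 0" by (simp add: algebra_simps power2_eq_square)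
    then have "w $ 4 = 0" using aa_ne k k_nz by (metis mult_eq_0_iff power_eq_0_iff zero_neq_numeral)
    then have "w $ 3 = 0" using 0 by simp
    then show False using w'(1) \<open>w $ 4 = 0\<close> \<open>w $ 1 = 0\<close> \<open>w $ 2 = 0\<close> by (simp add: vec_eq_iff forall_4)
  qed
  have uC: "pt ?u \<in> Cs" unfolding in_Cs using u0 x2 x3 by simp
  have D: "(ps ?u $ 1)^2 = (ps ?u $ 3)^2 - a^2 * (ps ?u $ 4)^2" "(ps ?u $ 2)^2 = (ps ?u $ 3)^2 - a'^2 * (ps ?u $ 4)^2"
    using ps_in(2)[OF uC] unfolding in_Ds by auto
  have e: "(ps ?u $ 3)^2 - a^2 * (ps ?u $ 4)^2 = (w $ 3)^2 - a^2 * (w $ 4)^2"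
    "(ps ?u $ 3)^2 - a'^2 * (ps ?u $ 4)^2 = (w $ 3)^2 - a'^2 * (w $ 4)^2"
    using D w'(2,3) p12 by simp_all
  have "(a^2 - a'^2) * ((ps ?u $ 4)^2 - (w $ 4)^2)
    = ((ps ?u $ 3)^2 - a'^2 * (ps ?u $ 4)^2 - ((w $ 3)^2 - a'^2 * (w $ 4)^2))
      - ((ps ?u $ 3)^2 - a^2 * (ps ?u $ 4)^2 - ((w $ 3)^2 - a^2 * (w $ 4)^2))"
    by (simp add: algebra_simps)
  then have "(a^2 - a'^2) * ((ps ?u $ 4)^2 - (w $ 4)^2) = 0" unfolding e by simp
  moreover have "a + a' \<noteq> 0" using k k_nz by (metis mult_eq_0_iff zero_neq_numeral)
  then have "a^2 - a'^2 \<noteq> 0" using aa_ne by (simp add: power2_eq_square square_diff_square_factored)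
  ultimately have 4: "(ps ?u $ 4)^2 = (w $ 4)^2" by simp
  then have 3: "(ps ?u $ 3)^2 = (w $ 3)^2" using e(1) by simp
  have sgn: "\<exists>e. (e = 1 \<or> e = -1) \<and> y = e * x" if "x^2 = y^2" for x y :: 'a
    using that unfolding power2_eq_iff by (auto intro: exI[of _ 1] exI[of _ "-1"])
  obtain e where e: "e = 1 \<or> e = -1" "w $ 3 = e * ps ?u $ 3" using sgn[OF 3] by blast
  obtain e' where e': "e' = 1 \<or> e' = -1" "w $ 4 = e' * ps ?u $ 4" using sgn[OF 4] by blast
  let ?v = "vector [x1, e' * x2, e * x3, x4] :: 'a ^ 4"
  have "ps ?v = w" using p12 e e' by (simp add: vec_eq_iff forall_4) (simp add: ps_def)
  moreover have "pt ?v \<in> Cs"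
  proof -
    have "?v \<noteq> 0" using \<open>ps ?v = w\<close> w'(1) by (auto simp: ps_def vec_eq_iff forall_4)
    moreover have "e^2 = 1" "e'^2 = 1" using e e' by auto
    ultimately show ?thesis unfolding in_Cs using x2 x3 by (simp add: power_mult_distrib)
  qed
  ultimately show ?thesis using that by blast
qed

lemma lin_form: "form UNIV 1 (\<lambda>v::'a^4. c1 * v $ 1 + c2 * v $ 2 + c3 * v $ 3 + c4 * v $ 4)"
  by (intro form.add form_cmult form_coord)

lemma trace_ps:
  assumes "form UNIV (2 * n) f"
  shows "\<exists>g. form UNIV n g \<and> (\<forall>v. pt v \<in> Cs \<longrightarrow> f v + f (flip {1, 2} v) = g (ps v))"
proof -
  define l where "l c1 c2 c3 c4 v = c1 * v $ 1 + c2 * v $ 2 + c3 * v $ 3 + c4 * v $ 4" for c1 c2 c3 c4 and v :: "'a ^ 4"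
  have lf: "form UNIV 1 (l c1 c2 c3 c4)" for c1 c2 c3 c4 unfolding l_def by (rule lin_form)
  define p where "p = 1 / ((a - a') * k)"
  define q where "q = 1 / (a - a')"
  have p: "p * ((a - a') * k) = 1" "q * (a - a') = 1" using aa_ne k_nz unfolding p_def q_def by simp_all
  have s1: "v $ 1 * v $ 1 = l p (- p) 0 0 (ps v)" for v
  proof -
    have "v $ 1 * v $ 1 = (p * ((a - a') * k)) * (v $ 1)^2" unfolding p by (simp add: power2_eq_square)
    also have "\<dots> = p * (ps v $ 1 - ps v $ 2)" unfolding squares_ps(1)[of v, symmetric] by (simp only: mult.assoc)
    finally show ?thesis by (simp add: l_def algebra_simps)
  qed
  have s4: "v $ 4 * v $ 4 = l (q * a') (- (q * a)) 0 0 (ps v)" for v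
  proof -
    have "v $ 4 * v $ 4 = (q * (a - a')) * (v $ 4)^2" unfolding p by (simp add: power2_eq_square)
    also have "\<dots> = q * (a' * ps v $ 1 - a * ps v $ 2)" unfolding squares_ps(2)[of v, symmetric] by (simp only: mult.assoc)
    finally show ?thesis by (simp add: l_def algebra_simps)
  qed
  have "\<exists>l. form UNIV 1 l \<and> (\<forall>v\<in>{v. pt v \<in> Cs}. v $ i * v $ j = l (ps v))" if ij: "i \<in> {1, 2} \<longleftrightarrow> j \<in> {1, 2}" for i j
  proof -
    have C: "v $ 2 * v $ 2 = v $ 4 * v $ 4 - k^2 * (v $ 1 * v $ 1)" "v $ 3 * v $ 3 = v $ 4 * v $ 4 - v $ 1 * v $ 1" if "pt v \<in> Cs" for v
      using that unfolding in_Cs by (simp_all add: power2_eq_square)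
    have 22: "v $ 2 * v $ 2 = l (q * a' - k^2 * p) (- (q * a) + k^2 * p) 0 0 (ps v)" if "pt v \<in> Cs" for v
      unfolding C(1)[OF that] s1 s4 by (simp add: l_def algebra_simps)
    have 33: "v $ 3 * v $ 3 = l (q * a' - p) (- (q * a) + p) 0 0 (ps v)" if "pt v \<in> Cs" for v
      unfolding C(2)[OF that] s1 s4 by (simp add: l_def algebra_simps)
    have 34: "v $ 3 * v $ 4 = l 0 0 1 0 (ps v)" "v $ 4 * v $ 3 = l 0 0 1 0 (ps v)" for v by (simp_all add: l_def ps_def)
    have 12: "v $ 1 * v $ 2 = l 0 0 0 1 (ps v)" "v $ 2 * v $ 1 = l 0 0 0 1 (ps v)" for v by (simp_all add: l_def ps_def)
    consider "i = 1" "j = 1" | "i = 1" "j = 2" | "i = 2" "j = 1" | "i = 2" "j = 2" | "i = 3" "j = 3" | "i = 3" "j = 4" | "i = 4" "j = 3" | "i = 4" "j = 4"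
      using ij exhaust_4[of i] exhaust_4[of j] by auto
    then show ?thesis by cases (use lf s1 s4 22 33 34 12 in blast)+
  qed
  then show ?thesis using trace_flip[of "{1, 2}" "{v. pt v \<in> Cs}" ps n f] assms by blast
qed

lemma trace_po:
  assumes "form UNIV (2 * n) f"
  shows "\<exists>g. form UNIV n g \<and> (\<forall>v. pt v \<in> Ds \<longrightarrow> f v + f (flip {3, 4} v) = g (po v))"
proof -
  define l where "l c1 c2 c3 c4 v = c1 * v $ 1 + c2 * v $ 2 + c3 * v $ 3 + c4 * v $ 4" for c1 c2 c3 c4 and v :: "'a ^ 4"
  have lf: "form UNIV 1 (l c1 c2 c3 c4)" for c1 c2 c3 c4 unfolding l_def by (rule lin_form)
  have 33: "v $ 3 * v $ 3 = l 0 0 (1/2) (1/2) (po v)" and 44: "v $ 4 * v $ 4 = l 0 0 (- 1/2) (1/2) (po v)"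
    and 34: "v $ 3 * v $ 4 = l (1/2) 0 0 0 (po v)" "v $ 4 * v $ 3 = l (1/2) 0 0 0 (po v)"
    and 12: "v $ 1 * v $ 2 = l 0 1 0 0 (po v)" "v $ 2 * v $ 1 = l 0 1 0 0 (po v)" for v
    by (simp_all add: l_def po_def field_simps power2_eq_square)
  have "\<exists>l. form UNIV 1 l \<and> (\<forall>v\<in>{v. pt v \<in> Ds}. v $ i * v $ j = l (po v))" if ij: "i \<in> {3, 4} \<longleftrightarrow> j \<in> {3, 4}" for i j
  proof -
    have C: "v $ 1 * v $ 1 = v $ 3 * v $ 3 - a^2 * (v $ 4 * v $ 4)" "v $ 2 * v $ 2 = v $ 3 * v $ 3 - a'^2 * (v $ 4 * v $ 4)" if "pt v \<in> Ds" for v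
      using that unfolding in_Ds by (simp_all add: power2_eq_square)
    have 11: "v $ 1 * v $ 1 = l 0 0 (1/2 + a^2/2) (1/2 - a^2/2) (po v)" if "pt v \<in> Ds" for v
      unfolding C(1)[OF that] 33 44 by (simp add: l_def algebra_simps)
    have 22: "v $ 2 * v $ 2 = l 0 0 (1/2 + a'^2/2) (1/2 - a'^2/2) (po v)" if "pt v \<in> Ds" for v
      unfolding C(2)[OF that] 33 44 by (simp add: l_def algebra_simps)
    consider "i = 1" "j = 1" | "i = 1" "j = 2" | "i = 2" "j = 1" | "i = 2" "j = 2" | "i = 3" "j = 3" | "i = 3" "j = 4" | "i = 4" "j = 3" | "i = 4" "j = 4"
      using ij exhaust_4[of i] exhaust_4[of j] by auto
    then show ?thesis by cases (use lf 11 22 33 34 44 12 in blast)+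
  qed
  then show ?thesis using trace_flip[of "{3, 4}" "{v. pt v \<in> Ds}" po n f] assms by blast
qed

text \<open>The trace over the group of order 4 is the trace along \<open>ps\<close> followed by the
  one along \<open>po\<close>.\<close>

lemma trace_double:
  assumes "form UNIV (4 * n) f"
  shows "\<exists>g. form UNIV n g \<and> (\<forall>v. pt v \<in> Cs \<longrightarrow> (\<Sum>S\<in>{{}, {1, 2}, {1, 3}, {2, 3}}. f (flip S v)) = g (po (ps v)))"
proof -
  have "form UNIV (2 * (2 * n)) f" using assms by simp
  then obtain g where g: "form UNIV (2 * n) g" "\<And>v. pt v \<in> Cs \<Longrightarrow> f v + f (flip {1, 2} v) = g (ps v)"
    using trace_ps by blast
  obtain g' where g': "form UNIV n g'" "\<And>v. pt v \<in> Ds \<Longrightarrow> g v + g (flip {3, 4} v) = g' (po v)"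
    using trace_po[OF g(1)] by blast
  have "(\<Sum>S\<in>{{}, {1, 2}, {1, 3}, {2, 3}}. f (flip S v)) = g' (po (ps v))" if v: "pt v \<in> Cs" for v
  proof -
    have ne: "{1, 2} \<noteq> {1, 3 :: 4}" "{1, 2} \<noteq> {2, 3 :: 4}" "{1, 3} \<noteq> {2, 3 :: 4}" by (simp_all add: doubleton_eq_iff)
    have ff: "flip {1, 2} (flip {1, 3} v) = flip {2, 3} v" by (simp add: vec_eq_iff forall_4 flip_nth)
    have "(\<Sum>S\<in>{{}, {1, 2}, {1, 3}, {2, 3}}. f (flip S v))
      = (f v + f (flip {1, 2} v)) + (f (flip {1, 3} v) + f (flip {1, 2} (flip {1, 3} v)))"
      unfolding ff using ne by (simp add: add.assoc)
    also have "\<dots> = g' (po (ps v))"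
      unfolding g(2)[OF v] g(2)[OF flip_Cs[OF v]] ps_sigma by (rule g'(2)[OF ps_in(2)[OF v]])
    finally show ?thesis .
  qed
  then show ?thesis using g' by blast
qed

end

section \<open>Inverses of morphisms of curves\<close>

lemma isomorphism_inverse:
  assumes "isomorphism UNIV V W \<phi>"
  obtains \<psi> where "isomorphism UNIV W V \<psi>" "\<And>P. P \<in> V \<Longrightarrow> \<psi> (\<phi> P) = P" "\<And>Q. Q \<in> W \<Longrightarrow> \<phi> (\<psi> Q) = Q"
proof -
  obtain \<psi> where *: "morphism UNIV V W \<phi>" "morphism UNIV W V \<psi>" "\<forall>P\<in>V. \<psi> (\<phi> P) = P" "\<forall>Q\<in>W. \<phi> (\<psi> Q) = Q"
    using assms unfolding isomorphism_def by metis
  then have "isomorphism UNIV W V \<psi>" unfolding isomorphism_def by metis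
  then show thesis using that * by blast
qed

lemma isomorphism_morphism: "isomorphism S V W \<phi> \<Longrightarrow> morphism S V W \<phi>"
  unfolding isomorphism_def by simp

text \<open>Two local inverses give the same point wherever both are non-zero on the infinite image
  of \<open>f\<close>, hence wherever both are non-zero on \<open>W\<close>; so they glue. Their
  values satisfy the equations \<open>fs\<close> of \<open>D\<close> on the image, hence
  everywhere.\<close>

lemma isomorphism_from_inverse:
  fixes D :: "('a::field, 'n::finite) ppoint set" and W :: "('a, 'm::finite) ppoint set"
  assumes D: "irr_curve D" and W: "irr_curve W" and f: "morphism UNIV D W f"
    and inv: "\<And>q. pt q \<in> W \<Longrightarrow> \<exists>e h. form_tuple UNIV e h \<and> h q \<noteq> 0 \<and>
     (\<forall>v w i j. pt v \<in> D \<longrightarrow> f (pt v) = pt w \<longrightarrow> h w $ i * v $ j = h w $ j * v $ i)"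
    and closed: "\<And>v. v \<noteq> 0 \<Longrightarrow> pt v \<in> D \<longleftrightarrow> (\<forall>F\<in>fs. F v = 0)" and fs: "\<And>F. F \<in> fs \<Longrightarrow> form UNIV dF F" "dF > 0"
  shows "isomorphism UNIV D W f"
proof -
  have Dp: "D \<subseteq> proj_space" and Wp: "W \<subseteq> proj_space" using D W irr_curve_proj by blast+
  define good where "good e h \<longleftrightarrow> form_tuple UNIV e h \<and>
     (\<forall>v w i j. pt v \<in> D \<longrightarrow> f (pt v) = pt w \<longrightarrow> h w $ i * v $ j = h w $ j * v $ i)" for e and h :: "'a ^ 'm \<Rightarrow> 'a ^ 'n"
  have goodD: "form_tuple UNIV e h" "pt v \<in> D \<Longrightarrow> f (pt v) = pt w \<Longrightarrow> h w $ i * v $ j = h w $ j * v $ i"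
    if "good e h" for e h v w i j using that unfolding good_def by blast+
  have ex: "\<exists>e h. good e h \<and> h q \<noteq> 0" if "pt q \<in> W" for q
    using inv[OF that] unfolding good_def by blast
  have on_image: "h w = 0 \<or> pt (h w) = pt v" if "good e h" "pt v \<in> D" "f (pt v) = pt w" for e h v w
  proof (cases "h w = 0")
    case False
    have "v \<noteq> 0" using that(2) Dp pt_in_proj_space by blast
    then show ?thesis using pt_eq_minors[OF False] goodD(2)[OF that] by blast
  qed simp
  have inj: "inj_on f D"
  proof (rule inj_onI)
    fix P Q assume P: "P \<in> D" and Q: "Q \<in> D" and eq: "f P = f Q"
    obtain v where v: "P = pt v" using proj_setE[OF Dp P] by metis
    obtain u where u: "Q = pt u" using proj_setE[OF Dp Q] by metis
    have fP: "f P \<in> W" using morphism_in[OF f P] .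
    then obtain q where q: "f P = pt q" using proj_setE[OF Wp fP] by metis
    obtain e h where h: "good e h" "h q \<noteq> 0" using ex[of q] q fP by auto
    have "pt (h q) = pt v" "pt (h q) = pt u" using on_image[OF h(1)] h(2) P Q q v u eq by auto
    then show "P = Q" using u v by simp
  qed
  have inf: "infinite (f ` D)" using inj D finite_imageD unfolding irr_curve_def by blast
  have im: "f ` D \<subseteq> W" using morphism_in[OF f] by blast
  have imE: "\<exists>v. pt v \<in> D \<and> f (pt v) = pt w" if w: "pt w \<in> f ` D" for w
  proof -
    obtain P where P: "P \<in> D" "pt w = f P" using w by blast
    then obtain v where "P = pt v" using proj_setE[OF Dp P(1)] by metis
    then show ?thesis using P by auto
  qed
  have consistent: "h w $ i * h' w $ j - h w $ j * h' w $ i = 0" if g: "good e h" "good e' h'" and w: "pt w \<in> W" for e e' h h' w i j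
  proof (rule irr_curve_zero[OF W _ inf im _ w])
    show "form UNIV (e + e') (\<lambda>w. h w $ i * h' w $ j - h w $ j * h' w $ i)"
      by (intro form_diff form_mult[OF form_tuple_nth form_tuple_nth refl] goodD(1) g)
    fix u assume "pt u \<in> f ` D"
    then obtain v where v: "pt v \<in> D" "f (pt v) = pt u" using imE by blast
    show "h u $ i * h' u $ j - h u $ j * h' u $ i = 0"
    proof (cases "h u = 0 \<or> h' u = 0")
      case False
      then have "pt (h u) = pt v" "pt (h' u) = pt v" using on_image[OF g(1) v] on_image[OF g(2) v] by auto
      then have "pt (h u) = pt (h' u)" by simp
      then show ?thesis using pt_eq_minors False by (metis diff_self)
    qed auto
  qed
  have inD: "pt (h q) \<in> D" if g: "good e h" and q: "pt q \<in> W" "h q \<noteq> 0" for e h q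
  proof -
    have "F (h q) = 0" if F: "F \<in> fs" for F
    proof (rule irr_curve_zero[OF W _ inf im _ q(1)])
      show "form UNIV (dF * e) (\<lambda>w. F (h w))" by (rule form_comp[OF fs(1)[OF F] goodD(1)[OF g] refl])
      fix u assume "pt u \<in> f ` D"
      then obtain v where v: "pt v \<in> D" "f (pt v) = pt u" using imE by blast
      show "F (h u) = 0"
      proof (cases "h u = 0")
        case True then show ?thesis using form_at_0[OF fs(1)[OF F] fs(2)] by simp
      next
        case False
        then have "pt (h u) \<in> D" using on_image[OF g v] v by auto
        then show ?thesis using closed[OF False] F by blast
      qed
    qed
    then show ?thesis using closed[OF q(2)] by blast
  qed
  \<comment> \<open>An arbitrary choice among the local inverses; the next claim shows that the
    value does not depend on it.\<close>
  define e where "e P = (SOME R. \<exists>q n h. P = pt q \<and> good n h \<and> h q \<noteq> 0 \<and> R = pt (h q))" for P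
  have e: "e (pt q) = pt (h q)" if g: "good n h" and q: "pt q \<in> W" "h q \<noteq> 0" for n h q
  proof -
    have "\<exists>R q' n h. pt q = pt q' \<and> good n h \<and> h q' \<noteq> 0 \<and> R = pt (h q')" using that by blast
    from someI_ex[OF this] obtain q' n' h' where *: "pt q = pt q'" "good n' h'" "h' q' \<noteq> 0" "e (pt q) = pt (h' q')"
      unfolding e_def by blast
    obtain c where c: "c \<noteq> 0" "q' = c *s q" using *(1) unfolding pt_eq_iff by (metis *(1) pt_eq_iff)
    have h'q: "h' q \<noteq> 0" using *(3) c form_tuple_eq_0_iff_smult[OF goodD(1)[OF *(2)] c(1)] by simp
    have "pt (h' q') = pt (h' q)" unfolding c(2) by (rule form_tuple_pt_smult[OF goodD(1)[OF *(2)] c(1)])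
    also have "\<dots> = pt (h q)" using pt_eq_minors[OF h'q q(2)] consistent[OF *(2) g q(1)] by simp
    finally show ?thesis using *(4) by simp
  qed
  have em: "morphism UNIV W D e"
  proof (rule morphismI[OF Wp])
    fix q assume q: "pt q \<in> W"
    obtain n h where h: "good n h" "h q \<noteq> 0" using ex[OF q] by blast
    show "e (pt q) \<in> D" using e[OF h(1) q h(2)] inD[OF h(1) q h(2)] by simp
    show "\<exists>d h. form_tuple UNIV d h \<and> h q \<noteq> 0 \<and> (\<forall>w. pt w \<in> W \<and> h w \<noteq> 0 \<longrightarrow> e (pt w) = pt (h w))"
      by (rule exI[of _ n], rule exI[of _ h]) (use h goodD(1)[OF h(1)] e[OF h(1)] in blast)
  qed
  have ef: "e (f P) = P" if P: "P \<in> D" for P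
  proof -
    obtain v where v: "P = pt v" using proj_setE[OF Dp P] by metis
    have fP: "f P \<in> W" using morphism_in[OF f P] .
    then obtain q where q: "f P = pt q" using proj_setE[OF Wp fP] by metis
    obtain n h where h: "good n h" "h q \<noteq> 0" using ex[of q] q fP by auto
    have "pt (h q) = pt v" using on_image[OF h(1), of v q] h(2) P q v by auto
    then show ?thesis using e[OF h(1) _ h(2)] fP q v by simp
  qed
  have "f (e Q) = Q" if Q: "Q \<in> W" for Q
  proof (rule morphism_eqI[OF W morphism_comp[OF em f Wp Dp] morphism_id[OF Wp] inf im _ Q])
    show "f (e R) = R" if "R \<in> f ` D" for R using that ef by auto
  qed
  then show ?thesis unfolding isomorphism_def using f em ef by blast
qed

section \<open>The quotient by translation by T, and the theorem for the standard curves\<close>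

context standard_curves
begin

text \<open>The origin of the group law: \<open>sn = 0\<close> and
  \<open>dn = cn = 1\<close>.\<close>

definition Oc :: "'a ^ 4" where "Oc = vector [0, 1, 1, 1]"

lemma Oc_in: "pt Oc \<in> Cs"
  unfolding in_Cs by (simp add: Oc_def vec_eq_iff forall_4)

lemma flip_Oc_ne:
  "pt (flip {1, 2} Oc) \<noteq> pt Oc" "pt (flip {1, 3} Oc) \<noteq> pt Oc" "pt (flip {2, 3} Oc) \<noteq> pt Oc"
  "pt (flip {1, 3} Oc) \<noteq> pt (flip {1, 2} Oc)" "pt (flip {2, 3} Oc) \<noteq> pt (flip {1, 2} Oc)"
  unfolding pt_eq_iff by (auto simp: vec_eq_iff forall_4 flip_nth Oc_def)

lemma infinite_Ds: "infinite Ds"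
proof -
  have "\<exists>y. y^2 = x" for x :: 'a using nth_root_exists[of 2 x] by auto
  then obtain r where r: "\<And>x :: 'a. (r x)^2 = x" by metis
  let ?w = "\<lambda>t. vector [r (1 - a^2 * t^2), r (1 - a'^2 * t^2), 1, t] :: 'a ^ 4"
  have "inj (\<lambda>t. pt (?w t))" unfolding inj_def pt_eq_iff by (auto simp: vec_eq_iff forall_4)
  then have "infinite (range (\<lambda>t. pt (?w t)))"
    using finite_imageD[of "\<lambda>t. pt (?w t)" UNIV] infinite_UNIV_char_0[where 'a = 'a] by blast
  moreover have "range (\<lambda>t. pt (?w t)) \<subseteq> Ds" unfolding image_subset_iff in_Ds by (simp add: r vec_eq_iff forall_4)
  ultimately show ?thesis using infinite_super by blast
qed

lemma ps_morphism: "morphism UNIV Cs Ds (proj_map ps)"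
  by (rule proj_map_morphism[OF ps_form Cs_proj]) (use ps_in in blast)

lemma po_morphism: "morphism UNIV Ds Cs (proj_map po)"
  by (rule proj_map_morphism[OF po_form Ds_proj]) (use po_in in blast)

lemma irr_Ds: "irr_curve Cs \<Longrightarrow> irr_curve Ds"
proof (rule irr_curve_surj_image[OF _ ps_morphism _ Ds_proj infinite_Ds])
  show "proj_map ps ` Cs = Ds"
  proof
    show "proj_map ps ` Cs \<subseteq> Ds" using morphism_in[OF ps_morphism] by blast
    show "Ds \<subseteq> proj_map ps ` Cs"
    proof
      fix P assume P: "P \<in> Ds"
      then obtain w where w: "P = pt w" using proj_setE[OF Ds_proj] by metis
      obtain v where "pt v \<in> Cs" "ps v = w" using ps_surj[of w] P w by blast
      then show "P \<in> proj_map ps ` Cs" using proj_map_pt[OF ps_form, of v] w by (metis image_eqI)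
    qed
  qed
qed

text \<open>A fixed point is an eigenvector of the sign change, so it lies on the line
  \<open>x1 = x2 = 0\<close> or on \<open>x3 = x4 = 0\<close>; both lines miss the curve.\<close>

lemma tau_no_fixed_point:
  assumes "pt v \<in> Cs"
  shows "pt (flip {1, 2} v) \<noteq> pt v"
proof
  assume "pt (flip {1, 2} v) = pt v"
  then obtain c where c: "flip {1, 2} v = c *s v" unfolding pt_eq_iff by blast
  have v: "v \<noteq> 0" "(v $ 3)^2 = (v $ 4)^2 - (v $ 1)^2" "(v $ 2)^2 = (v $ 4)^2 - k^2 * (v $ 1)^2"
    using assms in_Cs by auto
  have "- v $ 1 = c * v $ 1" "- v $ 2 = c * v $ 2" "v $ 3 = c * v $ 3" "v $ 4 = c * v $ 4"
    using c by (simp_all add: vec_eq_iff forall_4 flip_nth)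
  then have "(c = -1 \<or> v $ 1 = 0 \<and> v $ 2 = 0) \<and> (c = 1 \<or> v $ 3 = 0 \<and> v $ 4 = 0)"
    by (metis mult_cancel_right1 mult_cancel_right2 mult_minus1 mult_right_cancel)
  then consider "v $ 1 = 0" "v $ 2 = 0" | "v $ 3 = 0" "v $ 4 = 0" by fastforce
  then show False
  proof cases
    case 1
    then have "v $ 4 = 0" "v $ 3 = 0" using v(2,3) by auto
    then show False using v(1) 1 by (simp add: vec_eq_iff forall_4)
  next
    case 2
    then have "v $ 1 = 0" using v(2) by simp
    moreover from this have "v $ 2 = 0" using v(3) 2 by simp
    ultimately show False using v(1) 2 by (simp add: vec_eq_iff forall_4)
  qed
qed

text \<open>The set-theoretic quotient map must be shown regular. A local representative
  \<open>h\<close> is multiplied by a form \<open>s\<close> that vanishes at the conjugate of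
  \<open>v\<close> but not at \<open>v\<close>; the trace of \<open>s h\<close> is then a tuple of
  forms in \<open>ps\<close>, non-zero at the image of \<open>v\<close>. At other points both
  summands of the trace are multiples of the same vector by invariance.\<close>

lemma quotient_morphism:
  fixes W :: "('a, 'm::finite) ppoint set"
  assumes \<Phi>: "morphism UNIV Cs W \<Phi>" and W: "W \<subseteq> proj_space"
    and inv: "\<And>v. pt v \<in> Cs \<Longrightarrow> \<Phi> (pt (flip {1, 2} v)) = \<Phi> (pt v)"
  obtains f where "morphism UNIV Ds W f" "\<And>v. pt v \<in> Cs \<Longrightarrow> f (pt (ps v)) = \<Phi> (pt v)"
proof -
  define f where "f P = \<Phi> (pt (SOME v. pt v \<in> Cs \<and> P = pt (ps v)))" for P
  have f: "f (pt (ps v)) = \<Phi> (pt v)" if v: "pt v \<in> Cs" for v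
  proof -
    have "\<exists>v'. pt v' \<in> Cs \<and> pt (ps v) = pt (ps v')" using v by blast
    from someI_ex[OF this] obtain u where u: "pt u \<in> Cs" "pt (ps v) = pt (ps u)" "f (pt (ps v)) = \<Phi> (pt u)"
      unfolding f_def by blast
    have "pt u = pt v \<or> pt u = pt (flip {1, 2} v)" by (rule ps_fibre[OF v u(1,2)])
    then show ?thesis using u(3) inv[OF v] by auto
  qed
  have "morphism UNIV Ds W f"
  proof (rule morphismI[OF Ds_proj])
    fix w assume w: "pt w \<in> Ds"
    obtain v where v: "pt v \<in> Cs" "ps v = w" using ps_surj[OF w] by blast
    show "f (pt w) \<in> W" using f[OF v(1)] v(2) morphism_in[OF \<Phi> v(1)] by simp
    obtain d h where h: "form_tuple UNIV d h" "d > 0" "h v \<noteq> 0"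
      "\<And>u. pt u \<in> Cs \<Longrightarrow> h u \<noteq> 0 \<Longrightarrow> \<Phi> (pt u) = pt (h u)"
      using morphism_local[OF \<Phi> Cs_proj v(1)] by metis
    have v0: "v \<noteq> 0" "flip {1, 2} v \<noteq> 0" using v(1) in_Cs by auto
    obtain i j where ij: "v $ i * flip {1, 2} v $ j \<noteq> v $ j * flip {1, 2} v $ i"
      using pt_eq_minors[OF v0] tau_no_fixed_point[OF v(1)] by metis
    obtain l where l: "v $ l \<noteq> 0" using v0(1) by (auto simp: vec_eq_iff)
    define t where "t = flip {1, 2} v"
    \<comment> \<open>The linear factor vanishes at \<open>t\<close> and not at \<open>v\<close>;
      the power brings the degree to \<open>d\<close>, so that \<open>s\<close> times
      \<open>h\<close> has even degree.\<close>
    define s where "s x = (t $ j * x $ i - t $ i * x $ j) * x $ l ^ (d - 1)" for x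
    have s: "form UNIV d s" unfolding s_def
      by (rule form_mult[OF form_diff[OF form_cmult[OF form_coord] form_cmult[OF form_coord]] form_power[OF form_coord]])
        (use h(2) in auto)
    have s0: "s v \<noteq> 0" "s t = 0" unfolding s_def using ij l by (auto simp: t_def[symmetric] mult.commute)
    have sh: "form UNIV (2 * d) (\<lambda>x. s x * h x $ i)" for i
      by (rule form_mult[OF s form_tuple_nth[OF h(1)]]) simp
    have "\<forall>i. \<exists>g. form UNIV d g \<and> (\<forall>v. pt v \<in> Cs \<longrightarrow> s v * h v $ i + s (flip {1, 2} v) * h (flip {1, 2} v) $ i = g (ps v))"
      using trace_ps[OF sh] by blast
    then obtain g where g: "\<And>i. form UNIV d (g i)"
      "\<And>i v. pt v \<in> Cs \<Longrightarrow> s v * h v $ i + s (flip {1, 2} v) * h (flip {1, 2} v) $ i = g i (ps v)" by metis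
    define G where "G u = (\<chi> i. g i u)" for u
    have G: "G (ps u) = s u *s h u + s (flip {1, 2} u) *s h (flip {1, 2} u)" if "pt u \<in> Cs" for u
      unfolding G_def vec_eq_iff using g(2)[OF that] by simp
    show "\<exists>d h. form_tuple UNIV d h \<and> h w \<noteq> 0 \<and> (\<forall>u. pt u \<in> Ds \<and> h u \<noteq> 0 \<longrightarrow> f (pt u) = pt (h u))"
    proof (intro exI conjI allI impI)
      show "form_tuple UNIV d G" unfolding form_tuple_def G_def using g(1) by simp
      show "G w \<noteq> 0" using G[OF v(1)] s0 h(3) v(2) unfolding t_def[symmetric] by (simp add: vec_eq_iff)
      fix u assume u: "pt u \<in> Ds \<and> G u \<noteq> 0"
      then obtain x where x: "pt x \<in> Cs" "ps x = u" using ps_surj by blast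
      have fx: "f (pt u) = \<Phi> (pt x)" using f[OF x(1)] x(2) by simp
      have inW: "\<Phi> (pt x) \<in> W" by (rule morphism_in[OF \<Phi> x(1)])
      obtain y where y: "\<Phi> (pt x) = pt y" using proj_setE[OF W inW] by metis
      have mult: "\<exists>c. h z = c *s y" if "pt z \<in> Cs" "\<Phi> (pt z) = pt y" for z
      proof (cases "h z = 0")
        case True then show ?thesis by (intro exI[of _ 0]) simp
      next
        case False
        then have "pt (h z) = pt y" using h(4) that by simp
        then show ?thesis unfolding pt_eq_iff by blast
      qed
      obtain c1 where c1: "h x = c1 *s y" using mult[OF x(1) y] by blast
      obtain c2 where c2: "h (flip {1, 2} x) = c2 *s y" using mult[OF flip_Cs[OF x(1)]] inv[OF x(1)] y by metis
      have Gu: "G u = (s x * c1 + s (flip {1, 2} x) * c2) *s y"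
        using G[OF x(1)] unfolding x(2) c1 c2 by (simp add: vec_eq_iff algebra_simps)
      then have "s x * c1 + s (flip {1, 2} x) * c2 \<noteq> 0" using u by (metis vector_smult_lzero)
      then show "f (pt u) = pt (G u)" unfolding fx y Gu using pt_smult by metis
    qed
  qed
  then show thesis using that f by blast
qed

text \<open>\<open>double\<close> is asked for only where a form \<open>f0\<close> is non-zero,
  since doubling is computed at points in general position; both sides are morphisms, so density
  gives it everywhere.\<close>

theorem covering_standard:
  fixes E E' :: "'a weierstrass"
  assumes E: "discriminant E \<noteq> 0" "discriminant E' \<noteq> 0" and g: "isomorphism UNIV Cs (points E) g"
    and O: "g (pt Oc) = origin" and T: "g (pt (flip {1, 2} Oc)) = T"
    and \<phi>: "morphism UNIV (points E) (points E') \<phi>" "\<phi> origin = origin" "{P \<in> points E. \<phi> P = origin} = {origin, T}"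
    and \<phi>': "morphism UNIV (points E') (points E) \<phi>'"
    and f0: "form UNIV d0 f0" "pt x0 \<in> Cs" "f0 x0 \<noteq> 0"
    and double: "\<And>v. pt v \<in> Cs \<Longrightarrow> f0 v \<noteq> 0 \<Longrightarrow> \<phi>' (\<phi> (g (pt v))) = g (pt (po (ps v)))"
  shows "\<exists>f. isomorphism UNIV Ds (points E') f \<and> (\<forall>w. pt w \<in> Ds \<longrightarrow> g (pt (po w)) = \<phi>' (f (pt w)))"
proof -
  obtain gi where gi: "isomorphism UNIV (points E) Cs gi" "\<And>P. P \<in> Cs \<Longrightarrow> gi (g P) = P" "\<And>P. P \<in> points E \<Longrightarrow> g (gi P) = P"
    using isomorphism_inverse[OF g] by metis
  have irrE: "irr_curve (points E)" "irr_curve (points E')" using E irr_points by blast+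
  have irrC: "irr_curve Cs" by (rule irr_curve_isomorphic[OF irrE(1) gi(1) Cs_proj])
  have irrD: "irr_curve Ds" by (rule irr_Ds[OF irrC])
  note g' = isomorphism_morphism[OF g] and gi' = isomorphism_morphism[OF gi(1)]
  define \<Phi> where "\<Phi> P = \<phi> (g P)" for P
  define \<kappa> where "\<kappa> P = gi (\<phi>' P)" for P
  have \<Phi>: "morphism UNIV Cs (points E') \<Phi>" unfolding \<Phi>_def
    by (rule morphism_comp[OF g' \<phi>(1) Cs_proj points_proj])
  have \<kappa>: "morphism UNIV (points E') Cs \<kappa>" unfolding \<kappa>_def
    by (rule morphism_comp[OF \<phi>' gi' points_proj points_proj])
  have \<kappa>\<Phi>: "\<kappa> (\<Phi> (pt v)) = pt (po (ps v))" if v: "pt v \<in> Cs" for v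
  proof -
    have "\<kappa> (\<Phi> P) = proj_map po (proj_map ps P)" if "P \<in> Cs" for P
    proof (rule morphism_eqI_form[OF irrC morphism_comp[OF \<Phi> \<kappa> Cs_proj points_proj] morphism_comp[OF ps_morphism po_morphism Cs_proj Ds_proj] f0 _ that])
      fix v assume v: "pt v \<in> Cs" "f0 v \<noteq> 0"
      have "pt (po (ps v)) \<in> Cs" using po_in(2)[OF ps_in(2)[OF v(1)]] .
      then show "\<kappa> (\<Phi> (pt v)) = proj_map po (proj_map ps (pt v))"
        unfolding \<kappa>_def \<Phi>_def double[OF v] proj_map_pt[OF ps_form] proj_map_pt[OF po_form] using gi(2) by blast
    qed
    from this[OF v] show ?thesis unfolding proj_map_pt[OF ps_form] proj_map_pt[OF po_form] .
  qed
  have ginj: "pt u = pt v" if "pt u \<in> Cs" "pt v \<in> Cs" "g (pt u) = g (pt v)" for u v using gi(2) that by metis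
  have \<Phi>O: "\<Phi> (pt Oc) = origin" unfolding \<Phi>_def O \<phi>(2) ..
  have "T \<in> points E" using T morphism_in[OF g' flip_Cs[OF Oc_in]] by metis
  then have \<Phi>T: "\<Phi> (pt (flip {1, 2} Oc)) = origin" unfolding \<Phi>_def T using \<phi>(3) by blast
  have sepO: "\<Phi> (pt (flip S Oc)) \<noteq> \<Phi> (pt Oc)" if S: "S = {1, 3} \<or> S = {2, 3}" for S
  proof
    assume "\<Phi> (pt (flip S Oc)) = \<Phi> (pt Oc)"
    then have "g (pt (flip S Oc)) \<in> {P \<in> points E. \<phi> P = origin}"
      using morphism_in[OF g' flip_Cs[OF Oc_in, of S]] \<Phi>O unfolding \<Phi>_def by simp
    then have "g (pt (flip S Oc)) = g (pt Oc) \<or> g (pt (flip S Oc)) = g (pt (flip {1, 2} Oc))" unfolding \<phi>(3) O T by simp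
    then have "pt (flip S Oc) = pt Oc \<or> pt (flip S Oc) = pt (flip {1, 2} Oc)"
      using ginj flip_Cs[OF Oc_in] Oc_in by blast
    then show False using flip_Oc_ne S by auto
  qed
  have ext: "extends_maps (points E') TYPE(4)" by (rule extends_points[OF E(2)])
  \<comment> \<open>If \<Phi> were not invariant it would separate the fibres of
    \<open>po \<circ> ps\<close>, and descent would give a rational inverse. Extended to the origin
    of \<open>E'\<close>, that inverse would have a single value there, yet \<open>Oc\<close> and
    its translate both lie over the origin.\<close>
  have inv: "\<Phi> (pt (flip {1, 2} v)) = \<Phi> (pt v)" if v: "pt v \<in> Cs" for v
  proof (rule ccontr)
    assume neq: "\<Phi> (pt (flip {1, 2} v)) \<noteq> \<Phi> (pt v)"
    have sep: "\<exists>v. pt v \<in> Cs \<and> \<Phi> (pt (flip S v)) \<noteq> \<Phi> (pt v)" if "S \<in> {{}, {1, 2}, {1, 3}, {2, 3}}" "S \<noteq> {}" for S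
      using that neq v sepO[of S] Oc_in by blast
    have "\<exists>e (H :: 'a ^ 3 \<Rightarrow> 'a ^ 4). form_tuple UNIV e H \<and>
     (\<forall>v w i j. pt v \<in> Cs \<and> \<Phi> (pt v) = pt w \<longrightarrow> H w $ i * v $ j = H w $ j * v $ i) \<and>
     (\<exists>v w. pt v \<in> Cs \<and> \<Phi> (pt v) = pt w \<and> H w \<noteq> 0)"
      by (rule galois_descent[OF irrC points_proj _ _ trace_double _ \<Phi> \<kappa> \<kappa>\<Phi> sep]) (use flip_Cs in auto)
    then obtain e and H :: "'a ^ 3 \<Rightarrow> 'a ^ 4" and v0 w0 where H: "form_tuple UNIV e H"
      "\<And>v w i j. pt v \<in> Cs \<Longrightarrow> \<Phi> (pt v) = pt w \<Longrightarrow> H w $ i * v $ j = H w $ j * v $ i"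
      "pt v0 \<in> Cs" "\<Phi> (pt v0) = pt w0" "H w0 \<noteq> 0" by blast
    let ?q = "vector [0, 1, 0] :: 'a ^ 3"
    obtain e' and h :: "'a ^ 3 \<Rightarrow> 'a ^ 4" where h: "h ?q \<noteq> 0"
      "\<And>v w i j. pt v \<in> Cs \<Longrightarrow> \<Phi> (pt v) = pt w \<Longrightarrow> h w $ i * v $ j = h w $ j * v $ i"
      using extended_inverse[OF irrC ext \<Phi> H, of ?q] origin_in_points[of E'] unfolding origin_def by blast
    have "pt (h ?q) = pt u" if u: "pt u \<in> Cs" "\<Phi> (pt u) = origin" for u
    proof -
      have "u \<noteq> 0" using u(1) in_Cs by auto
      then show ?thesis using pt_eq_minors[OF h(1)] h(2)[OF u(1)] u(2) unfolding origin_def by blast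
    qed
    then have "pt (flip {1, 2} Oc) = pt Oc" using \<Phi>O \<Phi>T Oc_in flip_Cs by metis
    then show False using flip_Oc_ne by blast
  qed
  obtain f where f: "morphism UNIV Ds (points E') f" "\<And>v. pt v \<in> Cs \<Longrightarrow> f (pt (ps v)) = \<Phi> (pt v)"
    using quotient_morphism[OF \<Phi> points_proj inv] by blast
  have \<kappa>f: "\<kappa> (f (pt w)) = pt (po w)" if w: "pt w \<in> Ds" for w
  proof -
    obtain v where v: "pt v \<in> Cs" "ps v = w" using ps_surj[OF w] by blast
    then show ?thesis using f(2)[OF v(1)] \<kappa>\<Phi>[OF v(1)] by simp
  qed
  have trace: "\<exists>g. form UNIV n g \<and> (\<forall>v. pt v \<in> Ds \<longrightarrow> (\<Sum>S\<in>{{}, {3, 4}}. h (flip S v)) = g (po v))"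
    if "form UNIV (2 * n) h" for n h using trace_po[OF that] by simp
  \<comment> \<open>The involution belonging to \<open>po\<close> lifts to the sign change of
    \<open>{1, 3}\<close> on \<open>Cs\<close>, which moves \<open>Oc\<close> to a point outside the
    kernel.\<close>
  have sep: "\<exists>v. pt v \<in> Ds \<and> f (pt (flip S v)) \<noteq> f (pt v)" if "S \<in> {{}, {3, 4}}" "S \<noteq> {}" for S
  proof -
    have S: "S = {3, 4}" using that by blast
    have "f (pt (flip S (ps Oc))) = \<Phi> (pt (flip {1, 3} Oc))"
      unfolding S using f(2)[OF flip_Cs[OF Oc_in, of "{1, 3}"]] unfolding ps_sigma .
    moreover have "f (pt (ps Oc)) = \<Phi> (pt Oc)" using f(2)[OF Oc_in] .
    ultimately show ?thesis using sepO[of "{1, 3}"] ps_in(2)[OF Oc_in] by metis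
  qed
  have "\<exists>e (H :: 'a ^ 3 \<Rightarrow> 'a ^ 4). form_tuple UNIV e H \<and>
     (\<forall>v w i j. pt v \<in> Ds \<and> f (pt v) = pt w \<longrightarrow> H w $ i * v $ j = H w $ j * v $ i) \<and>
     (\<exists>v w. pt v \<in> Ds \<and> f (pt v) = pt w \<and> H w \<noteq> 0)"
    by (rule galois_descent[OF irrD points_proj _ _ trace _ f(1) \<kappa> \<kappa>f sep]) (use flip_Ds in auto)
  then obtain e and H :: "'a ^ 3 \<Rightarrow> 'a ^ 4" and v0 w0 where H: "form_tuple UNIV e H"
      "\<And>v w i j. pt v \<in> Ds \<Longrightarrow> f (pt v) = pt w \<Longrightarrow> H w $ i * v $ j = H w $ j * v $ i"
      "pt v0 \<in> Ds" "f (pt v0) = pt w0" "H w0 \<noteq> 0" by blast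
  define fs :: "('a ^ 4 \<Rightarrow> 'a) set" where "fs = {\<lambda>w. w $ 1 * w $ 1 - w $ 3 * w $ 3 + a^2 * (w $ 4 * w $ 4), \<lambda>w. w $ 2 * w $ 2 - w $ 3 * w $ 3 + a'^2 * (w $ 4 * w $ 4)}"
  have sq: "form UNIV 2 (\<lambda>v::'a^4. v $ i * v $ j)" for i j by (rule form_mult[OF form_coord form_coord]) simp
  have fs: "form UNIV 2 F" if "F \<in> fs" for F
    using that unfolding fs_def by (auto intro!: form.add form_diff form_cmult sq)
  have closed: "pt v \<in> Ds \<longleftrightarrow> (\<forall>F\<in>fs. F v = 0)" if "v \<noteq> 0" for v
    unfolding in_Ds fs_def using that by (simp add: power2_eq_square) (auto simp: algebra_simps)
  have "isomorphism UNIV Ds (points E') f"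
    by (rule isomorphism_from_inverse[OF irrD irrE(2) f(1) extended_inverse[OF irrD ext f(1) H] closed fs]) auto
  moreover have "g (pt (po w)) = \<phi>' (f (pt w))" if w: "pt w \<in> Ds" for w
  proof -
    have "\<phi>' (f (pt w)) \<in> points E" using morphism_in[OF \<phi>' morphism_in[OF f(1) w]] .
    then show ?thesis using gi(3) \<kappa>f[OF w] unfolding \<kappa>_def by metis
  qed
  ultimately show ?thesis by blast
qed

end

section \<open>Orders of linear forms on the standard curve\<close>

lemma uniformizerI:
  fixes V :: "('a::field, 'n::finite) ppoint set"
  assumes V: "V \<subseteq> proj_space" and t: "form UNIV d t" "t x = 0"
    and gen: "\<And>d l. form UNIV d l \<Longrightarrow> l x = 0 \<Longrightarrow> \<exists>e e' g h. form UNIV e g \<and> form UNIV e' h \<and> g x \<noteq> 0 \<and> (\<forall>v. pt v \<in> V \<longrightarrow> l v * g v = t v * h v)"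
  shows "uniformizer V (pt x) t"
  unfolding uniformizer_def
proof (intro conjI allI impI ballI)
  show "\<exists>d. form UNIV d t" using t by blast
  show "t v = 0" if "v \<in> pt x" for v using that form_zero_smult[OF t] unfolding in_pt by auto
  fix d l assume l: "form UNIV d l \<and> (\<forall>v\<in>pt x. l v = 0)"
  then obtain e e' g h where gh: "form UNIV e g" "form UNIV e' h" "g x \<noteq> 0" "\<And>v. pt v \<in> V \<Longrightarrow> l v * g v = t v * h v"
    using gen[of d l] self_in_pt by blast
  show "\<exists>e e' g h. form UNIV e g \<and> form UNIV e' h \<and> (\<forall>v\<in>pt x. g v \<noteq> 0) \<and> (\<forall>v\<in>\<Union> V. l v * g v = t v * h v)"
    by (rule exI[of _ e], rule exI[of _ e'], rule exI[of _ g], rule exI[of _ h])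
      (use gh form_eq_0_iff_smult[OF gh(1)] in_Union_proj_set[OF V] in \<open>auto simp: in_pt\<close>)
qed

lemma has_orderI:
  fixes V :: "('a::field, 'n::finite) ppoint set"
  assumes V: "V \<subseteq> proj_space" and "uniformizer V (pt x) t" "form UNIV e g" "form UNIV e' h" "g x \<noteq> 0" "h x \<noteq> 0"
    "\<And>v. pt v \<in> V \<Longrightarrow> f v * g v = t v ^ n * h v"
  shows "has_order V (pt x) f n"
  unfolding has_order_def
  by (rule exI[of _ t], rule exI[of _ e], rule exI[of _ e'], rule exI[of _ g], rule exI[of _ h])
    (use assms form_eq_0_iff_smult[OF assms(3)] form_eq_0_iff_smult[OF assms(4)] in_Union_proj_set[OF V] in \<open>auto simp: in_pt\<close>)

lemma has_order_linear:
  fixes L L' :: "'a::field ^ 'n::finite \<Rightarrow> 'a ^ 'n"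
  assumes L: "form_tuple UNIV 1 L" and L': "form_tuple UNIV 1 L'"
    and inv: "\<And>v. L (L' v) = v" "\<And>v. L' (L v) = v"
    and V: "V \<subseteq> proj_space" and W: "W \<subseteq> proj_space" and WV: "\<And>v. pt v \<in> W \<longleftrightarrow> pt (L v) \<in> V"
    and ord: "has_order V (pt x) f n"
  shows "has_order W (pt (L' x)) (\<lambda>v. f (L v)) n"
proof -
  obtain t e e' g h where tgh: "uniformizer V (pt x) t \<and> form UNIV e g \<and> form UNIV e' h \<and>
      (\<forall>v\<in>pt x. g v \<noteq> 0 \<and> h v \<noteq> 0) \<and> (\<forall>v\<in>\<Union> V. f v * g v = t v ^ n * h v)"
    using ord unfolding has_order_def by (elim exE) (rule that)
  note t = tgh[THEN conjunct1]
  note gh = tgh[THEN conjunct2, THEN conjunct1] tgh[THEN conjunct2, THEN conjunct2, THEN conjunct1]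
    tgh[THEN conjunct2, THEN conjunct2, THEN conjunct2, THEN conjunct1]
    tgh[THEN conjunct2, THEN conjunct2, THEN conjunct2, THEN conjunct2]
  note u = t[unfolded uniformizer_def]
  obtain d where d: "form UNIV d t" using u[THEN conjunct1] by blast
  have tx: "t x = 0" using u[THEN conjunct2, THEN conjunct1] self_in_pt by blast
  have "uniformizer W (pt (L' x)) (\<lambda>v. t (L v))"
  proof (rule uniformizerI[OF W])
    show "form UNIV d (\<lambda>v. t (L v))" by (rule form_comp[OF d L]) simp
    show "t (L (L' x)) = 0" using tx inv by simp
    fix c l assume l: "form UNIV c l" "l (L' x) = 0"
    have l': "form UNIV c (\<lambda>v. l (L' v))" by (rule form_comp[OF l(1) L']) simp
    have "\<forall>v\<in>pt x. l (L' v) = 0" using form_zero_smult[OF l', of x] l(2) by (auto simp: in_pt)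
    from u[THEN conjunct2, THEN conjunct2, rule_format, OF conjI[OF l' this]]
    obtain e e' g h where gh: "form UNIV e g" "form UNIV e' h" "\<forall>v\<in>pt x. g v \<noteq> 0" "\<forall>v\<in>\<Union> V. l (L' v) * g v = t v * h v"
      by (elim exE conjE) (rule that)
    show "\<exists>e e' g h. form UNIV e g \<and> form UNIV e' h \<and> g (L' x) \<noteq> 0 \<and> (\<forall>v. pt v \<in> W \<longrightarrow> l v * g v = t (L v) * h v)"
    proof (rule exI[of _ e], rule exI[of _ e'], rule exI[of _ "\<lambda>v. g (L v)"], rule exI[of _ "\<lambda>v. h (L v)"], intro conjI allI impI)
      show "form UNIV e (\<lambda>v. g (L v))" "form UNIV e' (\<lambda>v. h (L v))"
        using form_comp[OF gh(1) L, of e] form_comp[OF gh(2) L, of e'] by auto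
      show "g (L (L' x)) \<noteq> 0" using gh(3) inv self_in_pt by metis
      show "l v * g (L v) = t (L v) * h (L v)" if "pt v \<in> W" for v
        using gh(4) in_Union_proj_set[OF V, of "L v"] that WV inv by metis
    qed
  qed
  then show ?thesis
  proof (rule has_orderI[OF W])
    show "form UNIV e (\<lambda>v. g (L v))" "form UNIV e' (\<lambda>v. h (L v))"
      using form_comp[OF gh(1) L, of e] form_comp[OF gh(2) L, of e'] by auto
    show "g (L (L' x)) \<noteq> 0" "h (L (L' x)) \<noteq> 0" using gh(3) inv self_in_pt by metis+
    show "f (L v) * g (L v) = t (L v) ^ n * h (L v)" if "pt v \<in> W" for v
      using gh(4) in_Union_proj_set[OF V, of "L v"] that WV by blast
  qed
qed

lemma sum_four:
  fixes f :: "4 \<Rightarrow> 'b::comm_monoid_add"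
  assumes "distinct [i, j, m, n]"
  shows "sum f UNIV = f i + f j + f m + f n"
proof -
  have "card {i, j, m, n} = 4" using assms by simp
  then have "{i, j, m, n} = UNIV" by (intro card_subset_eq) auto
  then have "sum f UNIV = sum f {i, j, m, n}" by simp
  also have "\<dots> = f i + f j + f m + f n" using assms by (simp add: add.assoc)
  finally show ?thesis .
qed

lemma four_cases:
  assumes "distinct [i, j, m, n :: 4]"
  shows "r = i \<or> r = j \<or> r = m \<or> r = n"
proof -
  have "card {i, j, m, n} = 4" using assms by simp
  then have "{i, j, m, n} = UNIV" by (intro card_subset_eq) auto
  then show ?thesis by auto
qed

lemma four_complement: "\<exists>i j m :: 4. distinct [i, j, m, n]"
proof -
  consider "n = 1" | "n = 2" | "n = 3" | "n = 4" using exhaust_4 by blast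
  then show ?thesis
  proof cases
    case 1 then show ?thesis by (intro exI[of _ 2] exI[of _ 3] exI[of _ 4]) simp
  next
    case 2 then show ?thesis by (intro exI[of _ 1] exI[of _ 3] exI[of _ 4]) simp
  next
    case 3 then show ?thesis by (intro exI[of _ 1] exI[of _ 2] exI[of _ 4]) simp
  next
    case 4 then show ?thesis by (intro exI[of _ 1] exI[of _ 2] exI[of _ 3]) simp
  qed
qed

section \<open>Uniformizers, tangents and projections of the standard curve\<close>

context standard_curves
begin

text \<open>The squares of the coordinates are linear functions of those of the first and last one.\<close>

definition pc :: "4 \<Rightarrow> 'a" where "pc i = (if i = 1 then 1 else if i = 2 then - (k^2) else if i = 3 then -1 else 0)"
definition qc :: "4 \<Rightarrow> 'a" where "qc i = (if i = 1 then 0 else 1)"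
text \<open>The 2 by 2 minors of the coefficient pairs \<open>(pc i, qc i)\<close>. They are
  non-zero for distinct indices because \<open>k^2\<close> is neither 0 nor 1.\<close>

definition dt :: "4 \<Rightarrow> 4 \<Rightarrow> 'a" where "dt i j = pc i * qc j - pc j * qc i"

lemma squares: "pt v \<in> Cs \<Longrightarrow> (v $ i)^2 = pc i * (v $ 1)^2 + qc i * (v $ 4)^2"
  using exhaust_4[of i] unfolding in_Cs by (auto simp: pc_def qc_def)

lemma dt_nz: "i \<noteq> j \<Longrightarrow> dt i j \<noteq> 0"
  using exhaust_4[of i] exhaust_4[of j] k_nz k2 by (auto simp: dt_def pc_def qc_def)

lemma dt_sym: "dt j i = - dt i j"
  by (simp add: dt_def)

text \<open>Elimination of the two parameters from three squares: this is the cone whose vertex is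
  the coordinate point of the remaining index.\<close>

lemma conic: "pt v \<in> Cs \<Longrightarrow> dt j m * (v $ i)^2 + dt m i * (v $ j)^2 + dt i j * (v $ m)^2 = 0"
  unfolding squares[of v i] squares[of v j] squares[of v m] dt_def by (simp add: algebra_simps)

lemma not_two_zero:
  assumes v: "pt v \<in> Cs" and "i \<noteq> j" "v $ i = 0" "v $ j = 0"
  shows False
proof -
  have "dt i j * (v $ m)^2 = 0" for m using conic[OF v, of j m i] assms by simp
  then have "v $ m = 0" for m using dt_nz[OF assms(2)] by simp
  then have "v = 0" by (simp add: vec_eq_iff)
  then show False using v in_Cs by blast
qed

text \<open>With \<open>y_r = x_i v_r - x_r v_i\<close> and \<open>s_r = x_i v_r + x_r v_i\<close>,
  each product \<open>y_r s_r\<close> is a difference of squares and thus \<open>dt i r\<close>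
  times one common expression, up to sign. As \<open>s_r\<close> is \<open>2 x_i x_r\<close> at
  \<open>v = x\<close>, it is a unit there if both coordinates are non-zero.\<close>

lemma difference_relation:
  assumes x: "pt x \<in> Cs" and v: "pt v \<in> Cs"
  shows "dt i j * ((x $ i * v $ m - x $ m * v $ i) * (x $ i * v $ m + x $ m * v $ i))
       = dt i m * ((x $ i * v $ j - x $ j * v $ i) * (x $ i * v $ j + x $ j * v $ i))"
proof -
  have id: "(x $ i * v $ r - x $ r * v $ i) * (x $ i * v $ r + x $ r * v $ i) = (x $ i)^2 * (v $ r)^2 - (x $ r)^2 * (v $ i)^2" for r
    by (simp add: algebra_simps power2_eq_square)
  show ?thesis
    unfolding id squares[OF v, of i] squares[OF v, of j] squares[OF v, of m]
      squares[OF x, of i] squares[OF x, of j] squares[OF x, of m] dt_def by (simp add: algebra_simps)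
qed

definition lf :: "(4 \<Rightarrow> 'a) \<Rightarrow> 'a ^ 4 \<Rightarrow> 'a" where "lf l v = (\<Sum>r\<in>UNIV. l r * v $ r)"

lemma lf_form: "form UNIV 1 (lf l)"
  unfolding lf_def by (intro form_sum form_cmult form_coord)

lemma lf_smult: "lf l (c *s v) = c * lf l v"
  using form_homog[OF lf_form] by simp

text \<open>A form vanishing at \<open>x\<close> expands in the differences \<open>y_r\<close>;
  after multiplication by the units \<open>s_m\<close> and \<open>s_n\<close>, \<open>y_m\<close>
  and \<open>y_n\<close> become multiples of \<open>y_j\<close>. The coordinate \<open>x $ j\<close>
  may vanish, so every point of the curve is covered by some choice of indices.\<close>

lemma uniformizer_coordinate:
  assumes d: "distinct [i, j, m, n]" and x: "pt x \<in> Cs" and nz: "x $ i \<noteq> 0" "x $ m \<noteq> 0" "x $ n \<noteq> 0"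
  shows "uniformizer Cs (pt x) (\<lambda>v. x $ i * v $ j - x $ j * v $ i)"
proof (rule uniformizerI[OF Cs_proj])
  let ?y = "\<lambda>r v. x $ i * v $ r - x $ r * v $ i" and ?s = "\<lambda>r v. x $ i * v $ r + x $ r * v $ i"
  have yf: "form UNIV 1 (?y r)" and sf: "form UNIV 1 (?s r)" for r
    by (intro form_diff form.add form_cmult form_coord)+
  show "form UNIV 1 (?y j)" by (rule yf)
  show "x $ i * x $ j - x $ j * x $ i = 0" by simp
  fix c l assume l: "form UNIV c l" "l x = 0"
  define x' where "x' = (1 / x $ i) *s x"
  have x'i: "x' $ i = 1" using nz by (simp add: x'_def)
  have "l x' = 0" unfolding x'_def using form_zero_smult[OF l] by blast
  then obtain g where g: "\<And>r. form UNIV (c - 1) (g r)" "\<And>v. l v = (\<Sum>r\<in>UNIV. (v $ r - x' $ r * v $ i) * g r v)"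
    using form_expand[OF l(1) x'i] by auto
  have xl: "x $ i * l v = ?y j v * g j v + ?y m v * g m v + ?y n v * g n v" for v
  proof -
    have "x $ i * l v = (\<Sum>r\<in>UNIV. ?y r v * g r v)"
      unfolding g(2) sum_distrib_left by (rule sum.cong) (use nz in \<open>auto simp: x'_def field_simps\<close>)
    also have "\<dots> = ?y i v * g i v + ?y j v * g j v + ?y m v * g m v + ?y n v * g n v" by (rule sum_four[OF d])
    finally show ?thesis by simp
  qed
  let ?g = "\<lambda>v. (x $ i * dt i j) * (?s m v * ?s n v)"
  let ?h = "\<lambda>v. dt i j * (?s m v * ?s n v * g j v) + dt i m * (?s j v * ?s n v * g m v) + dt i n * (?s j v * ?s m v * g n v)"
  have "form UNIV (1 + 1) ?g" by (intro form_cmult form_mult[OF sf sf refl])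
  moreover have "form UNIV (1 + 1 + (c - 1)) ?h"
    by (intro form.add form_cmult form_mult[OF form_mult[OF sf sf refl] g(1) refl])
  moreover have "?g x \<noteq> 0" using nz dt_nz[of i j] d by simp
  moreover have "l v * ?g v = ?y j v * ?h v" if v: "pt v \<in> Cs" for v
  proof -
    have "l v * ?g v = (x $ i * l v) * dt i j * (?s m v * ?s n v)" by (simp add: mult_ac)
    also have "\<dots> = dt i j * (?s m v * ?s n v * (?y j v * g j v)) + (dt i j * (?y m v * ?s m v)) * (?s n v * g m v)
      + (dt i j * (?y n v * ?s n v)) * (?s m v * g n v)" unfolding xl by (simp only: algebra_simps)
    also have "\<dots> = ?y j v * ?h v" unfolding difference_relation[OF x v, of i j] by (simp only: algebra_simps)
    finally show ?thesis .
  qed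
  ultimately show "\<exists>e e' g h. form UNIV e g \<and> form UNIV e' h \<and> g x \<noteq> 0 \<and>
      (\<forall>v. pt v \<in> Cs \<longrightarrow> l v * g v = ?y j v * h v)" by blast
qed

lemma order_0:
  assumes x: "pt x \<in> Cs" and f: "form UNIV d f" "f x \<noteq> 0"
  shows "has_order Cs (pt x) f 0"
proof -
  have "\<exists>i j m n. distinct [i, j, m, n] \<and> x $ i \<noteq> 0 \<and> x $ m \<noteq> 0 \<and> x $ n \<noteq> 0"
  proof (cases "\<exists>j. x $ j = 0")
    case True
    then obtain j where j: "x $ j = 0" by blast
    obtain i m n where d: "distinct [i, m, n, j]" using four_complement by blast
    then have "x $ i \<noteq> 0" "x $ m \<noteq> 0" "x $ n \<noteq> 0" using not_two_zero[OF x, of _ j] j by auto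
    then show ?thesis using d by (intro exI[of _ i] exI[of _ j] exI[of _ m] exI[of _ n]) auto
  next
    case False
    then show ?thesis by (intro exI[of _ 1] exI[of _ 2] exI[of _ 3] exI[of _ 4]) auto
  qed
  then obtain i j m n where "distinct [i, j, m, n]" "x $ i \<noteq> 0" "x $ m \<noteq> 0" "x $ n \<noteq> 0" by blast
  from has_orderI[OF Cs_proj uniformizer_coordinate[OF this(1) x this(2-4)] form.const[of 1 UNIV] f(1) _ f(2), of f 0]
  show ?thesis by simp
qed

lemma lf_expand:
  assumes "distinct [i, j, m, n]" "lf l x = 0"
  shows "x $ i * lf l v = l j * (x $ i * v $ j - x $ j * v $ i) + l m * (x $ i * v $ m - x $ m * v $ i) + l n * (x $ i * v $ n - x $ n * v $ i)"
proof -
  have "l i * x $ i + l j * x $ j + l m * x $ m + l n * x $ n = 0"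
    using assms(2) unfolding lf_def sum_four[OF assms(1)] .
  then have "x $ i * l i = - (l j * x $ j + l m * x $ m + l n * x $ n)"
    by (simp add: eq_neg_iff_add_eq_0 algebra_simps)
  then have *: "x $ i * l i * v $ i = - (l j * x $ j + l m * x $ m + l n * x $ n) * v $ i" by simp
  have "x $ i * lf l v = x $ i * l i * v $ i + x $ i * (l j * v $ j + l m * v $ m + l n * v $ n)"
    unfolding lf_def sum_four[OF assms(1)] by (simp add: algebra_simps)
  then show ?thesis unfolding * by (simp add: algebra_simps)
qed

text \<open>Up to units, the quotient of \<open>lf l\<close> by the uniformizer takes at
  \<open>x\<close> the value on the left of \<open>tr\<close>. So \<open>tr\<close> says that the
  plane does not contain the tangent at \<open>x\<close>.\<close>

lemma order_1:
  assumes d: "distinct [i, j, m, n]" and x: "pt x \<in> Cs" and nz: "x $ i \<noteq> 0" "x $ m \<noteq> 0" "x $ n \<noteq> 0"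
    and l: "lf l x = 0" and tr: "dt i j * (l j * x $ m * x $ n) + dt i m * (l m * x $ j * x $ n) + dt i n * (l n * x $ j * x $ m) \<noteq> 0"
  shows "has_order Cs (pt x) (lf l) 1"
proof (rule has_orderI[OF Cs_proj uniformizer_coordinate[OF d x nz]])
  let ?y = "\<lambda>r v. x $ i * v $ r - x $ r * v $ i" and ?s = "\<lambda>r v. x $ i * v $ r + x $ r * v $ i"
  have sf: "form UNIV 1 (?s r)" for r by (intro form.add form_cmult form_coord)
  let ?g = "\<lambda>v. (x $ i * dt i j) * (?s m v * ?s n v)"
  let ?h = "\<lambda>v. dt i j * (l j * (?s m v * ?s n v)) + dt i m * (l m * (?s j v * ?s n v)) + dt i n * (l n * (?s j v * ?s m v))"
  show "form UNIV (1 + 1) ?g" by (intro form_cmult form_mult[OF sf sf refl])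
  show "form UNIV (1 + 1) ?h" by (intro form.add form_cmult form_mult[OF sf sf refl])
  show "?g x \<noteq> 0" using nz dt_nz[of i j] d by simp
  have "?h x = 4 * (x $ i)^2 * (dt i j * (l j * x $ m * x $ n) + dt i m * (l m * x $ j * x $ n) + dt i n * (l n * x $ j * x $ m))"
    by (simp add: algebra_simps power2_eq_square)
  then show "?h x \<noteq> 0" using tr nz by simp
  fix v assume v: "pt v \<in> Cs"
  have "lf l v * ?g v = (x $ i * lf l v) * dt i j * (?s m v * ?s n v)" by (simp add: mult_ac)
  also have "\<dots> = dt i j * (l j * ?y j v * (?s m v * ?s n v)) + (dt i j * (?y m v * ?s m v)) * (l m * ?s n v)
      + (dt i j * (?y n v * ?s n v)) * (l n * ?s m v)" unfolding lf_expand[OF d l] by (simp only: algebra_simps)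
  also have "\<dots> = ?y j v * ?h v" unfolding difference_relation[OF x v, of i j] by (simp only: algebra_simps)
  finally show "lf l v * ?g v = ?y j v ^ 1 * ?h v" by simp
qed

text \<open>Since \<open>x $ j = 0\<close>, the unit \<open>s_j\<close> is replaced by
  \<open>y_j\<close> itself and the relation between the differences yields its square: the
  projection from the vertex \<open>j\<close>, along which the plane is pulled back, ramifies at
  \<open>x\<close>.\<close>

lemma order_2:
  assumes d: "distinct [i, j, m, n]" and x: "pt x \<in> Cs" and z: "x $ j = 0" "l j = 0"
    and l: "lf l x = 0" and tr: "dt i m * (l m * x $ n) + dt i n * (l n * x $ m) \<noteq> 0"
  shows "has_order Cs (pt x) (lf l) 2"
proof -
  have nz: "x $ i \<noteq> 0" "x $ m \<noteq> 0" "x $ n \<noteq> 0" using not_two_zero[OF x, of i j] not_two_zero[OF x, of m j] not_two_zero[OF x, of n j] z d by auto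
  let ?y = "\<lambda>r v. x $ i * v $ r - x $ r * v $ i" and ?s = "\<lambda>r v. x $ i * v $ r + x $ r * v $ i"
  have sf: "form UNIV 1 (?s r)" for r by (intro form.add form_cmult form_coord)
  let ?g = "\<lambda>v. (x $ i * dt i j) * (?s m v * ?s n v)"
  let ?h = "\<lambda>v. dt i m * (l m * ?s n v) + dt i n * (l n * ?s m v)"
  show ?thesis
  proof (rule has_orderI[OF Cs_proj uniformizer_coordinate[OF d x nz]])
    show "form UNIV (1 + 1) ?g" by (intro form_cmult form_mult[OF sf sf refl])
    show "form UNIV 1 ?h" by (intro form.add form_cmult sf)
    show "?g x \<noteq> 0" using nz dt_nz[of i j] d by simp
    have "?h x = 2 * x $ i * (dt i m * (l m * x $ n) + dt i n * (l n * x $ m))"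
      by (simp add: algebra_simps)
    then show "?h x \<noteq> 0" using tr nz by simp
    fix v assume v: "pt v \<in> Cs"
    have yj: "?s j v = ?y j v" using z by simp
    have "lf l v * ?g v = (x $ i * lf l v) * dt i j * (?s m v * ?s n v)" by (simp add: mult_ac)
    also have "\<dots> = (dt i j * (?y m v * ?s m v)) * (l m * ?s n v)
        + (dt i j * (?y n v * ?s n v)) * (l n * ?s m v)" unfolding lf_expand[OF d l] z by (simp only: algebra_simps mult_zero_left add_0_left)
    also have "\<dots> = (?y j v * ?s j v) * ?h v" unfolding difference_relation[OF x v, of i j] by (simp only: algebra_simps)
    finally show "lf l v * ?g v = ?y j v ^ 2 * ?h v" unfolding yj by (simp only: power2_eq_square)
  qed
qed

text \<open>The relations make the Gram determinant of the first two coordinates equal to that of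
  the third alone, which is 0; it is also \<open>e1 * e2 * (x1 * p2 - x2 * p1)^2\<close>. Behind it:
  a smooth conic contains no line.\<close>

lemma isotropic_proportional:
  fixes x1 x2 x3 p1 p2 p3 e1 e2 e3 :: 'a
  assumes "e1 * x1^2 + e2 * x2^2 + e3 * x3^2 = 0" "e1 * p1^2 + e2 * p2^2 + e3 * p3^2 = 0"
    "e1 * x1 * p1 + e2 * x2 * p2 + e3 * x3 * p3 = 0" "e1 \<noteq> 0" "e2 \<noteq> 0"
  shows "x1 * p2 = x2 * p1"
proof -
  have 1: "e3 * x3^2 = - (e1 * x1^2 + e2 * x2^2)" using assms(1) unfolding add_eq_0_iff .
  have 2: "e3 * p3^2 = - (e1 * p1^2 + e2 * p2^2)" using assms(2) unfolding add_eq_0_iff .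
  have 3: "e3 * x3 * p3 = - (e1 * x1 * p1 + e2 * x2 * p2)" using assms(3) unfolding add_eq_0_iff .
  have "(e3 * x3^2) * (e3 * p3^2) = (e3 * x3 * p3)^2" by (simp add: power2_eq_square mult_ac)
  then have "(e1 * x1^2 + e2 * x2^2) * (e1 * p1^2 + e2 * p2^2) = (e1 * x1 * p1 + e2 * x2 * p2)^2"
    unfolding 1 2 3 minus_mult_minus power2_minus .
  then have "(e1 * x1^2 + e2 * x2^2) * (e1 * p1^2 + e2 * p2^2) - (e1 * x1 * p1 + e2 * x2 * p2)^2 = 0"
    by simp
  moreover have "(e1 * x1^2 + e2 * x2^2) * (e1 * p1^2 + e2 * p2^2) - (e1 * x1 * p1 + e2 * x2 * p2)^2
    = e1 * e2 * (x1 * p2 - x2 * p1)^2" by (simp add: algebra_simps power2_eq_square)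
  ultimately show ?thesis using assms(4,5) by simp
qed

text \<open>Equality of the images under the projection from the coordinate point of index
  \<rho>.\<close>

definition same :: "4 \<Rightarrow> 'a ^ 4 \<Rightarrow> 'a ^ 4 \<Rightarrow> bool" where
  "same \<rho> x y \<longleftrightarrow> pt x = pt y \<or> pt x = pt (flip {\<rho>} y)"

lemma pt_flip_cong: "pt x = pt y \<Longrightarrow> pt (flip S x) = pt (flip S y)"
  unfolding pt_eq_iff by (metis flip_smult)

lemma pt_flip_eq: "pt (flip S x) = pt y \<longleftrightarrow> pt x = pt (flip S y)"
  using pt_flip_cong flip_flip by metis

lemma same_sym: "same \<rho> x y \<Longrightarrow> same \<rho> y x"
  unfolding same_def using pt_flip_eq by metis

lemma same_trans: "same \<rho> x y \<Longrightarrow> same \<rho> y z \<Longrightarrow> same \<rho> x z"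
  unfolding same_def using pt_flip_cong flip_flip by metis

text \<open>The conic relation gives the square of the fourth coordinate from the other three. The
  factor \<open>c\<close> is non-zero because no two coordinates vanish together.\<close>

lemma sameI:
  assumes d: "distinct [i, j, m, \<rho>]" and x: "pt x \<in> Cs" and p: "pt p \<in> Cs"
    and "x $ i = c * p $ i" "x $ j = c * p $ j" "x $ m = c * p $ m"
  shows "same \<rho> x p"
proof -
  have "dt i j * (x $ \<rho>)^2 = - (dt j \<rho> * (x $ i)^2 + dt \<rho> i * (x $ j)^2)"
    using conic[OF x, of j \<rho> i] unfolding add_eq_0_iff .
  also have "\<dots> = c^2 * - (dt j \<rho> * (p $ i)^2 + dt \<rho> i * (p $ j)^2)"
    unfolding assms(4,5) by (simp add: algebra_simps power_mult_distrib)
  also have "- (dt j \<rho> * (p $ i)^2 + dt \<rho> i * (p $ j)^2) = dt i j * (p $ \<rho>)^2"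
    using conic[OF p, of j \<rho> i] unfolding add_eq_0_iff by simp
  finally have "dt i j * (x $ \<rho>)^2 = dt i j * (c * p $ \<rho>)^2" by (simp add: power_mult_distrib mult_ac)
  then have "(x $ \<rho>)^2 = (c * p $ \<rho>)^2" using dt_nz[of i j] d by simp
  then have sgn: "x $ \<rho> = c * p $ \<rho> \<or> x $ \<rho> = - (c * p $ \<rho>)" unfolding power2_eq_iff .
  have "c \<noteq> 0" using not_two_zero[OF x, of i j] assms(4,5) d by auto
  have "x = c *s p \<or> x = c *s flip {\<rho>} p"
  proof -
    from sgn show ?thesis
    proof
      assume "x $ \<rho> = c * p $ \<rho>"
      then have "x $ r = (c *s p) $ r" for r using four_cases[OF d, of r] assms by auto
      then show ?thesis by (simp add: vec_eq_iff)
    next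
      assume "x $ \<rho> = - (c * p $ \<rho>)"
      then have "x $ r = (c *s flip {\<rho>} p) $ r" for r using four_cases[OF d, of r] assms by (auto simp: flip_nth)
      then show ?thesis by (simp add: vec_eq_iff)
    qed
  qed
  then show ?thesis unfolding same_def using pt_smult[OF \<open>c \<noteq> 0\<close>] by metis
qed

lemma same_minors:
  assumes d: "distinct [i, j, m, \<rho>]" and x: "pt x \<in> Cs" and p: "pt p \<in> Cs"
    and "x $ i * p $ j = x $ j * p $ i" "x $ i * p $ m = x $ m * p $ i" "x $ j * p $ m = x $ m * p $ j"
  shows "same \<rho> x p"
proof (cases "p $ i = 0")
  case False
  show ?thesis by (rule sameI[OF d x p, of "x $ i / p $ i"]) (use assms(4-6) False in \<open>simp_all add: field_simps\<close>)
next
  case True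
  then have "p $ j \<noteq> 0" using not_two_zero[OF p, of i j] d by auto
  then show ?thesis by (intro sameI[OF d x p, of "x $ j / p $ j"]) (use assms(4-6) in \<open>simp_all add: field_simps\<close>)
qed

lemma same_orthogonal:
  assumes d: "distinct [i, j, m, \<rho>]" and x: "pt x \<in> Cs" and p: "pt p \<in> Cs"
    and B: "dt j m * x $ i * p $ i + dt m i * x $ j * p $ j + dt i j * x $ m * p $ m = 0"
  shows "same \<rho> x p"
proof -
  have e: "dt j m \<noteq> 0" "dt m i \<noteq> 0" "dt i j \<noteq> 0" using d dt_nz by auto
  note c = conic[OF x, of j m i] conic[OF p, of j m i]
  show ?thesis
  proof (rule same_minors[OF d x p])
    show "x $ i * p $ j = x $ j * p $ i" by (rule isotropic_proportional[OF c B e(1,2)])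
    show "x $ i * p $ m = x $ m * p $ i"
      by (rule isotropic_proportional[of "dt j m" _ "dt i j" _ "dt m i" "x $ j" _ _ "p $ j"]) (use c B e in \<open>simp_all add: algebra_simps\<close>)
    show "x $ j * p $ m = x $ m * p $ j"
      by (rule isotropic_proportional[of "dt m i" _ "dt i j" _ "dt j m" "x $ i" _ _ "p $ i"]) (use c B e in \<open>simp_all add: algebra_simps\<close>)
  qed
qed

end

section \<open>Plane sections through a vertex\<close>

context standard_curves
begin

text \<open>The plane through \<open>p\<close>, \<open>s\<close> and the vertex of index \<rho>,
  that is, the pullback of a chord of the conic onto which the curve is projected.\<close>

definition chord :: "4 \<Rightarrow> 'a ^ 4 \<Rightarrow> 'a ^ 4 \<Rightarrow> (4 \<Rightarrow> 'a) \<Rightarrow> bool" where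
  "chord \<rho> p s l \<longleftrightarrow> l \<rho> = 0 \<and> (\<exists>r. l r \<noteq> 0) \<and> lf l p = 0 \<and> lf l s = 0"

lemma four_complement2: "i \<noteq> \<rho> \<Longrightarrow> \<exists>j m :: 4. distinct [i, j, m, \<rho>]"
proof -
  assume i: "i \<noteq> \<rho>"
  obtain a b c where d: "distinct [a, b, c, \<rho>]" using four_complement by blast
  then consider "i = a" | "i = b" | "i = c" using four_cases[OF d, of i] i by blast
  then show ?thesis
  proof cases
    case 1 then show ?thesis using d by (intro exI[of _ b] exI[of _ c]) auto
  next
    case 2 then show ?thesis using d by (intro exI[of _ a] exI[of _ c]) auto
  next
    case 3 then show ?thesis using d by (intro exI[of _ a] exI[of _ b]) auto
  qed
qed

lemma lf_three: "distinct [i, j, m, \<rho>] \<Longrightarrow> l \<rho> = 0 \<Longrightarrow> lf l v = l i * v $ i + l j * v $ j + l m * v $ m"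
  unfolding lf_def by (subst sum_four) auto

lemma chord_exists:
  assumes p: "pt p \<in> Cs" and s: "pt s \<in> Cs" and ns: "\<not> same \<rho> p s"
  shows "\<exists>l. chord \<rho> p s l"
proof -
  obtain i j m where d: "distinct [i, j, m, \<rho>]" using four_complement by blast
  \<comment> \<open>The cross product of the two points in the coordinates other than
    \<rho>.\<close>
  define l where "l r = (if r = i then p $ j * s $ m - p $ m * s $ j else if r = j then p $ m * s $ i - p $ i * s $ m
    else if r = m then p $ i * s $ j - p $ j * s $ i else 0)" for r
  have lv: "l i = p $ j * s $ m - p $ m * s $ j" "l j = p $ m * s $ i - p $ i * s $ m" "l m = p $ i * s $ j - p $ j * s $ i" "l \<rho> = 0"
    using d by (auto simp: l_def)
  have "\<exists>r. l r \<noteq> 0"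
  proof (rule ccontr)
    assume "\<not> ?thesis"
    then have "l i = 0" "l j = 0" "l m = 0" by blast+
    then have "same \<rho> p s" unfolding lv by (intro same_minors[OF d p s]) (simp_all add: algebra_simps)
    then show False using ns by blast
  qed
  moreover have "lf l p = 0" "lf l s = 0"
    unfolding lf_three[where l = l, OF d lv(4)] lv(1-3) by (simp_all add: algebra_simps)
  ultimately show ?thesis using lv(4) unfolding chord_def by blast
qed

text \<open>A line meets a conic in at most two points. In the coordinates other than \<rho>,
  \<open>x\<close> is \<open>c p + c' s\<close>, and the conic form takes there the value
  \<open>2 c c' B p s\<close>; as \<open>B p s\<close> is non-zero, \<open>c\<close> or
  \<open>c'\<close> vanishes.\<close>

lemma chord_zeros:
  assumes p: "pt p \<in> Cs" and s: "pt s \<in> Cs" and ns: "\<not> same \<rho> p s" and l: "chord \<rho> p s l"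
    and x: "pt x \<in> Cs" "lf l x = 0"
  shows "same \<rho> x p \<or> same \<rho> x s"
proof -
  have l0: "l \<rho> = 0" "lf l p = 0" "lf l s = 0" using l unfolding chord_def by auto
  obtain i where i: "l i \<noteq> 0" using l unfolding chord_def by blast
  then have "i \<noteq> \<rho>" using l0 by auto
  then obtain j m where d: "distinct [i, j, m, \<rho>]" using four_complement2 by blast
  have eq: "v $ i = - (l j * v $ j + l m * v $ m) / l i" if "lf l v = 0" for v
  proof -
    have "l i * v $ i + (l j * v $ j + l m * v $ m) = 0" using that unfolding lf_three[where l = l, OF d l0(1)] by (simp add: add.assoc)
    then have "l i * v $ i = - (l j * v $ j + l m * v $ m)" by (simp only: eq_neg_iff_add_eq_0)
    then show ?thesis using i by (simp add: field_simps)
  qed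
  note pi = eq[OF l0(2)] and si = eq[OF l0(3)] and xi = eq[OF x(2)]
  define w where "w = p $ j * s $ m - p $ m * s $ j"
  have w: "w \<noteq> 0"
  proof
    assume w0: "w = 0"
    have "l i * (p $ i * s $ j - p $ j * s $ i) = - l m * (p $ m * s $ j - p $ j * s $ m)"
      unfolding pi si using i by (simp add: field_simps)
    then have 1: "p $ i * s $ j = p $ j * s $ i" using w0 i unfolding w_def by simp
    have "l i * (p $ i * s $ m - p $ m * s $ i) = - l j * (p $ j * s $ m - p $ m * s $ j)"
      unfolding pi si using i by (simp add: field_simps)
    then have 2: "p $ i * s $ m = p $ m * s $ i" using w0 i unfolding w_def by simp
    have "same \<rho> p s" by (rule same_minors[OF d p s 1 2]) (use w0 in \<open>simp add: w_def\<close>)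
    then show False using ns by blast
  qed
  define c where "c = (x $ j * s $ m - x $ m * s $ j) / w"
  define c' where "c' = (p $ j * x $ m - p $ m * x $ j) / w"
  have cw: "c * w = x $ j * s $ m - x $ m * s $ j" "c' * w = p $ j * x $ m - p $ m * x $ j" using w by (simp_all add: c_def c'_def)
  have "w * (c * p $ j + c' * s $ j) = (c * w) * p $ j + (c' * w) * s $ j" by (simp add: algebra_simps)
  also have "\<dots> = w * x $ j" unfolding cw by (simp add: w_def algebra_simps)
  finally have xj: "x $ j = c * p $ j + c' * s $ j" using w by simp
  have "w * (c * p $ m + c' * s $ m) = (c * w) * p $ m + (c' * w) * s $ m" by (simp add: algebra_simps)
  also have "\<dots> = w * x $ m" unfolding cw by (simp add: w_def algebra_simps)
  finally have xm: "x $ m = c * p $ m + c' * s $ m" using w by simp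
  have xi': "x $ i = c * p $ i + c' * s $ i"
    unfolding xi pi si xj xm using i by (simp add: field_simps)
  define B where "B u v = dt j m * u $ i * v $ i + dt m i * u $ j * v $ j + dt i j * u $ m * v $ m" for u v :: "'a ^ 4"
  have Bz: "B v v = 0" if "pt v \<in> Cs" for v using conic[OF that, of j m i] by (simp add: B_def power2_eq_square mult.assoc)
  have "B x x = c^2 * B p p + 2 * c * c' * B p s + c'^2 * B s s"
    unfolding B_def xi' xj xm by (simp add: algebra_simps power2_eq_square)
  then have "c * c' * B p s = 0" using Bz[OF x(1)] Bz[OF p] Bz[OF s] by simp
  moreover have "B p s \<noteq> 0" using same_orthogonal[OF d p s] ns unfolding B_def by blast
  ultimately have "c = 0 \<or> c' = 0" by simp
  then show ?thesis
    using sameI[OF d x(1) p, of c] sameI[OF d x(1) s, of c'] xi' xj xm by auto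
qed

text \<open>The line cut out by a chord meets the conic transversally, since it is no tangent.\<close>

lemma chord_transversal:
  assumes p: "pt p \<in> Cs" and s: "pt s \<in> Cs" and ns: "\<not> same \<rho> p s" and l: "chord \<rho> p s l"
    and x: "pt x \<in> Cs" "lf l x = 0" and d: "distinct [i, m, n, \<rho>]" and xi: "x $ i \<noteq> 0"
  shows "dt i m * (l m * x $ n) + dt i n * (l n * x $ m) \<noteq> 0"
proof
  assume 0: "dt i m * (l m * x $ n) + dt i n * (l n * x $ m) = 0"
  have l0: "l \<rho> = 0" "lf l p = 0" "lf l s = 0" using l unfolding chord_def by auto
  have e: "dt m n \<noteq> 0" "dt n i \<noteq> 0" "dt i m \<noteq> 0" using d dt_nz by auto
  \<comment> \<open>Two entries of the gradient of the conic at \<open>x\<close>. Failure of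
    transversality makes \<open>l\<close> proportional to the gradient, so the line would be the
    tangent at \<open>x\<close>, which meets the conic in the image of \<open>x\<close>
    only.\<close>
  define Tm Tn where "Tm = dt n i * x $ m" and "Tn = dt i m * x $ n"
  have cr: "Tn * l m = Tm * l n" using 0 unfolding Tm_def Tn_def dt_sym[of n i] by (simp add: algebra_simps eq_neg_iff_add_eq_0)
  have "\<not> (x $ m = 0 \<and> x $ n = 0)" using not_two_zero[OF x(1), of m n] d by auto
  then have "Tm \<noteq> 0 \<or> Tn \<noteq> 0" using e unfolding Tm_def Tn_def by auto
  then obtain c where c: "l m = c * Tm" "l n = c * Tn"
  proof
    assume "Tm \<noteq> 0"
    then show thesis using cr by (intro that[of "l m / Tm"]) (simp_all add: field_simps)
  next
    assume "Tn \<noteq> 0"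
    then show thesis using cr by (intro that[of "l n / Tn"]) (simp_all add: field_simps)
  qed
  have "l i * x $ i + l m * x $ m + l n * x $ n = 0" using x(2) unfolding lf_three[where l = l, OF d l0(1)] .
  then have A: "l i * x $ i + c * (dt n i * (x $ m)^2 + dt i m * (x $ n)^2) = 0"
    unfolding c Tm_def Tn_def by (simp add: algebra_simps power2_eq_square)
  have "dt n i * (x $ m)^2 + dt i m * (x $ n)^2 = - (dt m n * (x $ i)^2)"
    using conic[OF x(1), of m n i] by (simp add: eq_neg_iff_add_eq_0 algebra_simps)
  with A have "l i * x $ i = c * (dt m n * (x $ i)^2)" by simp
  then have "x $ i * l i = x $ i * (c * (dt m n * x $ i))" by (simp only: power2_eq_square mult_ac)
  then have ci: "l i = c * (dt m n * x $ i)" using mult_left_cancel[OF xi] by blast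
  have "c \<noteq> 0"
  proof
    assume "c = 0"
    then have "l r = 0" for r using four_cases[OF d, of r] ci c l0 by auto
    then show False using l unfolding chord_def by blast
  qed
  have "same \<rho> x q" if q: "pt q \<in> Cs" "lf l q = 0" for q
  proof (rule same_orthogonal[OF d x(1) q(1)])
    have "c * (dt m n * x $ i * q $ i + dt n i * x $ m * q $ m + dt i m * x $ n * q $ n) = 0"
      using q(2) unfolding lf_three[where l = l, OF d l0(1)] ci c Tm_def Tn_def by (simp add: algebra_simps)
    then show "dt m n * x $ i * q $ i + dt n i * x $ m * q $ m + dt i m * x $ n * q $ n = 0" using \<open>c \<noteq> 0\<close> by simp
  qed
  then have "same \<rho> x p" "same \<rho> x s" using p s l0 by blast+
  then show False using ns same_sym same_trans by blast
qed

text \<open>The multiplicity of a point in the effective divisor listed by \<open>xs\<close>,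
  vectors being compared as projective points.\<close>

definition cnt :: "('a ^ 4) list \<Rightarrow> 'a ^ 4 \<Rightarrow> nat" where
  "cnt xs x = length (filter (\<lambda>y. pt y = pt x) xs)"

lemma cnt_append: "cnt (xs @ ys) x = cnt xs x + cnt ys x"
  by (simp add: cnt_def)

lemma cnt_zero: "pt x \<notin> pt ` set xs \<Longrightarrow> cnt xs x = 0"
  unfolding cnt_def by (induction xs) auto

lemma cnt_distinct: "distinct (map pt xs) \<Longrightarrow> y \<in> set xs \<Longrightarrow> pt x = pt y \<Longrightarrow> cnt xs x = 1"
proof (induction xs)
  case (Cons z zs)
  show ?case
  proof (cases "pt x = pt z")
    case True
    then have "cnt zs x = 0" using Cons.prems(1) by (intro cnt_zero) simp
    then show ?thesis using True by (simp add: cnt_def)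
  next
    case False
    then have "y \<in> set zs" using Cons.prems by auto
    then have "cnt zs x = 1" using Cons by simp
    then show ?thesis using False by (simp add: cnt_def eq_commute[of "pt z"])
  qed
qed simp

lemma cnt_pair:
  assumes x: "pt x \<in> Cs" and p: "pt p \<in> Cs"
  shows "cnt [p, flip {\<rho>} p] x = (if same \<rho> x p then if x $ \<rho> = 0 then 2 else 1 else 0)"
proof (cases "same \<rho> x p")
  case False
  then show ?thesis unfolding same_def cnt_def by auto
next
  case True
  show ?thesis
  proof (cases "x $ \<rho> = 0")
    case z: True
    have "p $ \<rho> = 0" using True z unfolding same_def pt_eq_iff by (auto simp: flip_nth)
    then have "flip {\<rho>} p = p" by (simp add: vec_eq_iff flip_nth)
    then show ?thesis using True z unfolding same_def cnt_def by auto
  next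
    case nz: False
    have "pt p \<noteq> pt (flip {\<rho>} p)"
    proof
      assume "pt p = pt (flip {\<rho>} p)"
      then obtain c where c: "p = c *s flip {\<rho>} p" unfolding pt_eq_iff by blast
      have "p $ \<rho> \<noteq> 0" using True nz unfolding same_def pt_eq_iff by (auto simp: flip_nth)
      moreover have "p $ \<rho> = - c * p $ \<rho>" using arg_cong[OF c, of "\<lambda>v. v $ \<rho>"] by (simp add: flip_nth)
      ultimately have "c = -1" by (metis minus_minus mult_cancel_right1)
      have "p $ r = 0" if "r \<noteq> \<rho>" for r
      proof -
        have "p $ r = - p $ r" using arg_cong[OF c, of "\<lambda>v. v $ r"] that \<open>c = -1\<close> by (simp add: flip_nth)
        then have "2 * p $ r = 0" by (simp add: eq_neg_iff_add_eq_0)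
        then show ?thesis by simp
      qed
      moreover obtain i j m where "distinct [i, j, m, \<rho>]" using four_complement by blast
      ultimately show False using not_two_zero[OF p, of i j] by auto
    qed
    then show ?thesis using True nz unfolding same_def cnt_def by auto
  qed
qed

text \<open>The divisor of a chord is the sum of the fibres through \<open>p\<close> and
  \<open>s\<close>. Order 2 occurs exactly at the ramification points of the projection, where
  coordinate \<rho> vanishes.\<close>

lemma chord_order:
  assumes p: "pt p \<in> Cs" and s: "pt s \<in> Cs" and ns: "\<not> same \<rho> p s" and l: "chord \<rho> p s l" and x: "pt x \<in> Cs"
  shows "has_order Cs (pt x) (lf l) (cnt [p, flip {\<rho>} p, s, flip {\<rho>} s] x)"
proof -
  have l0: "l \<rho> = 0" "lf l p = 0" "lf l s = 0" using l unfolding chord_def by auto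
  have c: "cnt [p, flip {\<rho>} p, s, flip {\<rho>} s] x = cnt [p, flip {\<rho>} p] x + cnt [s, flip {\<rho>} s] x"
    using cnt_append[of "[p, flip {\<rho>} p]" "[s, flip {\<rho>} s]" x] by simp
  show ?thesis
  proof (cases "lf l x = 0")
    case False
    have fl: "lf l (flip {\<rho>} v) = lf l v" for v
      unfolding lf_def by (rule sum.cong) (auto simp: flip_nth l0)
    have "lf l x = 0" if "same \<rho> x q" "lf l q = 0" for q
      using that fl[of q] lf_smult unfolding same_def pt_eq_iff by auto
    then have "\<not> same \<rho> x p" "\<not> same \<rho> x s" using False l0 by blast+
    then have "cnt [p, flip {\<rho>} p, s, flip {\<rho>} s] x = 0" unfolding c cnt_pair[OF x p] cnt_pair[OF x s] by simp
    then show ?thesis using order_0[OF x lf_form False] by simp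
  next
    case True
    have "same \<rho> x p \<or> same \<rho> x s" by (rule chord_zeros[OF p s ns l x True])
    moreover have "\<not> (same \<rho> x p \<and> same \<rho> x s)" using ns same_sym same_trans by blast
    ultimately have c': "cnt [p, flip {\<rho>} p, s, flip {\<rho>} s] x = (if x $ \<rho> = 0 then 2 else 1)"
      unfolding c cnt_pair[OF x p] cnt_pair[OF x s] by auto
    show ?thesis
    proof (cases "x $ \<rho> = 0")
      case z: True
      obtain i m n where d: "distinct [i, m, n, \<rho>]" using four_complement by blast
      then have xi: "x $ i \<noteq> 0" using not_two_zero[OF x, of i \<rho>] z by auto
      have d': "distinct [i, \<rho>, m, n]" using d by auto
      show ?thesis unfolding c' using z order_2[OF d' x z l0(1) True chord_transversal[OF p s ns l x True d xi]] by simp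
    next
      case nz: False
      have "\<exists>i j m. distinct [i, j, m, \<rho>] \<and> x $ i \<noteq> 0 \<and> x $ m \<noteq> 0"
      proof (cases "\<exists>j. x $ j = 0")
        case True
        then obtain j where j: "x $ j = 0" by blast
        then have "j \<noteq> \<rho>" using nz by auto
        then obtain i m where d: "distinct [j, i, m, \<rho>]" using four_complement2 by blast
        then have "x $ i \<noteq> 0" "x $ m \<noteq> 0" using not_two_zero[OF x, of i j] not_two_zero[OF x, of m j] j by auto
        then show ?thesis using d by (intro exI[of _ i] exI[of _ j] exI[of _ m]) auto
      next
        case False
        then show ?thesis using four_complement[of \<rho>] by blast
      qed
      then obtain i j m where d: "distinct [i, j, m, \<rho>]" and xim: "x $ i \<noteq> 0" "x $ m \<noteq> 0" by blast
      have "dt i j * (l j * x $ m) + dt i m * (l m * x $ j) \<noteq> 0"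
        by (rule chord_transversal[OF p s ns l x True d xim(1)])
      then have "x $ \<rho> * (dt i j * (l j * x $ m) + dt i m * (l m * x $ j)) \<noteq> 0" using nz by simp
      then have "dt i j * (l j * x $ m * x $ \<rho>) + dt i m * (l m * x $ j * x $ \<rho>) + dt i \<rho> * (l \<rho> * x $ j * x $ m) \<noteq> 0"
        using l0(1) by (simp add: algebra_simps)
      from order_1[OF d x xim nz True this] show ?thesis unfolding c' using nz by simp
    qed
  qed
qed

text \<open>For generic \<open>p\<close> the plane through \<open>-p\<close>, its translate by \<open>T\<close>, and \<open>T\<close> meets the curve
  again in \<open>2p\<close>.\<close>

definition plane :: "'a ^ 4 \<Rightarrow> 4 \<Rightarrow> 'a" where
  "plane p r = (if r = 1 then (p $ 4 - p $ 3) * p $ 2 else if r = 2 then (p $ 4 - p $ 3) * p $ 1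
     else if r = 3 then p $ 1 * p $ 4 else - (p $ 1 * p $ 3))"

lemma lf_plane: "lf (plane p) x = (p $ 4 - p $ 3) * (p $ 2 * x $ 1 + p $ 1 * x $ 2) + p $ 1 * (p $ 4 * x $ 3 - p $ 3 * x $ 4)"
  unfolding lf_def plane_def by (simp add: sum_4 algebra_simps)

abbreviation dbl :: "'a ^ 4 \<Rightarrow> 'a ^ 4" where "dbl p \<equiv> po (ps p)"

lemma dbl_nth:
  "dbl p $ 1 = 2 * (p $ 3 * p $ 4) * (p $ 1 * p $ 2)" "dbl p $ 3 = (p $ 3 * p $ 4)^2 - (p $ 1 * p $ 2)^2"
  "dbl p $ 4 = (p $ 3 * p $ 4)^2 + (p $ 1 * p $ 2)^2"
  by (simp_all add: po_def ps_def)

lemma dbl_2: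
  shows "dbl p $ 2 = k^2 * (p $ 1)^4 - 2 * k^2 * (p $ 1)^2 * (p $ 4)^2 + (p $ 4)^4"
proof -
  have "dbl p $ 2 = (a * a') * k^2 * (p $ 1)^4 - (a + a') * k * (p $ 1)^2 * (p $ 4)^2 + (p $ 4)^4"
    by (simp add: po_def ps_def algebra_simps power2_eq_square power4_eq_xxxx)
  then show ?thesis unfolding aa' k[symmetric] by (simp add: power2_eq_square mult_ac)
qed

text \<open>Once a factor \<open>p $ 1\<close> is taken out, \<open>p $ 1\<close> and
  \<open>p $ 2\<close> occur in even powers only; replacing their squares by the curve equations
  leaves a polynomial identity in the last two coordinates.\<close>

lemma plane_dbl:
  assumes p: "pt p \<in> Cs"
  shows "lf (plane p) (dbl p) = 0"
proof -
  define P Q R where "P = p $ 3" and "Q = p $ 4" and "R = (p $ 2)^2"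
  have p1: "(p $ 1)^2 = Q^2 - P^2" using p unfolding in_Cs P_def Q_def by simp
  have R: "R = Q^2 - k^2 * (Q^2 - P^2)" using p p1 unfolding in_Cs R_def Q_def by simp
  have p14: "(p $ 1)^4 = (Q^2 - P^2)^2" unfolding p1[symmetric] by (simp add: power4_eq_xxxx power2_eq_square mult.assoc)
  have N2: "dbl p $ 2 = k^2 * (Q^2 - P^2)^2 - 2 * k^2 * (Q^2 - P^2) * Q^2 + Q^4"
    unfolding dbl_2 p1 p14 by (simp add: Q_def)
  have N3: "dbl p $ 3 = P^2 * Q^2 - (Q^2 - P^2) * R" and N4: "dbl p $ 4 = P^2 * Q^2 + (Q^2 - P^2) * R"
    unfolding dbl_nth power_mult_distrib p1 R_def[symmetric] by (simp_all add: P_def Q_def)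
  have "p $ 2 * dbl p $ 1 = p $ 1 * (2 * P * Q * R)"
    unfolding dbl_nth R_def P_def Q_def by (simp add: power2_eq_square)
  then have "lf (plane p) (dbl p) = p $ 1 * ((Q - P) * (2 * P * Q * R + dbl p $ 2) + (Q * dbl p $ 3 - P * dbl p $ 4))"
    unfolding lf_plane P_def[symmetric] Q_def[symmetric] by (simp add: algebra_simps)
  also have "(Q - P) * (2 * P * Q * R + dbl p $ 2) + (Q * dbl p $ 3 - P * dbl p $ 4) = 0"
    unfolding N2 N3 N4 R by (simp add: algebra_simps power2_eq_square power4_eq_xxxx)
  finally show ?thesis by simp
qed

text \<open>The plane is \<open>(p $ 4 - p $ 3) * u + p $ 1 * y = 0\<close>, and the curve gives
  \<open>u * u' = - (y * z)\<close>. So either \<open>u = y = 0\<close>, a line containing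
  \<open>flip {1} p\<close> and \<open>flip {2} p\<close>, or a second linear equation
  \<open>p $ 1 * u' = (p $ 4 - p $ 3) * z\<close> holds, which leads to the other two
  points.\<close>

lemma plane_zeros:
  assumes p: "pt p \<in> Cs" and nz: "p $ 1 \<noteq> 0" "p $ 2 \<noteq> 0" "p $ 4 \<noteq> 0" "p $ 4 \<noteq> p $ 3"
    and x: "pt x \<in> Cs" "lf (plane p) x = 0"
  shows "pt x = pt (dbl p) \<or> pt x = pt (flip {1, 2} Oc) \<or> pt x = pt (flip {1} p) \<or> pt x = pt (flip {2} p)"
proof -
  have x': "x \<noteq> 0" "(x $ 3)^2 = (x $ 4)^2 - (x $ 1)^2" "(x $ 2)^2 = (x $ 4)^2 - k^2 * (x $ 1)^2" using x in_Cs by auto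
  have p': "(p $ 3)^2 = (p $ 4)^2 - (p $ 1)^2" "(p $ 2)^2 = (p $ 4)^2 - k^2 * (p $ 1)^2" using p in_Cs by auto
  define y where "y = p $ 4 * x $ 3 - p $ 3 * x $ 4"
  define z where "z = p $ 4 * x $ 3 + p $ 3 * x $ 4"
  define u where "u = p $ 2 * x $ 1 + p $ 1 * x $ 2"
  define u' where "u' = p $ 2 * x $ 1 - p $ 1 * x $ 2"
  have l0: "(p $ 4 - p $ 3) * u + p $ 1 * y = 0" using x(2) unfolding lf_plane u_def y_def .
  have "u * u' = (p $ 2)^2 * (x $ 1)^2 - (p $ 1)^2 * (x $ 2)^2" unfolding u_def u'_def by (simp add: algebra_simps power2_eq_square)
  also have "\<dots> = (p $ 4)^2 * (x $ 1)^2 - (p $ 1)^2 * (x $ 4)^2" unfolding x'(3) p'(2) by (simp add: algebra_simps)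
  also have "\<dots> = - ((p $ 4)^2 * (x $ 3)^2 - (p $ 3)^2 * (x $ 4)^2)" unfolding x'(2) p'(1) by (simp add: algebra_simps)
  also have "\<dots> = - (y * z)" unfolding y_def z_def by (simp add: algebra_simps power2_eq_square)
  finally have uu: "u * u' = - (y * z)" .
  show ?thesis
  proof (cases "y = 0")
    case True
    then have u0: "u = 0" using l0 nz by simp
    define c where "c = x $ 4 / p $ 4"
    have c: "x $ 4 = c * p $ 4" "x $ 3 = c * p $ 3" using True nz unfolding c_def y_def by (simp_all add: field_simps)
    have "(x $ 1)^2 = (x $ 4)^2 - (x $ 3)^2" using x'(2) by simp
    also have "\<dots> = (c * p $ 1)^2" unfolding c power_mult_distrib p'(1) by (simp add: algebra_simps)
    finally have "x $ 1 = c * p $ 1 \<or> x $ 1 = - (c * p $ 1)" unfolding power2_eq_iff .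
    moreover have x2: "p $ 1 * x $ 2 = - (p $ 2 * x $ 1)" using u0 unfolding u_def by (simp add: eq_neg_iff_add_eq_0 add.commute)
    have "p $ 1 * x $ 2 = p $ 1 * (- (c * p $ 2))" if "x $ 1 = c * p $ 1" unfolding x2 that by (simp add: mult_ac)
    then have "x $ 2 = - (c * p $ 2)" if "x $ 1 = c * p $ 1" using that nz(1) mult_left_cancel by blast
    moreover have "p $ 1 * x $ 2 = p $ 1 * (c * p $ 2)" if "x $ 1 = - (c * p $ 1)" unfolding x2 that by (simp add: mult_ac)
    then have "x $ 2 = c * p $ 2" if "x $ 1 = - (c * p $ 1)" using that nz(1) mult_left_cancel by blast
    ultimately have "x = c *s flip {1} p \<or> x = c *s flip {2} p"
      using c by (auto simp: vec_eq_iff forall_4 flip_nth)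
    moreover from this have "c \<noteq> 0" using x'(1) by auto
    ultimately show ?thesis using pt_smult by metis
  next
    case False
    have "p $ 1 * y = - ((p $ 4 - p $ 3) * u)" using l0 by (simp add: eq_neg_iff_add_eq_0 add.commute)
    then have "p $ 1 * y * u' = - ((p $ 4 - p $ 3) * (u * u'))" by simp
    then have "y * (p $ 1 * u') = y * ((p $ 4 - p $ 3) * z)" unfolding uu by (simp add: mult_ac)
    then have pu': "p $ 1 * u' = (p $ 4 - p $ 3) * z" using mult_left_cancel[OF False] by blast
    \<comment> \<open>The last two coordinates of \<open>ps p\<close>;
      \<open>2 \<theta> \<psi>\<close>, \<open>\<theta>^2 - \<psi>^2\<close> and
      \<open>\<theta>^2 + \<psi>^2\<close> are coordinates 1, 3 and 4 of
      \<open>dbl p\<close>.\<close>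
    define \<theta> \<psi> where "\<theta> = p $ 3 * p $ 4" and "\<psi> = p $ 1 * p $ 2"
    have \<psi>: "\<psi> \<noteq> 0" using nz by (simp add: \<psi>_def)
    have "(p $ 4 - p $ 3) * (2 * \<psi> * x $ 1) = (p $ 4 - p $ 3) * (p $ 1 * u + p $ 1 * u')"
      unfolding u_def u'_def \<psi>_def by (simp add: algebra_simps)
    also have "\<dots> = p $ 1 * ((p $ 4 - p $ 3) * u) + (p $ 4 - p $ 3) * (p $ 1 * u')" by (simp add: algebra_simps)
    also have "(p $ 4 - p $ 3) * u = - (p $ 1 * y)" using l0 by (simp add: eq_neg_iff_add_eq_0)
    also have "p $ 1 * - (p $ 1 * y) + (p $ 4 - p $ 3) * (p $ 1 * u') = (p $ 4 - p $ 3) * ((p $ 4 - p $ 3) * z) - (p $ 1)^2 * y"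
      unfolding pu' by (simp add: power2_eq_square)
    also have "(p $ 1)^2 = (p $ 4 - p $ 3) * (p $ 4 + p $ 3)" using p'(1) by (simp add: algebra_simps power2_eq_square)
    also have "(p $ 4 - p $ 3) * ((p $ 4 - p $ 3) * z) - (p $ 4 - p $ 3) * (p $ 4 + p $ 3) * y = (p $ 4 - p $ 3) * (2 * \<theta> * (x $ 4 - x $ 3))"
      unfolding z_def y_def \<theta>_def by (simp add: algebra_simps)
    finally have "2 * (\<psi> * x $ 1) = 2 * (\<theta> * (x $ 4 - x $ 3))" using nz(4) by (simp only: mult_left_cancel mult.assoc right_minus_eq not_False_eq_True) 
    then have x1: "\<psi> * x $ 1 = \<theta> * (x $ 4 - x $ 3)" by simp
    have x1sq: "(x $ 1)^2 = (x $ 4 - x $ 3) * (x $ 4 + x $ 3)" using x'(2) by (simp add: algebra_simps power2_eq_square)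
    have x2: "(p $ 4 - p $ 3) * (p $ 1 * x $ 2) = - ((p $ 4 - p $ 3) * (p $ 2 * x $ 1) + p $ 1 * y)"
      using l0 unfolding u_def by (simp add: eq_neg_iff_add_eq_0 algebra_simps)
    show ?thesis
    proof (cases "x $ 4 = x $ 3")
      case True
      then have "x $ 1 = 0" using x1 \<psi> by simp
      have "(p $ 4 - p $ 3) * p $ 1 * x $ 2 = (p $ 4 - p $ 3) * p $ 1 * (- x $ 4)"
        using x2 unfolding \<open>x $ 1 = 0\<close> y_def True[symmetric] by (simp add: algebra_simps)
      moreover have "(p $ 4 - p $ 3) * p $ 1 \<noteq> 0" using nz by simp
      ultimately have "x $ 2 = - x $ 4" using mult_left_cancel by blast
      then have "x = x $ 4 *s flip {1, 2} Oc" using True \<open>x $ 1 = 0\<close> by (simp add: vec_eq_iff forall_4 flip_nth Oc_def)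
      moreover from this have "x $ 4 \<noteq> 0" using x'(1) by auto
      ultimately show ?thesis using pt_smult by metis
    next
      case ne: False
      have "(x $ 4 - x $ 3) * (\<psi>^2 * (x $ 4 + x $ 3)) = (\<psi> * x $ 1)^2" unfolding power_mult_distrib x1sq by (simp add: mult_ac)
      also have "\<dots> = (x $ 4 - x $ 3) * (\<theta>^2 * (x $ 4 - x $ 3))" unfolding x1 by (simp add: power2_eq_square mult_ac)
      finally have s: "\<psi>^2 * (x $ 4 + x $ 3) = \<theta>^2 * (x $ 4 - x $ 3)" using ne by simp
      define c where "c = (x $ 4 - x $ 3) / (2 * \<psi>^2)"
      have c: "x $ 4 - x $ 3 = 2 * c * \<psi>^2" using \<psi> by (simp add: c_def)
      have "\<psi>^2 * (x $ 4 + x $ 3) = \<psi>^2 * (2 * c * \<theta>^2)" unfolding s c by (simp add: mult_ac)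
      then have c2: "x $ 4 + x $ 3 = 2 * c * \<theta>^2" using \<psi> by simp
      have "2 * x $ 4 = 2 * (c * dbl p $ 4)" "2 * x $ 3 = 2 * (c * dbl p $ 3)"
        unfolding dbl_nth \<theta>_def[symmetric] \<psi>_def[symmetric] using c c2 by (simp_all add: algebra_simps)
      then have x34: "x $ 4 = c * dbl p $ 4" "x $ 3 = c * dbl p $ 3" by simp_all
      have "\<psi> * x $ 1 = \<psi> * (c * dbl p $ 1)"
        unfolding x1 c dbl_nth \<theta>_def[symmetric] \<psi>_def[symmetric] by (simp add: power2_eq_square mult_ac)
      then have x1': "x $ 1 = c * dbl p $ 1" using \<psi> by simp
      have "c * lf (plane p) (dbl p) = 0" unfolding plane_dbl[OF p] by simp
      then have "(p $ 4 - p $ 3) * (p $ 1 * (c * dbl p $ 2)) = - ((p $ 4 - p $ 3) * (p $ 2 * x $ 1) + p $ 1 * y)"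
        unfolding lf_plane y_def x34 x1' by (simp add: eq_neg_iff_add_eq_0 algebra_simps)
      then have "(p $ 4 - p $ 3) * (p $ 1 * x $ 2) = (p $ 4 - p $ 3) * (p $ 1 * (c * dbl p $ 2))" using x2 by simp
      then have "x $ 2 = c * dbl p $ 2" using nz by simp
      then have "x = c *s dbl p" using x34 x1' by (simp add: vec_eq_iff forall_4)
      moreover from this have "c \<noteq> 0" using x'(1) by auto
      ultimately show ?thesis using pt_smult by metis
    qed
  qed
qed

text \<open>The first three factors make the points distinct; the last three are the transversality
  conditions at \<open>-p\<close>, \<open>-p + T\<close> and \<open>2p\<close>.\<close>

definition tangency :: "'a ^ 4 \<Rightarrow> 'a ^ 4 \<Rightarrow> 'a" where
  "tangency p x = (p $ 1 * p $ 4) * (x $ 1 * x $ 2) - ((p $ 4 - p $ 3) * p $ 2) * (x $ 3 * x $ 2) + k^2 * (((p $ 4 - p $ 3) * p $ 1) * (x $ 3 * x $ 1))"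

definition generic :: "'a ^ 4 \<Rightarrow> 'a" where
  "generic p = p $ 3 * ((p $ 1 * p $ 2) * (p $ 4 * (p $ 4 - p $ 3)) * (dbl p $ 2 * dbl p $ 4) * (p $ 4 * dbl p $ 3 - p $ 3 * dbl p $ 4)
     * (tangency p (flip {1} p) * tangency p (flip {2} p)) * tangency p (dbl p))"

lemma plane_order_at:
  assumes x: "pt x \<in> Cs" and l: "lf (plane p) x = 0" and nz: "x $ 4 \<noteq> 0" "x $ 1 \<noteq> 0" "x $ 2 \<noteq> 0" and t: "tangency p x \<noteq> 0"
  shows "has_order Cs (pt x) (lf (plane p)) 1"
proof (rule order_1[of 4 3 1 2])
  show "dt 4 3 * (plane p 3 * x $ 1 * x $ 2) + dt 4 1 * (plane p 1 * x $ 3 * x $ 2) + dt 4 2 * (plane p 2 * x $ 3 * x $ 1) \<noteq> 0"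
    using t unfolding dt_def pc_def qc_def plane_def tangency_def by (simp add: algebra_simps)
qed (use assms in auto)

lemma flip12_Oc [simp]: "flip {1} (flip {1, 2} Oc) = flip {1, 2} Oc" "flip {2} Oc = flip {1, 2} Oc" "flip {1} Oc = Oc"
  by (simp_all add: vec_eq_iff forall_4 flip_nth Oc_def)

lemma plane_order:
  assumes p: "pt p \<in> Cs" and gp: "generic p \<noteq> 0" and x: "pt x \<in> Cs"
  shows "has_order Cs (pt x) (lf (plane p)) (cnt [dbl p, flip {1, 2} Oc, flip {1} p, flip {2} p] x)"
proof -
  have nz: "p $ 1 \<noteq> 0" "p $ 2 \<noteq> 0" "p $ 3 \<noteq> 0" "p $ 4 \<noteq> 0" "p $ 4 \<noteq> p $ 3" "dbl p $ 2 \<noteq> 0" "dbl p $ 4 \<noteq> 0"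
    "p $ 4 * dbl p $ 3 - p $ 3 * dbl p $ 4 \<noteq> 0" "tangency p (flip {1} p) \<noteq> 0" "tangency p (flip {2} p) \<noteq> 0" "tangency p (dbl p) \<noteq> 0"
    using gp unfolding generic_def by auto
  have N1: "dbl p $ 1 \<noteq> 0" unfolding dbl_nth using nz by simp
  have N: "pt (dbl p) \<in> Cs" using po_in(2)[OF ps_in(2)[OF p]] .
  let ?xs = "[dbl p, flip {1, 2} Oc, flip {1} p, flip {2} p]"
  have d: "pt (dbl p) \<noteq> pt (flip {1, 2} Oc)" "pt (dbl p) \<noteq> pt (flip {1} p)" "pt (dbl p) \<noteq> pt (flip {2} p)"
    "pt (flip {1, 2} Oc) \<noteq> pt (flip {1} p)" "pt (flip {1, 2} Oc) \<noteq> pt (flip {2} p)"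
  proof -
    show "pt (dbl p) \<noteq> pt (flip {1, 2} Oc)"
    proof
      assume "pt (dbl p) = pt (flip {1, 2} Oc)"
      then obtain c where "dbl p = c *s flip {1, 2} Oc" unfolding pt_eq_iff by blast
      then have "dbl p $ 1 = 0" by (simp add: flip_nth Oc_def)
      then show False using N1 by blast
    qed
    show "pt (dbl p) \<noteq> pt (flip {1} p)"
    proof
      assume "pt (dbl p) = pt (flip {1} p)"
      then obtain c where "dbl p = c *s flip {1} p" unfolding pt_eq_iff by blast
      then have "dbl p $ 3 = c * p $ 3" "dbl p $ 4 = c * p $ 4" by (simp_all add: flip_nth)
      then show False using nz(8) by simp
    qed
    show "pt (dbl p) \<noteq> pt (flip {2} p)"
    proof
      assume "pt (dbl p) = pt (flip {2} p)"
      then obtain c where "dbl p = c *s flip {2} p" unfolding pt_eq_iff by blast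
      then have "dbl p $ 3 = c * p $ 3" "dbl p $ 4 = c * p $ 4" by (simp_all add: flip_nth)
      then show False using nz(8) by simp
    qed
    show "pt (flip {1, 2} Oc) \<noteq> pt (flip {1} p)" "pt (flip {1, 2} Oc) \<noteq> pt (flip {2} p)"
      using nz(1) unfolding pt_eq_iff by (auto simp: vec_eq_iff forall_4 flip_nth Oc_def)
  qed
  have "flip {1, 2} (flip {2} p) = flip {1} p" by (simp add: vec_eq_iff forall_4 flip_nth)
  then have d': "pt (flip {1} p) \<noteq> pt (flip {2} p)" using tau_no_fixed_point[OF flip_Cs[OF p, of "{2}"]] by simp
  have l12: "lf (plane p) (flip {1} p) = 0" "lf (plane p) (flip {2} p) = 0" "lf (plane p) (flip {1, 2} Oc) = 0"
    unfolding lf_plane by (simp_all add: flip_nth Oc_def algebra_simps)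
  have ord: "has_order Cs (pt y) (lf (plane p)) 1" if "y \<in> set ?xs" for y
  proof -
    consider "y = dbl p" | "y = flip {1, 2} Oc" | "y = flip {1} p" | "y = flip {2} p" using \<open>y \<in> set ?xs\<close> by auto
    then show ?thesis
    proof cases
      case 1
      then show ?thesis using plane_order_at[OF N plane_dbl[OF p] nz(7) N1 nz(6,11)] by simp
    next
      case 2
      \<comment> \<open>As the first coordinate vanishes at this point, only one term of the
        transversality condition is left, and it is \<open>(p $ 4 - p $ 3) * p $ 2\<close> up to
        sign.\<close>
      have "has_order Cs (pt (flip {1, 2} Oc)) (lf (plane p)) 1"
        by (rule order_1[of 4 1 2 3, OF _ flip_Cs[OF Oc_in] _ _ _ l12(3)])
          (use nz in \<open>auto simp: flip_nth Oc_def plane_def dt_def pc_def qc_def\<close>)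
      then show ?thesis using 2 by simp
    next
      case 3
      then show ?thesis using plane_order_at[OF flip_Cs[OF p] l12(1) _ _ _ nz(9)] nz by (simp add: flip_nth)
    next
      case 4
      then show ?thesis using plane_order_at[OF flip_Cs[OF p] l12(2) _ _ _ nz(10)] nz by (simp add: flip_nth)
    qed
  qed
  show ?thesis
  proof (cases "lf (plane p) x = 0")
    case True
    then obtain y where y: "y \<in> set ?xs" "pt x = pt y" using plane_zeros[OF p nz(1,2,4,5) x] by auto
    have "distinct (map pt ?xs)" using d d' by simp
    then have "cnt ?xs x = 1" by (rule cnt_distinct[OF _ y])
    then show ?thesis using ord[OF y(1)] y(2) by simp
  next
    case False
    have "lf (plane p) y = 0" if "y \<in> set ?xs" for y using that l12 plane_dbl[OF p] by auto
    then have "pt x \<noteq> pt y" if "y \<in> set ?xs" for y using that False lf_smult[of "plane p"] unfolding pt_eq_iff by force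
    then have "cnt ?xs x = 0" by (intro cnt_zero) blast
    then show ?thesis using order_0[OF x lf_form False] by simp
  qed
qed

lemma dbl_form: "form_tuple UNIV 4 dbl"
  by (rule form_tuple_comp[OF po_form ps_form]) simp

lemma generic_form: "\<exists>d. form UNIV d generic"
proof -
  note N = form_tuple_nth[OF dbl_form] and co = form_coord
  have t: "form UNIV (1 + 1 + (e + e)) (\<lambda>p. tangency p (h p))" if "form_tuple UNIV e h" for e and h :: "'a ^ 4 \<Rightarrow> 'a ^ 4"
    unfolding tangency_def
    by (intro form.add form_diff form_cmult form_mult[OF form_mult[OF _ _ refl] form_mult[OF form_tuple_nth[OF that] form_tuple_nth[OF that] refl] refl] form_diff co)
  show ?thesis
    unfolding generic_def
    by (rule exI) (rule form_mult[OF co form_mult[OF form_mult[OF form_mult[OF form_mult[OF form_mult[OF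
      form_mult[OF co co refl] form_mult[OF co form_diff[OF co co] refl] refl] form_mult[OF N N refl] refl]
      form_diff[OF form_mult[OF co N refl] form_mult[OF co N refl]] refl] form_mult[OF t[OF flip_form] t[OF flip_form] refl] refl]
      t[OF dbl_form] refl] refl])
qed

lemma generic_exists:
  assumes "irr_curve Cs"
  obtains d x where "form UNIV d generic" "pt x \<in> Cs" "generic x \<noteq> 0"
proof -
  \<comment> \<open>The point \<open>W\<close> with \<open>cn = 0\<close> makes all factors of
    \<open>generic\<close> except \<open>p $ 3\<close> easy to evaluate and non-zero;
    \<open>Oc\<close> serves for that factor, and irreducibility combines the two.\<close>
  obtain e where e: "e^2 = 1 - k^2" using nth_root_exists[of 2 "1 - k^2"] by auto
  have e0: "e \<noteq> 0" using e k2 by auto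
  define W where "W = (vector [1, e, 0, 1] :: 'a ^ 4)"
  have W: "W $ 1 = 1" "W $ 2 = e" "W $ 3 = 0" "W $ 4 = 1" by (simp_all add: W_def)
  have "W \<noteq> 0" using W(1) by (metis zero_index zero_neq_one)
  then have WC: "pt W \<in> Cs" unfolding in_Cs W e by simp
  have N: "dbl W $ 1 = 0" "dbl W $ 2 = e^2" "dbl W $ 3 = - (e^2)" "dbl W $ 4 = e^2"
    unfolding dbl_2 dbl_nth W using e by (simp_all add: algebra_simps)
  let ?R = "\<lambda>p. (p $ 1 * p $ 2) * (p $ 4 * (p $ 4 - p $ 3)) * (dbl p $ 2 * dbl p $ 4) * (p $ 4 * dbl p $ 3 - p $ 3 * dbl p $ 4)
     * (tangency p (flip {1} p) * tangency p (flip {2} p)) * tangency p (dbl p)"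
  have R: "?R W \<noteq> 0" unfolding N W tangency_def using e0 by (simp add: flip_nth W)
  obtain d where d: "form UNIV d generic" using generic_form by blast
  have "\<exists>d. form UNIV d ?R"
  proof -
    note N = form_tuple_nth[OF dbl_form] and co = form_coord
    have t: "form UNIV (1 + 1 + (e + e)) (\<lambda>p. tangency p (h p))" if "form_tuple UNIV e h" for e and h :: "'a ^ 4 \<Rightarrow> 'a ^ 4"
      unfolding tangency_def
      by (intro form.add form_diff form_cmult form_mult[OF form_mult[OF _ _ refl] form_mult[OF form_tuple_nth[OF that] form_tuple_nth[OF that] refl] refl] form_diff co)
    show ?thesis
      by (rule exI) (rule form_mult[OF form_mult[OF form_mult[OF form_mult[OF form_mult[OF
        form_mult[OF co co refl] form_mult[OF co form_diff[OF co co] refl] refl] form_mult[OF N N refl] refl]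
        form_diff[OF form_mult[OF co N refl] form_mult[OF co N refl]] refl] form_mult[OF t[OF flip_form] t[OF flip_form] refl] refl]
        t[OF dbl_form] refl])
  qed
  then obtain d' where d': "form UNIV d' ?R" by blast
  have "Oc $ 3 \<noteq> 0" by (simp add: Oc_def)
  then obtain x where "pt x \<in> Cs" "x $ 3 \<noteq> 0" "?R x \<noteq> 0"
    using irr_curve_nonzero_mult[OF assms form_coord d' Oc_in _ WC R] by blast
  then show thesis using that d unfolding generic_def by simp
qed

end

section \<open>Linear equivalences on the curve\<close>

lemma divisor_degree_superset:
  assumes "finite S" "Poly_Mapping.keys D \<subseteq> S"
  shows "divisor_degree D = (\<Sum>P\<in>S. Poly_Mapping.lookup D P)"
  unfolding divisor_degree_def
  by (rule sum.mono_neutral_left) (use assms in \<open>auto simp: in_keys_iff\<close>)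

lemma divisor_degree_add: "divisor_degree (D + D') = divisor_degree D + divisor_degree D'"
proof -
  let ?S = "Poly_Mapping.keys D \<union> Poly_Mapping.keys D'"
  have "Poly_Mapping.keys (D + D') \<subseteq> ?S" by (rule Poly_Mapping.keys_add)
  then show ?thesis
    using divisor_degree_superset[of ?S D] divisor_degree_superset[of ?S D'] divisor_degree_superset[of ?S "D + D'"]
    by (simp add: lookup_add sum.distrib)
qed

lemma divisor_degree_minus: "divisor_degree (- D) = - divisor_degree D"
  unfolding divisor_degree_def by (simp add: sum_negf)

lemma divisor_degree_frag_of: "divisor_degree (frag_of P) = 1"
  unfolding divisor_degree_def by (simp add: keys_frag_of)

definition dv :: "('a::field, 'n::finite) ppoint list \<Rightarrow> ('a, 'n) divisor" where
  "dv Ps = (\<Sum>P\<leftarrow>Ps. frag_of P)"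

lemma dv_simps [simp]: "dv [] = 0" "dv (P # Ps) = frag_of P + dv Ps"
  by (simp_all add: dv_def)

lemma divisor_degree_dv: "divisor_degree (dv Ps) = int (length Ps)"
  by (induction Ps) (simp_all add: divisor_degree_add divisor_degree_frag_of divisor_degree_superset[of "{}"])

lemma keys_dv: "Poly_Mapping.keys (dv Ps) \<subseteq> set Ps"
proof (induction Ps)
  case (Cons P Ps)
  have "Poly_Mapping.keys (frag_of P + dv Ps) \<subseteq> Poly_Mapping.keys (frag_of P) \<union> Poly_Mapping.keys (dv Ps)"
    by (rule Poly_Mapping.keys_add)
  then show ?case using Cons by (auto simp: keys_frag_of)
qed simp

lemma keys_dv_diff: "Poly_Mapping.keys (dv Ps - dv Qs) \<subseteq> set Ps \<union> set Qs"
  using Poly_Mapping.keys_diff[of "dv Ps" "dv Qs"] keys_dv[of Ps] keys_dv[of Qs] by blast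

lemma div0_dv: "set Ps \<subseteq> C \<Longrightarrow> set Qs \<subseteq> C \<Longrightarrow> length Ps = length Qs \<Longrightarrow> dv Ps - dv Qs \<in> div0 C"
  using keys_dv_diff[of Ps Qs] divisor_degree_add[of "dv Ps" "- dv Qs"]
  unfolding div0_def by (auto simp: divisor_degree_minus divisor_degree_dv)

lemma div0_add: "D \<in> div0 C \<Longrightarrow> D' \<in> div0 C \<Longrightarrow> D + D' \<in> div0 C"
  unfolding div0_def using Poly_Mapping.keys_add[of D D'] by (auto simp: divisor_degree_add)

lemma ell_add_origin: "ell_add E P origin = P"
  by (simp add: ell_add_def)

text \<open>All linear equivalences are applied in this form, where the only law of
  \<open>ell_add\<close> that enters is \<open>ell_add E P origin = P\<close>.\<close>

lemma jacobian_class: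
  assumes add: "\<And>D D'. D \<in> div0 C \<Longrightarrow> D' \<in> div0 C \<Longrightarrow> j (D + D') = ell_add E (j D) (j D')"
    and "j Z = origin" "Z \<in> div0 C" "D \<in> div0 C"
  shows "j (D + Z) = j D"
  using add[OF assms(4,3)] assms(2) ell_add_origin by metis

text \<open>\<open>L\<close> is the change of coordinates to the standard curve.
  \<open>irrCs\<close> is an assumption because irreducibility comes from the elliptic curve through
  an Abel-Jacobi isomorphism.\<close>

locale curve_with_jacobian = standard_curves a a' k
  for a a' k :: "'a::{alg_closed_field, field_char_0}" +
  fixes L L' :: "'a ^ 4 \<Rightarrow> 'a ^ 4" and C :: "('a, 4) ppoint set" and E :: "'a weierstrass"
    and j :: "('a, 4) divisor \<Rightarrow> ('a, 3) ppoint"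
  assumes L: "form_tuple UNIV 1 L" and L': "form_tuple UNIV 1 L'"
    and LL': "L (L' v) = v" and L'L: "L' (L v) = v"
    and C: "C \<subseteq> proj_space" "pt v \<in> C \<longleftrightarrow> pt (L v) \<in> Cs"
    and add: "D \<in> div0 C \<Longrightarrow> D' \<in> div0 C \<Longrightarrow> j (D + D') = ell_add E (j D) (j D')"
    and zero: "D \<in> div0 C \<Longrightarrow> principal C D \<Longrightarrow> j D = origin"
    and irrCs: "irr_curve Cs"
begin

definition pnt :: "'a ^ 4 \<Rightarrow> ('a, 4) ppoint" where "pnt x = pt (L' x)"

lemma pnt_in: "pnt x \<in> C \<longleftrightarrow> pt x \<in> Cs"
  unfolding pnt_def C LL' ..

lemma pnt_eq: "pnt x = pnt y \<longleftrightarrow> pt x = pt y"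
proof
  assume "pnt x = pnt y"
  then obtain c where "c \<noteq> 0" "L' x = c *s L' y" unfolding pnt_def pt_eq_iff by blast
  then have "L (L' x) = c *s L (L' y)" using form_tuple_homog[OF L, of c] by simp
  then show "pt x = pt y" unfolding LL' using \<open>c \<noteq> 0\<close> pt_smult by metis
next
  assume "pt x = pt y"
  then obtain c where "c \<noteq> 0" "x = c *s y" unfolding pt_eq_iff by blast
  then show "pnt x = pnt y" unfolding pnt_def using form_tuple_pt_smult[OF L'] by simp
qed

lemma pnt_surj: "P \<in> C \<Longrightarrow> \<exists>x. P = pnt x \<and> pt x \<in> Cs"
proof -
  assume P: "P \<in> C"
  then obtain v where "P = pt v" using proj_setE[OF C(1)] by metis
  then show ?thesis using P C(2) unfolding pnt_def by (metis L'L)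
qed

lemma lookup_dv: "Poly_Mapping.lookup (dv (map pnt xs)) (pnt x) = int (cnt xs x)"
  by (induction xs) (auto simp: cnt_def lookup_add pnt_eq)

lemma principal_lists:
  assumes xs: "\<And>x. x \<in> set xs \<union> set ys \<Longrightarrow> pt x \<in> Cs"
    and ord: "\<And>x. pt x \<in> Cs \<Longrightarrow> has_order Cs (pt x) (lf f) (cnt xs x)" "\<And>x. pt x \<in> Cs \<Longrightarrow> has_order Cs (pt x) (lf g) (cnt ys x)"
  shows "principal C (dv (map pnt xs) - dv (map pnt ys))"
  unfolding principal_def
proof (intro conjI)
  show "Poly_Mapping.keys (dv (map pnt xs) - dv (map pnt ys)) \<subseteq> C"
    using keys_dv_diff[of "map pnt xs" "map pnt ys"] xs pnt_in by auto
  show "\<exists>d f g. form UNIV d f \<and> form UNIV d g \<and> (\<forall>P\<in>C. \<exists>m n. has_order C P f m \<and> has_order C P g n \<and>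
      Poly_Mapping.lookup (dv (map pnt xs) - dv (map pnt ys)) P = int m - int n)"
  proof (rule exI[of _ 1], rule exI[of _ "\<lambda>v. lf f (L v)"], rule exI[of _ "\<lambda>v. lf g (L v)"], intro conjI ballI)
    show "form UNIV 1 (\<lambda>v. lf f (L v))" "form UNIV 1 (\<lambda>v. lf g (L v))"
      by (rule form_comp[OF lf_form L], simp)+
    fix P assume "P \<in> C"
    then obtain x where x: "P = pnt x" "pt x \<in> Cs" using pnt_surj by blast
    have "has_order C P (\<lambda>v. lf f (L v)) (cnt xs x)" "has_order C P (\<lambda>v. lf g (L v)) (cnt ys x)"
      unfolding x(1) pnt_def
      by (rule has_order_linear[OF L L' LL' L'L Cs_proj C ord(1)[OF x(2)]], rule has_order_linear[OF L L' LL' L'L Cs_proj C ord(2)[OF x(2)]])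
    moreover have "Poly_Mapping.lookup (dv (map pnt xs) - dv (map pnt ys)) P = int (cnt xs x) - int (cnt ys x)"
      unfolding x(1) lookup_minus lookup_dv ..
    ultimately show "\<exists>m n. has_order C P (\<lambda>v. lf f (L v)) m \<and> has_order C P (\<lambda>v. lf g (L v)) n \<and>
      Poly_Mapping.lookup (dv (map pnt xs) - dv (map pnt ys)) P = int m - int n" by blast
  qed
qed

text \<open>\<open>Oc\<close>, \<open>flip {3} Oc\<close> and \<open>W\<close> lie in pairwise
  different fibres of the projection, so one of them avoids the fibres of \<open>p\<close> and
  \<open>r\<close>.\<close>

lemma three_points:
  assumes "\<rho> = 1 \<or> \<rho> = 2" and p: "pt p \<in> Cs" and r: "pt r \<in> Cs"
  obtains s where "pt s \<in> Cs" "\<not> same \<rho> p s" "\<not> same \<rho> r s"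
proof -
  obtain e where e: "e^2 = 1 - k^2" using nth_root_exists[of 2 "1 - k^2"] by auto
  define W where "W = (vector [1, e, 0, 1] :: 'a ^ 4)"
  have W: "W $ 1 = 1" "W $ 2 = e" "W $ 3 = 0" "W $ 4 = 1" by (simp_all add: W_def)
  have "W \<noteq> 0" using W(1) by (metis zero_index zero_neq_one)
  then have WC: "pt W \<in> Cs" unfolding in_Cs W e by simp
  let ?s2 = "flip {3} Oc"
  have ne: "\<not> same \<rho> Oc ?s2" "\<not> same \<rho> Oc W" "\<not> same \<rho> ?s2 W"
    using assms(1) W unfolding same_def pt_eq_iff by (auto simp: vec_eq_iff forall_4 flip_nth Oc_def)
  have "\<exists>s \<in> {Oc, ?s2, W}. \<not> same \<rho> p s \<and> \<not> same \<rho> r s"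
  proof -
    have u: "\<not> (same \<rho> u x \<and> same \<rho> u y)" if "\<not> same \<rho> x y" for u x y
      using that same_trans[OF same_sym[of \<rho> u x], of y] by blast
    show ?thesis using u[OF ne(1), of p] u[OF ne(1), of r] u[OF ne(2), of p] u[OF ne(2), of r]
      u[OF ne(3), of p] u[OF ne(3), of r] by blast
  qed
  then show thesis using that Oc_in flip_Cs[OF Oc_in] WC by blast
qed

text \<open>The two chords to a common auxiliary point \<open>s\<close> share the fibre through
  \<open>s\<close>, which cancels in the quotient of the linear forms.\<close>

lemma fibre_equiv:
  assumes \<rho>: "\<rho> = 1 \<or> \<rho> = 2" and p: "pt p \<in> Cs" and r: "pt r \<in> Cs"
  shows "j (dv [pnt p, pnt (flip {\<rho>} p)] - dv [pnt r, pnt (flip {\<rho>} r)]) = origin"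
proof -
  obtain s where s: "pt s \<in> Cs" "\<not> same \<rho> p s" "\<not> same \<rho> r s" using three_points[OF assms] by blast
  obtain f where f: "chord \<rho> p s f" using chord_exists[OF p s(1,2)] by blast
  obtain g where g: "chord \<rho> r s g" using chord_exists[OF r s(1,3)] by blast
  have "principal C (dv (map pnt [p, flip {\<rho>} p, s, flip {\<rho>} s]) - dv (map pnt [r, flip {\<rho>} r, s, flip {\<rho>} s]))"
    by (rule principal_lists[OF _ chord_order[OF p s(1,2) f] chord_order[OF r s(1,3) g]])
      (use p r s flip_Cs in auto)
  moreover have "dv (map pnt [p, flip {\<rho>} p, s, flip {\<rho>} s]) - dv (map pnt [r, flip {\<rho>} r, s, flip {\<rho>} s])
     = dv [pnt p, pnt (flip {\<rho>} p)] - dv [pnt r, pnt (flip {\<rho>} r)]" by (simp add: algebra_simps)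
  ultimately have "principal C (dv [pnt p, pnt (flip {\<rho>} p)] - dv [pnt r, pnt (flip {\<rho>} r)])" by (simp only:)
  moreover have "dv [pnt p, pnt (flip {\<rho>} p)] - dv [pnt r, pnt (flip {\<rho>} r)] \<in> div0 C"
    by (rule div0_dv) (use p r flip_Cs pnt_in in auto)
  ultimately show ?thesis using zero by blast
qed

lemma fibre_div0:
  assumes "pt p \<in> Cs" "pt r \<in> Cs"
  shows "dv [pnt p, pnt (flip S p)] - dv [pnt r, pnt (flip S' r)] \<in> div0 C"
  by (rule div0_dv) (use assms flip_Cs pnt_in in auto)

text \<open>Let \<open>t\<close> be the translate of \<open>Oc\<close>. The first coordinate of
  \<open>t\<close> is 0, so its fibre under the first projection is \<open>2 t\<close>, while the
  fibre of \<open>Oc\<close> under the second is \<open>Oc + t\<close>. The difference is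
  \<open>t - Oc\<close>, and all other fibres are equivalent to these.\<close>

lemma jacobian_T:
  assumes p: "pt p \<in> Cs" and q: "pt q \<in> Cs"
  shows "j (frag_of (pnt (flip {1, 2} Oc)) - frag_of (pnt Oc)) = j (dv [pnt p, pnt (flip {1} p)] - dv [pnt q, pnt (flip {2} q)])"
proof -
  let ?t = "flip {1, 2} Oc"
  have t: "pt ?t \<in> Cs" by (rule flip_Cs[OF Oc_in])
  let ?A = "dv [pnt p, pnt (flip {1} p)] - dv [pnt q, pnt (flip {2} q)]"
  let ?B = "dv [pnt ?t, pnt (flip {1} ?t)] - dv [pnt p, pnt (flip {1} p)]"
  let ?D = "dv [pnt q, pnt (flip {2} q)] - dv [pnt Oc, pnt (flip {2} Oc)]"
  have d: "?A \<in> div0 C" "?B \<in> div0 C" "?D \<in> div0 C" using fibre_div0 p q t Oc_in by blast+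
  have "j ((?A + ?B) + ?D) = j (?A + ?B)"
    by (rule jacobian_class[OF add fibre_equiv[OF disjI2[OF refl] q Oc_in] d(3) div0_add[OF d(1,2)]])
  also have "\<dots> = j ?A"
    by (rule jacobian_class[OF add fibre_equiv[OF disjI1[OF refl] t p] d(2,1)])
  also have "(?A + ?B) + ?D = frag_of (pnt ?t) - frag_of (pnt Oc)" by (simp add: algebra_simps)
  finally show ?thesis .
qed

text \<open>With \<open>v' = flip {1} v\<close> and \<open>v'' = flip {2} v\<close>,
  \<open>?Z1\<close> is the plane section \<open>dbl v + t + v' + v''\<close> minus the chord
  section \<open>v + v' + 2 Oc\<close>; \<open>?Z2\<close> is \<open>(Oc + t) - (v + v'')\<close>
  and \<open>?Z3\<close> is \<open>2 Oc - 2 t\<close>, both differences of fibres. Together they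
  turn \<open>2 v - 2 Oc\<close> into \<open>dbl v - Oc\<close>.\<close>

lemma jacobian_double:
  assumes v: "pt v \<in> Cs" and gv: "generic v \<noteq> 0"
  shows "j (frag_of (pnt (dbl v)) - frag_of (pnt Oc))
    = ell_add E (j (frag_of (pnt v) - frag_of (pnt Oc))) (j (frag_of (pnt v) - frag_of (pnt Oc)))"
proof -
  let ?t = "flip {1, 2} Oc"
  have t: "pt ?t \<in> Cs" by (rule flip_Cs[OF Oc_in])
  have N: "pt (dbl v) \<in> Cs" using po_in(2)[OF ps_in(2)[OF v]] .
  have "v $ 1 \<noteq> 0" using gv unfolding generic_def by auto
  then have ns: "\<not> same 1 v Oc" unfolding same_def flip12_Oc(3) pt_eq_iff by (auto simp: Oc_def)
  obtain g where g: "chord 1 v Oc g" using chord_exists[OF v Oc_in ns] by blast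
  let ?Z1 = "dv [pnt (dbl v), pnt ?t, pnt (flip {1} v), pnt (flip {2} v)] - dv [pnt v, pnt (flip {1} v), pnt Oc, pnt (flip {1} Oc)]"
  have "principal C (dv (map pnt [dbl v, ?t, flip {1} v, flip {2} v]) - dv (map pnt [v, flip {1} v, Oc, flip {1} Oc]))"
    by (rule principal_lists[OF _ plane_order[OF v gv] chord_order[OF v Oc_in ns g]]) (use v N t Oc_in flip_Cs in auto)
  moreover have Z1: "?Z1 \<in> div0 C" by (rule div0_dv) (use v N t Oc_in flip_Cs pnt_in in auto)
  ultimately have jZ1: "j ?Z1 = origin" using zero by (simp only: list.map)
  let ?Z2 = "dv [pnt Oc, pnt (flip {2} Oc)] - dv [pnt v, pnt (flip {2} v)]"
  let ?Z3 = "dv [pnt Oc, pnt (flip {1} Oc)] - dv [pnt ?t, pnt (flip {1} ?t)]"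
  have d: "?Z2 \<in> div0 C" "?Z3 \<in> div0 C" using fibre_div0 v t Oc_in by blast+
  let ?A = "dv [pnt v] - dv [pnt Oc]"
  have A: "?A \<in> div0 C" by (rule div0_dv) (use v Oc_in pnt_in in auto)
  have "j (((?A + ?A) + ?Z1) + ?Z2 + ?Z3) = j (((?A + ?A) + ?Z1) + ?Z2)"
    by (rule jacobian_class[OF add fibre_equiv[OF disjI1[OF refl] Oc_in t] d(2) div0_add[OF div0_add[OF div0_add[OF A A] Z1] d(1)]])
  also have "\<dots> = j ((?A + ?A) + ?Z1)"
    by (rule jacobian_class[OF add fibre_equiv[OF disjI2[OF refl] Oc_in v] d(1) div0_add[OF div0_add[OF A A] Z1]])
  also have "\<dots> = j (?A + ?A)"
    by (rule jacobian_class[OF add jZ1 Z1 div0_add[OF A A]])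
  also have "\<dots> = ell_add E (j ?A) (j ?A)" by (rule add[OF A A])
  also have "((?A + ?A) + ?Z1) + ?Z2 + ?Z3 = frag_of (pnt (dbl v)) - frag_of (pnt Oc)" by (simp add: algebra_simps)
  finally show ?thesis by simp
qed

end

section \<open>Automorphisms of the algebraic closure\<close>

context
  fixes K :: "'k::field alg_closure set"
  defines "K \<equiv> base_field"
begin

lemma K_closed:
  "0 \<in> K" "1 \<in> K" "x \<in> K \<Longrightarrow> y \<in> K \<Longrightarrow> x + y \<in> K" "x \<in> K \<Longrightarrow> y \<in> K \<Longrightarrow> x * y \<in> K" "x \<in> K \<Longrightarrow> - x \<in> K"
  "x \<in> K \<Longrightarrow> inverse x \<in> K" "x \<in> K \<Longrightarrow> y \<in> K \<Longrightarrow> x - y \<in> K" "x \<in> K \<Longrightarrow> y \<in> K \<Longrightarrow> x / y \<in> K"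
  unfolding K_def base_field_def
  by (auto simp: to_ac_0[symmetric] to_ac_1[symmetric] to_ac_add[symmetric] to_ac_mult[symmetric] to_ac_minus[symmetric]
      to_ac_inverse[symmetric] to_ac_diff[symmetric] to_ac_divide[symmetric] simp del: to_ac_0 to_ac_1 to_ac_add to_ac_mult to_ac_minus to_ac_inverse to_ac_diff to_ac_divide)

lemma algebraic:
  obtains p :: "'k alg_closure poly" where "\<And>i. Polynomial.coeff p i \<in> K" "p \<noteq> 0" "poly p x = 0"
proof -
  obtain q :: "'k poly" where q: "q \<noteq> 0" "poly (map_poly to_ac q) x = 0" using alg_closure_algebraic by blast
  show thesis
    by (rule that[of "map_poly to_ac q"]) (use q in \<open>auto simp: coeff_map_poly K_def base_field_def poly_eq_iff\<close>)
qed

text \<open>A partial homomorphism over \<open>K\<close> is represented by its graph, a subring of the square of the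
  algebraic closure.\<close>

definition partial_hom :: "('k alg_closure \<times> 'k alg_closure) set \<Rightarrow> bool" where
  "partial_hom R \<longleftrightarrow> (\<forall>x\<in>K. (x, x) \<in> R) \<and>
     (\<forall>x y x' y'. (x, y) \<in> R \<and> (x', y') \<in> R \<longrightarrow> (x + x', y + y') \<in> R \<and> (x * x', y * y') \<in> R) \<and>
     (\<forall>y. (0, y) \<in> R \<longrightarrow> y = 0)"

definition poly_pairs :: "('k alg_closure \<times> 'k alg_closure) set \<Rightarrow> ('k alg_closure poly \<times> 'k alg_closure poly) set" where
  "poly_pairs R = {(p, q). \<forall>i. (Polynomial.coeff p i, Polynomial.coeff q i) \<in> R}"

context
  fixes R assumes R: "partial_hom R"
begin

lemma R_K: "x \<in> K \<Longrightarrow> (x, x) \<in> R"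
  by (rule R[unfolded partial_hom_def, THEN conjunct1, rule_format])

lemma R_add: "(x, y) \<in> R \<Longrightarrow> (x', y') \<in> R \<Longrightarrow> (x + x', y + y') \<in> R"
  and R_mult: "(x, y) \<in> R \<Longrightarrow> (x', y') \<in> R \<Longrightarrow> (x * x', y * y') \<in> R"
  using R[unfolded partial_hom_def, THEN conjunct2, THEN conjunct1, rule_format, of x y x' y'] by simp_all

lemma R_0: "(0, y) \<in> R \<Longrightarrow> y = 0"
  by (rule R[unfolded partial_hom_def, THEN conjunct2, THEN conjunct2, rule_format])

lemma R_zero: "(0, 0) \<in> R" and R_one: "(1, 1) \<in> R"
  by (rule R_K[OF K_closed(1)], rule R_K[OF K_closed(2)])

lemma R_minus: "(x, y) \<in> R \<Longrightarrow> (- x, - y) \<in> R"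
proof -
  assume "(x, y) \<in> R"
  moreover have "(- 1, - 1) \<in> R" by (rule R_K[OF K_closed(5)[OF K_closed(2)]])
  ultimately have "(- 1 * x, - 1 * y) \<in> R" by (rule R_mult[rotated])
  then show ?thesis by simp
qed

lemma R_functional: "(x, y) \<in> R \<Longrightarrow> (x, y') \<in> R \<Longrightarrow> y = y'"
proof -
  assume a: "(x, y) \<in> R" "(x, y') \<in> R"
  then have "(x + - x, y + - y') \<in> R" by (intro R_add R_minus)
  then have "y + - y' = 0" using R_0[of "y + - y'"] by simp
  then show ?thesis by simp
qed

lemma R_sum: "finite I \<Longrightarrow> (\<And>i. i \<in> I \<Longrightarrow> (f i, g i) \<in> R) \<Longrightarrow> (sum f I, sum g I) \<in> R"
  by (induction I rule: finite_induct) (auto intro: R_zero R_add)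

lemma R_poly: "(p, q) \<in> poly_pairs R \<Longrightarrow> (x, y) \<in> R \<Longrightarrow> (poly p x, poly q y) \<in> R"
proof -
  assume a: "(p, q) \<in> poly_pairs R" "(x, y) \<in> R"
  have pw: "(x ^ n, y ^ n) \<in> R" for n by (induction n) (auto intro: R_one R_mult a)
  let ?N = "max (Polynomial.degree p) (Polynomial.degree q)"
  have "poly p x = (\<Sum>i\<le>?N. Polynomial.coeff p i * x ^ i)" "poly q y = (\<Sum>i\<le>?N. Polynomial.coeff q i * y ^ i)"
    unfolding poly_altdef by (rule sum.mono_neutral_left; auto simp: coeff_eq_0)+
  then show ?thesis using a(1) pw by (auto simp: poly_pairs_def intro!: R_sum R_mult)
qed

lemma K_poly: "(\<And>i. Polynomial.coeff p i \<in> K) \<Longrightarrow> (p, p) \<in> poly_pairs R"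
  unfolding poly_pairs_def using R_K by auto

text \<open>The domain of a partial homomorphism is a field: an element algebraic over
  \<open>K\<close> satisfies an equation with non-zero constant term, which expresses its inverse as
  a polynomial in it.\<close>

lemma R_inverse:
  assumes "(x, y) \<in> R" "x \<noteq> 0"
  obtains x' y' where "(x', y') \<in> R" "x * x' = 1"
proof -
  obtain p where p: "\<And>i. Polynomial.coeff p i \<in> K" "p \<noteq> 0" "poly p x = 0" using algebraic by blast
  have "\<exists>q. (\<forall>i. Polynomial.coeff q i \<in> K) \<and> Polynomial.coeff q 0 \<noteq> 0 \<and> poly q x = 0"
    using p
  proof (induction p)
    case (pCons c p)
    show ?case
    proof (cases "c = 0")
      case False
      then show ?thesis using pCons by (intro exI[of _ "pCons c p"]) auto
    next
      case True
      have "Polynomial.coeff p i \<in> K" for i using pCons.prems(1)[of "Suc i"] by simp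
      moreover have "p \<noteq> 0" "poly p x = 0" using pCons.prems assms(2) True by auto
      ultimately show ?thesis using pCons.IH by blast
    qed
  qed simp
  then obtain q where q: "\<And>i. Polynomial.coeff q i \<in> K" "Polynomial.coeff q 0 \<noteq> 0" "poly q x = 0" by blast
  obtain c r where cr: "q = pCons c r" by (cases q)
  have r: "Polynomial.coeff r i \<in> K" for i using q(1)[of "Suc i"] cr by simp
  have c: "c \<in> K" "c \<noteq> 0" using q(1)[of 0] q(2) cr by auto
  have e: "x * poly r x = - c" using q(3) cr by (simp add: eq_neg_iff_add_eq_0 add.commute)
  have "(poly r x * (- inverse c), poly r y * (- inverse c)) \<in> R"
    using R_poly[OF K_poly[OF r] assms(1)] R_K[of "- inverse c"] K_closed c by (intro R_mult) auto
  moreover have "x * (poly r x * (- inverse c)) = 1" using e c by (simp add: mult.assoc[symmetric])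
  ultimately show thesis by (rule that)
qed

lemma R_inj: "(x, 0) \<in> R \<Longrightarrow> x = 0"
proof (rule ccontr)
  assume a: "(x, 0) \<in> R" "x \<noteq> 0"
  then obtain x' y' where "(x', y') \<in> R" "x * x' = 1" using R_inverse by blast
  then have "(1, 0) \<in> R" using R_mult[OF a(1)] by fastforce
  then show False using R_functional[OF R_one] by fastforce
qed

lemma pairs_degree: "(p, q) \<in> poly_pairs R \<Longrightarrow> Polynomial.degree p = Polynomial.degree q"
proof -
  assume pq: "(p, q) \<in> poly_pairs R"
  have "Polynomial.coeff p i = 0 \<longleftrightarrow> Polynomial.coeff q i = 0" for i
  proof -
    have i: "(Polynomial.coeff p i, Polynomial.coeff q i) \<in> R" using pq unfolding poly_pairs_def by simp
    show ?thesis
    proof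
      assume "Polynomial.coeff p i = 0" then show "Polynomial.coeff q i = 0" using i R_0[of "Polynomial.coeff q i"] by simp
    next
      assume "Polynomial.coeff q i = 0" then show "Polynomial.coeff p i = 0" using i R_inj[of "Polynomial.coeff p i"] by simp
    qed
  qed
  then show ?thesis unfolding Polynomial.degree_def by simp
qed

lemma pairs_zero: "(0, q) \<in> poly_pairs R \<Longrightarrow> q = 0"
  using R_0 by (auto simp: poly_pairs_def poly_eq_iff)

lemma pairs_add: "(p, q) \<in> poly_pairs R \<Longrightarrow> (p', q') \<in> poly_pairs R \<Longrightarrow> (p + p', q + q') \<in> poly_pairs R"
  unfolding poly_pairs_def by (auto intro: R_add)

lemma pairs_minus: "(p, q) \<in> poly_pairs R \<Longrightarrow> (- p, - q) \<in> poly_pairs R"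
  unfolding poly_pairs_def by (auto intro: R_minus)

lemma pairs_mult: "(p, q) \<in> poly_pairs R \<Longrightarrow> (p', q') \<in> poly_pairs R \<Longrightarrow> (p * p', q * q') \<in> poly_pairs R"
  unfolding poly_pairs_def by (auto simp: coeff_mult intro!: R_sum R_mult)

lemma pairs_monom: "(x, y) \<in> R \<Longrightarrow> (Polynomial.monom x n, Polynomial.monom y n) \<in> poly_pairs R"
  unfolding poly_pairs_def by (auto intro: R_zero)

text \<open>\<open>p\<close> is a monic annihilator of \<alpha> of least degree over the domain, and
  \<alpha>' is a root of its image \<open>q\<close>. By division, every \<open>f\<close> with root
  \<alpha> has an image with root \<alpha>', so sending \<alpha> to \<alpha>' is well
  defined.\<close>

lemma extend_partial_hom: "\<exists>R'. partial_hom R' \<and> R \<subseteq> R' \<and> (\<exists>y. (\<alpha>, y) \<in> R')"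
proof -
  define ann where "ann n \<longleftrightarrow> (\<exists>p q. (p, q) \<in> poly_pairs R \<and> p \<noteq> 0 \<and> poly p \<alpha> = 0 \<and> Polynomial.degree p = n)" for n
  obtain p0 where "\<And>i. Polynomial.coeff p0 i \<in> K" "p0 \<noteq> 0" "poly p0 \<alpha> = 0" using algebraic by blast
  then have "ann (Polynomial.degree p0)" unfolding ann_def using K_poly by blast
  define n where "n = (LEAST n. ann n)"
  have n: "ann n" unfolding n_def by (rule LeastI) fact
  have min: "\<not> ann m" if "m < n" for m using that not_less_Least unfolding n_def by blast
  obtain p1 q1 where pq1: "(p1, q1) \<in> poly_pairs R" "p1 \<noteq> 0" "poly p1 \<alpha> = 0" "Polynomial.degree p1 = n" using n unfolding ann_def by blast
  have lcR: "(Polynomial.coeff p1 n, Polynomial.coeff q1 n) \<in> R" using pq1(1) unfolding poly_pairs_def by auto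
  have lc0: "Polynomial.coeff p1 n \<noteq> 0" using pq1(2,4) leading_coeff_neq_0 by blast
  obtain c d where cd: "(c, d) \<in> R" "Polynomial.coeff p1 n * c = 1" using R_inverse[OF lcR lc0] by blast
  define p q where "p = Polynomial.monom c 0 * p1" and "q = Polynomial.monom d 0 * q1"
  have pq: "(p, q) \<in> poly_pairs R" unfolding p_def q_def by (rule pairs_mult[OF pairs_monom[OF cd(1)] pq1(1)])
  have c0: "c \<noteq> 0" using cd by auto
  have p: "poly p \<alpha> = 0" "Polynomial.degree p = n" "Polynomial.coeff p n = 1"
    using pq1 cd c0 by (auto simp: p_def monom_0 Polynomial.degree_mult_eq mult.commute)
  have q: "Polynomial.degree q = n" using pairs_degree[OF pq] p(2) by simp
  have "n > 0"
  proof (rule ccontr)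
    assume "\<not> n > 0"
    then have "p = [:1:]" using p(2,3) by (metis degree_0_id gr0I one_pCons)
    then show False using p(1) by simp
  qed
  then obtain \<alpha>' where \<alpha>': "poly q \<alpha>' = 0" using alg_closed_imp_poly_has_root[of q] q by auto
  have key: "poly g \<alpha>' = 0" if "(f, g) \<in> poly_pairs R" "poly f \<alpha> = 0" for f g
    using that
  proof (induction "Polynomial.degree f" arbitrary: f g rule: less_induct)
    case less
    show ?case
    proof (cases "Polynomial.degree f < n")
      case True
      have "f = 0"
      proof (rule ccontr)
        assume "f \<noteq> 0"
        then have "ann (Polynomial.degree f)" unfolding ann_def using less.prems by blast
        then show False using min True by blast
      qed
      then have "g = 0" using pairs_zero[of g] less.prems(1) by simp
      then show ?thesis by simp
    next
      case False
      define m where "m = Polynomial.degree f - n"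
      define x y where "x = Polynomial.coeff f (Polynomial.degree f)" and "y = Polynomial.coeff g (Polynomial.degree f)"
      have xy: "(x, y) \<in> R" using less.prems(1) unfolding x_def y_def poly_pairs_def by auto
      let ?f = "f + - (Polynomial.monom x m * p)" and ?g = "g + - (Polynomial.monom y m * q)"
      have fg: "(?f, ?g) \<in> poly_pairs R"
        by (intro pairs_add[OF less.prems(1)] pairs_minus pairs_mult pairs_monom xy pq)
      have ev: "poly ?f \<alpha> = 0" "poly ?g \<alpha>' = poly g \<alpha>'" using less.prems(2) p(1) \<alpha>' by simp_all
      have df: "Polynomial.degree f = m + n" using False m_def by simp
      have "Polynomial.coeff ?f i = 0" if "i \<ge> Polynomial.degree f" for i
      proof (cases "i = Polynomial.degree f")
        case True
        then show ?thesis using df p(3) by (simp add: coeff_monom_mult x_def)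
      next
        case False
        then have "i > Polynomial.degree f" "i - m > n" using that df by auto
        then show ?thesis using p(2) df by (simp add: coeff_monom_mult coeff_eq_0)
      qed
      then have "?f = 0 \<or> Polynomial.degree ?f < Polynomial.degree f"
        by (metis leading_coeff_0_iff not_less)
      then show ?thesis
      proof
        assume "?f = 0"
        then have "(0, ?g) \<in> poly_pairs R" using fg by (simp only:)
        then have "?g = 0" by (rule pairs_zero)
        then show ?thesis using ev(2) by simp
      next
        assume "Polynomial.degree ?f < Polynomial.degree f"
        from less.hyps[OF this fg ev(1)] show ?thesis using ev(2) by simp
      qed
    qed
  qed
  define R' where "R' = {(poly f \<alpha>, poly g \<alpha>') | f g. (f, g) \<in> poly_pairs R}"
  have R'I: "(x, y) \<in> R'" if "x = poly f \<alpha>" "y = poly g \<alpha>'" "(f, g) \<in> poly_pairs R" for x y f g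
    using that unfolding R'_def by blast
  have sub: "R \<subseteq> R'"
  proof
    fix z assume z: "z \<in> R"
    obtain x y where xy: "z = (x, y)" by (cases z)
    show "z \<in> R'" unfolding xy by (rule R'I[OF _ _ pairs_monom[of x y 0]]) (use z xy in \<open>auto simp: monom_0\<close>)
  qed
  have "partial_hom R'"
    unfolding partial_hom_def
  proof (intro conjI allI ballI impI)
    show "(x, x) \<in> R'" if "x \<in> K" for x using R_K[OF that] sub by blast
    show "y = 0" if "(0, y) \<in> R'" for y
    proof -
      obtain f g where "poly f \<alpha> = 0" "y = poly g \<alpha>'" "(f, g) \<in> poly_pairs R" using \<open>(0, y) \<in> R'\<close> unfolding R'_def by auto
      then show ?thesis using key by blast
    qed
    fix x y x' y' assume "(x, y) \<in> R' \<and> (x', y') \<in> R'"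
    then obtain f g f' g' where fg: "x = poly f \<alpha>" "y = poly g \<alpha>'" "(f, g) \<in> poly_pairs R"
      "x' = poly f' \<alpha>" "y' = poly g' \<alpha>'" "(f', g') \<in> poly_pairs R" unfolding R'_def by blast
    show "(x + x', y + y') \<in> R'" by (rule R'I[OF _ _ pairs_add[OF fg(3,6)]]) (use fg in auto)
    show "(x * x', y * y') \<in> R'" by (rule R'I[OF _ _ pairs_mult[OF fg(3,6)]]) (use fg in auto)
  qed
  moreover have "(\<alpha>, \<alpha>') \<in> R'"
    by (rule R'I[OF _ _ pairs_monom[OF R_one, of 1]]) (auto simp: poly_monom)
  ultimately show ?thesis using sub by blast
qed

end

lemma partial_hom_Union:
  assumes "\<C> \<noteq> {}" "subset.chain {R. partial_hom R \<and> R0 \<subseteq> R} \<C>"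
  shows "\<Union>\<C> \<in> {R. partial_hom R \<and> R0 \<subseteq> R}"
proof -
  have C: "\<And>R. R \<in> \<C> \<Longrightarrow> partial_hom R \<and> R0 \<subseteq> R" "\<And>R S. R \<in> \<C> \<Longrightarrow> S \<in> \<C> \<Longrightarrow> R \<subseteq> S \<or> S \<subseteq> R"
    using assms(2) unfolding subset_chain_def by auto
  have two: "\<exists>R\<in>\<C>. z \<in> R \<and> z' \<in> R" if "z \<in> \<Union>\<C>" "z' \<in> \<Union>\<C>" for z z'
    using that C(2) by blast
  have "partial_hom (\<Union>\<C>)"
    unfolding partial_hom_def
  proof (intro conjI allI ballI impI)
    obtain S where "S \<in> \<C>" using assms(1) by blast
    then show "(x, x) \<in> \<Union>\<C>" if "x \<in> K" for x using C(1) R_K[of S x] that by blast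
    show "y = 0" if y: "(0, y) \<in> \<Union>\<C>" for y
    proof -
      obtain R where "R \<in> \<C>" "(0, y) \<in> R" using y by blast
      then show ?thesis using C(1) R_0[of R y] by blast
    qed
    fix x y x' y' assume "(x, y) \<in> \<Union>\<C> \<and> (x', y') \<in> \<Union>\<C>"
    then obtain R where R: "R \<in> \<C>" "(x, y) \<in> R" "(x', y') \<in> R" using two by blast
    then have "partial_hom R" using C(1) by blast
    then show "(x + x', y + y') \<in> \<Union>\<C>" "(x * x', y * y') \<in> \<Union>\<C>"
      using R_add[of R x y x' y'] R_mult[of R x y x' y'] R by blast+
  qed
  then show ?thesis using assms(1) C(1) by blast
qed

text \<open>A maximal partial homomorphism, given by Zorn's lemma, is defined everywhere, because
  any other could be extended by one more element.\<close>

lemma automorphism_extends: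
  assumes R0: "partial_hom R0"
  obtains \<sigma> where "\<sigma> \<in> galois_group K" "\<And>x y. (x, y) \<in> R0 \<Longrightarrow> \<sigma> x = y"
proof -
  have "{R. partial_hom R \<and> R0 \<subseteq> R} \<noteq> {}" using R0 by blast
  then have "\<exists>M\<in>{R. partial_hom R \<and> R0 \<subseteq> R}. \<forall>S\<in>{R. partial_hom R \<and> R0 \<subseteq> R}. M \<subseteq> S \<longrightarrow> S = M"
    by (rule subset_Zorn_nonempty) (rule partial_hom_Union)
  then obtain R where M: "R \<in> {R. partial_hom R \<and> R0 \<subseteq> R}" "\<forall>S\<in>{R. partial_hom R \<and> R0 \<subseteq> R}. R \<subseteq> S \<longrightarrow> S = R"
    by (elim bexE) (rule that)
  have R: "partial_hom R" "R0 \<subseteq> R" "\<And>S. partial_hom S \<Longrightarrow> R0 \<subseteq> S \<Longrightarrow> R \<subseteq> S \<Longrightarrow> S = R"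
    using M by simp_all
  have "\<exists>y. (x, y) \<in> R" for x
  proof -
    obtain S where S: "partial_hom S" "R \<subseteq> S" "\<exists>y. (x, y) \<in> S" using extend_partial_hom[OF R(1), of x] by blast
    have "S = R" by (rule R(3)[OF S(1) _ S(2)]) (use R(2) S(2) in blast)
    then show ?thesis using S(3) by simp
  qed
  then have "\<forall>x. \<exists>y. (x, y) \<in> R" by blast
  then obtain \<sigma> where \<sigma>: "\<And>x. (x, \<sigma> x) \<in> R" unfolding choice_iff by blast
  have \<sigma>I: "\<sigma> x = y" if "(x, y) \<in> R" for x y using R_functional[OF R(1) \<sigma> that] .
  have plus: "\<sigma> (x + y) = \<sigma> x + \<sigma> y" and times: "\<sigma> (x * y) = \<sigma> x * \<sigma> y" for x y
    by (rule \<sigma>I, rule R_add[OF R(1) \<sigma> \<sigma>]) (rule \<sigma>I, rule R_mult[OF R(1) \<sigma> \<sigma>])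
  have fix_K: "\<sigma> x = x" if "x \<in> K" for x using \<sigma>I R_K[OF R(1) that] by blast
  have inj: "inj \<sigma>"
  proof (rule injI)
    fix x y assume "\<sigma> x = \<sigma> y"
    moreover have "(x + - y, \<sigma> x + - \<sigma> y) \<in> R" by (intro R_add[OF R(1)] R_minus[OF R(1)] \<sigma>)
    ultimately have "x + - y = 0" using R_inj[OF R(1), of "x + - y"] by simp
    then show "x = y" by simp
  qed
  have "y \<in> range \<sigma>" for y
  proof -
    obtain p where p: "\<And>i. Polynomial.coeff p i \<in> K" "p \<noteq> 0" "poly p y = 0" using algebraic by blast
    let ?Z = "{z. poly p z = 0}"
    \<comment> \<open>An injective map of the finite set of roots of a polynomial over
      \<open>K\<close> to itself is onto; this gives surjectivity of \<sigma>.\<close>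
    have "\<sigma> ` ?Z \<subseteq> ?Z"
    proof
      fix z assume "z \<in> \<sigma> ` ?Z"
      then obtain x where x: "poly p x = 0" "z = \<sigma> x" by blast
      have "(poly p x, poly p (\<sigma> x)) \<in> R" by (rule R_poly[OF R(1) K_poly[OF R(1) p(1)] \<sigma>])
      then show "z \<in> ?Z" using x R_0[OF R(1)] by simp
    qed
    moreover have "finite ?Z" by (rule poly_roots_finite[OF p(2)])
    ultimately have "\<sigma> ` ?Z = ?Z"
      using endo_inj_surj[of ?Z \<sigma>] inj_on_subset[OF inj subset_UNIV] by blast
    then show ?thesis using p(3) by blast
  qed
  then have "bij \<sigma>" using inj unfolding bij_def by blast
  then have "\<sigma> \<in> galois_group K" unfolding galois_group_def using plus times fix_K by blast
  then show thesis using that \<sigma>I R(2) by blast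
qed

text \<open>The graph of conjugation on \<open>K(\<beta>)\<close> is extended to the closure. The
  non-split construction describes the second cone through automorphisms that move \<beta>, so such
  an automorphism has to be at hand.\<close>

lemma conjugation:
  assumes \<beta>: "\<beta> \<notin> K" "b \<in> K" "c \<in> K" "\<beta>^2 + b * \<beta> + c = 0"
  obtains \<sigma> where "\<sigma> \<in> galois_group K" "\<sigma> \<beta> = - b - \<beta>"
proof -
  define \<beta>' where "\<beta>' = - b - \<beta>"
  have sq: "\<beta> * \<beta> = - b * \<beta> - c" using \<beta>(4) by (simp add: power2_eq_square eq_neg_iff_add_eq_0 algebra_simps)
  have "\<beta>' * \<beta>' = \<beta> * \<beta> + 2 * b * \<beta> + b * b" unfolding \<beta>'_def by (simp add: algebra_simps)
  also have "\<dots> = - b * \<beta>' - c" unfolding sq \<beta>'_def by (simp add: algebra_simps)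
  finally have sq': "\<beta>' * \<beta>' = - b * \<beta>' - c" .
  define R0 where "R0 = {(u + v * \<beta>, u + v * \<beta>') | u v. u \<in> K \<and> v \<in> K}"
  have I: "(x, y) \<in> R0" if "x = u + v * \<beta>" "y = u + v * \<beta>'" "u \<in> K" "v \<in> K" for x y u v
    using that unfolding R0_def by blast
  have "partial_hom R0"
    unfolding partial_hom_def
  proof (intro conjI allI ballI impI)
    show "(x, x) \<in> R0" if "x \<in> K" for x by (rule I[of _ x 0]) (use that K_closed in auto)
    show "y = 0" if "(0, y) \<in> R0" for y
    proof -
      obtain u v where uv: "0 = u + v * \<beta>" "y = u + v * \<beta>'" "u \<in> K" "v \<in> K" using \<open>(0, y) \<in> R0\<close> unfolding R0_def by blast
      have "v = 0"
      proof (rule ccontr)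
        assume "v \<noteq> 0"
        then have "\<beta> = - u / v" using uv(1) by (simp add: field_simps eq_neg_iff_add_eq_0)
        then show False using \<beta>(1) K_closed(8)[OF K_closed(5)[OF uv(3)] uv(4)] by simp
      qed
      then show ?thesis using uv by simp
    qed
    fix x y x' y' assume "(x, y) \<in> R0 \<and> (x', y') \<in> R0"
    then obtain u v u' v' where uv: "x = u + v * \<beta>" "y = u + v * \<beta>'" "u \<in> K" "v \<in> K"
      "x' = u' + v' * \<beta>" "y' = u' + v' * \<beta>'" "u' \<in> K" "v' \<in> K" unfolding R0_def by blast
    show "(x + x', y + y') \<in> R0"
      by (rule I[of _ "u + u'" "v + v'"]) (use uv K_closed in \<open>auto simp: algebra_simps\<close>)
    have prod: "(u + v * t) * (u' + v' * t) = (u * u' - v * v' * c) + (u * v' + v * u' - v * v' * b) * t" if "t * t = - b * t - c" for t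
    proof -
      have "(u + v * t) * (u' + v' * t) = u * u' + (u * v' + v * u') * t + v * v' * (t * t)" by (simp add: algebra_simps)
      then show ?thesis unfolding that by (simp add: algebra_simps)
    qed
    show "(x * x', y * y') \<in> R0"
      by (rule I[of _ "u * u' - v * v' * c" "u * v' + v * u' - v * v' * b"])
        (use uv \<beta> K_closed prod[OF sq] prod[OF sq'] in auto)
  qed
  then obtain \<sigma> where \<sigma>: "\<sigma> \<in> galois_group K" "\<And>x y. (x, y) \<in> R0 \<Longrightarrow> \<sigma> x = y" using automorphism_extends by blast
  have "(\<beta>, \<beta>') \<in> R0" by (rule I[of _ 0 1]) (use K_closed in auto)
  then show thesis using that \<sigma> unfolding \<beta>'_def by blast
qed

end

section \<open>Linear and quadratic forms\<close>

lemma form_Suc: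
  assumes "form UNIV (Suc d) (f :: 'a::comm_ring_1 ^ 'n \<Rightarrow> 'a)"
  shows "\<exists>g. (\<forall>i. form UNIV d (g i)) \<and> (\<forall>v. f v = (\<Sum>i\<in>UNIV. v $ i * g i v))"
proof -
  have "\<forall>d. e = Suc d \<longrightarrow> (\<exists>g. (\<forall>i. form UNIV d (g i)) \<and> (\<forall>v. f v = (\<Sum>i\<in>UNIV. v $ i * g i v)))"
    if "form UNIV e f" for e and f :: "'a ^ 'n \<Rightarrow> 'a" using that
  proof (induction rule: form.induct)
    case (coord d f i)
    show ?case
    proof (intro allI impI)
      fix d' assume "Suc d = Suc d'"
      then have d: "d' = d" by simp
      define g where "g j = (if j = i then f else (\<lambda>_. 0))" for j
      have "\<forall>j. form UNIV d' (g j)" using coord(1) form_zero unfolding g_def d by auto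
      moreover have "\<forall>v. v $ i * f v = (\<Sum>j\<in>UNIV. v $ j * g j v)"
      proof
        fix v
        have "(\<Sum>j\<in>UNIV. v $ j * g j v) = (\<Sum>j\<in>UNIV. if j = i then v $ j * f v else 0)"
          by (rule sum.cong) (auto simp: g_def)
        then show "v $ i * f v = (\<Sum>j\<in>UNIV. v $ j * g j v)" by simp
      qed
      ultimately show "\<exists>g. (\<forall>i. form UNIV d' (g i)) \<and> (\<forall>v. v $ i * f v = (\<Sum>i\<in>UNIV. v $ i * g i v))" by blast
    qed
  next
    case (add d f g)
    show ?case
    proof (intro allI impI)
      fix d' assume "d = Suc d'"
      then obtain u u' where u: "\<forall>i. form UNIV d' (u i)" "\<forall>v. f v = (\<Sum>i\<in>UNIV. v $ i * u i v)"
        and u': "\<forall>i. form UNIV d' (u' i)" "\<forall>v. g v = (\<Sum>i\<in>UNIV. v $ i * u' i v)" using add(3,4) by blast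
      have "\<forall>i. form UNIV d' (\<lambda>v. u i v + u' i v)" using u(1) u'(1) form.add by blast
      moreover have "\<forall>v. f v + g v = (\<Sum>i\<in>UNIV. v $ i * (u i v + u' i v))"
        using u(2) u'(2) by (simp add: sum.distrib algebra_simps)
      ultimately show "\<exists>h. (\<forall>i. form UNIV d' (h i)) \<and> (\<forall>v. f v + g v = (\<Sum>i\<in>UNIV. v $ i * h i v))"
        by (intro exI[of _ "\<lambda>i v. u i v + u' i v"]) blast
    qed
  qed simp
  then show ?thesis using assms by blast
qed

lemma form_const:
  assumes "form UNIV 0 f" shows "f v = f w"
proof -
  have "d = 0 \<longrightarrow> f v = f w" if "form UNIV d f" for d using that by (induction rule: form.induct) auto
  then show ?thesis using assms by blast
qed

lemma form_linear:
  assumes "form UNIV 1 (f :: 'a::comm_ring_1 ^ 'n \<Rightarrow> 'a)"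
  shows "\<exists>l. \<forall>v. f v = (\<Sum>i\<in>UNIV. l i * v $ i)"
proof -
  obtain g where g: "\<forall>i. form UNIV 0 (g i)" "\<forall>v. f v = (\<Sum>i\<in>UNIV. v $ i * g i v)"
    using form_Suc assms unfolding One_nat_def by blast
  then have "\<forall>v. f v = (\<Sum>i\<in>UNIV. g i 0 * v $ i)" using form_const by (metis (no_types, lifting) mult.commute sum.cong)
  then show ?thesis by (rule exI[of _ "\<lambda>i. g i 0"])
qed

lemma form_linear_add: "form UNIV 1 f \<Longrightarrow> f (v + w) = f v + f w"
  using form_linear by (fastforce simp: algebra_simps sum.distrib)

lemma form_tuple_linear:
  assumes "form_tuple UNIV 1 h" shows "\<exists>M. \<forall>v. h v = M *v v"
proof -
  have "\<forall>i. \<exists>l. \<forall>v. h v $ i = (\<Sum>j\<in>UNIV. l j * v $ j)"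
    using form_linear form_tuple_nth[OF assms] by blast
  then obtain l where l: "\<And>i v. h v $ i = (\<Sum>j\<in>UNIV. l i j * v $ j)" unfolding choice_iff by blast
  have "h v = (\<chi> i j. l i j) *v v" for v unfolding matrix_vector_mult_def vec_eq_iff by (simp add: l)
  then show ?thesis by blast
qed

lemma form_tuple_linear_add: "form_tuple UNIV 1 h \<Longrightarrow> h (v + w) = h v + h w"
  unfolding vec_eq_iff vector_add_component by (intro allI form_linear_add form_tuple_nth)

lemma form_tuple_linear_smult: "form_tuple S 1 h \<Longrightarrow> h (c *s v) = c *s h v"
  using form_tuple_homog by fastforce

lemma form_tuple_linear_diff: "form_tuple UNIV 1 (h :: 'a::comm_ring_1 ^ 'n \<Rightarrow> 'a ^ 'm) \<Longrightarrow> h (v - w) = h v - h w"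
  using form_tuple_linear_add[of h "v - w" w] by (simp add: algebra_simps)

lemma linear_inverse:
  fixes h :: "'a::field ^ 'n \<Rightarrow> 'a ^ 'n"
  assumes h: "form_tuple UNIV 1 h" and inj: "\<And>v. h v = 0 \<Longrightarrow> v = 0"
  obtains h' where "form_tuple UNIV 1 h'" "\<And>v. h (h' v) = v" "\<And>v. h' (h v) = v"
proof -
  obtain M where M: "\<And>v. h v = M *v v" using form_tuple_linear[OF h] by blast
  obtain N where N: "N ** M = mat 1"
    using inj unfolding M matrix_left_invertible_ker[symmetric] by (metis matrix_left_invertible_ker)
  then have N': "M ** N = mat 1" using matrix_left_right_inverse by blast
  show thesis
  proof (rule that[of "\<lambda>v. N *v v"])
    show "h (N *v v) = v" for v unfolding M by (simp add: matrix_vector_mul_assoc N')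
    show "N *v h v = v" for v unfolding M by (simp add: matrix_vector_mul_assoc N)
  qed (rule form_tuple_matrix)
qed

text \<open>A zero row makes the matrix square; an injective square map would be onto, but the last
  coordinate of its values is always 0.\<close>

lemma kernel_4_3:
  fixes M :: "'a::field ^ 4 ^ 3" obtains v where "v \<noteq> 0" "M *v v = 0"
proof -
  define h where "h v = (vector [(M *v v) $ 1, (M *v v) $ 2, (M *v v) $ 3, 0] :: 'a ^ 4)" for v
  have h: "form_tuple UNIV 1 h" unfolding form_tuple_def forall_4 h_def vector_4
    by (intro conjI form_tuple_nth[OF form_tuple_matrix] form_zero)
  have "\<exists>v. v \<noteq> 0 \<and> M *v v = 0"
  proof (rule ccontr)
    assume *: "\<nexists>v. v \<noteq> 0 \<and> M *v v = 0"
    have "v = 0" if "h v = 0" for v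
    proof -
      have "M *v v = 0" using that unfolding h_def vec_eq_iff forall_4 forall_3 by simp
      then show ?thesis using * by blast
    qed
    then obtain h' where h': "\<And>v. h (h' v) = v" using linear_inverse[OF h] by metis
    have "h (h' (axis 4 1)) $ 4 = 1" unfolding h' by simp
    then show False unfolding h_def by simp
  qed
  then show thesis using that by blast
qed

lemma polar_sym: "polar f v w = polar f w v"
  unfolding polar_def by (simp add: algebra_simps)

lemma form_quadratic:
  fixes f :: "'a::field ^ 'n \<Rightarrow> 'a"
  assumes "form UNIV 2 f"
  shows "polar f v (w + w') = polar f v w + polar f v w'" "polar f v (c *s w) = c * polar f v w"
    "polar f v v = 2 * f v"
proof -
  have "form UNIV (Suc 1) f" using assms by (simp add: numeral_2_eq_2)
  then obtain g where g: "\<And>i. form UNIV 1 (g i)" "\<And>v. f v = (\<Sum>i\<in>UNIV. v $ i * g i v)" using form_Suc by blast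
  have *: "polar f v w = (\<Sum>i\<in>UNIV. v $ i * g i w + w $ i * g i v)" for v w
    unfolding polar_def g(2) form_linear_add[OF g(1)]
    by (simp add: sum.distrib[symmetric] sum_subtractf[symmetric] algebra_simps)
  show "polar f v (w + w') = polar f v w + polar f v w'"
    unfolding * form_linear_add[OF g(1)] by (simp add: sum.distrib[symmetric] algebra_simps)
  show "polar f v (c *s w) = c * polar f v w"
    unfolding * form_homog[OF g(1)] by (simp add: sum_distrib_left algebra_simps)
  show "polar f v v = 2 * f v" unfolding * g(2) by (simp add: sum_distrib_left algebra_simps)
qed

lemma quadratic_smult: "form S 2 f \<Longrightarrow> f (c *s v) = c^2 * f v"
  by (rule form_homog)

lemma quadratic_add: "f (v + w) = f v + f w + polar f v w"
  unfolding polar_def by simp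

lemma quadratic_orthogonal_sum:
  fixes f :: "'a::field ^ 'n \<Rightarrow> 'a" and v :: "4 \<Rightarrow> 'a ^ 'n"
  assumes f: "form UNIV 2 f" and o: "\<forall>i j. i \<noteq> j \<longrightarrow> polar f (v i) (v j) = 0"
  shows "f (\<Sum>i\<in>UNIV. x i *s v i) = (\<Sum>i\<in>UNIV. (x i)^2 * f (v i))"
    and "polar f (v j) (\<Sum>i\<in>UNIV. x i *s v i) = 2 * x j * f (v j)"
proof -
  have o': "polar f (c *s v i) (c' *s v j) = 0" if "i \<noteq> j" for c c' i j
    by (simp add: form_quadratic(2)[OF f] polar_sym[of f "c *s v i"] o that[symmetric])
  have l: "polar f (u + u') w = polar f u w + polar f u' w" for u u' w
    by (simp add: polar_sym[of f _ w] form_quadratic(1)[OF f])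
  show "f (\<Sum>i\<in>UNIV. x i *s v i) = (\<Sum>i\<in>UNIV. (x i)^2 * f (v i))"
    unfolding sum_4 by (simp add: quadratic_add l o' quadratic_smult[OF f])
  have "\<forall>j. polar f (v j) (\<Sum>i\<in>UNIV. x i *s v i) = 2 * x j * f (v j)"
    unfolding sum_4 forall_4 by (simp add: form_quadratic[OF f] o)
  then show "polar f (v j) (\<Sum>i\<in>UNIV. x i *s v i) = 2 * x j * f (v j)" by blast
qed

section \<open>Simultaneous diagonalisation\<close>

text \<open>The vertex \<open>v i\<close> lies in the radical of \<open>s i A + t i B\<close>. For
  two vertices this gives two independent linear relations between their polar values for
  \<open>A\<close> and \<open>B\<close>, so the vertices are orthogonal for both forms.
  Non-singularity keeps them off the curve.\<close>

lemma diagonalisation: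
  fixes A B :: "'a::{alg_closed_field, field_char_0} ^ 4 \<Rightarrow> 'a" and m :: "4 \<Rightarrow> 'a ^ 4 ^ 3"
  assumes ns: "nonsingular_quadric_intersection K A B"
    and q: "\<And>i. form UNIV 2 (q i)" and cone: "\<And>i p. q i (m i *v p) = s i * A p + t i * B p"
    and st: "\<And>i j. i \<noteq> j \<Longrightarrow> s i * t j \<noteq> s j * t i"
  obtains L L' where "form_tuple UNIV 1 L" "form_tuple UNIV 1 L'" "\<And>v. L (L' v) = v" "\<And>v. L' (L v) = v"
    "\<And>p. A p = (\<Sum>i\<in>UNIV. t i * (L p $ i)^2)" "\<And>p. B p = - (\<Sum>i\<in>UNIV. s i * (L p $ i)^2)"
proof -
  have A: "form UNIV 2 A" and B: "form UNIV 2 B"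
    using ns form_UNIV unfolding nonsingular_quadric_intersection_def by blast+
  have "\<forall>i. \<exists>v. v \<noteq> 0 \<and> m i *v v = 0" using kernel_4_3 by metis
  then obtain v where v: "\<And>i. v i \<noteq> 0" "\<And>i. m i *v v i = 0" unfolding choice_iff by blast
  have rad: "s i * polar A (v i) w + t i * polar B (v i) w = 0" for i w
  proof -
    have "q i (m i *v (v i + w)) = q i (m i *v w)" by (simp add: matrix_vector_right_distrib v)
    moreover have "q i (m i *v v i) = 0" unfolding v by (rule form_at_0[OF q]) simp
    ultimately show ?thesis unfolding cone polar_def by (simp add: algebra_simps)
  qed
  have o: "polar A (v i) (v j) = 0" "polar B (v i) (v j) = 0" if "i \<noteq> j" for i j
  proof -
    let ?a = "polar A (v i) (v j)" and ?b = "polar B (v i) (v j)"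
    have 1: "s i * ?a + t i * ?b = 0" "s j * ?a + t j * ?b = 0"
      using rad[of i "v j"] rad[of j "v i"] polar_sym by metis+
    have "(s i * t j - s j * t i) * ?a = t j * (s i * ?a + t i * ?b) - t i * (s j * ?a + t j * ?b)" by (simp add: algebra_simps)
    then show "?a = 0" using st[OF that] unfolding 1 by simp
    have "(s i * t j - s j * t i) * ?b = s i * (s j * ?a + t j * ?b) - s j * (s i * ?a + t i * ?b)" by (simp add: algebra_simps)
    then show "?b = 0" using st[OF that] unfolding 1 by simp
  qed
  then have oA: "\<forall>i j. i \<noteq> j \<longrightarrow> polar A (v i) (v j) = 0" and oB: "\<forall>i j. i \<noteq> j \<longrightarrow> polar B (v i) (v j) = 0" by blast+
  have other: "\<exists>j. j \<noteq> i" for i :: 4 by (rule exI[of _ "i + 1"]) simp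
  have st0: "s i \<noteq> 0 \<or> t i \<noteq> 0" for i
  proof -
    obtain j where "i \<noteq> j" using other by metis
    then show ?thesis using st[of i j] by auto
  qed
  have ab: "A (v i) \<noteq> 0 \<or> B (v i) \<noteq> 0" for i
  proof (rule ccontr)
    assume *: "\<not> ?thesis"
    then have "\<forall>w. s i * polar A (v i) w + t i * polar B (v i) w = 0" using rad by blast
    then have "s i = 0 \<and> t i = 0" using ns v(1)[of i] * unfolding nonsingular_quadric_intersection_def by blast
    then show False using st0[of i] by blast
  qed
  have sAtB: "s i * A (v i) + t i * B (v i) = 0" for i
    using rad[of i "v i"] unfolding form_quadratic(3)[OF A] form_quadratic(3)[OF B] by (simp add: algebra_simps add_eq_0_iff)
  \<comment> \<open>\<open>s i A + t i B\<close> vanishes at its vertex, so \<open>A\<close> and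
    \<open>B\<close> have there the ratio of \<open>t i\<close> to \<open>- s i\<close>; the square
    root rescales the vertex.\<close>
  have "\<exists>\<rho>. \<rho> \<noteq> 0 \<and> A (v i) = \<rho>^2 * t i \<and> B (v i) = - (\<rho>^2 * s i)" for i
  proof -
    have "\<exists>\<rho>. A (v i) = \<rho> * t i \<and> B (v i) = - (\<rho> * s i)"
    proof (cases "t i = 0")
      case True
      then have "s i \<noteq> 0" "A (v i) = 0" using st0[of i] sAtB[of i] by auto
      then show ?thesis using True by (intro exI[of _ "- B (v i) / s i"]) simp
    next
      case False
      have "B (v i) = - (s i * A (v i)) / t i" using sAtB[of i] False by (simp add: field_simps eq_neg_iff_add_eq_0)
      then show ?thesis using False by (intro exI[of _ "A (v i) / t i"]) simp
    qed
    then obtain \<rho> where \<rho>: "A (v i) = \<rho> * t i" "B (v i) = - (\<rho> * s i)" by blast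
    obtain \<rho>' where "\<rho>'^2 = \<rho>" using nth_root_exists[of 2 \<rho>] by auto
    then show ?thesis using \<rho> ab[of i] by (intro exI[of _ \<rho>']) auto
  qed
  then have "\<forall>i. \<exists>\<rho>. \<rho> \<noteq> 0 \<and> A (v i) = \<rho>^2 * t i \<and> B (v i) = - (\<rho>^2 * s i)" by blast
  then obtain \<rho> where \<rho>: "\<And>i. \<rho> i \<noteq> 0" "\<And>i. A (v i) = (\<rho> i)^2 * t i" "\<And>i. B (v i) = - ((\<rho> i)^2 * s i)"
    unfolding choice_iff by blast
  define L' where "L' x = (\<Sum>i\<in>UNIV. (x $ i / \<rho> i) *s v i)" for x
  have L': "form_tuple UNIV 1 L'"
    unfolding form_tuple_def L'_def
  proof
    fix r
    have "form UNIV 1 (\<lambda>x. \<Sum>i\<in>UNIV. (v i $ r / \<rho> i) * x $ i)" by (rule form_sum form_cmult form_coord)+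
    then show "form UNIV 1 (\<lambda>x. (\<Sum>i\<in>UNIV. (x $ i / \<rho> i) *s v i) $ r)" by (rule form_cong) (simp add: mult_ac)
  qed
  have AL: "A (L' x) = (\<Sum>i\<in>UNIV. t i * (x $ i)^2)" and BL: "B (L' x) = - (\<Sum>i\<in>UNIV. s i * (x $ i)^2)" for x
    unfolding L'_def quadratic_orthogonal_sum(1)[where v = v, OF A oA] quadratic_orthogonal_sum(1)[where v = v, OF B oB]
    by (simp_all add: \<rho> power_divide sum_negf[symmetric] mult_ac)
  have "x = 0" if "L' x = 0" for x
  proof -
    have 0: "polar f w (L' x) = 0" if "form UNIV 2 f" for f w
      using form_quadratic(2)[OF that, of w 0 0] unfolding \<open>L' x = 0\<close> by simp
    have "x $ i = 0" for i
    proof -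
      have "2 * (x $ i / \<rho> i) * A (v i) = 0" "2 * (x $ i / \<rho> i) * B (v i) = 0"
        using quadratic_orthogonal_sum(2)[where v = v, OF A oA, of i "\<lambda>i. x $ i / \<rho> i"] quadratic_orthogonal_sum(2)[where v = v, OF B oB, of i "\<lambda>i. x $ i / \<rho> i"]
          0[OF A, of "v i"] 0[OF B, of "v i"] unfolding L'_def by simp_all
      then show ?thesis using ab[of i] \<rho>(1)[of i] by auto
    qed
    then show ?thesis by (simp add: vec_eq_iff)
  qed
  then obtain L where L: "form_tuple UNIV 1 L" "\<And>v. L' (L v) = v" "\<And>v. L (L' v) = v" using linear_inverse[OF L'] by metis
  show thesis
    by (rule that[OF L(1) L' L(3,2)]) (use AL[of "L _"] BL[of "L _"] L(2) in simp_all)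
qed

lemma diagonal_scaling:
  fixes L L' :: "'a::field ^ 'n \<Rightarrow> 'a ^ 'n"
  assumes L: "form_tuple UNIV 1 L" "form_tuple UNIV 1 L'" "\<And>v. L (L' v) = v" "\<And>v. L' (L v) = v"
    and c: "\<And>i. c i \<noteq> 0"
  obtains M M' where "form_tuple UNIV 1 M" "form_tuple UNIV 1 M'" "\<And>v. M (M' v) = v" "\<And>v. M' (M v) = v"
    "\<And>p i. M p $ i = c i * L p $ i"
proof (rule that)
  let ?M = "\<lambda>p. \<chi> i. c i * L p $ i" and ?M' = "\<lambda>v. L' (\<chi> i. v $ i / c i)"
  show "form_tuple UNIV 1 ?M" unfolding form_tuple_def by (simp add: form_cmult[OF form_tuple_nth[OF L(1), unfolded One_nat_def]])
  have "form_tuple UNIV 1 (\<lambda>v. \<chi> i. v $ i / c i)"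
    unfolding form_tuple_def
  proof
    show "form UNIV 1 (\<lambda>v. (\<chi> i. v $ i / c i) $ i)" for i
      by (rule form_cong[OF form_cmult[OF form_coord[of i], of "inverse (c i)"]]) (simp add: divide_inverse mult.commute)
  qed
  from form_tuple_comp[OF L(2) this] show "form_tuple UNIV 1 ?M'" by simp
  show "?M (?M' v) = v" for v by (simp add: vec_eq_iff L(3) c)
  show "?M' (?M v) = v" for v by (simp add: c L(4))
qed simp

lemma standard_coordinates:
  fixes A B :: "'a::{alg_closed_field, field_char_0} ^ 4 \<Rightarrow> 'a" and m :: "4 \<Rightarrow> 'a ^ 4 ^ 3"
  assumes ns: "nonsingular_quadric_intersection K A B"
    and q: "\<And>i. form UNIV 2 (q i)" and cone: "\<And>i p. q i (m i *v p) = s i * A p + t i * B p"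
    and st: "\<And>i j. i \<noteq> j \<Longrightarrow> s i * t j \<noteq> s j * t i"
  obtains a a' k and L L' :: "'a ^ 4 \<Rightarrow> 'a ^ 4" and \<mu> \<mu>' v where "standard_curves a a' k"
    "form_tuple UNIV 1 L" "form_tuple UNIV 1 L'" "\<And>v. L (L' v) = v" "\<And>v. L' (L v) = v" "\<mu> \<noteq> 0" "\<mu>' \<noteq> 0"
    "\<And>p. s 1 * A p + t 1 * B p = \<mu> * ((L p $ 2)^2 - k^2 * (L p $ 3)^2 - (1 - k^2) * (L p $ 4)^2)"
    "\<And>p. s 2 * A p + t 2 * B p = \<mu>' * ((L p $ 1)^2 + (L p $ 3)^2 - (L p $ 4)^2)"
    "v \<noteq> 0" "A v = t 2" "B v = - s 2"
proof -
  obtain L L' where L: "form_tuple UNIV 1 L" "form_tuple UNIV 1 L'" "\<And>v. L (L' v) = v" "\<And>v. L' (L v) = v"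
    and AB: "\<And>p. A p = (\<Sum>i\<in>UNIV. t i * (L p $ i)^2)" "\<And>p. B p = - (\<Sum>i\<in>UNIV. s i * (L p $ i)^2)"
    using diagonalisation[where s = s and t = t and q = q and m = m, OF ns q cone st] by blast
  define d where "d i j = s i * t j - s j * t i" for i j
  have dnz: "d i j \<noteq> 0" if "i \<noteq> j" for i j using st[OF that] unfolding d_def by simp
  have d21: "d 2 1 = - d 1 2" unfolding d_def by simp
  \<comment> \<open>The Pluecker relation between the minors \<open>d i j\<close>. It makes
    \<open>1 - \<kappa>\<close> another cross-ratio, as the coefficient \<open>1 - k^2\<close> of
    the first cone requires.\<close>
  have pl: "d 1 2 * d 3 4 = d 1 3 * d 2 4 - d 1 4 * d 2 3" unfolding d_def by (simp add: algebra_simps)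
  have nz: "d 1 2 \<noteq> 0" "d 1 3 \<noteq> 0" "d 1 4 \<noteq> 0" "d 2 3 \<noteq> 0" "d 2 4 \<noteq> 0" "d 3 4 \<noteq> 0" by (rule dnz, simp)+
  \<comment> \<open>\<open>C 1\<close>, \<open>C 3\<close> and \<open>C 4\<close> are chosen to
    bring the second cone into standard form exactly, \<open>C 2\<close> to make the first cone
    proportional to its standard form.\<close>
  define C where "C i = (if i = 1 then - d 1 2 else if i = 2 then - (d 2 3 * d 2 4) / d 3 4 else if i = 3 then d 2 3 else - d 2 4)" for i :: 4
  have Cnz: "C i \<noteq> 0" for i using nz unfolding C_def by auto
  have "\<forall>i. \<exists>c. c^2 = C i" using nth_root_exists[of 2] by auto
  then obtain c where c: "\<And>i. (c i)^2 = C i" unfolding choice_iff by blast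
  have cnz: "c i \<noteq> 0" for i using c[of i] Cnz[of i] by auto
  obtain M M' where M: "form_tuple UNIV 1 M" "form_tuple UNIV 1 M'" "\<And>v. M (M' v) = v" "\<And>v. M' (M v) = v"
    "\<And>p i. M p $ i = c i * L p $ i" by (rule diagonal_scaling[where c = c, OF L cnz]) blast
  have M2: "(M p $ i)^2 = C i * (L p $ i)^2" for p i unfolding M(5) power_mult_distrib c ..
  \<comment> \<open>The cross-ratio of the four singular parameters \<open>(s i : t i)\<close>; its
    square root is the modulus.\<close>
  define \<kappa> where "\<kappa> = d 1 3 * d 2 4 / (d 1 2 * d 3 4)"
  have \<kappa>: "\<kappa> \<noteq> 0" "1 - \<kappa> = - (d 1 4 * d 2 3) / (d 1 2 * d 3 4)" "\<kappa> \<noteq> 1"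
  proof -
    show "\<kappa> \<noteq> 0" unfolding \<kappa>_def using nz by simp
    show 1: "1 - \<kappa> = - (d 1 4 * d 2 3) / (d 1 2 * d 3 4)"
    proof -
      have "1 - \<kappa> = (d 1 2 * d 3 4 - d 1 3 * d 2 4) / (d 1 2 * d 3 4)"
        unfolding \<kappa>_def diff_divide_distrib using nz by simp
      also have "d 1 2 * d 3 4 - d 1 3 * d 2 4 = - (d 1 4 * d 2 3)" unfolding pl by simp
      finally show ?thesis .
    qed
    show "\<kappa> \<noteq> 1" using 1 nz by auto
  qed
  obtain k where k: "k^2 = \<kappa>" using nth_root_exists[of 2 \<kappa>] by auto
  obtain e where e: "e^2 = \<kappa> - 1" using nth_root_exists[of 2 "\<kappa> - 1"] by auto
  \<comment> \<open>\<open>a\<close> and \<open>a'\<close> are the roots of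
    \<open>X^2 - 2 k X + 1\<close>.\<close>
  define a where "a = k + e"
  define a' where "a' = k - e"
  have aa': "a * a' = 1" unfolding a_def a'_def using k e by (simp add: algebra_simps power2_eq_square)
  have "a ^ 4 \<noteq> 1"
  proof
    assume "a ^ 4 = 1"
    then have "a^2 * a^2 = (a * a') * (a * a')" unfolding aa' by (simp add: power4_eq_xxxx power2_eq_square mult.assoc)
    then have "a^2 * (a^2 - a'^2) = 0" by (simp add: algebra_simps power2_eq_square)
    then have "(a - a') * (a + a') = 0" using aa' by (auto simp: algebra_simps power2_eq_square)
    then show False using k e \<kappa> unfolding a_def a'_def by auto
  qed
  then have std: "standard_curves a a' k" by unfold_locales (use aa' in \<open>auto simp: a_def a'_def\<close>)
  have 1: "s 1 * A p + t 1 * B p = (- (d 1 2 * d 3 4) / (d 2 3 * d 2 4)) * ((M p $ 2)^2 - k^2 * (M p $ 3)^2 - (1 - k^2) * (M p $ 4)^2)" for p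
  proof -
    have "s 1 * A p + t 1 * B p = d 1 2 * (L p $ 2)^2 + d 1 3 * (L p $ 3)^2 + d 1 4 * (L p $ 4)^2"
      unfolding AB sum_4 d_def by (simp add: algebra_simps)
    then show ?thesis unfolding M2 k \<kappa>(2) using nz by (simp add: C_def \<kappa>_def algebra_simps)
  qed
  have 2: "s 2 * A p + t 2 * B p = 1 * ((M p $ 1)^2 + (M p $ 3)^2 - (M p $ 4)^2)" for p
  proof -
    have "s 2 * A p + t 2 * B p = - d 1 2 * (L p $ 1)^2 + d 2 3 * (L p $ 3)^2 + d 2 4 * (L p $ 4)^2"
      unfolding AB sum_4 d_def by (simp add: algebra_simps)
    then show ?thesis unfolding M2 by (simp add: C_def)
  qed
  \<comment> \<open>The vertex of the second cone. The values of \<open>A\<close> and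
    \<open>B\<close> at it determine the ratio of \<open>s 2\<close> to \<open>t 2\<close>, so any
    other equation of this cone can be recognised by vanishing there.\<close>
  define v where "v = L' (axis 2 1)"
  have v: "L v = axis 2 1" unfolding v_def L ..
  have "v \<noteq> 0" using v form_tuple_linear_smult[OF L(1), of 0 0] by (metis axis_eq_0_iff vector_smult_lzero zero_neq_one)
  moreover have "A v = t 2" "B v = - s 2" unfolding AB v sum_4 axis_def by simp_all
  ultimately show thesis using that[OF std M(1-4) _ _ 1 2] nz by simp
qed

section \<open>The cones and their parametrisations\<close>

definition veronese :: "'a::comm_ring_1 ^ 2 \<Rightarrow> 'a ^ 3" where
  "veronese z = vector [(z $ 1)^2, z $ 1 * z $ 2, (z $ 2)^2]"

definition std_conic :: "'a::comm_ring_1 ^ 3 \<Rightarrow> 'a" where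
  "std_conic y = (y $ 2)^2 - y $ 1 * y $ 3"

lemma veronese_nth: "veronese z $ 1 = (z $ 1)^2" "veronese z $ 2 = z $ 1 * z $ 2" "veronese z $ 3 = (z $ 2)^2"
  by (simp_all add: veronese_def)

text \<open>\<open>M\<close> and \<open>U\<close> project from the same vertex, since the kernel of
  each is spanned by \<open>e\<close>. So \<open>M\<close> factors through \<open>U\<close> by an
  invertible map \<open>N\<close>, which is restricted by the section \<open>S\<close>.\<close>

lemma cone_factor:
  fixes M :: "'a::field_char_0 ^ 4 ^ 3"
  assumes q: "form UNIV 2 q" and U: "form_tuple UNIV 1 U" and S: "form_tuple UNIV 1 S" and US: "\<And>y. U (S y) = y"
    and e: "\<And>p. U p = 0 \<Longrightarrow> \<exists>c. p = c *s e" and \<mu>: "\<mu> \<noteq> 0" and qU: "\<And>p. q (M *v p) = \<mu> * std_conic (U p)"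
  obtains N N' where "form_tuple UNIV 1 N" "form_tuple UNIV 1 N'" "\<And>y. N (N' y) = y" "\<And>y. N' (N y) = y"
    "\<And>p. M *v p = N (U p)" "\<And>y. q (N y) = \<mu> * std_conic y"
proof -
  have ker: "U w = 0" if w: "M *v w = 0" for w
  proof -
    \<comment> \<open>Adding a kernel vector of \<open>M\<close> does not change the quadric, so
      \<open>U w\<close> can be added to any argument of the conic form; non-degeneracy then forces
      it to be 0.\<close>
    have *: "std_conic (U w + y) = std_conic y" for y
    proof -
      have "q (M *v (w + S y)) = q (M *v S y)" by (simp add: matrix_vector_right_distrib w)
      then show ?thesis unfolding qU form_tuple_linear_add[OF U] US using mult_left_cancel[OF \<mu>] by blast
    qed
    have "U w $ 1 = 0" "U w $ 2 = 0" "U w $ 3 = 0"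
      using *[of 0] *[of "vector [1, 0, 0]"] *[of "vector [0, 1, 0]"] *[of "vector [0, 0, 1]"]
      unfolding std_conic_def by (simp_all add: algebra_simps power2_eq_square)
    then show ?thesis by (simp add: vec_eq_iff forall_3)
  qed
  obtain w where w: "w \<noteq> 0" "M *v w = 0" by (rule kernel_4_3)
  obtain c where c: "w = c *s e" using e ker[OF w(2)] by blast
  then have c0: "c \<noteq> 0" using w(1) by auto
  have "c *s (M *v e) = 0" using w(2) unfolding c by (simp add: vector_scalar_commute)
  then have Me: "M *v e = 0" using c0 by simp
  have ker': "M *v p = 0" if p: "U p = 0" for p
    using e[OF p] Me by (auto simp: vector_scalar_commute)
  have N: "form_tuple UNIV 1 (\<lambda>y. M *v S y)" by (rule form_tuple_comp[OF form_tuple_matrix S]) simp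
  have "y = 0" if "M *v S y = 0" for y using ker[OF that] US by simp
  then obtain N' where N': "form_tuple UNIV 1 N'" "\<And>y. M *v S (N' y) = y" "\<And>y. N' (M *v S y) = y"
    using linear_inverse[OF N] by metis
  show thesis
  proof (rule that[OF N N'])
    show "M *v p = M *v S (U p)" for p
    proof -
      have "U (p - S (U p)) = 0" unfolding form_tuple_linear_diff[OF U] US by simp
      from ker'[OF this] show ?thesis by (simp add: matrix_vector_mult_diff_distrib)
    qed
    show "q (M *v S y) = \<mu> * std_conic y" for y unfolding qU US ..
  qed
qed

lemma binary_quadratic:
  fixes f :: "'a::field ^ 'n \<Rightarrow> 'a"
  assumes f: "form UNIV 2 f"
  shows "f (x *s u + y *s v) = x^2 * f u + x * y * polar f u v + y^2 * f v"
proof -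
  have "polar f (x *s u) (y *s v) = x * y * polar f u v"
    unfolding form_quadratic(2)[OF f] polar_sym[of f "x *s u"] by (simp add: form_quadratic(2)[OF f] polar_sym[of f v])
  then show ?thesis unfolding quadratic_add quadratic_smult[OF f] by simp
qed

text \<open>In the coordinates for which two points of \<open>P\<^sup>1\<close> map to the points \<open>(1 : 0 : 0)\<close> and
  \<open>(0 : 0 : 1)\<close> of the conic, every quadratic parametrisation is the Veronese map up to a sign.\<close>

lemma conic_parametrised:
  fixes Q :: "'a::field_char_0 ^ 2 \<Rightarrow> 'a ^ 3"
  assumes Q: "form_tuple UNIV 2 Q" and on: "\<And>z. std_conic (Q z) = 0" and surj: "\<And>y. std_conic y = 0 \<Longrightarrow> \<exists>z. Q z = y"
  obtains \<omega> where "form_tuple UNIV 1 \<omega>" "\<And>z. \<omega> z = 0 \<Longrightarrow> z = 0" "\<And>z. Q z = veronese (\<omega> z)"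
proof -
  obtain z0 where z0: "Q z0 = vector [1, 0, 0]" using surj[of "vector [1, 0, 0]"] by (auto simp: std_conic_def)
  obtain z1 where z1: "Q z1 = vector [0, 0, 1]" using surj[of "vector [0, 0, 1]"] by (auto simp: std_conic_def)
  define b where "b i = polar (\<lambda>z. Q z $ i) z0 z1" for i
  define P where "P u = u $ 1 *s z0 + u $ 2 *s z1" for u :: "'a ^ 2"
  have QP: "Q (P u) $ 1 = (u $ 1)^2 + b 1 * u $ 1 * u $ 2" "Q (P u) $ 2 = b 2 * u $ 1 * u $ 2"
    "Q (P u) $ 3 = b 3 * u $ 1 * u $ 2 + (u $ 2)^2" for u
    unfolding P_def binary_quadratic[OF form_tuple_nth[OF Q]] z0 z1 b_def by (simp_all add: mult_ac)
  have on': "(b 2 * x * y)^2 = (x^2 + b 1 * x * y) * (b 3 * x * y + y^2)" for x y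
    using on[of "P (vector [x, y])"] unfolding std_conic_def QP by simp
  \<comment> \<open>The conic equation leaves three unknowns \<open>b i\<close>; its values at
    \<open>(1, 1)\<close>, \<open>(1, -1)\<close> and \<open>(2, 1)\<close> give
    \<open>b 1 = b 3 = 0\<close> and \<open>(b 2)^2 = 1\<close>.\<close>
  have "b 1 + b 3 = 0"
  proof -
    have "(1 + b 1) * (b 3 + 1) = (1 - b 1) * (1 - b 3)"
      using on'[of 1 1] on'[of 1 "-1"] by (simp add: power2_eq_square)
    then have "2 * (b 1 + b 3) = 0" by (simp add: algebra_simps)
    then show ?thesis unfolding mult_eq_0_iff by simp
  qed
  then have b3: "b 3 = - b 1" by (simp add: eq_neg_iff_add_eq_0 add.commute)
  have "b 1 = 0"
  proof -
    have 1: "(b 2)^2 = (1 + b 1) * (1 - b 1)" using on'[of 1 1] unfolding b3 by simp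
    have "4 * (b 2)^2 = (4 + b 1 * 2) * (1 - b 1 * 2)" using on'[of 2 1] unfolding b3 by (simp add: power2_eq_square algebra_simps)
    then have "6 * b 1 = 0" unfolding 1 by (simp add: algebra_simps)
    then show ?thesis by simp
  qed
  then have b0: "b 1 = 0" "b 3 = 0" using b3 by auto
  have b2: "(b 2)^2 = 1" using on'[of 1 1] unfolding b0 by simp
  have P: "form_tuple UNIV 1 P"
    unfolding form_tuple_def
  proof
    fix i
    have "form UNIV 1 (\<lambda>u::'a ^ 2. z0 $ i * u $ 1 + z1 $ i * u $ 2)" by (intro form.add form_cmult form_coord)
    then show "form UNIV 1 (\<lambda>u. P u $ i)" by (rule form_cong) (simp add: P_def mult_ac)
  qed
  have "u = 0" if "P u = 0" for u
  proof -
    have "Q (P u) $ i = 0" for i unfolding that by (rule form_at_0[OF form_tuple_nth[OF Q]]) simp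
    then show ?thesis using QP[of u] unfolding b0 by (simp add: vec_eq_iff forall_2)
  qed
  then obtain P' where P': "form_tuple UNIV 1 P'" "\<And>u. P (P' u) = u" "\<And>u. P' (P u) = u" using linear_inverse[OF P] by metis
  define \<omega> where "\<omega> z = (vector [P' z $ 1, b 2 * P' z $ 2] :: 'a ^ 2)" for z
  show thesis
  proof (rule that[of \<omega>])
    show "form_tuple UNIV 1 \<omega>" unfolding form_tuple_def forall_2 \<omega>_def vector_2
      by (intro conjI form_cmult form_tuple_nth[OF P'(1)])
    show "z = 0" if "\<omega> z = 0" for z
    proof -
      have "P' z $ 1 = 0 \<and> b 2 * P' z $ 2 = 0" using that unfolding \<omega>_def vec_eq_iff forall_2 by simp
      then have "P' z = 0" using b2 by (auto simp: vec_eq_iff forall_2)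
      then show ?thesis using P'(2)[of z] unfolding P_def by simp
    qed
    show "Q z = veronese (\<omega> z)" for z
      using QP[of "P' z"] b2 unfolding P'(2) b0 \<omega>_def vec_eq_iff forall_3 veronese_nth by (simp add: power_mult_distrib mult_ac)
  qed
qed

lemma cone_parametrised:
  fixes Q :: "'a::field_char_0 ^ 2 \<Rightarrow> 'a ^ 3"
  assumes Q: "form_tuple UNIV 2 Q" and on: "\<And>z. q (Q z) = 0" and surj: "\<And>y. q y = 0 \<Longrightarrow> \<exists>z. Q z = y"
    and N: "form_tuple UNIV 1 N'" "\<And>y. N (N' y) = y" "\<And>y. N' (N y) = y"
    and \<mu>: "\<mu> \<noteq> 0" and qN: "\<And>y. q (N y) = \<mu> * std_conic y"
  obtains \<omega> where "form_tuple UNIV 1 \<omega>" "\<And>z. \<omega> z = 0 \<Longrightarrow> z = 0" "\<And>y z. N y = Q z \<longleftrightarrow> y = veronese (\<omega> z)"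
proof -
  have "form_tuple UNIV 2 (\<lambda>z. N' (Q z))" using form_tuple_comp[OF N(1) Q] by simp
  moreover have "std_conic (N' (Q z)) = 0" for z using qN[of "N' (Q z)"] on \<mu> unfolding N(2) by simp
  moreover have "\<exists>z. N' (Q z) = y" if "std_conic y = 0" for y
    using surj[of "N y"] that N(3) unfolding qN by (metis mult_zero_right)
  ultimately show thesis
  proof (rule conic_parametrised)
    fix \<omega> assume \<omega>: "form_tuple UNIV 1 \<omega>" "\<And>z. \<omega> z = 0 \<Longrightarrow> z = 0" "\<And>z. N' (Q z) = veronese (\<omega> z)"
    show thesis by (rule that[OF \<omega>(1,2)], assumption) (use \<omega>(3) N(2,3) in metis)
  qed
qed

lemma in_plane_conic: "form UNIV 2 q \<Longrightarrow> pt y \<in> plane_conic q \<longleftrightarrow> y \<noteq> 0 \<and> q y = 0"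
  unfolding plane_conic_def by (subst in_zero_locus) (auto intro!: exI[of _ 2] simp: quadratic_smult)

text \<open>The isomorphism concerns points; on vectors \<open>Q\<close> is still onto the affine
  cone, because it is quadratic and every scalar is a square.\<close>

lemma parametrisation_onto:
  fixes Q :: "'a::{alg_closed_field, field_char_0} ^ 2 \<Rightarrow> 'a ^ 3"
  assumes q: "form UNIV 2 q" and Q: "parametrisation S q Q"
  shows "form_tuple UNIV 2 Q" "q (Q z) = 0" "q y = 0 \<Longrightarrow> \<exists>z. Q z = y"
proof -
  have QS: "form_tuple S 2 Q" and iso: "isomorphism S proj_space (plane_conic q) (proj_map Q)"
    using Q unfolding parametrisation_def by blast+
  show Q2: "form_tuple UNIV 2 Q" using form_tuple_UNIV[OF QS] .
  have Q0: "Q 0 = 0" unfolding vec_eq_iff using form_at_0[OF form_tuple_nth[OF Q2]] by simp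
  show "q (Q z) = 0"
  proof (cases "z = 0")
    case True
    then show ?thesis using Q0 form_at_0[OF q] by simp
  next
    case False
    then have "proj_map Q (pt z) \<in> plane_conic q" using isomorphism_in[OF iso] pt_in_proj_space by blast
    then show ?thesis unfolding proj_map_pt[OF QS] in_plane_conic[OF q] by blast
  qed
  show "\<exists>z. Q z = y" if "q y = 0"
  proof (cases "y = 0")
    case True
    then show ?thesis using Q0 by blast
  next
    case False
    then have y: "pt y \<in> plane_conic q" using that in_plane_conic[OF q] by blast
    obtain \<psi> where 1: "morphism S (plane_conic q) proj_space \<psi>" and 2: "\<forall>R\<in>plane_conic q. proj_map Q (\<psi> R) = R"
      using iso[unfolded isomorphism_def, THEN conjunct2] by (elim exE conjE) (rule that)
    note \<psi> = morphism_in[OF 1 y] bspec[OF 2 y]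
    obtain z where z: "\<psi> (pt y) = pt z" using proj_setE[OF order.refl \<psi>(1)] by metis
    obtain c where c: "c \<noteq> 0" "Q z = c *s y" using \<psi>(2) unfolding z proj_map_pt[OF QS] pt_eq_iff by blast
    obtain e where e: "e^2 = inverse c" using nth_root_exists[of 2 "inverse c"] by auto
    have "Q (e *s z) = y" unfolding form_tuple_homog[OF QS] e c(2) using c(1) by simp
    then show ?thesis by blast
  qed
qed

section \<open>The first two cones of the standard model\<close>

context standard_curves
begin

text \<open>The coordinates are chosen so that at \<open>po w\<close>, for \<open>w\<close> on
  \<open>Ds\<close>, they become \<open>w1^2\<close>, \<open>w1 w2\<close> and \<open>w2^2\<close>;
  those of \<open>cone2\<close> become \<open>w3^2\<close>, \<open>w3 w4\<close> and
  \<open>w4^2\<close>.\<close>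

definition cone1 :: "'a ^ 4 \<Rightarrow> 'a ^ 3" where
  "cone1 x = vector [((1 + a^2) * x $ 3 + (1 - a^2) * x $ 4) / 2, x $ 2, ((1 + a'^2) * x $ 3 + (1 - a'^2) * x $ 4) / 2]"

definition cone2 :: "'a ^ 4 \<Rightarrow> 'a ^ 3" where
  "cone2 x = vector [(x $ 4 + x $ 3) / 2, x $ 1 / 2, (x $ 4 - x $ 3) / 2]"

lemma cone_nth:
  "cone1 x $ 1 = ((1 + a^2) * x $ 3 + (1 - a^2) * x $ 4) / 2" "cone1 x $ 2 = x $ 2"
  "cone1 x $ 3 = ((1 + a'^2) * x $ 3 + (1 - a'^2) * x $ 4) / 2"
  "cone2 x $ 1 = (x $ 4 + x $ 3) / 2" "cone2 x $ 2 = x $ 1 / 2" "cone2 x $ 3 = (x $ 4 - x $ 3) / 2"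
  by (simp_all add: cone1_def cone2_def)

lemma a_diff: "a^2 - a'^2 \<noteq> 0"
proof -
  have "a^2 - a'^2 = (a - a') * (2 * k)" unfolding k by (simp add: algebra_simps power2_eq_square)
  then show ?thesis using aa_ne k_nz by simp
qed

lemma aa2: "a^2 * a'^2 = 1"
  using aa' by (metis power_mult_distrib power_one)

lemma cone1_form: "form_tuple UNIV 1 cone1"
  unfolding form_tuple_def forall_3 cone_nth
proof (intro conjI)
  show "form UNIV 1 (\<lambda>x::'a ^ 4. ((1 + a^2) * x $ 3 + (1 - a^2) * x $ 4) / 2)"
    by (rule form_cong[OF lin_form[of 0 0 "(1 + a^2) / 2" "(1 - a^2) / 2"]]) (simp add: add_divide_distrib)
  show "form UNIV 1 (\<lambda>x::'a ^ 4. ((1 + a'^2) * x $ 3 + (1 - a'^2) * x $ 4) / 2)"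
    by (rule form_cong[OF lin_form[of 0 0 "(1 + a'^2) / 2" "(1 - a'^2) / 2"]]) (simp add: add_divide_distrib)
qed (rule form_coord)

lemma cone2_form: "form_tuple UNIV 1 cone2"
  unfolding form_tuple_def forall_3 cone_nth
proof (intro conjI)
  show "form UNIV 1 (\<lambda>x::'a ^ 4. (x $ 4 + x $ 3) / 2)"
    by (rule form_cong[OF lin_form[of 0 0 "1/2" "1/2"]]) (simp add: add_divide_distrib)
  show "form UNIV 1 (\<lambda>x::'a ^ 4. (x $ 4 - x $ 3) / 2)"
    by (rule form_cong[OF lin_form[of 0 0 "-1/2" "1/2"]]) (simp add: diff_divide_distrib)
  show "form UNIV 1 (\<lambda>x::'a ^ 4. x $ 1 / 2)"
    by (rule form_cong[OF lin_form[of "1/2" 0 0 0]]) simp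
qed

lemma std_conic_cone1: "std_conic (cone1 x) = (x $ 2)^2 - k^2 * (x $ 3)^2 - (1 - k^2) * (x $ 4)^2"
proof -
  define p where "p = a^2"
  define p' where "p' = a'^2"
  have pp: "p * p' = 1" unfolding p_def p'_def by (rule aa2)
  have k2: "4 * k^2 = p + 2 + p'" using ak(3) unfolding p_def p'_def .
  have "4 * std_conic (cone1 x) = 4 * (x $ 2)^2 - ((1 + p) * x $ 3 + (1 - p) * x $ 4) * ((1 + p') * x $ 3 + (1 - p') * x $ 4)"
    unfolding std_conic_def cone_nth p_def p'_def by simp
  also have "((1 + p) * x $ 3 + (1 - p) * x $ 4) * ((1 + p') * x $ 3 + (1 - p') * x $ 4)
    = (1 + p + p' + p * p') * (x $ 3)^2 + (1 - p - p' + p * p') * (x $ 4)^2 + 2 * (1 - p * p') * x $ 3 * x $ 4"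
    by (simp add: algebra_simps power2_eq_square)
  also have "\<dots> = (4 * k^2) * (x $ 3)^2 + (4 - 4 * k^2) * (x $ 4)^2"
    unfolding pp k2 by (simp add: algebra_simps)
  also have "4 * (x $ 2)^2 - \<dots> = 4 * ((x $ 2)^2 - k^2 * (x $ 3)^2 - (1 - k^2) * (x $ 4)^2)" by (simp add: algebra_simps)
  finally show ?thesis using mult_left_cancel[of "4::'a"] zero_neq_numeral by metis
qed

lemma std_conic_cone2: "4 * std_conic (cone2 x) = (x $ 1)^2 + (x $ 3)^2 - (x $ 4)^2"
proof -
  have "4 * ((p / 2)^2 - u / 2 * (v / 2)) = p^2 - u * v" for p u v :: 'a
    by (simp add: power2_eq_square right_diff_distrib)
  then have "4 * std_conic (cone2 x) = (x $ 1)^2 - (x $ 4 + x $ 3) * (x $ 4 - x $ 3)" unfolding std_conic_def cone_nth .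
  then show ?thesis by (simp add: algebra_simps power2_eq_square)
qed

lemma cone1_inv:
  "(a^2 - a'^2) * x $ 3 = cone1 x $ 1 * (1 - a'^2) - cone1 x $ 3 * (1 - a^2)"
  "(a^2 - a'^2) * x $ 4 = cone1 x $ 3 * (1 + a^2) - cone1 x $ 1 * (1 + a'^2)"
proof -
  have "2 * ((a^2 - a'^2) * x $ 3) = 2 * (cone1 x $ 1 * (1 - a'^2) - cone1 x $ 3 * (1 - a^2))"
    "2 * ((a^2 - a'^2) * x $ 4) = 2 * (cone1 x $ 3 * (1 + a^2) - cone1 x $ 1 * (1 + a'^2))"
    unfolding cone_nth by (simp_all add: field_simps)
  then show "(a^2 - a'^2) * x $ 3 = cone1 x $ 1 * (1 - a'^2) - cone1 x $ 3 * (1 - a^2)"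
    "(a^2 - a'^2) * x $ 4 = cone1 x $ 3 * (1 + a^2) - cone1 x $ 1 * (1 + a'^2)"
    using mult_left_cancel[of "2::'a"] zero_neq_numeral by metis+
qed

lemma cone1_eq: "cone1 x = cone1 x' \<longleftrightarrow> x $ 2 = x' $ 2 \<and> x $ 3 = x' $ 3 \<and> x $ 4 = x' $ 4"
proof
  assume *: "cone1 x = cone1 x'"
  have "x $ 3 = x' $ 3" "x $ 4 = x' $ 4"
    using cone1_inv[of x] cone1_inv[of x'] a_diff unfolding * by (metis mult_left_cancel)+
  moreover have "x $ 2 = x' $ 2" using * cone_nth(2) by metis
  ultimately show "x $ 2 = x' $ 2 \<and> x $ 3 = x' $ 3 \<and> x $ 4 = x' $ 4" by blast
qed (simp add: cone1_def)

lemma cone2_eq: "cone2 x = cone2 x' \<longleftrightarrow> x $ 1 = x' $ 1 \<and> x $ 3 = x' $ 3 \<and> x $ 4 = x' $ 4"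
proof
  assume *: "cone2 x = cone2 x'"
  have "y $ 3 = cone2 y $ 1 - cone2 y $ 3" "y $ 4 = cone2 y $ 1 + cone2 y $ 3" "y $ 1 = 2 * cone2 y $ 2" for y
    unfolding cone_nth by (simp_all add: field_simps)
  then show "x $ 1 = x' $ 1 \<and> x $ 3 = x' $ 3 \<and> x $ 4 = x' $ 4" using * by metis
qed (simp add: cone2_def)

definition sec1 :: "'a ^ 3 \<Rightarrow> 'a ^ 4" where
  "sec1 y = vector [0, y $ 2, (y $ 1 * (1 - a'^2) - y $ 3 * (1 - a^2)) / (a^2 - a'^2), (y $ 3 * (1 + a^2) - y $ 1 * (1 + a'^2)) / (a^2 - a'^2)]"

definition sec2 :: "'a ^ 3 \<Rightarrow> 'a ^ 4" where
  "sec2 y = vector [2 * y $ 2, 0, y $ 1 - y $ 3, y $ 1 + y $ 3]"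

lemma cone1_sec1: "cone1 (sec1 y) = y"
proof -
  define d where "d = a^2 - a'^2"
  have d: "d \<noteq> 0" unfolding d_def by (rule a_diff)
  have "(1 + a^2) * (y $ 1 * (1 - a'^2) - y $ 3 * (1 - a^2)) + (1 - a^2) * (y $ 3 * (1 + a^2) - y $ 1 * (1 + a'^2)) = d * (2 * y $ 1)"
    "(1 + a'^2) * (y $ 1 * (1 - a'^2) - y $ 3 * (1 - a^2)) + (1 - a'^2) * (y $ 3 * (1 + a^2) - y $ 1 * (1 + a'^2)) = d * (2 * y $ 3)"
    unfolding d_def by (simp_all add: algebra_simps)
  then show ?thesis
    unfolding vec_eq_iff forall_3 cone_nth sec1_def d_def[symmetric] using d by (simp add: add_divide_distrib[symmetric])
qed

lemma cone2_sec2: "cone2 (sec2 y) = y"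
  unfolding vec_eq_iff forall_3 cone_nth sec2_def by simp

lemma sec1_form: "form_tuple UNIV 1 sec1"
proof -
  have *: "form UNIV 1 (\<lambda>y::'a ^ 3. (y $ i * c - y $ j * c') / d)" for i j c c' d
    by (rule form_cong[OF form_diff[OF form_cmult[OF form_coord, of "c / d" i] form_cmult[OF form_coord, of "c' / d" j]]])
      (simp add: diff_divide_distrib mult_ac)
  show ?thesis unfolding form_tuple_def forall_4 sec1_def vector_4 by (intro conjI form_zero form_coord *)
qed

lemma sec2_form: "form_tuple UNIV 1 sec2"
  unfolding form_tuple_def forall_4 sec2_def vector_4
  by (intro conjI form_zero form_cmult form_coord form_diff form.add)

text \<open>\<open>U\<close> does not involve the coordinate \<rho>, so a linear section lifts
  \<open>y\<close> up to that coordinate, which one equation of the curve then gives as a square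
  root.\<close>

lemma cone_lift:
  fixes \<rho> :: 4
  assumes "\<rho> = 1 \<and> U = cone1 \<or> \<rho> = 2 \<and> U = cone2" and y: "std_conic y = 0" "y \<noteq> 0"
  obtains x where "pt x \<in> Cs" "U x = y"
proof -
  define z where "z = (if \<rho> = 1 then sec1 y else sec2 y)"
  have z: "U z = y" unfolding z_def using assms(1) cone1_sec1 cone2_sec2 by auto
  define e where "e = (if \<rho> = 1 then (z $ 4)^2 - (z $ 3)^2 else (z $ 4)^2 - k^2 * (z $ 1)^2)"
  obtain r where r: "r^2 = e" using nth_root_exists[of 2 e] by auto
  define x where "x = (\<chi> i. if i = \<rho> then r else z $ i)"
  have "U x = y" using z assms(1) cone1_eq[of x z] cone2_eq[of x z] unfolding x_def by auto
  moreover have "pt x \<in> Cs"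
  proof -
    have "x \<noteq> 0" using \<open>U x = y\<close> y(2) form_tuple_linear_smult[OF cone1_form, of 0 0] form_tuple_linear_smult[OF cone2_form, of 0 0] assms(1)
      by auto
    have "4 * std_conic (U z) = 0" unfolding z y by simp
    then show ?thesis using assms(1)
    proof (elim disjE conjE)
      assume *: "\<rho> = 1" "U = cone1" "4 * std_conic (U z) = 0"
      then have "(z $ 2)^2 = k^2 * (z $ 3)^2 + (1 - k^2) * (z $ 4)^2"
        using z y(1) std_conic_cone1[of z] unfolding *(2) by (simp add: algebra_simps)
      moreover have r': "r^2 = (z $ 4)^2 - (z $ 3)^2" using r *(1) unfolding e_def by simp
      ultimately have "(z $ 2)^2 = (z $ 4)^2 - k^2 * r^2" unfolding r' by (simp add: algebra_simps)
      then show ?thesis unfolding in_Cs using \<open>x \<noteq> 0\<close> r' *(1) unfolding x_def by simp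
    next
      assume *: "\<rho> = 2" "U = cone2" "4 * std_conic (U z) = 0"
      then have "(z $ 3)^2 = (z $ 4)^2 - (z $ 1)^2" unfolding *(2) std_conic_cone2 by (simp add: algebra_simps eq_neg_iff_add_eq_0)
      then show ?thesis unfolding in_Cs using \<open>x \<noteq> 0\<close> r *(1) unfolding x_def e_def by simp
    qed
  qed
  ultimately show thesis using that by blast
qed

lemma cone_same:
  assumes "\<rho> = 1 \<and> U = cone1 \<or> \<rho> = 2 \<and> U = cone2" and x: "pt x \<in> Cs" and p: "pt p \<in> Cs"
  shows "(\<exists>c. c \<noteq> 0 \<and> U x = c *s U p) \<longleftrightarrow> same \<rho> x p"
proof
  have U: "form_tuple UNIV 1 U" using assms(1) cone1_form cone2_form by blast
  show "same \<rho> x p" if ex: "\<exists>c. c \<noteq> 0 \<and> U x = c *s U p"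
  proof -
    obtain c where "c \<noteq> 0" "U x = c *s U p" using ex by blast
    then have c: "U x = U (c *s p)" using form_tuple_linear_smult[OF U] by simp
    show ?thesis using assms(1)
    proof (elim disjE conjE)
      assume *: "\<rho> = 1" "U = cone1"
      show ?thesis using c unfolding * cone1_eq by (intro sameI[of 2 3 4 _ _ _ c] x p) auto
    next
      assume *: "\<rho> = 2" "U = cone2"
      show ?thesis using c unfolding * cone2_eq by (intro sameI[of 1 3 4 _ _ _ c] x p) auto
    qed
  qed
  have fl: "U (flip {\<rho>} p) = U p" using assms(1) by (auto simp: cone1_eq cone2_eq flip_nth)
  show "\<exists>c. c \<noteq> 0 \<and> U x = c *s U p" if "same \<rho> x p"
    using that fl form_tuple_linear_smult[OF U] unfolding same_def pt_eq_iff by metis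
qed

text \<open>The construction of the covering in standard coordinates: equating both cones to their
  Veronese parametrisations gives exactly the map \<open>po\<close> and the equations of
  \<open>Ds\<close>.\<close>

lemma cone_solution:
  "cone1 x = veronese (vector [w $ 1, w $ 2]) \<and> cone2 x = veronese (vector [w $ 3, w $ 4]) \<longleftrightarrow>
    x = po w \<and> (w $ 1)^2 = (w $ 3)^2 - a^2 * (w $ 4)^2 \<and> (w $ 2)^2 = (w $ 3)^2 - a'^2 * (w $ 4)^2"
proof
  assume *: "cone1 x = veronese (vector [w $ 1, w $ 2]) \<and> cone2 x = veronese (vector [w $ 3, w $ 4])"
  have 2: "(x $ 4 + x $ 3) / 2 = (w $ 3)^2" "x $ 1 / 2 = w $ 3 * w $ 4" "(x $ 4 - x $ 3) / 2 = (w $ 4)^2"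
    using conjunct2[OF *] unfolding vec_eq_iff forall_3 cone_nth veronese_nth by simp_all
  have x: "x $ 3 = (w $ 3)^2 - (w $ 4)^2" "x $ 4 = (w $ 3)^2 + (w $ 4)^2" "x $ 1 = 2 * w $ 3 * w $ 4"
  proof -
    have "x $ 3 = (x $ 4 + x $ 3) / 2 - (x $ 4 - x $ 3) / 2" "x $ 4 = (x $ 4 + x $ 3) / 2 + (x $ 4 - x $ 3) / 2"
      by (simp_all add: field_simps)
    then show "x $ 3 = (w $ 3)^2 - (w $ 4)^2" "x $ 4 = (w $ 3)^2 + (w $ 4)^2" unfolding 2 by blast+
    have "x $ 1 = 2 * (x $ 1 / 2)" by simp
    then show "x $ 1 = 2 * w $ 3 * w $ 4" unfolding 2 by simp
  qed
  have 1: "((1 + a^2) * x $ 3 + (1 - a^2) * x $ 4) / 2 = (w $ 1)^2" "x $ 2 = w $ 1 * w $ 2"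
    "((1 + a'^2) * x $ 3 + (1 - a'^2) * x $ 4) / 2 = (w $ 2)^2"
    using conjunct1[OF *] unfolding vec_eq_iff forall_3 cone_nth veronese_nth by simp_all
  have "x = po w" unfolding vec_eq_iff forall_4 po_def using x 1(2) by simp
  moreover have "(w $ 1)^2 = (w $ 3)^2 - a^2 * (w $ 4)^2" "(w $ 2)^2 = (w $ 3)^2 - a'^2 * (w $ 4)^2"
    unfolding 1[symmetric] x by (simp_all add: field_simps)
  ultimately show "x = po w \<and> (w $ 1)^2 = (w $ 3)^2 - a^2 * (w $ 4)^2 \<and> (w $ 2)^2 = (w $ 3)^2 - a'^2 * (w $ 4)^2" by blast
next
  assume *: "x = po w \<and> (w $ 1)^2 = (w $ 3)^2 - a^2 * (w $ 4)^2 \<and> (w $ 2)^2 = (w $ 3)^2 - a'^2 * (w $ 4)^2"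
  have x: "x $ 1 = 2 * w $ 3 * w $ 4" "x $ 2 = w $ 1 * w $ 2" "x $ 3 = (w $ 3)^2 - (w $ 4)^2" "x $ 4 = (w $ 3)^2 + (w $ 4)^2"
    unfolding conjunct1[OF *] po_def by simp_all
  note w = conjunct1[OF conjunct2[OF *]] conjunct2[OF conjunct2[OF *]]
  show "cone1 x = veronese (vector [w $ 1, w $ 2]) \<and> cone2 x = veronese (vector [w $ 3, w $ 4])"
    unfolding vec_eq_iff forall_3 cone_nth veronese_nth vector_2 x w by (simp add: field_simps)
qed

end

section \<open>The covering defined by two cones\<close>

context curve_with_jacobian
begin

lemma cone_fibre:
  fixes \<rho> :: 4 and M :: "'a ^ 4 ^ 3"
  assumes \<rho>: "\<rho> = 1 \<and> U = cone1 \<or> \<rho> = 2 \<and> U = cone2" and q: "form UNIV 2 q"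
    and N: "form_tuple UNIV 1 N" "\<And>y. N (N' y) = y" "\<And>y. N' (N y) = y"
    and MN: "\<And>p. M *v p = N (U (L p))" and \<mu>: "\<mu> \<noteq> 0" and qN: "\<And>y. q (N y) = \<mu> * std_conic y"
    and R: "R \<in> plane_conic q"
  obtains x where "pt x \<in> Cs" "double_cover_fibre C (projection M) R = dv [pnt x, pnt (flip {\<rho>} x)]"
proof -
  obtain y where Ry: "R = pt y" using proj_setE[OF zero_locus_subset R[unfolded plane_conic_def]] by metis
  have y: "y \<noteq> 0" "q y = 0" using R unfolding Ry in_plane_conic[OF q] by blast+
  have N0: "N 0 = 0" using form_tuple_linear_smult[OF N(1), of 0 0] by simp
  have "std_conic (N' y) = 0" using qN[of "N' y"] \<mu> y(2) unfolding N(2) by simp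
  moreover have "N' y \<noteq> 0" using N(2)[of y] N0 y(1) by metis
  ultimately obtain x where x: "pt x \<in> Cs" "U x = N' y" using cone_lift[OF \<rho>] by metis
  have proj: "projection M (pnt z) = pt (N (U z))" for z
    unfolding pnt_def proj_map_pt[OF form_tuple_matrix] unfolding MN LL' ..
  have R': "R = pt (N (U x))" unfolding Ry x(2) N(2) ..
  have iff: "projection M (pnt z) = R \<longleftrightarrow> same \<rho> z x" if z: "pt z \<in> Cs" for z
  proof -
    have "N (U z) = c *s N (U x) \<longleftrightarrow> U z = c *s U x" for c
      using N(3) form_tuple_linear_smult[OF N(1), of c "U x"] by metis
    then show ?thesis unfolding proj R' pt_eq_iff using cone_same[OF \<rho> z x(1)] by simp
  qed
  have fx: "pt (flip {\<rho>} x) \<in> Cs" by (rule flip_Cs[OF x(1)])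
  have F: "{P \<in> C. projection M P = R} = {pnt x, pnt (flip {\<rho>} x)}"
  proof
    show "{P \<in> C. projection M P = R} \<subseteq> {pnt x, pnt (flip {\<rho>} x)}"
    proof
      fix P assume "P \<in> {P \<in> C. projection M P = R}"
      then have P: "P \<in> C" "projection M P = R" by auto
      obtain z where z: "P = pnt z" "pt z \<in> Cs" using pnt_surj[OF P(1)] by blast
      have "same \<rho> z x" using P(2) iff[OF z(2)] unfolding z(1) by blast
      then show "P \<in> {pnt x, pnt (flip {\<rho>} x)}" unfolding same_def z(1) pnt_eq[symmetric] by blast
    qed
    have "same \<rho> x x" "same \<rho> (flip {\<rho>} x) x" unfolding same_def by blast+
    then show "{pnt x, pnt (flip {\<rho>} x)} \<subseteq> {P \<in> C. projection M P = R}"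
      using iff[OF x(1)] iff[OF fx] x(1) fx pnt_in by blast
  qed
  have "double_cover_fibre C (projection M) R = dv [pnt x, pnt (flip {\<rho>} x)]"
  proof (cases "pnt x = pnt (flip {\<rho>} x)")
    case True
    have "frag_cmul 2 (frag_of P) = frag_of P + frag_of P" for P :: "('a, 4) ppoint"
      using frag_cmul_distrib[of 1 1 "frag_of P"] by simp
    then show ?thesis unfolding double_cover_fibre_def Let_def F using True[symmetric] by simp
  next
    case False
    then show ?thesis unfolding double_cover_fibre_def Let_def F by simp
  qed
  then show thesis using that x(1) by blast
qed

text \<open>\<open>W w\<close> lists the Veronese parameters of the two cones. Since
  \<open>p\<close> is determined by \<open>w\<close> on both sides of the system, its solvability
  alone identifies the zeros of \<open>F\<close> and \<open>G\<close> with those of the equations of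
  \<open>Ds\<close>.\<close>

lemma system_coordinates:
  fixes \<omega>1 \<omega>2 :: "'a ^ 2 \<Rightarrow> 'a ^ 2" and z1 z2 :: "'a ^ 4 \<Rightarrow> 'a ^ 2" and r :: "'a ^ 4 \<Rightarrow> 'a ^ 4"
  assumes \<omega>1: "form_tuple UNIV 1 \<omega>1" "\<And>z. \<omega>1 z = 0 \<Longrightarrow> z = 0" and \<omega>2: "form_tuple UNIV 1 \<omega>2" "\<And>z. \<omega>2 z = 0 \<Longrightarrow> z = 0"
    and z: "form_tuple UNIV 1 z1" "form_tuple UNIV 1 z2" "\<And>w. z1 w = 0 \<Longrightarrow> z2 w = 0 \<Longrightarrow> w = 0"
    and F: "form S 2 F" and G: "form S 2 G"
    and sys: "\<And>p w. (cone1 (L p) = veronese (\<omega>1 (z1 w)) \<and> cone2 (L p) = veronese (\<omega>2 (z2 w))) \<longleftrightarrow> (p = r w \<and> F w = 0 \<and> G w = 0)"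
  obtains W W' where "form_tuple UNIV 1 W" "form_tuple UNIV 1 W'" "\<And>v. W (W' v) = v" "\<And>v. W' (W v) = v"
    "\<And>w. pt w \<in> zero_locus {F, G} \<longleftrightarrow> pt (W w) \<in> Ds" "\<And>w. pt w \<in> zero_locus {F, G} \<Longrightarrow> L (r w) = po (W w)"
proof -
  define W where "W w = (vector [\<omega>1 (z1 w) $ 1, \<omega>1 (z1 w) $ 2, \<omega>2 (z2 w) $ 1, \<omega>2 (z2 w) $ 2] :: 'a ^ 4)" for w
  have c: "form_tuple UNIV 1 (\<lambda>w. \<omega>1 (z1 w))" "form_tuple UNIV 1 (\<lambda>w. \<omega>2 (z2 w))"
    by (rule form_tuple_comp[OF \<omega>1(1) z(1)], simp) (rule form_tuple_comp[OF \<omega>2(1) z(2)], simp)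
  have W: "form_tuple UNIV 1 W" unfolding form_tuple_def forall_4 W_def vector_4
    by (intro conjI form_tuple_nth c)
  have "w = 0" if "W w = 0" for w
  proof -
    have "\<omega>1 (z1 w) = 0" "\<omega>2 (z2 w) = 0" using that unfolding vec_eq_iff forall_4 forall_2 W_def by simp_all
    then show ?thesis using z(3) \<omega>1(2) \<omega>2(2) by blast
  qed
  then obtain W' where W': "form_tuple UNIV 1 W'" "\<And>v. W (W' v) = v" "\<And>v. W' (W v) = v" using linear_inverse[OF W] by metis
  have v: "vector [W w $ 1, W w $ 2] = \<omega>1 (z1 w)" "vector [W w $ 3, W w $ 4] = \<omega>2 (z2 w)" for w
    unfolding vec_eq_iff forall_2 by (simp_all add: W_def)
  define eqs where "eqs w \<longleftrightarrow> (w $ 1)^2 = (w $ 3)^2 - a^2 * (w $ 4)^2 \<and> (w $ 2)^2 = (w $ 3)^2 - a'^2 * (w $ 4)^2" for w :: "'a ^ 4"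
  have *: "(p = r w \<and> F w = 0 \<and> G w = 0) \<longleftrightarrow> (L p = po (W w) \<and> eqs (W w))" for p w
    using sys[of p w] cone_solution[of "L p" "W w"] unfolding v eqs_def by blast
  have FG: "F w = 0 \<and> G w = 0 \<longleftrightarrow> eqs (W w)" for w
    using *[of "r w" w] *[of "L' (po (W w))" w] LL' by blast
  have D: "pt w \<in> zero_locus {F, G} \<longleftrightarrow> w \<noteq> 0 \<and> F w = 0 \<and> G w = 0" for w
    by (subst in_zero_locus) (auto intro!: exI[of _ 2] simp: quadratic_smult[OF F] quadratic_smult[OF G])
  have W0: "W w = 0 \<longleftrightarrow> w = 0" for w using W'(3)[of w] form_tuple_linear_smult[OF W, of 0 0] form_tuple_linear_smult[OF W'(1), of 0 0] by auto
  show thesis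
  proof (rule that[OF W W'])
    show "pt w \<in> zero_locus {F, G} \<longleftrightarrow> pt (W w) \<in> Ds" for w
      unfolding D in_Ds FG W0 eqs_def ..
    show "L (r w) = po (W w)" if "pt w \<in> zero_locus {F, G}" for w using that * unfolding D by blast
  qed
qed

theorem isogeny_covering_standard:
  fixes r :: "'a ^ 4 \<Rightarrow> 'a ^ 4"
  assumes E: "discriminant E \<noteq> 0" "discriminant E' \<noteq> 0"
    and iso: "isomorphism UNIV C (points E) (\<lambda>P. j (frag_of P - frag_of (pnt Oc)))"
    and T: "j (frag_of (pnt (flip {1, 2} Oc)) - frag_of (pnt Oc)) = T"
    and \<phi>: "morphism UNIV (points E) (points E') \<phi>" "\<phi> origin = origin" "{P \<in> points E. \<phi> P = origin} = {origin, T}"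
    and \<phi>': "morphism UNIV (points E') (points E) \<phi>'" and double: "\<And>P. P \<in> points E \<Longrightarrow> \<phi>' (\<phi> P) = ell_add E P P"
    and W: "form_tuple UNIV 1 W" "form_tuple UNIV 1 W'" "\<And>v. W (W' v) = v" "\<And>v. W' (W v) = v"
    and D: "D \<subseteq> proj_space" "\<And>w. pt w \<in> D \<longleftrightarrow> pt (W w) \<in> Ds" and r: "form_tuple S 2 r" "\<And>w. pt w \<in> D \<Longrightarrow> L (r w) = po (W w)"
  shows "isogeny_covering S E' E \<phi>' D C (proj_map r)"
proof -
  define g where "g P = j (frag_of P - frag_of (pnt Oc))" for P
  have g: "isomorphism UNIV C (points E) g" using iso unfolding g_def .
  have L'iso: "isomorphism UNIV Cs C (proj_map L')"
    by (rule linear_isomorphism[OF L' L L'L LL' C(1) Cs_proj]) (simp add: C(2) LL')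
  define gs where "gs P = g (proj_map L' P)" for P
  have gs: "isomorphism UNIV Cs (points E) gs"
    unfolding gs_def by (rule isomorphism_comp[OF L'iso g Cs_proj C(1) points_proj])
  have gs_pt: "gs (pt v) = g (pnt v)" for v unfolding gs_def pnt_def proj_map_pt[OF L'] ..
  have "j 0 = origin" using fibre_equiv[of 1, OF _ Oc_in Oc_in] by simp
  then have O: "gs (pt Oc) = origin" unfolding gs_pt g_def by simp
  have T': "gs (pt (flip {1, 2} Oc)) = T" unfolding gs_pt g_def by (rule T)
  obtain d x where x: "form UNIV d generic" "pt x \<in> Cs" "generic x \<noteq> 0" using generic_exists[OF irrCs] by metis
  have dbl: "\<phi>' (\<phi> (gs (pt v))) = gs (pt (po (ps v)))" if v: "pt v \<in> Cs" "generic v \<noteq> 0" for v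
  proof -
    have P: "gs (pt v) \<in> points E" by (rule isomorphism_in[OF gs v(1)])
    show ?thesis unfolding double[OF P] unfolding gs_pt g_def jacobian_double[OF v] ..
  qed
  obtain f where f: "isomorphism UNIV Ds (points E') f" "\<And>w. pt w \<in> Ds \<Longrightarrow> gs (pt (po w)) = \<phi>' (f (pt w))"
    using covering_standard[OF E gs O T' \<phi> \<phi>' x dbl] by metis
  have Wiso: "isomorphism UNIV D Ds (proj_map W)" by (rule linear_isomorphism[OF W Ds_proj D])
  have fW: "isomorphism UNIV D (points E') (\<lambda>P. f (proj_map W P))"
    by (rule isomorphism_comp[OF Wiso f(1) D(1) Ds_proj points_proj])
  have rw: "pt (r w) \<in> C" if w: "pt w \<in> D" for w
    unfolding C(2) r(2)[OF w] using po_in(2) w unfolding D(2) by blast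
  show ?thesis
    unfolding isogeny_covering_def
  proof (rule conjI)
    show "morphism S D C (proj_map r)"
      by (rule proj_map_morphism[OF r(1) D(1)]) (use rw C(1) pt_in_proj_space in blast)
    have comm: "g (proj_map r P) = \<phi>' (f (proj_map W P))" if "P \<in> D" for P
    proof -
      from that obtain w where w: "P = pt w" "pt w \<in> D" using proj_setE[OF D(1)] by metis
      have "r w = L' (po (W w))" using r(2)[OF w(2)] L'L by metis
      then have "g (proj_map r P) = gs (pt (po (W w)))" unfolding w(1) proj_map_pt[OF r(1)] gs_pt pnt_def by simp
      also have "\<dots> = \<phi>' (f (pt (W w)))" using f(2)[of "W w"] w(2) unfolding D(2) by blast
      finally show ?thesis unfolding w(1) proj_map_pt[OF W(1)] .
    qed
    show "\<exists>f g. isomorphism UNIV D (points E') f \<and> isomorphism UNIV C (points E) g \<and> (\<forall>P\<in>D. g (proj_map r P) = \<phi>' (f P))"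
      by (rule exI[of _ "\<lambda>P. f (proj_map W P)"], rule exI[of _ g]) (use fW g comm in blast)
  qed
qed

end

lemma morphism_UNIV: "morphism S V W \<phi> \<Longrightarrow> morphism UNIV V W \<phi>"
  unfolding morphism_def
proof (elim conjE, intro conjI ballI)
  fix P assume "P \<in> V" and *: "\<forall>P\<in>V. \<exists>d h. form_tuple S d h \<and> (\<forall>v\<in>P. h v \<noteq> 0) \<and> (\<forall>Q\<in>V. \<forall>v\<in>Q. h v \<noteq> 0 \<longrightarrow> \<phi> Q = pt (h v))"
  obtain d h where h: "form_tuple S d h \<and> (\<forall>v\<in>P. h v \<noteq> 0) \<and> (\<forall>Q\<in>V. \<forall>v\<in>Q. h v \<noteq> 0 \<longrightarrow> \<phi> Q = pt (h v))"
    using bspec[OF * \<open>P \<in> V\<close>] by (elim exE) (rule that)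
  show "\<exists>d h. form_tuple UNIV d h \<and> (\<forall>v\<in>P. h v \<noteq> 0) \<and> (\<forall>Q\<in>V. \<forall>v\<in>Q. h v \<noteq> 0 \<longrightarrow> \<phi> Q = pt (h v))"
    by (rule exI[of _ d], rule exI[of _ h], rule conjI[OF form_tuple_UNIV[OF conjunct1[OF h]] conjunct2[OF h]])
qed

text \<open>Both cases of the construction in one statement. \<open>q2\<close> and \<open>M2\<close>
  are a second description of the second cone: itself in the split case, the conjugate of the first
  cone in the other. Fibres are taken with \<open>q 2\<close> and \<open>m 2\<close>, the
  parametrised system with \<open>q2\<close> and \<open>M2\<close>.\<close>

theorem isogeny_covering_of_cones:
  fixes A B F G :: "'a::{alg_closed_field, field_char_0} ^ 4 \<Rightarrow> 'a" and m :: "4 \<Rightarrow> 'a ^ 4 ^ 3"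
    and r :: "'a ^ 4 \<Rightarrow> 'a ^ 4" and z1 z2 :: "'a ^ 4 \<Rightarrow> 'a ^ 2" and M2 :: "'a ^ 4 ^ 3"
  assumes ns: "nonsingular_quadric_intersection K A B" and C: "C = zero_locus {A, B}" and jac: "is_jacobian K C E j"
    and q: "\<And>i. form UNIV 2 (q i)" and cone: "\<And>i p. q i (m i *v p) = s i * A p + t i * B p"
    and st: "\<And>i j. i \<noteq> j \<Longrightarrow> s i * t j \<noteq> s j * t i"
    and R: "R1 \<in> plane_conic (q 1)" "R2 \<in> plane_conic (q 2)"
    and T: "j (double_cover_fibre C (projection (m 1)) R1 - double_cover_fibre C (projection (m 2)) R2) = T"
    and E': "discriminant E' \<noteq> 0"
    and \<phi>: "two_isogeny_with_kernel K E E' T \<phi>" and \<phi>': "dual_two_isogeny K E E' \<phi> \<phi>'"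
    and q2: "form UNIV 2 q2" "\<And>p. q2 (M2 *v p) = s' * A p + t' * B p" "s' \<noteq> 0 \<or> t' \<noteq> 0"
    and same_cone: "\<And>p. q 2 (m 2 *v p) = 0 \<Longrightarrow> q2 (M2 *v p) = 0"
    and Q1: "form_tuple UNIV 2 Q1" "\<And>z. q 1 (Q1 z) = 0" "\<And>y. q 1 y = 0 \<Longrightarrow> \<exists>z. Q1 z = y"
    and Q2: "form_tuple UNIV 2 Q2" "\<And>z. q2 (Q2 z) = 0" "\<And>y. q2 y = 0 \<Longrightarrow> \<exists>z. Q2 z = y"
    and z: "form_tuple UNIV 1 z1" "form_tuple UNIV 1 z2" "\<And>w. z1 w = 0 \<Longrightarrow> z2 w = 0 \<Longrightarrow> w = 0"
    and F: "form K 2 F" and G: "form K 2 G" and r: "form_tuple K 2 r"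
    and sys: "\<And>p w. (m 1 *v p = Q1 (z1 w) \<and> M2 *v p = Q2 (z2 w)) \<longleftrightarrow> (p = r w \<and> F w = 0 \<and> G w = 0)"
  shows "isogeny_covering K E' E \<phi>' (zero_locus {F, G}) C (proj_map r)"
proof (rule standard_coordinates[where s = s and t = t and q = q and m = m, OF ns q cone])
  show "s i * t j \<noteq> s j * t i" if "i \<noteq> j" for i j by (rule st[OF that])
  fix a a' k and L L' :: "'a ^ 4 \<Rightarrow> 'a ^ 4" and \<mu>1 \<mu>2 v assume std: "standard_curves a a' k"
    and lin: "form_tuple UNIV 1 L" "form_tuple UNIV 1 L'" "\<And>v. L (L' v) = v" "\<And>v. L' (L v) = v" and \<mu>: "\<mu>1 \<noteq> 0" "\<mu>2 \<noteq> 0"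
    and c1: "\<And>p. s 1 * A p + t 1 * B p = \<mu>1 * ((L p $ 2)^2 - k^2 * (L p $ 3)^2 - (1 - k^2) * (L p $ 4)^2)"
    and c2: "\<And>p. s 2 * A p + t 2 * B p = \<mu>2 * ((L p $ 1)^2 + (L p $ 3)^2 - (L p $ 4)^2)"
    and v: "v \<noteq> 0" "A v = t 2" "B v = - s 2"
  interpret standard_curves a a' k by (rule std)
  have A: "form K 2 A" and B: "form K 2 B" using ns unfolding nonsingular_quadric_intersection_def by blast+
  have in_C: "pt p \<in> C \<longleftrightarrow> p \<noteq> 0 \<and> A p = 0 \<and> B p = 0" for p
    unfolding C by (subst in_zero_locus) (auto intro!: exI[of _ 2] simp: quadratic_smult[OF A] quadratic_smult[OF B])
  have Cp: "C \<subseteq> proj_space" unfolding C by (rule zero_locus_subset)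
  have L0: "L p = 0 \<longleftrightarrow> p = 0" for p
    using lin(4)[of p] form_tuple_linear_smult[OF lin(1), of 0 0] form_tuple_linear_smult[OF lin(2), of 0 0] by auto
  have CL: "pt p \<in> C \<longleftrightarrow> pt (L p) \<in> Cs" for p
  proof -
    have "A p = 0 \<and> B p = 0 \<longleftrightarrow> s 1 * A p + t 1 * B p = 0 \<and> s 2 * A p + t 2 * B p = 0"
    proof
      assume *: "s 1 * A p + t 1 * B p = 0 \<and> s 2 * A p + t 2 * B p = 0"
      have "(s 1 * t 2 - s 2 * t 1) * A p = t 2 * (s 1 * A p + t 1 * B p) - t 1 * (s 2 * A p + t 2 * B p)"
        "(s 1 * t 2 - s 2 * t 1) * B p = s 1 * (s 2 * A p + t 2 * B p) - s 2 * (s 1 * A p + t 1 * B p)"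
        by (simp_all add: algebra_simps)
      then show "A p = 0 \<and> B p = 0" using st[of 1 2] unfolding conjunct1[OF *] conjunct2[OF *] by simp
    qed simp
    also have "\<dots> \<longleftrightarrow> (L p $ 3)^2 = (L p $ 4)^2 - (L p $ 1)^2 \<and> (L p $ 2)^2 = (L p $ 4)^2 - k^2 * (L p $ 1)^2"
    proof -
      have "x2 - k^2 * x3 - (1 - k^2) * x4 = 0 \<and> x1 + x3 - x4 = 0 \<longleftrightarrow> x3 = x4 - x1 \<and> x2 = x4 - k^2 * x1" for x1 x2 x3 x4 :: 'a
        by (auto simp: algebra_simps)
      then show ?thesis unfolding c1 c2 using \<mu> by simp
    qed
    finally show ?thesis unfolding in_C in_Cs L0 by blast
  qed
  have jE: "discriminant E \<noteq> 0" "\<And>D D'. D \<in> div0 C \<Longrightarrow> D' \<in> div0 C \<Longrightarrow> j (D + D') = ell_add E (j D) (j D')"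
    "\<And>D. D \<in> div0 C \<Longrightarrow> principal C D \<Longrightarrow> j D = origin"
    "\<And>P0. P0 \<in> C \<Longrightarrow> isomorphism UNIV C (points E) (\<lambda>P. j (frag_of P - frag_of P0))"
    using jac unfolding is_jacobian_def elliptic_curve_def by blast+
  \<comment> \<open>Obtained from the Weierstrass cubic: an Abel-Jacobi isomorphism leads from
    \<open>points E\<close> back to \<open>C\<close>, and \<open>L\<close> from there to the
    standard curve.\<close>
  have irrCs: "irr_curve Cs"
  proof -
    have "pt (L' Oc) \<in> C" unfolding CL lin(3) by (rule Oc_in)
    then obtain \<psi> where "isomorphism UNIV (points E) C \<psi>" using isomorphism_inverse[OF jE(4)] by metis
    then have "irr_curve C" using irr_curve_isomorphic[OF irr_points[OF jE(1)] _ Cp] by blast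
    moreover have "isomorphism UNIV C Cs (proj_map L)" by (rule linear_isomorphism[OF lin Cs_proj Cp CL])
    ultimately show ?thesis using irr_curve_isomorphic Cs_proj by blast
  qed
  interpret curve_with_jacobian a a' k L L' C E j
    by unfold_locales (fact lin Cp CL jE(2,3) irrCs)+
  have U1: "form_tuple UNIV 1 (\<lambda>p. cone1 (L p))" "form_tuple UNIV 1 (\<lambda>y. L' (sec1 y))" "\<And>y. cone1 (L (L' (sec1 y))) = y"
    by (rule form_tuple_comp[OF cone1_form lin(1)], simp) (rule form_tuple_comp[OF lin(2) sec1_form], simp, simp add: LL' cone1_sec1)
  have U2: "form_tuple UNIV 1 (\<lambda>p. cone2 (L p))" "form_tuple UNIV 1 (\<lambda>y. L' (sec2 y))" "\<And>y. cone2 (L (L' (sec2 y))) = y"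
    by (rule form_tuple_comp[OF cone2_form lin(1)], simp) (rule form_tuple_comp[OF lin(2) sec2_form], simp, simp add: LL' cone2_sec2)
  have ax: "\<exists>c. p = c *s L' (axis i 1)" if "\<And>l. l \<noteq> i \<Longrightarrow> L p $ l = 0" for p and i :: 4
  proof -
    have "L p = (L p $ i) *s axis i 1" unfolding vec_eq_iff axis_def using that by auto
    then have "p = (L p $ i) *s L' (axis i 1)" using L'L form_tuple_linear_smult[OF lin(2)] by metis
    then show ?thesis by blast
  qed
  have cone0: "cone1 0 = 0" "cone2 0 = 0" using form_tuple_linear_smult[OF cone1_form, of 0 0] form_tuple_linear_smult[OF cone2_form, of 0 0] by simp_all
  have U1e: "\<exists>c. p = c *s L' (axis 1 1)" if "cone1 (L p) = 0" for p
    by (rule ax) (use that cone1_eq[of "L p" 0] cone0 exhaust_4 in \<open>metis zero_index\<close>)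
  have U2e: "\<exists>c. p = c *s L' (axis 2 1)" if "cone2 (L p) = 0" for p
    by (rule ax) (use that cone2_eq[of "L p" 0] cone0 exhaust_4 in \<open>metis zero_index\<close>)
  have q1U: "q 1 (m 1 *v p) = \<mu>1 * std_conic (cone1 (L p))" for p unfolding cone c1 std_conic_cone1 ..
  have q2U: "q 2 (m 2 *v p) = (4 * \<mu>2) * std_conic (cone2 (L p))" for p
    unfolding cone c2 std_conic_cone2[symmetric] by simp
  \<comment> \<open>The vertex \<open>v\<close> of the second cone lies on only one member of the
    pencil, so the two descriptions have equations that differ by a factor.\<close>
  obtain \<nu> where \<nu>: "\<nu> \<noteq> 0" "s' = \<nu> * s 2" "t' = \<nu> * t 2"
  proof -
    have "q 2 (m 2 *v v) = 0" unfolding cone v by simp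
    then have "s' * t 2 = t' * s 2" using same_cone[of v] unfolding q2(2) v by simp
    moreover have "s 2 \<noteq> 0 \<or> t 2 \<noteq> 0" using st[of 1 2] by auto
    ultimately have "\<exists>\<nu>. \<nu> \<noteq> 0 \<and> s' = \<nu> * s 2 \<and> t' = \<nu> * t 2"
    proof (cases "s 2 = 0")
      case True
      then show ?thesis using \<open>s' * t 2 = t' * s 2\<close> \<open>s 2 \<noteq> 0 \<or> t 2 \<noteq> 0\<close> q2(3) by (intro exI[of _ "t' / t 2"]) auto
    next
      case False
      then have "t' = s' / s 2 * t 2" using \<open>s' * t 2 = t' * s 2\<close> by (simp add: field_simps)
      then show ?thesis using False q2(3) by (intro exI[of _ "s' / s 2"]) auto
    qed
    then show thesis using that by blast
  qed
  have q2U': "q2 (M2 *v p) = (4 * \<nu> * \<mu>2) * std_conic (cone2 (L p))" for p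
  proof -
    have "q2 (M2 *v p) = \<nu> * (s 2 * A p + t 2 * B p)" unfolding q2(2) \<nu> by (simp add: algebra_simps)
    then show ?thesis unfolding c2 std_conic_cone2[symmetric] by simp
  qed
  have \<mu>': "4 * \<mu>2 \<noteq> 0" "4 * \<nu> * \<mu>2 \<noteq> 0" using \<mu> \<nu> by simp_all
  obtain N1 N1' where N1: "form_tuple UNIV 1 N1" "form_tuple UNIV 1 N1'" "\<And>y. N1 (N1' y) = y" "\<And>y. N1' (N1 y) = y"
    "\<And>p. m 1 *v p = N1 (cone1 (L p))" "\<And>y. q 1 (N1 y) = \<mu>1 * std_conic y"
    using cone_factor[OF q U1 U1e \<mu>(1) q1U] by metis
  obtain N2 N2' where N2: "form_tuple UNIV 1 N2" "form_tuple UNIV 1 N2'" "\<And>y. N2 (N2' y) = y" "\<And>y. N2' (N2 y) = y"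
    "\<And>p. m 2 *v p = N2 (cone2 (L p))" "\<And>y. q 2 (N2 y) = (4 * \<mu>2) * std_conic y"
    using cone_factor[OF q U2 U2e \<mu>'(1) q2U] by metis
  obtain N3 N3' where N3: "form_tuple UNIV 1 N3" "form_tuple UNIV 1 N3'" "\<And>y. N3 (N3' y) = y" "\<And>y. N3' (N3 y) = y"
    "\<And>p. M2 *v p = N3 (cone2 (L p))" "\<And>y. q2 (N3 y) = (4 * \<nu> * \<mu>2) * std_conic y"
    using cone_factor[OF q2(1) U2 U2e \<mu>'(2) q2U'] by metis
  obtain x where x: "pt x \<in> Cs" "double_cover_fibre C (projection (m 1)) R1 = dv [pnt x, pnt (flip {1} x)]"
    by (rule cone_fibre[where \<rho> = 1 and U = cone1, OF _ q N1(1,3,4,5) \<mu>(1) N1(6) R(1)]) simp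
  obtain y where y: "pt y \<in> Cs" "double_cover_fibre C (projection (m 2)) R2 = dv [pnt y, pnt (flip {2} y)]"
    by (rule cone_fibre[where \<rho> = 2 and U = cone2, OF _ q N2(1,3,4,5) \<mu>'(1) N2(6) R(2)]) simp
  have T': "j (frag_of (pnt (flip {1, 2} Oc)) - frag_of (pnt Oc)) = T"
    unfolding jacobian_T[OF x(1) y(1)] using T unfolding x(2) y(2) .
  obtain \<omega>1 where \<omega>1: "form_tuple UNIV 1 \<omega>1" "\<And>z. \<omega>1 z = 0 \<Longrightarrow> z = 0" "\<And>y z. N1 y = Q1 z \<longleftrightarrow> y = veronese (\<omega>1 z)"
    by (rule cone_parametrised[OF Q1 N1(2,3,4) \<mu>(1) N1(6)]) blast+
  obtain \<omega>2 where \<omega>2: "form_tuple UNIV 1 \<omega>2" "\<And>z. \<omega>2 z = 0 \<Longrightarrow> z = 0" "\<And>y z. N3 y = Q2 z \<longleftrightarrow> y = veronese (\<omega>2 z)"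
    by (rule cone_parametrised[OF Q2 N3(2,3,4) \<mu>'(2) N3(6)]) blast+
  obtain W W' where W: "form_tuple UNIV 1 W" "form_tuple UNIV 1 W'" "\<And>v. W (W' v) = v" "\<And>v. W' (W v) = v"
    "\<And>w. pt w \<in> zero_locus {F, G} \<longleftrightarrow> pt (W w) \<in> Ds" "\<And>w. pt w \<in> zero_locus {F, G} \<Longrightarrow> L (r w) = po (W w)"
    by (rule system_coordinates[OF \<omega>1(1,2) \<omega>2(1,2) z F G sys[unfolded N1(5) N3(5) \<omega>1(3) \<omega>2(3)]]) blast+
  have PO: "pnt Oc \<in> C" unfolding pnt_in by (rule Oc_in)
  note \<phi> = \<phi>[unfolded two_isogeny_with_kernel_def isogeny_def] and \<phi>' = \<phi>'[unfolded dual_two_isogeny_def isogeny_def]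
  note iso\<phi> = morphism_UNIV[OF conjunct1[OF conjunct1[OF \<phi>]]] conjunct2[OF conjunct1[OF \<phi>]] conjunct2[OF \<phi>]
  note iso\<phi>' = morphism_UNIV[OF conjunct1[OF conjunct1[OF \<phi>']]] bspec[OF conjunct2[OF \<phi>']]
  show ?thesis
    by (rule isogeny_covering_standard[OF jE(1) E' jE(4)[OF PO] T' iso\<phi> iso\<phi>' W(1-4) zero_locus_subset W(5) r W(6)])
qed

section \<open>Conjugate forms\<close>

lemma galois_inverse:
  assumes \<sigma>: "\<sigma> \<in> galois_group K"
  obtains \<kappa> where "\<kappa> \<in> galois_group K" "\<And>x. \<sigma> (\<kappa> x) = x" "\<And>x. \<kappa> (\<sigma> x) = x"
proof -
  have b: "bij \<sigma>" and h: "\<And>x y. \<sigma> (x + y) = \<sigma> x + \<sigma> y" "\<And>x y. \<sigma> (x * y) = \<sigma> x * \<sigma> y" "\<And>x. x \<in> K \<Longrightarrow> \<sigma> x = x"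
    using \<sigma> unfolding galois_group_def by blast+
  define \<kappa> where "\<kappa> = inv_into UNIV \<sigma>"
  have i: "\<sigma> (\<kappa> x) = x" "\<kappa> (\<sigma> x) = x" for x
    unfolding \<kappa>_def using b by (simp_all add: bij_is_surj surj_f_inv_f bij_is_inj inv_f_f)
  have "\<kappa> (x + y) = \<kappa> x + \<kappa> y" "\<kappa> (x * y) = \<kappa> x * \<kappa> y" for x y
    using i(2)[of "\<kappa> x + \<kappa> y"] i(2)[of "\<kappa> x * \<kappa> y"] unfolding h i by simp_all
  moreover have "\<kappa> x = x" if "x \<in> K" for x using i(2)[of x] unfolding h(3)[OF that] .
  moreover have "bij \<kappa>" unfolding \<kappa>_def by (rule bij_imp_bij_inv[OF b])
  ultimately have "\<kappa> \<in> galois_group K" unfolding galois_group_def by blast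
  then show thesis using that i by blast
qed

lemma galois_hom:
  assumes "\<sigma> \<in> galois_group K"
  shows "\<sigma> (x + y) = \<sigma> x + \<sigma> y" "\<sigma> (x * y) = \<sigma> x * \<sigma> y" "x \<in> K \<Longrightarrow> \<sigma> x = x" "\<sigma> 0 = 0" "\<sigma> x = 0 \<longleftrightarrow> x = 0"
    "\<sigma> (sum f I) = (\<Sum>i\<in>I. \<sigma> (f i))"
proof -
  have b: "bij \<sigma>" and h: "\<And>x y. \<sigma> (x + y) = \<sigma> x + \<sigma> y" "\<And>x y. \<sigma> (x * y) = \<sigma> x * \<sigma> y" "\<And>x. x \<in> K \<Longrightarrow> \<sigma> x = x"
    using assms unfolding galois_group_def by blast+
  show "\<sigma> (x + y) = \<sigma> x + \<sigma> y" "\<sigma> (x * y) = \<sigma> x * \<sigma> y" "x \<in> K \<Longrightarrow> \<sigma> x = x" by (rule h, assumption?)+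
  show 0: "\<sigma> 0 = 0" using h(1)[of 0 0] by (metis add.right_neutral add_left_cancel)
  then show "\<sigma> x = 0 \<longleftrightarrow> x = 0" using bij_is_inj[OF b] by (metis injD)
  show "\<sigma> (sum f I) = (\<Sum>i\<in>I. \<sigma> (f i))"
    by (induction I rule: infinite_finite_induct) (simp_all add: 0 h)
qed

definition vmap :: "('a \<Rightarrow> 'b) \<Rightarrow> 'a ^ 'n \<Rightarrow> 'b ^ 'n" where
  "vmap \<sigma> v = (\<chi> i. \<sigma> (v $ i))"

lemma vmap_nth [simp]: "vmap \<sigma> v $ i = \<sigma> (v $ i)"
  by (simp add: vmap_def)

text \<open>With \<kappa> inverse to \<sigma> this function is the form whose coefficients are
  conjugated by \<sigma>.\<close>

lemma form_conjugate:
  assumes \<sigma>: "\<sigma> \<in> galois_group K" and inv: "\<And>x. \<sigma> (\<kappa> x) = x"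
  shows "form S d f \<Longrightarrow> form UNIV d (\<lambda>v. \<sigma> (f (vmap \<kappa> v)))"
proof (induction rule: form.induct)
  case (const c)
  then show ?case by (intro form.const) simp
next
  case (coord d f i)
  then show ?case unfolding galois_hom(2)[OF \<sigma>] vmap_nth inv by (intro form.coord)
next
  case (add d f g)
  then show ?case unfolding galois_hom(1)[OF \<sigma>] by (intro form.add)
qed

lemma form_conjugate_base:
  assumes \<sigma>: "\<sigma> \<in> galois_group K" and inv: "\<And>x. \<sigma> (\<kappa> x) = x"
  shows "form K d f \<Longrightarrow> \<sigma> (f (vmap \<kappa> v)) = f v"
  by (induction rule: form.induct) (simp_all add: galois_hom[OF \<sigma>] inv)

lemma form_tuple_conjugate_base:
  assumes \<sigma>: "\<sigma> \<in> galois_group K" and inv: "\<And>x. \<sigma> (\<kappa> x) = x" and h: "form_tuple K d h"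
  shows "vmap \<sigma> (h (vmap \<kappa> v)) = h v"
  unfolding vec_eq_iff vmap_nth
  using form_conjugate_base[OF \<sigma> inv] h unfolding form_tuple_def by blast

lemma pair_form: "form_tuple UNIV 1 (\<lambda>w::'a::comm_ring_1 ^ 4. vector [w $ 1 + c * w $ 2, w $ 3 + c * w $ 4] :: 'a ^ 2)"
  unfolding form_tuple_def forall_2 vector_2 by (intro conjI form.add form_cmult form_coord)

theorem theorem7p3:
  fixes A B F G :: "'k::field_char_0 alg_closure ^ 4 \<Rightarrow> 'k alg_closure"
    and q :: "4 \<Rightarrow> 'k alg_closure ^ 3 \<Rightarrow> 'k alg_closure"
    and m :: "4 \<Rightarrow> 'k alg_closure ^ 4 ^ 3"
    and r :: "'k alg_closure ^ 4 \<Rightarrow> 'k alg_closure ^ 4"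
    and E E' :: "'k alg_closure weierstrass"
    and j :: "('k alg_closure, 4) divisor \<Rightarrow> ('k alg_closure, 3) ppoint"
    and T :: "('k alg_closure, 3) ppoint"
    and \<phi> \<phi>' :: "('k alg_closure, 3) ppoint \<Rightarrow> ('k alg_closure, 3) ppoint"
    and a :: "4 \<Rightarrow> ('k alg_closure, 4) divisor"
    and C D :: "('k alg_closure, 4) ppoint set"
    and K :: "'k alg_closure set"
  assumes "number_field TYPE('k)" and "K = base_field"
    and "nonsingular_quadric_intersection K A B" and "C = zero_locus {A, B}"
    and "is_jacobian K C E j"
    and "T \<in> points E" and "rational_over K T" and "T \<noteq> origin" and "ell_add E T T = origin"
    and "singular_cones A B q m"
    and "\<forall>i. \<exists>Q\<in>plane_conic (q i). a i = double_cover_fibre C (projection (m i)) Q"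
    and "j (a 1 - a 2) = T" and "j (a 3 - a 4) = T"
    and "galois_image_in_12_34 K q m"
    and "split_construction K q m r F G \<or> nonsplit_construction K q m r F G"
    and "D = zero_locus {F, G}"
    and "elliptic_curve K E'"
    and "two_isogeny_with_kernel K E E' T \<phi>" and "dual_two_isogeny K E E' \<phi> \<phi>'"
  shows "isogeny_covering K E' E \<phi>' D C (proj_map r)"
proof -
  note K = assms(2) and ns = assms(3) and CAB = assms(4) and jac = assms(5) and D = assms(16)
    and \<phi> = assms(18) and \<phi>' = assms(19)
  have q: "\<And>i. form UNIV 2 (q i)" using assms(10) unfolding singular_cones_def by blast
  obtain s t where st: "(\<forall>i p. q i (m i *v p) = s i * A p + t i * B p) \<and> (\<forall>i j. i \<noteq> j \<longrightarrow> s i * t j \<noteq> s j * t i)"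
    using assms(10)[unfolded singular_cones_def, THEN conjunct2] by (elim exE) (rule that)
  have cone: "\<And>i p. q i (m i *v p) = s i * A p + t i * B p" and ne: "\<And>i j. i \<noteq> j \<Longrightarrow> s i * t j \<noteq> s j * t i"
    using st by blast+
  obtain R1 R2 where R: "R1 \<in> plane_conic (q 1)" "R2 \<in> plane_conic (q 2)"
    "a 1 = double_cover_fibre C (projection (m 1)) R1" "a 2 = double_cover_fibre C (projection (m 2)) R2"
    using assms(11) by metis
  have T: "j (double_cover_fibre C (projection (m 1)) R1 - double_cover_fibre C (projection (m 2)) R2) = T"
    using assms(12) unfolding R(3,4) .
  have E': "discriminant E' \<noteq> 0" using assms(17) unfolding elliptic_curve_def by blast
  note core = isogeny_covering_of_cones[where s = s and t = t and q = q and m = m, OF ns CAB jac q cone _ R(1,2) T E' \<phi> \<phi>']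
  from assms(15) show ?thesis
  proof
    assume "split_construction K q m r F G"
    then obtain Q1 Q2 where Q: "parametrisation K (q 1) Q1" "parametrisation K (q 2) Q2"
      and sys: "\<And>p w. (m 1 *v p = Q1 (vector [w $ 1, w $ 2]) \<and> m 2 *v p = Q2 (vector [w $ 3, w $ 4]))
         \<longleftrightarrow> (p = r w \<and> F w = 0 \<and> G w = 0)" and r: "form_tuple K 2 r" and F: "form K 2 F" and G: "form K 2 G"
      unfolding split_construction_def by blast
    have z: "form_tuple UNIV 1 (\<lambda>w::'k alg_closure ^ 4. vector [w $ 1, w $ 2] :: 'k alg_closure ^ 2)"
      "form_tuple UNIV 1 (\<lambda>w::'k alg_closure ^ 4. vector [w $ 3, w $ 4] :: 'k alg_closure ^ 2)"
      unfolding form_tuple_def forall_2 vector_2 by (intro conjI form_coord)+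
    have z0: "w = 0" if "vector [w $ 1, w $ 2] = (0 :: 'k alg_closure ^ 2)" "vector [w $ 3, w $ 4] = (0 :: 'k alg_closure ^ 2)" for w :: "'k alg_closure ^ 4"
      using that unfolding vec_eq_iff forall_2 forall_4 by simp
    have "s 2 \<noteq> 0 \<or> t 2 \<noteq> 0" using ne[of 1 2] by auto
    then show ?thesis unfolding D
      by (intro core[OF _ q cone _ _ parametrisation_onto[OF q Q(1)] parametrisation_onto[OF q Q(2)] z z0 F G r sys] ne)
  next
    assume "nonsplit_construction K q m r F G"
    then obtain \<beta> S Q Q' Q'' m' m'' where r: "form_tuple K 2 r" and F: "form K 2 F" and G: "form K 2 G"
      and \<beta>: "\<beta> \<notin> K" "\<exists>b\<in>K. \<exists>c\<in>K. \<beta>^2 + b * \<beta> + c = 0"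
      and conj: "\<forall>\<sigma>\<in>galois_group K. \<sigma> \<beta> \<noteq> \<beta> \<longrightarrow> conj_point \<sigma> ` quadric_cone (q 1) (m 1) = quadric_cone (q 2) (m 2)"
      and Q: "parametrisation S (q 1) Q" and Q': "form_tuple K 2 Q'" "form_tuple K 2 Q''"
      and QQ: "\<forall>w. Q (vector [w $ 1 + \<beta> * w $ 2, w $ 3 + \<beta> * w $ 4]) = Q' w + \<beta> *s Q'' w"
      and mm: "\<forall>k l. m' $ k $ l \<in> K \<and> m'' $ k $ l \<in> K \<and> m 1 $ k $ l = m' $ k $ l + \<beta> * m'' $ k $ l"
      and sys: "\<forall>p w. (m' *v p = Q' w \<and> m'' *v p = Q'' w) \<longleftrightarrow> (p = r w \<and> F w = 0 \<and> G w = 0)"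
      unfolding nonsplit_construction_def by (elim conjE exE) (rule that)
    obtain b c where bc: "b \<in> K" "c \<in> K" "\<beta>^2 + b * \<beta> + c = 0" using \<beta>(2) by blast
    define \<beta>' where "\<beta>' = - b - \<beta>"
    obtain \<sigma> where \<sigma>: "\<sigma> \<in> galois_group K" "\<sigma> \<beta> = \<beta>'"
      using conjugation[OF \<beta>(1)[unfolded K] bc(1,2)[unfolded K] bc(3)] unfolding \<beta>'_def K by blast
    have \<beta>\<beta>': "\<beta> - \<beta>' \<noteq> 0"
    proof
      assume "\<beta> - \<beta>' = 0"
      then have "2 * \<beta> = - b" unfolding \<beta>'_def by (simp add: eq_neg_iff_add_eq_0 algebra_simps)
      then have "\<beta> = - b / (1 + 1)" by (simp add: field_simps)
      moreover have "- b / (1 + 1) \<in> K" using bc(1) unfolding K by (intro K_closed)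
      ultimately show False using \<beta>(1) by simp
    qed
    obtain \<kappa> where \<kappa>: "\<kappa> \<in> galois_group K" "\<And>x. \<sigma> (\<kappa> x) = x" "\<And>x. \<kappa> (\<sigma> x) = x" using galois_inverse[OF \<sigma>(1)] by metis
    note hom = galois_hom[OF \<sigma>(1)] and hom' = galois_hom[OF \<kappa>(1)]
    have vi: "vmap \<sigma> (vmap \<kappa> v) = v" "vmap \<kappa> (vmap \<sigma> v) = v" for v :: "'k alg_closure ^ 'x::finite"
      using \<kappa>(2,3) by (simp_all add: vec_eq_iff)
    \<comment> \<open>The first cone and its parametrisation conjugated by \<sigma>: the
      coefficients of \<open>1\<close> and \<beta> stay fixed, and \<beta> becomes \<beta>'. The
      result is the second cone, possibly with other equations than \<open>q 2\<close> and
      \<open>m 2\<close>.\<close>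
    define q2 where "q2 v = \<sigma> (q 1 (vmap \<kappa> v))" for v
    define M2 where "M2 = (\<chi> k l. m' $ k $ l + \<beta>' * m'' $ k $ l)"
    define Q2 where "Q2 v = vmap \<sigma> (Q (vmap \<kappa> v))" for v
    have A: "form K 2 A" and B: "form K 2 B" using ns unfolding nonsingular_quadric_intersection_def by blast+
    have q2: "form UNIV 2 q2" unfolding q2_def by (rule form_conjugate[OF \<sigma>(1) \<kappa>(2) q])
    have M2: "M2 *v p = vmap \<sigma> (m 1 *v vmap \<kappa> p)" for p
    proof -
      have "\<sigma> (m 1 $ k $ l) = m' $ k $ l + \<beta>' * m'' $ k $ l" for k l
        using mm by (simp add: hom \<sigma>(2))
      then show ?thesis unfolding vec_eq_iff matrix_vector_mult_def M2_def by (simp add: hom \<kappa>(2))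
    qed
    have q2M: "q2 (M2 *v p) = \<sigma> (q 1 (m 1 *v vmap \<kappa> p))" for p unfolding q2_def M2 vi ..
    have q2AB: "q2 (M2 *v p) = \<sigma> (s 1) * A p + \<sigma> (t 1) * B p" for p
      unfolding q2M cone hom form_conjugate_base[OF \<sigma>(1) \<kappa>(2) A] form_conjugate_base[OF \<sigma>(1) \<kappa>(2) B] ..
    have st1: "\<sigma> (s 1) \<noteq> 0 \<or> \<sigma> (t 1) \<noteq> 0" unfolding hom using ne[of 1 2] by auto
    have same: "q2 (M2 *v p) = 0" if p: "q 2 (m 2 *v p) = 0" for p
    proof (cases "p = 0")
      case True
      then show ?thesis using form_at_0[OF q2] by simp
    next
      case False
      have "pt p \<in> quadric_cone (q 2) (m 2)" unfolding quadric_cone_def zero_locus_def using p False by blast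
      moreover have "\<sigma> \<beta> \<noteq> \<beta>" using \<beta>\<beta>' \<sigma>(2) by auto
      ultimately have "pt p \<in> conj_point \<sigma> ` quadric_cone (q 1) (m 1)" using conj \<sigma>(1) by blast
      then obtain u where u: "q 1 (m 1 *v u) = 0" "pt p = conj_point \<sigma> (pt u)"
        unfolding quadric_cone_def zero_locus_def by auto
      have "p \<in> conj_point \<sigma> (pt u)" using self_in_pt[of p] unfolding u(2) .
      then obtain e where "p = vmap \<sigma> (e *s u)" unfolding conj_point_def vmap_def in_pt by (auto simp: in_pt)
      then have "vmap \<kappa> p = e *s u" using vi by metis
      then have "q 1 (m 1 *v vmap \<kappa> p) = 0" using u(1) by (simp add: vector_scalar_commute quadratic_smult[OF q])
      then show ?thesis unfolding q2M using hom(4) by simp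
    qed
    note Q1 = parametrisation_onto[OF q Q]
    have Q2: "form_tuple UNIV 2 Q2" unfolding form_tuple_def Q2_def vmap_nth
      using form_conjugate[OF \<sigma>(1) \<kappa>(2)] form_tuple_nth[OF Q1(1)] by blast
    have Q2on: "q2 (Q2 z) = 0" for z unfolding q2_def Q2_def vi Q1(2) by (rule hom(4))
    have Q2surj: "\<exists>z. Q2 z = y" if "q2 y = 0" for y
    proof -
      have "q 1 (vmap \<kappa> y) = 0" using that unfolding q2_def hom(5) .
      then obtain z where z: "Q z = vmap \<kappa> y" using Q1(3) by blast
      have "Q2 (vmap \<sigma> z) = y" unfolding Q2_def vi z ..
      then show ?thesis by blast
    qed
    define z1 where "z1 w = (vector [w $ 1 + \<beta> * w $ 2, w $ 3 + \<beta> * w $ 4] :: 'k alg_closure ^ 2)" for w :: "'k alg_closure ^ 4"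
    define z2 where "z2 w = (vector [w $ 1 + \<beta>' * w $ 2, w $ 3 + \<beta>' * w $ 4] :: 'k alg_closure ^ 2)" for w :: "'k alg_closure ^ 4"
    have z: "form_tuple UNIV 1 z1" "form_tuple UNIV 1 z2" unfolding z1_def z2_def by (rule pair_form)+
    have independent: "x = 0 \<and> y = 0" if "x + \<beta> * y = 0" "x + \<beta>' * y = 0" for x y
    proof -
      have "(\<beta> - \<beta>') * y = (x + \<beta> * y) - (x + \<beta>' * y)" by (simp add: algebra_simps)
      then have "y = 0" using \<beta>\<beta>' unfolding that by simp
      then show ?thesis using that by simp
    qed
    have z0: "w = 0" if "z1 w = 0" "z2 w = 0" for w
      using that independent unfolding vec_eq_iff forall_2 forall_4 z1_def z2_def vector_2 zero_index by blast
    have Q2z: "Q2 (z2 w) = Q' w + \<beta>' *s Q'' w" for w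
    proof -
      have "\<kappa> \<beta>' = \<beta>" using \<kappa>(3)[of \<beta>] unfolding \<sigma>(2) .
      then have v: "vmap \<kappa> (z2 w) = z1 (vmap \<kappa> w)" unfolding vec_eq_iff forall_2 z1_def z2_def by (simp add: hom')
      have "Q2 (z2 w) = vmap \<sigma> (Q' (vmap \<kappa> w) + \<beta> *s Q'' (vmap \<kappa> w))"
        unfolding Q2_def v unfolding z1_def QQ[rule_format] ..
      also have "\<dots> = vmap \<sigma> (Q' (vmap \<kappa> w)) + \<beta>' *s vmap \<sigma> (Q'' (vmap \<kappa> w))"
        unfolding vec_eq_iff by (simp add: hom \<sigma>(2))
      finally show ?thesis
        unfolding form_tuple_conjugate_base[OF \<sigma>(1) \<kappa>(2) Q'(1)] form_tuple_conjugate_base[OF \<sigma>(1) \<kappa>(2) Q'(2)] .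
    qed
    have M: "m 1 *v p = m' *v p + \<beta> *s (m'' *v p)" "M2 *v p = m' *v p + \<beta>' *s (m'' *v p)" for p
      unfolding vec_eq_iff matrix_vector_mult_def M2_def using mm by (simp_all add: sum.distrib sum_distrib_left algebra_simps)
    have sys': "(m 1 *v p = Q (z1 w) \<and> M2 *v p = Q2 (z2 w)) \<longleftrightarrow> (p = r w \<and> F w = 0 \<and> G w = 0)" for p w
    proof -
      \<comment> \<open>As \<beta> and \<beta>' differ, an equation together with its conjugate is
        equivalent to the equality of the coefficients of \<open>1\<close> and \<beta>.\<close>
      have ind: "x + \<beta> * y = x' + \<beta> * y' \<and> x + \<beta>' * y = x' + \<beta>' * y' \<longleftrightarrow> x = x' \<and> y = y'" for x y x' y'
        using independent[of "x - x'" "y - y'"] by (auto simp: algebra_simps)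
      have "m 1 *v p = Q (z1 w) \<and> M2 *v p = Q2 (z2 w) \<longleftrightarrow> m' *v p = Q' w \<and> m'' *v p = Q'' w"
        unfolding Q2z z1_def QQ[rule_format] M vec_eq_iff vector_add_component vector_smult_component all_conj_distrib[symmetric] ind ..
      then show ?thesis using sys by blast
    qed
    show ?thesis unfolding D
      by (rule core[OF ne q2 q2AB st1 same Q1 Q2 Q2on Q2surj z z0 F G r sys'])
  qed
qed

end
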